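(* Let $\sigma\in\mathcal T=[0,\sigma_M]$ and $x_\sigma\in(x_i,x_v)$ be such that $\overline\sigma(x_\sigma)=\sigma$ and $\overline\sigma'(x_\sigma)\neq0$. Assume that the perturbed piecewise smooth system $(x',y')^T=Z_\varepsilon(t,x,y)$ (described in the context) is $2\sigma$-periodic in the variable $t$. Suppose there exists $\theta^*\in\mathbb S^1_\sigma=\mathbb R/(2\sigma\mathbb Z)$ such that $$M(\theta^*,x_\sigma)=0\quad\text{and}\quad \frac{\partial M}{\partial\theta}(\theta^*,x_\sigma)\neq0 .$$ Then for every sufficiently small $\varepsilon>0$ there exists an isolated crossing $2\sigma$-periodic solution of $(x',y')^T=Z_\varepsilon(t,x,y)$ whose initial condition, in $\mathbb S^1_\sigma\times D$, is $\varepsilon$-close to $(t_0,z_0)=(\theta^*,(x_\sigma,0))$.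
   Context: **Unperturbed system.** Let $R(x,y)=(x,-y)$, let $D\subset\mathbb R^2$ be open, bounded and $R$-invariant, and let $F=(F_1,F_2)^T:D\to\mathbb R^2$ be $C^2$. Put $F^-(x,y)=F(x,y)$ and $F^+(x,y)=-RF(R(x,y))$, $\Sigma=\{y=0\}$. The unperturbed ($R$-reversible) system is $Z_0=F^+$ for $y>0$ and $Z_0=F^-$ for $y<0$. Let $\Gamma^\pm(t,z)$ be the solution of $(x',y')^T=F^\pm(x,y)$ with $\Gamma^\pm(0,z)=z$. Write $\Gamma=\Gamma^-=(\Gamma_1,\Gamma_2)^T$ and $Y(t,z)=D_z\Gamma^-(t,z)$ (a $2\times2$ matrix, the fundamental solution of the variational equation with $Y(0,z)=I_2$). **Standing hypotheses.** (h1) There are $x_i<x_v$ such that, with $p_i=(x_i,0)$, $p_v=(x_v,0)\in\Sigma$: $F_2(p_v)=F_2(p_i)=0$, $\frac{\partial F_2}{\partial x}(p_v)F_1(p_v)<0$, $\frac{\partial F_2}{\partial x}(p_i)F_1(p_i)>0$, and $F_2(x,0)\ne0$ for $x_i<x<x_v$. (h2) For each $x_i<x\le x_v$ the solution $\Gamma^-(t,x,0)$ enters $y<0$ and reaches $\Sigma$ transversely for the first positive time at $t=\overline\sigma(x)>0$, i.e. $\Gamma^-_2(\overline\sigma(x),x,0)=0$ and $F_2(\Gamma^-(\overline\sigma(x),x,0))\ne0$. The function $\overline\sigma$ is differentiable on $(x_i,x_v]$; $\sigma_M=\sup\{\overline\sigma(x):x_i<x\le x_v\}<\infty$ and $\mathcal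 T=[0,\sigma_M]$. For $0\le t\le\overline\sigma(x)$ put $\gamma(t,x)=\Gamma^-(t,x,0)$, and for $-\overline\sigma(x)\le t\le 0$ put $\gamma(t,x)=R\Gamma^-(-t,x,0)$; this is a $2\overline\sigma(x)$-periodic solution of $Z_0$. **Perturbed system.** $Z_\varepsilon(t,x,y)=X^+_\varepsilon(t,x,y)$ for $y>0$ and $X^-_\varepsilon(t,x,y)$ for $y<0$, where $$X^\pm_\varepsilon(t,x,y)=F^\pm(x,y)+\varepsilon G^\pm(t,x,y)+\varepsilon^2H^\pm(t,x,y;\varepsilon),$$ $G^\pm$ and $H^\pm$ are smooth on $\mathbb R\times D$ and $\mathbb R\times D\times(-\varepsilon_0,\varepsilon_0)$ respectively, and are $2\sigma$-periodic in $t$. **Melnikov function.** Put $\{G^-,G^+\}_\theta(t,z)=G^-(t+\theta,z)+RG^+(-t+\theta,Rz)$ and $(a_1,a_2)\wedge(b_1,b_2)=-a_2b_1+a_1b_2$. Define for $\theta\in\mathbb S^1_\sigma$, $x\in(x_i,x_v]$ $$M(\theta,x)=F(\gamma(\overline\sigma(x),x))\wedge\left(Y(\overline\sigma(x),x,0)\int_0^{\overline\sigma(x)}Y(t,x,0)^{-1}\{G^-,G^+\}_\theta(t,\gamma(t,x))\,dt\right).$$ **Terminology.** Solutions are understood in Filippov's sense, in the extended phase space $\mathbb S^1_\sigma\times D$ with $\theta'=1$, $(x',y')^T=Z_\varepsilon(\theta,x,y)$ and switching manifold $\mathbb S^1_\sigma\times\Sigma$. A point $(\theta,x,0)$ is a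 crossing point if the second components of $X^+_\varepsilon$ and $X^-_\varepsilon$ there have strictly positive product. A crossing periodic solution is a periodic solution that meets the switching manifold only at crossing points. Isolated means that a neighbourhood of its orbit in the extended phase space contains no other crossing $2\sigma$-periodic orbit. "$\varepsilon$-close" means at distance $O(\varepsilon)$ as $\varepsilon\to0^+$. *)

theory Defs
  imports "HOL-Analysis.Analysis"
begin

section \<open>Differentiability and absolute continuity\<close>

text \<open>
  \<open>Ck_on k f S\<close>: \<open>f\<close> is of class \<open>C\<^sup>k\<close> on the open set \<open>S\<close>. The recursion goes through the
  directional derivatives, since iterating the derivative itself would change its type; in
  finite dimension this is the usual notion.
\<close>

primrec Ck_on :: "nat \<Rightarrow> ('a::euclidean_space \<Rightarrow> 'b::euclidean_space) \<Rightarrow> 'a set \<Rightarrow> bool" where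
  "Ck_on 0 f S \<longleftrightarrow> continuous_on S f"
| "Ck_on (Suc k) f S \<longleftrightarrow>
     (\<forall>x\<in>S. f differentiable (at x)) \<and>
     (\<forall>v. Ck_on k (\<lambda>x. frechet_derivative f (at x) v) S)"

definition smooth_on :: "('a::euclidean_space \<Rightarrow> 'b::euclidean_space) \<Rightarrow> 'a set \<Rightarrow> bool" where
  "smooth_on f S \<longleftrightarrow> (\<forall>k. Ck_on k f S)"

definition absolutely_continuous_on :: "real set \<Rightarrow> (real \<Rightarrow> 'a::euclidean_space) \<Rightarrow> bool" where
  "absolutely_continuous_on S f \<longleftrightarrow>
     (\<forall>e>0. \<exists>d>0. \<forall>P. finite P \<and> (\<forall>(a,b)\<in>P. a < b \<and> {a..b} \<subseteq> S) \<and>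
        pairwise (\<lambda>(a,b) (a',b'). {a<..<b} \<inter> {a'<..<b'} = {}) P \<and>
        (\<Sum>(a,b)\<in>P. b - a) < d
        \<longrightarrow> (\<Sum>(a,b)\<in>P. dist (f a) (f b)) < e)"

section \<open>The unperturbed reversible system\<close>

type_synonym plane = "real \<times> real"

definition reflect :: "plane \<Rightarrow> plane" where
  "reflect z = (fst z, - snd z)"

definition upper_field :: "(plane \<Rightarrow> plane) \<Rightarrow> plane \<Rightarrow> plane" where
  "upper_field F z = - reflect (F (reflect z))"

definition ode_solution_on ::
    "(plane \<Rightarrow> plane) \<Rightarrow> plane set \<Rightarrow> real set \<Rightarrow> (real \<Rightarrow> plane) \<Rightarrow> bool" where
  "ode_solution_on F D T u \<longleftrightarrow>
     (\<forall>t\<in>T. u t \<in> D \<and> (u has_vector_derivative F (u t)) (at t within T))"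

definition flow_exists :: "(plane \<Rightarrow> plane) \<Rightarrow> plane set \<Rightarrow> real \<Rightarrow> plane \<Rightarrow> bool" where
  "flow_exists F D t z \<longleftrightarrow> (\<exists>u. ode_solution_on F D (closed_segment 0 t) u \<and> u 0 = z)"

text \<open>
  The value at time \<open>t\<close> of the solution in \<open>D\<close> starting from \<open>z\<close>. It is meaningful when
  \<open>flow_exists F D t z\<close> holds, the solution being unique for \<open>F\<close> of class \<open>C\<^sup>1\<close> on the open set
  \<open>D\<close>; the set of such \<open>z\<close> is then open.
\<close>

definition flow :: "(plane \<Rightarrow> plane) \<Rightarrow> plane set \<Rightarrow> real \<Rightarrow> plane \<Rightarrow> plane" where
  "flow F D t z =
     (THE w. \<exists>u. ode_solution_on F D (closed_segment 0 t) u \<and> u 0 = z \<and> u t = w)"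

text \<open>The matrix \<open>Y(t,z)\<close>, as a linear map.\<close>

definition flow_deriv :: "(plane \<Rightarrow> plane) \<Rightarrow> plane set \<Rightarrow> real \<Rightarrow> plane \<Rightarrow> plane \<Rightarrow> plane" where
  "flow_deriv F D t z = frechet_derivative (flow F D t) (at z)"

definition orbit0 :: "(plane \<Rightarrow> plane) \<Rightarrow> plane set \<Rightarrow> real \<Rightarrow> real \<Rightarrow> plane" where
  "orbit0 F D t x =
     (if 0 \<le> t then flow F D t (x, 0) else reflect (flow F D (- t) (x, 0)))"

section \<open>The Melnikov function\<close>

definition wedge :: "plane \<Rightarrow> plane \<Rightarrow> real" where
  "wedge a b = - snd a * fst b + fst a * snd b"

definition pert_bracket ::
    "(real \<Rightarrow> plane \<Rightarrow> plane) \<Rightarrow> (real \<Rightarrow> plane \<Rightarrow> plane) \<Rightarrow> real \<Rightarrow> real \<Rightarrow> plane \<Rightarrow> plane" where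
  "pert_bracket Gm Gp \<theta> t z = Gm (t + \<theta>) z + reflect (Gp (- t + \<theta>) (reflect z))"

definition Melnikov ::
    "(plane \<Rightarrow> plane) \<Rightarrow> plane set \<Rightarrow> (real \<Rightarrow> real) \<Rightarrow> (real \<Rightarrow> plane \<Rightarrow> plane) \<Rightarrow>
     (real \<Rightarrow> plane \<Rightarrow> plane) \<Rightarrow> real \<Rightarrow> real \<Rightarrow> real" where
  "Melnikov F D \<sigma>bar Gm Gp \<theta> x =
     wedge (F (orbit0 F D (\<sigma>bar x) x))
       (flow_deriv F D (\<sigma>bar x) (x, 0)
         (integral {0..\<sigma>bar x}
           (\<lambda>t. inv (flow_deriv F D t (x, 0)) (pert_bracket Gm Gp \<theta> t (orbit0 F D t x)))))"

section \<open>Filippov solutions of the perturbed system\<close>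

definition pert_field ::
    "(plane \<Rightarrow> plane) \<Rightarrow> (real \<Rightarrow> plane \<Rightarrow> plane) \<Rightarrow> (real \<Rightarrow> plane \<Rightarrow> real \<Rightarrow> plane) \<Rightarrow>
     real \<Rightarrow> real \<Rightarrow> plane \<Rightarrow> plane" where
  "pert_field F G H \<epsilon> t z = F z + \<epsilon> *\<^sub>R G t z + \<epsilon>\<^sup>2 *\<^sub>R H t z \<epsilon>"

text \<open>
  The extended phase space \<open>(\<real>/2\<sigma>\<int>) \<times> D\<close> is represented by its cover \<open>\<real> \<times> D\<close>, on which
  \<open>2\<sigma>\<close>-periodic vector fields are invariant under the deck transformation \<open>p \<mapsto> p + (2\<sigma>, 0)\<close>.
  Closed orbits of period \<open>2\<sigma>\<close> in the quotient correspond to curves \<open>w\<close> in the cover with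
  \<open>w (s + 2\<sigma>) = w s + (2\<sigma>, 0)\<close> (as \<open>\<theta>' = 1\<close>), and open sets of the quotient to invariant open
  sets.
\<close>

definition ext_field :: "(real \<Rightarrow> plane \<Rightarrow> plane) \<Rightarrow> real \<times> plane \<Rightarrow> real \<times> plane" where
  "ext_field X p = (1, X (fst p) (snd p))"

definition filippov_set ::
    "(real \<Rightarrow> plane \<Rightarrow> plane) \<Rightarrow> (real \<Rightarrow> plane \<Rightarrow> plane) \<Rightarrow> real \<times> plane \<Rightarrow> (real \<times> plane) set" where
  "filippov_set Xp Xm p =
     (if snd (snd p) > 0 then {ext_field Xp p}
      else if snd (snd p) < 0 then {ext_field Xm p}
      else closed_segment (ext_field Xm p) (ext_field Xp p))"

definition filippov_solution ::
    "plane set \<Rightarrow> (real \<Rightarrow> plane \<Rightarrow> plane) \<Rightarrow> (real \<Rightarrow> plane \<Rightarrow> plane) \<Rightarrow>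
     (real \<Rightarrow> real \<times> plane) \<Rightarrow> bool" where
  "filippov_solution D Xp Xm w \<longleftrightarrow>
     (\<forall>s. snd (w s) \<in> D) \<and>
     (\<forall>a b. absolutely_continuous_on {a..b} w) \<and>
     (AE s in lebesgue. \<exists>v\<in>filippov_set Xp Xm (w s). (w has_vector_derivative v) (at s))"

definition crossing_point ::
    "(real \<Rightarrow> plane \<Rightarrow> plane) \<Rightarrow> (real \<Rightarrow> plane \<Rightarrow> plane) \<Rightarrow> real \<times> plane \<Rightarrow> bool" where
  "crossing_point Xp Xm p \<longleftrightarrow>
     snd (snd p) = 0 \<and> snd (Xp (fst p) (snd p)) * snd (Xm (fst p) (snd p)) > 0"

definition crossing_periodic ::
    "real \<Rightarrow> plane set \<Rightarrow> (real \<Rightarrow> plane \<Rightarrow> plane) \<Rightarrow> (real \<Rightarrow> plane \<Rightarrow> plane) \<Rightarrow>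
     (real \<Rightarrow> real \<times> plane) \<Rightarrow> bool" where
  "crossing_periodic \<sigma> D Xp Xm w \<longleftrightarrow>
     filippov_solution D Xp Xm w \<and>
     (\<forall>s. w (s + 2 * \<sigma>) = w s + (2 * \<sigma>, 0)) \<and>
     (\<forall>s. snd (snd (w s)) = 0 \<longrightarrow> crossing_point Xp Xm (w s))"

definition isolated_crossing_periodic ::
    "real \<Rightarrow> plane set \<Rightarrow> (real \<Rightarrow> plane \<Rightarrow> plane) \<Rightarrow> (real \<Rightarrow> plane \<Rightarrow> plane) \<Rightarrow>
     (real \<Rightarrow> real \<times> plane) \<Rightarrow> bool" where
  "isolated_crossing_periodic \<sigma> D Xp Xm w \<longleftrightarrow>
     crossing_periodic \<sigma> D Xp Xm w \<and>
     (\<exists>U. open U \<and> (\<forall>p. p + (2 * \<sigma>, 0) \<in> U \<longleftrightarrow> p \<in> U) \<and> range w \<subseteq> U \<and>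
        (\<forall>w'. crossing_periodic \<sigma> D Xp Xm w' \<and> range w' \<subseteq> U \<longrightarrow> range w' = range w))"

section \<open>Standing hypotheses\<close>

definition fold_hyp :: "(plane \<Rightarrow> plane) \<Rightarrow> plane set \<Rightarrow> real \<Rightarrow> real \<Rightarrow> bool" where
  "fold_hyp F D xi xv \<longleftrightarrow>
     xi < xv \<and> (xi, 0) \<in> D \<and> (xv, 0) \<in> D \<and>
     snd (F (xv, 0)) = 0 \<and> snd (F (xi, 0)) = 0 \<and>
     deriv (\<lambda>x. snd (F (x, 0))) xv * fst (F (xv, 0)) < 0 \<and>
     deriv (\<lambda>x. snd (F (x, 0))) xi * fst (F (xi, 0)) > 0 \<and>
     (\<forall>x. xi < x \<and> x < xv \<longrightarrow> (x, 0) \<in> D \<and> snd (F (x, 0)) \<noteq> 0)"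

definition return_hyp ::
    "(plane \<Rightarrow> plane) \<Rightarrow> plane set \<Rightarrow> real \<Rightarrow> real \<Rightarrow> (real \<Rightarrow> real) \<Rightarrow> bool" where
  "return_hyp F D xi xv \<sigma>bar \<longleftrightarrow>
     (\<forall>x. xi < x \<and> x \<le> xv \<longrightarrow>
        \<sigma>bar x > 0 \<and> flow_exists F D (\<sigma>bar x) (x, 0) \<and>
        (\<forall>t. 0 < t \<and> t < \<sigma>bar x \<longrightarrow> snd (flow F D t (x, 0)) < 0) \<and>
        snd (flow F D (\<sigma>bar x) (x, 0)) = 0 \<and>
        snd (F (flow F D (\<sigma>bar x) (x, 0))) \<noteq> 0)"

end

theory Submission
  imports Defs
begin

text \<open>
  Reflecting the upper half plane and reversing time there turns both halves of a crossing orbit into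
  solutions of small perturbations of \<open>z' = F z\<close> that start at the same point of \<open>\<Sigma>\<close>. A \<open>2\<sigma>\<close>-periodic
  crossing orbit corresponds to a point \<open>(x\<^sub>\<sigma> + \<epsilon> \<xi>, 0)\<close>, a phase \<open>\<theta>\<close> and a splitting
  \<open>2\<sigma> = (\<sigma> + \<epsilon> s) + (\<sigma> - \<epsilon> s)\<close> for which the two halves meet again on \<open>\<Sigma>\<close>. After division by \<open>\<epsilon>\<close>
  these are three equations for \<open>(s, \<xi>, \<theta>)\<close> whose limit is triangular: the coefficient of \<open>s\<close> is
  \<open>2 F\<^sub>2\<close> at the return point, that of \<open>\<xi>\<close> is nonzero because the return time has nonzero
  derivative, and the remaining equation is \<open>M \<theta> = 0\<close>.

  No smooth dependence on parameters is needed. Gronwall's inequality, applied to differences of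
  solutions minus the differences of their linearizations, shows that the remainders are Lipschitz in
  \<open>(s, \<xi>, \<theta>)\<close> with constant \<open>O(\<epsilon>)\<close>, so that the three equations are solved, uniquely in a fixed
  neighbourhood, by a contraction. Local uniqueness gives isolation, as every crossing periodic orbit
  in a thin tube around the constructed one is again a solution of the three equations.
\<close>

section \<open>Differential inequalities and existence of solutions\<close>

text \<open>Both halves are compared with the same solution \<open>\<gamma>\<close>, so their
  first-order terms share the fundamental matrix \<open>Y\<close>. In the difference of the two end
  points \<open>\<xi> Y(1,0)\<close> cancels and \<open>2 s F + mm - mp\<close> is left; the wedge
  with \<open>F\<close> removes \<open>s\<close>, and this is how the bracket of
  \<open>G\<^sup>-\<close> and the reflected \<open>G\<^sup>+\<close> enters the Melnikov function.
  At \<epsilon> = 0 the phase is completely free, so the equations become solvable only after the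
  division by \<epsilon>. A mere bound on the remainders would not exclude further solutions; they
  must be Lipschitz with a small constant, and for this the Taylor estimates are carried in
  two-point form, including a mixed difference in phase and position. For isolation the competitors
  are all absolutely continuous curves that satisfy the Filippov inclusion almost everywhere. They
  are shown to be classical solutions between crossings: near a crossing point both fields cross
  \<Sigma> in the same direction, and elsewhere the orbit keeps a positive distance from \<Sigma>.
  The isolating tube may depend on \<epsilon>, so its thickness is chosen last.\<close>

lemma gronwall_vector_derivative:
  fixes u :: "real \<Rightarrow> 'a::euclidean_space"
  assumes u: "\<And>t. t \<in> {0..T} \<Longrightarrow> (u has_vector_derivative u' t) (at t within {0..T})"
    and bound: "\<And>t. t \<in> {0..T} \<Longrightarrow> norm (u' t) \<le> L * norm (u t) + b"
    and "0 \<le> L" "0 \<le> b" and t: "t \<in> {0..T}"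
  shows "norm (u t) \<le> (norm (u 0) + b * t) * exp (L * t)"
proof -
  \<comment> \<open>The norm need not be differentiable, so the inequality is passed to the integral
    majorant \<open>N\<close>, which satisfies \<open>N' = \<phi> \<le> L N + b\<close>.\<close>
  define \<phi> where "\<phi> s = L * norm (u s) + b" for s
  define N where "N s = norm (u 0) + integral {0..s} \<phi>" for s
  have cont_u: "continuous_on {0..T} u"
    using u by (meson continuous_on_eq_continuous_within has_vector_derivative_continuous)
  have cont_\<phi>: "continuous_on {0..T} \<phi>"
    unfolding \<phi>_def by (intro continuous_intros cont_u)
  have int_\<phi>: "\<phi> integrable_on {0..s}" if "s \<in> {0..T}" for s
    using that by (intro integrable_continuous_real continuous_on_subset[OF cont_\<phi>]) auto
  have u_le_N: "norm (u s) \<le> N s" if s: "s \<in> {0..T}" for s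
  proof -
    have "(u' has_integral (u s - u 0)) {0..s}"
      using s by (intro fundamental_theorem_of_calculus)
        (auto intro!: has_vector_derivative_within_subset[OF u])
    then have "u s - u 0 = integral {0..s} u'" "u' integrable_on {0..s}"
      by (auto simp: integral_unique)
    then have "norm (u s - u 0) \<le> integral {0..s} \<phi>"
      using int_\<phi>[OF s] bound s
      by (auto intro!: integral_norm_bound_integral simp: \<phi>_def)
    then show ?thesis
      unfolding N_def by (smt (verit) norm_triangle_sub)
  qed
  have N': "(N has_vector_derivative \<phi> s) (at s within {0..T})" if "s \<in> {0..T}" for s
    unfolding N_def
    using integral_has_vector_derivative[OF cont_\<phi> that]
    by (auto intro!: derivative_eq_intros)
  \<comment> \<open>The integrating factor absorbs \<open>L N\<close>, and \<open>b * s\<close>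
    absorbs the rest because \<open>exp (- L * s) \<le> 1\<close>; hence \<open>P\<close> is
    nonincreasing.\<close>
  define P where "P s = exp (- L * s) * N s - b * s" for s
  define P' where "P' s = exp (- L * s) * (\<phi> s - L * N s) - b" for s
  have P': "(P has_vector_derivative P' s) (at s within {0..T})" if "s \<in> {0..T}" for s
    unfolding P_def P'_def
    using N'[OF that] unfolding has_real_derivative_iff_has_vector_derivative[symmetric]
    by (auto intro!: derivative_eq_intros simp: algebra_simps)
  have "P' s \<le> 0" if "s \<in> {0..T}" for s
  proof -
    have "\<phi> s - L * N s \<le> b"
      using mult_left_mono[OF u_le_N[OF that] \<open>0 \<le> L\<close>] by (simp add: \<phi>_def)
    then have "exp (- L * s) * (\<phi> s - L * N s) \<le> exp (- L * s) * b"
      by (intro mult_left_mono) auto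
    also have "\<dots> \<le> 1 * b"
      using that \<open>0 \<le> L\<close> \<open>0 \<le> b\<close> by (intro mult_right_mono) auto
    finally show ?thesis
      by (simp add: P'_def)
  qed
  moreover have "(P' has_integral (P t - P 0)) {0..t}"
    using t by (intro fundamental_theorem_of_calculus)
      (auto intro!: has_vector_derivative_within_subset[OF P'])
  ultimately have "P t - P 0 \<le> 0"
    using t has_integral_le[of P' "P t - P 0" "{0..t}" "\<lambda>_. 0" 0] by auto
  then have "exp (- L * t) * N t \<le> norm (u 0) + b * t"
    by (simp add: P_def N_def)
  then have "exp (L * t) * (exp (- L * t) * N t) \<le> exp (L * t) * (norm (u 0) + b * t)"
    by (intro mult_left_mono) auto
  then have "N t \<le> (norm (u 0) + b * t) * exp (L * t)"
    by (simp add: exp_minus field_simps)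
  with u_le_N[OF t] show ?thesis by simp
qed

text \<open>Picard iteration in the norm weighted by \<open>exp (- 2 * L * t)\<close>, in which the integral operator
  contracts on the whole interval at once.\<close>

lemma lipschitz_ode_exists:
  fixes f :: "real \<Rightarrow> 'a::euclidean_space \<Rightarrow> 'a"
  assumes T: "0 \<le> T" and L: "0 < L"
    and cont: "continuous_on ({0..T} \<times> UNIV) (\<lambda>(t, x). f t x)"
    and lip: "\<And>t x y. t \<in> {0..T} \<Longrightarrow> norm (f t x - f t y) \<le> L * norm (x - y)"
  shows "\<exists>z. z 0 = z0 \<and> (\<forall>t\<in>{0..T}. (z has_vector_derivative f t (z t)) (at t within {0..T}))"
proof -
  \<comment> \<open>Times are clamped to \<open>{0..T}\<close> so that the iteration acts on bounded
    continuous functions of the whole real line, the type on which the fixed point theorem is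
    applied.\<close>
  define c where "c t = max 0 (min T t)" for t :: real
  have c: "c t \<in> {0..T}" for t using T by (auto simp: c_def)
  have c_id: "c t = t" if "t \<in> {0..T}" for t using that by (auto simp: c_def)
  have cont_c: "continuous_on UNIV c" unfolding c_def by (intro continuous_intros)
  \<comment> \<open>The unknown \<open>y\<close> is the solution divided by the weight, so the sup
    norm of \<open>y\<close> is the weighted norm of the solution.\<close>
  define h where "h y s = f s (exp (2 * L * s) *\<^sub>R y s)" for y s
  have cont_h: "continuous_on {0..T} (h y)" if "continuous_on {0..T} y" for y
    unfolding h_def
    by (rule continuous_on_compose2[OF cont, where f="\<lambda>s. (s, exp (2 * L * s) *\<^sub>R y s)", simplified])
      (auto intro!: continuous_intros that)
  have int_h: "h y integrable_on {0..t}" if "continuous_on {0..T} y" "t \<in> {0..T}" for y t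
    using that by (intro integrable_continuous_real continuous_on_subset[OF cont_h]) auto
  define \<Psi> where "\<Psi> y t = exp (- 2 * L * c t) *\<^sub>R (z0 + integral {0..c t} (h y))" for y t
  have \<Psi>_bc: "\<Psi> y \<in> bcontfun" if y: "continuous_on {0..T} y" for y
  proof -
    define q where "q t = exp (- 2 * L * t) *\<^sub>R (z0 + integral {0..t} (h y))" for t
    have "continuous_on {0..T} (\<lambda>t. integral {0..t} (h y))"
      using int_h[OF y, of T] T by (intro indefinite_integral_continuous_1) auto
    then have q: "continuous_on {0..T} q"
      unfolding q_def by (intro continuous_intros)
    have "continuous_on UNIV (\<lambda>t. q (c t))"
      by (rule continuous_on_compose2[OF q cont_c]) (use c in auto)
    moreover have "bounded (range (\<lambda>t. q (c t)))"
      by (rule bounded_subset[OF compact_imp_bounded[OF compact_continuous_image[OF q]]])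
        (use c in auto)
    moreover have "\<Psi> y = (\<lambda>t. q (c t))"
      by (auto simp: \<Psi>_def q_def)
    ultimately show ?thesis
      by (simp add: bcontfun_def)
  qed
  define \<Phi> where "\<Phi> y = Bcontfun (\<Psi> (apply_bcontfun y))" for y :: "(real, 'a) bcontfun"
  have \<Phi>_apply: "apply_bcontfun (\<Phi> y) = \<Psi> (apply_bcontfun y)" for y
    unfolding \<Phi>_def by (intro Bcontfun_inverse \<Psi>_bc) auto
  have "dist (\<Phi> y) (\<Phi> y') \<le> (1/2) * dist y y'" for y y'
  proof (rule dist_bound)
    fix t
    let ?d = "dist y y'"
    have cy: "continuous_on {0..T} (apply_bcontfun y)" "continuous_on {0..T} (apply_bcontfun y')" by auto
    have "norm (integral {0..c t} (\<lambda>s. h y s - h y' s)) \<le> integral {0..c t} (\<lambda>s. L * ?d * exp (2 * L * s))"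
    proof (rule integral_norm_bound_integral)
      show "(\<lambda>s. h y s - h y' s) integrable_on {0..c t}"
        using int_h[OF cy(1) c] int_h[OF cy(2) c] by (rule integrable_diff)
      show "(\<lambda>s. L * ?d * exp (2 * L * s)) integrable_on {0..c t}"
        by (intro integrable_continuous_real continuous_intros)
      fix s assume "s \<in> {0..c t}"
      then have "s \<in> {0..T}" using c[of t] by auto
      then have "norm (h y s - h y' s) \<le> L * norm (exp (2 * L * s) *\<^sub>R y s - exp (2 * L * s) *\<^sub>R y' s)"
        unfolding h_def by (rule lip)
      also have "\<dots> = L * exp (2 * L * s) * dist (y s) (y' s)"
        by (simp add: scaleR_diff_right[symmetric] dist_norm)
      also have "\<dots> \<le> L * exp (2 * L * s) * ?d"
        using L by (intro mult_left_mono dist_bounded) auto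
      finally show "norm (h y s - h y' s) \<le> L * ?d * exp (2 * L * s)"
        by (simp add: mult_ac)
    qed
    \<comment> \<open>The rate \<open>2 * L\<close> of the weight is twice the Lipschitz constant;
      integrating it produces the contraction factor 1/2.\<close>
    also have "((\<lambda>s. L * ?d * exp (2 * L * s)) has_integral
        (?d / 2 * exp (2 * L * c t) - ?d / 2 * exp (2 * L * 0))) {0..c t}"
      using c[of t] L
      by (intro fundamental_theorem_of_calculus)
        (auto intro!: derivative_eq_intros simp flip: has_real_derivative_iff_has_vector_derivative)
    from integral_unique[OF this]
    have "integral {0..c t} (\<lambda>s. L * ?d * exp (2 * L * s)) \<le> ?d / 2 * exp (2 * L * c t)"
      by (simp del: integral_mult_right)
    finally have *: "norm (integral {0..c t} (\<lambda>s. h y s - h y' s)) \<le> ?d / 2 * exp (2 * L * c t)" .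
    have "\<Psi> y t - \<Psi> y' t = exp (- 2 * L * c t) *\<^sub>R integral {0..c t} (\<lambda>s. h y s - h y' s)"
      using int_h[OF cy(1) c] int_h[OF cy(2) c]
      by (simp add: \<Psi>_def scaleR_diff_right[symmetric] integral_diff)
    then have "dist (\<Phi> y t) (\<Phi> y' t) = exp (- 2 * L * c t) * norm (integral {0..c t} (\<lambda>s. h y s - h y' s))"
      by (simp add: \<Phi>_apply dist_norm)
    also have "\<dots> \<le> exp (- 2 * L * c t) * (?d / 2 * exp (2 * L * c t))"
      by (intro mult_left_mono *) auto
    also have "\<dots> = 1/2 * ?d"
      by (simp add: exp_minus)
    finally show "dist (\<Phi> y t) (\<Phi> y' t) \<le> 1/2 * ?d" .
  qed
  then have "\<exists>!y. \<Phi> y = y"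
    by (intro banach_fix_type[of "1/2"]) auto
  then obtain y where y: "\<Phi> y = y" by blast
  define z where "z t = exp (2 * L * t) *\<^sub>R y t" for t
  have z_eq: "z t = z0 + integral {0..t} (h y)" if t: "t \<in> {0..T}" for t
  proof -
    have "apply_bcontfun y t = \<Psi> y t" using \<Phi>_apply[of y] y by simp
    then show ?thesis
      using c_id[OF t] by (simp add: z_def \<Psi>_def exp_minus)
  qed
  have "(z has_vector_derivative f t (z t)) (at t within {0..T})" if t: "t \<in> {0..T}" for t
  proof (rule has_vector_derivative_transform[OF t])
    show "z s = z0 + integral {0..s} (h y)" if "s \<in> {0..T}" for s
      using z_eq[OF that] .
    have "continuous_on {0..T} (h y)"
      by (rule cont_h) auto
    from integral_has_vector_derivative[OF this t]
    show "((\<lambda>s. z0 + integral {0..s} (h y)) has_vector_derivative f t (z t)) (at t within {0..T})"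
      by (auto intro!: derivative_eq_intros simp: h_def z_def)
  qed
  moreover have "z 0 = z0" using z_eq[of 0] T by simp
  ultimately show ?thesis by blast
qed

text \<open>\<open>K\<close> is not assumed convex, so the mean value inequality cannot join two of
  its points directly. It is applied on small balls inside \<open>S\<close>, and compactness turns
  the resulting local Lipschitz property into a global one.\<close>

lemma C1_lipschitz_on_compact:
  fixes f :: "'a::euclidean_space \<Rightarrow> 'b::euclidean_space"
  assumes f: "Ck_on 1 f S" and S: "open S" and K: "compact K" "K \<subseteq> S"
  obtains L where "0 \<le> L" "\<And>x y. x \<in> K \<Longrightarrow> y \<in> K \<Longrightarrow> norm (f x - f y) \<le> L * norm (x - y)"
proof -
  let ?D = "\<lambda>x. frechet_derivative f (at x)"
  have D: "(f has_derivative ?D x) (at x)" if "x \<in> S" for x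
    using f that frechet_derivative_works by auto
  \<comment> \<open>\<open>Ck_on\<close> gives continuity of each directional derivative; their sum
    over the basis is a continuous bound for the operator norm.\<close>
  have cont: "continuous_on S (\<lambda>x. \<Sum>b\<in>Basis. norm (?D x b))"
    using f by (auto intro!: continuous_intros)
  have onorm_le: "onorm (?D x) \<le> (\<Sum>b\<in>Basis. norm (?D x b))" if "x \<in> S" for x
  proof (rule onorm_le)
    fix v :: 'a
    interpret bounded_linear "?D x" using D[OF that] by (rule has_derivative_bounded_linear)
    have "?D x v = ?D x (\<Sum>b\<in>Basis. (v \<bullet> b) *\<^sub>R b)"
      by (simp add: euclidean_representation)
    also have "\<dots> = (\<Sum>b\<in>Basis. (v \<bullet> b) *\<^sub>R ?D x b)"
      by (simp add: sum scale)
    also have "norm \<dots> \<le> (\<Sum>b\<in>Basis. norm v * norm (?D x b))"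
      by (intro sum_norm_le) (auto simp: Basis_le_norm intro!: mult_right_mono)
    finally show "norm (?D x v) \<le> (\<Sum>b\<in>Basis. norm (?D x b)) * norm v"
      by (simp add: sum_distrib_left mult.commute)
  qed
  have "local_lipschitz {0} K (\<lambda>_::real. f)"
  proof (rule local_lipschitzI)
    fix t x assume "x \<in> K"
    then obtain u where u: "u > 0" "cball x u \<subseteq> S"
      using S K open_contains_cball by blast
    have "bounded ((\<lambda>x. \<Sum>b\<in>Basis. norm (?D x b)) ` cball x u)"
      by (intro compact_imp_bounded compact_continuous_image continuous_on_subset[OF cont] u) auto
    then obtain B where B: "0 < B" "\<And>y. y \<in> cball x u \<Longrightarrow> norm (\<Sum>b\<in>Basis. norm (?D y b)) \<le> B"
      by (auto simp: bounded_pos)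
    have "B-lipschitz_on (cball x u) f"
    proof (rule lipschitz_onI)
      fix y z assume yz: "y \<in> cball x u" "z \<in> cball x u"
      have "norm (f y - f z) \<le> B * norm (y - z)"
      proof (rule differentiable_bound[OF convex_cball _ _ yz])
        show "(f has_derivative ?D w) (at w within cball x u)" if "w \<in> cball x u" for w
          using D u that by (blast intro: has_derivative_at_withinI)
        show "onorm (?D w) \<le> B" if "w \<in> cball x u" for w
          using onorm_le[of w] B(2)[OF that] u(2) that by fastforce
      qed
      then show "dist (f y) (f z) \<le> B * dist y z" by (simp add: dist_norm)
    qed (use B in auto)
    then show "\<exists>u>0. \<exists>L. \<forall>t\<in>cball t u \<inter> {0}. L-lipschitz_on (cball x u \<inter> K) f"
      using u(1) by (blast intro: lipschitz_on_subset)
  qed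
  then obtain L where "L-lipschitz_on K f"
    by (rule local_lipschitz_compact_implies_lipschitz[where T="{0}"]) (use K in auto)
  then show ?thesis
    by (intro that[of L]) (auto simp: lipschitz_on_def dist_norm)
qed

section \<open>Absolutely continuous functions\<close>

text \<open>On the tags lying in the null set \<open>N\<close> the division intervals have small total length, so that
  absolute continuity controls the increments there; the other tags are handled as in the
  fundamental theorem of calculus for everywhere differentiable functions.\<close>

lemma absolutely_continuous_has_integral:
  fixes f :: "real \<Rightarrow> 'a::euclidean_space"
  assumes ab: "a \<le> b" and ac: "absolutely_continuous_on {a..b} f" and N: "negligible N"
    and der: "\<And>t. t \<in> {a..b} - N \<Longrightarrow> (f has_vector_derivative f' t) (at t within {a..b})"
  shows "(f' has_integral (f b - f a)) {a..b}"
proof -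
  \<comment> \<open>Changing \<open>f'\<close> on a null set does not affect the integral. With the
    value 0, a tag in \<open>N\<close> contributes just the increment of \<open>f\<close>.\<close>
  define g where "g t = (if t \<in> N then 0 else f' t)" for t
  have "(g has_integral (f b - f a)) (cbox a b)"
    unfolding has_integral
  proof (intro allI impI)
    fix e :: real assume e: "e > 0"
    \<comment> \<open>The \<open>+ 1\<close> keeps the quotient meaningful when \<open>a = b\<close>
      and still gives \<open>e' * (b - a) < e / 2\<close>.\<close>
    define e' where "e' = e / (4 * (b - a + 1))"
    have e': "e' > 0" using e ab by (simp add: e'_def)
    obtain \<delta> where \<delta>: "\<delta> > 0" and ac': "\<And>P. finite P \<Longrightarrow> (\<forall>(a',b')\<in>P. a' < b' \<and> {a'..b'} \<subseteq> {a..b}) \<Longrightarrow>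
        pairwise (\<lambda>(a,b) (a',b'). {a<..<b} \<inter> {a'<..<b'} = {}) P \<Longrightarrow>
        (\<Sum>(a,b)\<in>P. b - a) < \<delta> \<Longrightarrow> (\<Sum>(a,b)\<in>P. dist (f a) (f b)) < e / 2"
      using ac[unfolded absolutely_continuous_on_def, rule_format, of "e / 2"] e by auto
    obtain U where U: "open U" "N \<subseteq> U" "U \<in> lmeasurable" "measure lebesgue U < \<delta>"
    proof -
      obtain U where U: "open U" "N \<subseteq> U" "U - N \<in> lmeasurable" "emeasure lebesgue (U - N) < ennreal \<delta>"
        using sets_lebesgue_outer_open[OF negligible_imp_sets[OF N] \<delta>] by blast
      have "U = (U - N) \<union> N" using U(2) by auto
      then have "U \<in> lmeasurable"
        using fmeasurable.Un[OF U(3) negligible_imp_measurable[OF N]] by simp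
      moreover have "measure lebesgue (U - N) = measure lebesgue U"
        using N \<open>U \<in> lmeasurable\<close> by (simp add: measure_Diff_null_set negligible_iff_null_sets fmeasurableD)
      moreover have "measure lebesgue (U - N) < \<delta>"
        using U(3,4) \<delta> by (metis emeasure_eq_measure2 ennreal_leI not_less)
      ultimately show ?thesis using that U by simp
    qed
    \<comment> \<open>One gauge serves both kinds of tags: it confines the intervals tagged in
      \<open>N\<close> to the set \<open>U\<close> of small measure, and at the other tags it makes
      the linear approximation by \<open>f'\<close> accurate to \<open>e'\<close>.\<close>
    have "\<forall>x. \<exists>d>0. (x \<in> U \<longrightarrow> ball x d \<subseteq> U) \<and> (x \<in> {a..b} - N \<longrightarrow>
         (\<forall>y\<in>{a..b}. norm (y-x) < d \<longrightarrow> norm (f y - f x - (y-x) *\<^sub>R f' x) \<le> e' * norm (y-x)))"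
    proof
      fix x
      obtain d1 where d1: "d1 > 0" "x \<in> U \<longrightarrow> ball x d1 \<subseteq> U"
        using U(1) by (meson open_contains_ball zero_less_one)
      have "\<exists>d2>0. x \<in> {a..b} - N \<longrightarrow>
         (\<forall>y\<in>{a..b}. norm (y-x) < d2 \<longrightarrow> norm (f y - f x - (y-x) *\<^sub>R f' x) \<le> e' * norm (y-x))"
      proof (cases "x \<in> {a..b} - N")
        case True
        show ?thesis
          using der[OF True] e' unfolding has_vector_derivative_def has_derivative_within_alt by blast
      next
        case False
        then show ?thesis using zero_less_one by blast
      qed
      then obtain d2 where d2: "d2 > 0" "x \<in> {a..b} - N \<longrightarrow>
         (\<forall>y\<in>{a..b}. norm (y-x) < d2 \<longrightarrow> norm (f y - f x - (y-x) *\<^sub>R f' x) \<le> e' * norm (y-x))"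
        by blast
      show "\<exists>d>0. (x \<in> U \<longrightarrow> ball x d \<subseteq> U) \<and> (x \<in> {a..b} - N \<longrightarrow>
         (\<forall>y\<in>{a..b}. norm (y-x) < d \<longrightarrow> norm (f y - f x - (y-x) *\<^sub>R f' x) \<le> e' * norm (y-x)))"
        using d1 d2 by (intro exI[of _ "min d1 d2"]) auto
    qed
    then obtain d where d: "\<And>x. 0 < d x" "\<And>x. x \<in> U \<Longrightarrow> ball x (d x) \<subseteq> U"
      "\<And>x y. x \<in> {a..b} \<Longrightarrow> x \<notin> N \<Longrightarrow> y \<in> {a..b} \<Longrightarrow> norm (y-x) < d x \<Longrightarrow>
         norm (f y - f x - (y-x) *\<^sub>R f' x) \<le> e' * norm (y-x)"
      by (metis Diff_iff)
    show "\<exists>\<gamma>. gauge \<gamma> \<and> (\<forall>D. D tagged_division_of cbox a b \<and> \<gamma> fine D \<longrightarrow>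
          norm ((\<Sum>(x, K)\<in>D. measure lborel K *\<^sub>R g x) - (f b - f a)) < e)"
    proof (intro exI conjI allI impI; (elim conjE)?)
      show "gauge (\<lambda>x. ball x (d x))" using d(1) gauge_ball_dependent by blast
      fix p assume ptag: "p tagged_division_of cbox a b" and fine: "(\<lambda>x. ball x (d x)) fine p"
      have fin: "finite p" using tagged_division_ofD(1)[OF ptag] .
      have ba: "b - a = (\<Sum>(x,K)\<in>p. Sup K - Inf K)" "f b - f a = (\<Sum>(x,K)\<in>p. f(Sup K) - f(Inf K))"
        using additive_tagged_division_1[OF ab ptag[unfolded box_real], of "\<lambda>x. x"]
          additive_tagged_division_1[OF ab ptag[unfolded box_real], of f] by simp_all
      have K: "\<exists>u v. K = {u..v} \<and> Inf K = u \<and> Sup K = v \<and> measure lborel K = v - u \<and> u \<le> x \<and> x \<le> v \<and> u \<le> v \<and> a \<le> u \<and> v \<le> b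
          \<and> {u..v} \<subseteq> ball x (d x)" if xK: "(x, K) \<in> p" for x K
      proof -
        obtain u v where k: "K = cbox u v" "x \<in> K" "K \<subseteq> cbox a b"
          using tagged_division_ofD(2,3,4)[OF ptag xK] by metis
        moreover have "K \<subseteq> ball x (d x)" using fineD[OF fine xK] .
        ultimately show ?thesis
          by (intro exI[of _ u] exI[of _ v]) (auto simp: subset_iff)
      qed
      have Kle: "Inf K \<le> Sup K" "measure lborel K = Sup K - Inf K" "a \<le> Inf K" "Sup K \<le> b"
        "K = {Inf K..Sup K}" "K \<subseteq> ball x (d x)" if "(x, K) \<in> p" for x K
        using K[OF that] by auto
      define p1 where "p1 = {q \<in> p. fst q \<in> N}"
      define p2 where "p2 = {q \<in> p. fst q \<notin> N}"
      define c where "c = (\<lambda>(x,K). measure lborel K *\<^sub>R g x - (f (Sup K) - f (Inf K)))"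
      have split: "p = p1 \<union> p2" "p1 \<inter> p2 = {}" "finite p1" "finite p2"
        using fin by (auto simp: p1_def p2_def)
      \<comment> \<open>Each interval is split at its tag, which lies in it, so that the two errors
        add up to \<open>e'\<close> times its length.\<close>
      have "norm (sum c p2) \<le> (\<Sum>(x,K)\<in>p2. e' * (Sup K - Inf K))"
      proof (rule sum_norm_le, safe)
        fix x K assume xK: "(x, K) \<in> p2"
        then obtain u v where uv: "K = {u..v}" "Inf K = u" "Sup K = v" "measure lborel K = v - u" "u \<le> x" "x \<le> v"
          "u \<le> v" "a \<le> u" "v \<le> b" "{u..v} \<subseteq> ball x (d x)" using K[of x K] by (auto simp: p2_def)
        have "x \<notin> N" using xK by (auto simp: p2_def)
        have uvb: "norm (u - x) < d x" "norm (v - x) < d x"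
          using uv(7,10) by (auto simp: subset_iff dist_norm abs_minus_commute)
        have "norm (c (x, K)) = norm (f u - f x - (u - x) *\<^sub>R f' x - (f v - f x - (v - x) *\<^sub>R f' x))"
          using \<open>x \<notin> N\<close> uv by (auto simp: c_def g_def algebra_simps)
        also have "\<dots> \<le> norm (f u - f x - (u - x) *\<^sub>R f' x) + norm (f v - f x - (v - x) *\<^sub>R f' x)"
          by (rule norm_triangle_ineq4)
        also have "\<dots> \<le> e' * norm (u - x) + e' * norm (v - x)"
          using uv \<open>x \<notin> N\<close> uvb by (intro add_mono d(3)) auto
        also have "\<dots> = e' * (Sup K - Inf K)"
          using uv by (simp add: algebra_simps)
        finally show "norm (c (x, K)) \<le> e' * (Sup K - Inf K)" .
      qed
      also have "\<dots> \<le> (\<Sum>(x,K)\<in>p. e' * (Sup K - Inf K))"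
        using fin e' by (intro sum_mono2) (auto simp: p2_def Kle)
      also have "\<dots> = e' * (b - a)"
        by (simp add: ba sum_distrib_left case_prod_unfold)
      also have "\<dots> < e / 2"
      proof -
        have "e' * (b - a + 1) = e / 4" using ab unfolding e'_def by (simp add: divide_simps)
        then have "e' * (b - a) = e / 4 - e'" by (simp add: algebra_simps)
        then show ?thesis using e e' by simp
      qed
      finally have part2: "norm (sum c p2) < e / 2" .
      \<comment> \<open>Absolute continuity is stated for nondegenerate intervals. Intervals reduced
        to a point are dropped; their increments vanish.\<close>
      define P where "P = (\<lambda>(x,K). (Inf K, Sup K)) ` {q \<in> p1. Inf (snd q) < Sup (snd q)}"
      have disj: "{Inf K<..<Sup K} \<inter> {Inf K'<..<Sup K'} = {}"
        if "(x, K) \<in> p" "(x', K') \<in> p" "(x, K) \<noteq> (x', K')" for x x' K K'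
      proof -
        have "interior K \<inter> interior K' = {}"
          using tagged_division_ofD(5)[OF ptag that] .
        then show ?thesis
          using Kle(5)[OF that(1)] Kle(5)[OF that(2)] by (metis interior_atLeastAtMost_real)
      qed
      have inj: "inj_on (\<lambda>(x,K). (Inf K, Sup K)) {q \<in> p1. Inf (snd q) < Sup (snd q)}"
      proof (rule inj_onI, clarsimp)
        fix x x' K K' assume "(x, K) \<in> p1" "(x', K') \<in> p1" "Inf K = Inf K'" "Sup K = Sup K'" "Inf K' < Sup K'"
        then show "x = x' \<and> K = K'"
          using disj[of x K x' K'] by (auto simp: p1_def)
      qed
      have "(\<Sum>(a,b)\<in>P. dist (f a) (f b)) < e / 2"
      proof (rule ac')
        show "finite P" using split by (auto simp: P_def)
        show "\<forall>(a',b')\<in>P. a' < b' \<and> {a'..b'} \<subseteq> {a..b}"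
          using Kle(3,4) by (fastforce simp: P_def p1_def)
        show "pairwise (\<lambda>(a,b) (a',b'). {a<..<b} \<inter> {a'<..<b'} = {}) P"
        proof (rule pairwiseI)
          fix q q' assume "q \<in> P" "q' \<in> P" "q \<noteq> q'"
          then obtain x K x' K' where "(x, K) \<in> p" "(x', K') \<in> p" "(x, K) \<noteq> (x', K')"
            "q = (Inf K, Sup K)" "q' = (Inf K', Sup K')"
            by (auto simp: P_def p1_def)
          then show "(case q of (a, b) \<Rightarrow> \<lambda>(a', b'). {a<..<b} \<inter> {a'<..<b'} = {}) q'"
            using disj[of x K x' K'] by simp
        qed
        let ?q = "{q \<in> p1. Inf (snd q) < Sup (snd q)}"
        have part: "?q tagged_partial_division_of cbox a b"
          using ptag by (auto simp: p1_def tagged_division_of_def intro: tagged_partial_division_subset)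
        have inj_snd: "inj_on snd ?q"
        proof (rule inj_onI, clarsimp)
          fix x x' K assume "(x, K) \<in> p1" "(x', K) \<in> p1" "Inf K < Sup K"
          then show "x = x'"
            using disj[of x K x' K] by (auto simp: p1_def)
        qed
        have div: "(snd ` ?q) division_of \<Union>(snd ` ?q)"
          using part by (rule partial_division_of_tagged_division)
        \<comment> \<open>Division intervals have disjoint interiors, so their total length is the
          measure of their union, and the union lies in \<open>U\<close>.\<close>
        have "(\<Sum>(a,b)\<in>P. b - a) = (\<Sum>q\<in>?q. Sup (snd q) - Inf (snd q))"
          unfolding P_def by (subst sum.reindex[OF inj]) (auto simp: case_prod_unfold)
        also have "\<dots> = (\<Sum>q\<in>?q. measure lebesgue (snd q))"
        proof (rule sum.cong)
          fix q assume "q \<in> ?q"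
          then obtain x K where q: "q = (x, K)" "(x, K) \<in> p" by (cases q) (auto simp: p1_def)
          have "K \<in> sets borel" using Kle(5)[OF q(2)] by (metis atLeastAtMost_borel)
          then show "Sup (snd q) - Inf (snd q) = measure lebesgue (snd q)"
            using Kle(2)[OF q(2)] q(1) by (simp add: measure_completion)
        qed simp
        also have "\<dots> = (\<Sum>k\<in>snd ` ?q. measure lebesgue k)"
          by (simp add: sum.reindex[OF inj_snd])
        also have "\<dots> = measure lebesgue (\<Union>(snd ` ?q))"
          using div by (rule content_division)
        also have "\<dots> \<le> measure lebesgue U"
        proof (rule measure_mono_fmeasurable[OF _ _ U(3)])
          show "\<Union>(snd ` ?q) \<subseteq> U"
          proof
            fix y assume "y \<in> \<Union>(snd ` ?q)"
            then obtain x K where xK: "(x, K) \<in> p" "x \<in> N" "y \<in> K" by (auto simp: p1_def)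
            then show "y \<in> U" using Kle(6)[OF xK(1)] d(2)[of x] U(2) by blast
          qed
          show "\<Union>(snd ` ?q) \<in> sets lebesgue"
            using lmeasurable_division[OF div] by (rule fmeasurableD)
        qed
        finally show "(\<Sum>(a,b)\<in>P. b - a) < \<delta>" using U(4) by simp
      qed
      also have "(\<Sum>(a,b)\<in>P. dist (f a) (f b)) = (\<Sum>(x,K)\<in>{q \<in> p1. Inf (snd q) < Sup (snd q)}. dist (f (Inf K)) (f (Sup K)))"
        unfolding P_def by (subst sum.reindex[OF inj]) (auto simp: case_prod_unfold)
      also have "\<dots> = (\<Sum>(x,K)\<in>p1. dist (f (Inf K)) (f (Sup K)))"
      proof (rule sum.mono_neutral_left[OF split(3)])
        have "Inf K < Sup K" if "(x, K) \<in> p" "f (Inf K) \<noteq> f (Sup K)" for x K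
          using Kle(1)[OF that(1)] that(2) by (cases "Inf K = Sup K") auto
        then show "\<forall>q\<in>p1 - {q \<in> p1. Inf (snd q) < Sup (snd q)}. (case q of (x, K) \<Rightarrow> dist (f (Inf K)) (f (Sup K))) = 0"
          by (auto simp: p1_def)
      qed auto
      finally have "(\<Sum>(x,K)\<in>p1. dist (f (Inf K)) (f (Sup K))) < e / 2" .
      moreover have "norm (sum c p1) \<le> (\<Sum>(x,K)\<in>p1. dist (f (Inf K)) (f (Sup K)))"
        by (rule sum_norm_le) (auto simp: p1_def c_def g_def dist_norm norm_minus_commute)
      ultimately have part1: "norm (sum c p1) < e / 2" by simp
      have "(\<Sum>(x, K)\<in>p. measure lborel K *\<^sub>R g x) - (f b - f a) = sum c p"
        by (simp add: ba(2) c_def case_prod_unfold sum_subtractf)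
      also have "\<dots> = sum c p1 + sum c p2"
        using split by (metis sum.union_disjoint)
      finally show "norm ((\<Sum>(x, K)\<in>p. measure lborel K *\<^sub>R g x) - (f b - f a)) < e"
        using part1 part2 norm_triangle_ineq[of "sum c p1" "sum c p2"] by simp
    qed
  qed
  then show ?thesis
    using has_integral_spike[OF N, of "{a..b}" f' g] by (auto simp: g_def)
qed

section \<open>Perturbations along a solution\<close>

lemma vector_derivative_lipschitz:
  fixes u :: "real \<Rightarrow> 'a::euclidean_space"
  assumes S: "convex S" and u: "\<And>t. t \<in> S \<Longrightarrow> (u has_vector_derivative u' t) (at t within S)"
    and C: "\<And>t. t \<in> S \<Longrightarrow> norm (u' t) \<le> C" and t: "t \<in> S" "s \<in> S"
  shows "norm (u t - u s) \<le> C * \<bar>t - s\<bar>"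
proof -
  have "norm (u t - u s) \<le> C * norm (t - s)"
  proof (rule differentiable_bound[OF S _ _ t])
    show "(u has_derivative (\<lambda>h. h *\<^sub>R u' r)) (at r within S)" if "r \<in> S" for r
      using u[OF that] by (simp add: has_vector_derivative_def)
    show "onorm (\<lambda>h. h *\<^sub>R u' r) \<le> C" if "r \<in> S" for r
      by (rule onorm_le) (use C[OF that] in \<open>simp add: mult.commute[of C] mult_left_mono\<close>)
  qed
  then show ?thesis by simp
qed

text \<open>One constant \<open>L\<close> bounds all quantities on the tube of radius \<rho>.
  \<open>A t\<close> stands for the derivative of \<open>F\<close> at \<open>\<gamma> t\<close>. The
  decisive condition is \<open>F_A\<close>: the Taylor remainder is compared at two points, with the
  small factor \<open>norm a + norm b\<close> in front of \<open>norm (a - b)\<close>.\<close>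

locale solution_tube =
  fixes F :: "plane \<Rightarrow> plane" and A :: "real \<Rightarrow> plane \<Rightarrow> plane"
    and \<gamma> :: "real \<Rightarrow> plane" and T \<rho> L :: real
  assumes T: "0 < T" and rho: "0 < \<rho>" and L: "1 \<le> L"
    and \<gamma>': "\<And>t. t \<in> {0..T} \<Longrightarrow> (\<gamma> has_vector_derivative F (\<gamma> t)) (at t within {0..T})"
    and F_bound: "\<And>t. t \<in> {0..T} \<Longrightarrow> norm (F (\<gamma> t)) \<le> L"
    and F_lip: "\<And>t a b. t \<in> {0..T} \<Longrightarrow> norm a \<le> \<rho> \<Longrightarrow> norm b \<le> \<rho> \<Longrightarrow>
        norm (F (\<gamma> t + a) - F (\<gamma> t + b)) \<le> L * norm (a - b)"
    and F_cont: "continuous_on ({0..T} \<times> cball 0 \<rho>) (\<lambda>(t, a). F (\<gamma> t + a))"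
    and A_linear: "\<And>t. t \<in> {0..T} \<Longrightarrow> linear (A t)"
    and A_bound: "\<And>t a. t \<in> {0..T} \<Longrightarrow> norm (A t a) \<le> L * norm a"
    and A_cont: "\<And>c. continuous_on {0..T} (\<lambda>t. A t c)"
    and F_A: "\<And>t a b. t \<in> {0..T} \<Longrightarrow> norm a \<le> \<rho> \<Longrightarrow> norm b \<le> \<rho> \<Longrightarrow>
        norm (F (\<gamma> t + a) - F (\<gamma> t + b) - A t (a - b)) \<le> L * (norm a + norm b) * norm (a - b)"
begin

lemma L_mono: "a \<le> b \<Longrightarrow> L * a \<le> L * b"
  using L by simp

lemma \<gamma>_lip: "t \<in> {0..T} \<Longrightarrow> s \<in> {0..T} \<Longrightarrow> norm (\<gamma> t - \<gamma> s) \<le> L * \<bar>t - s\<bar>"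
  by (rule vector_derivative_lipschitz[OF _ \<gamma>' F_bound]) auto

text \<open>Linearity reduces joint continuity to that of the two columns of
  \<open>A t\<close>.\<close>

lemma A_joint_cont: "continuous_on ({0..T} \<times> UNIV) (\<lambda>(t, a). A t a)"
proof -
  have A_eq: "A t a = fst a *\<^sub>R A t (1, 0) + snd a *\<^sub>R A t (0, 1)" if "t \<in> {0..T}" for t a
  proof -
    have "a = fst a *\<^sub>R (1, 0) + snd a *\<^sub>R (0, 1)" by (simp add: prod_eq_iff)
    then have "A t a = A t (fst a *\<^sub>R (1, 0) + snd a *\<^sub>R (0, 1))" by (rule arg_cong)
    also have "\<dots> = fst a *\<^sub>R A t (1, 0) + snd a *\<^sub>R A t (0, 1)"
      by (simp only: linear_add[OF A_linear[OF that]] linear_scale[OF A_linear[OF that]])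
    finally show ?thesis .
  qed
  have eq: "fst (snd p) *\<^sub>R A (fst p) (1, 0) + snd (snd p) *\<^sub>R A (fst p) (0, 1) = (case p of (t, a) \<Rightarrow> A t a)"
    if "p \<in> {0..T} \<times> UNIV" for p
    using that A_eq[of "fst p" "snd p"] by (simp add: case_prod_unfold mem_Times_iff)
  have "continuous_on ({0..T} \<times> UNIV)
      (\<lambda>p. fst (snd p) *\<^sub>R A (fst p) (1, 0) + snd (snd p) *\<^sub>R A (fst p) (0, 1))"
    by (intro continuous_intros continuous_on_compose2[OF A_cont, of _ fst]) auto
  then show ?thesis by (rule continuous_on_eq) (rule eq)
qed

lemma linear_ode_exists:
  assumes "continuous_on {0..T} g"
  shows "\<exists>v. v 0 = c \<and> (\<forall>t\<in>{0..T}. (v has_vector_derivative A t (v t) + g t) (at t within {0..T}))"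
proof (rule lipschitz_ode_exists)
  show "continuous_on ({0..T} \<times> UNIV) (\<lambda>(t, x). A t x + g t)"
    using A_joint_cont unfolding case_prod_unfold
    by (intro continuous_intros continuous_on_compose2[OF assms, of _ fst]) auto
  show "norm (A t x + g t - (A t y + g t)) \<le> L * norm (x - y)" if "t \<in> {0..T}" for t x y
    using A_bound[OF that, of "x - y"] linear_diff[OF A_linear[OF that]] by simp
qed (use T L in auto)

text \<open>Gronwall's inequality with \<open>b = 0\<close>, run forwards from \<open>s\<close> and,
  after reversing time, backwards. The zero may lie anywhere in the interval because the lemma has
  to exclude a singular fundamental matrix at any time.\<close>

lemma linear_ode_zero:
  assumes v: "\<And>t. t \<in> {0..T} \<Longrightarrow> (v has_vector_derivative A t (v t)) (at t within {0..T})"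
    and s: "s \<in> {0..T}" "v s = 0" and t: "t \<in> {0..T}"
  shows "v t = 0"
proof (cases "s \<le> t")
  case True
  have "norm (v (s + (t - s))) \<le> (norm (v (s + 0)) + 0 * (t - s)) * exp (L * (t - s))"
  proof (rule gronwall_vector_derivative[where u="\<lambda>r. v (s + r)" and T="T - s" and b=0])
    fix r assume r: "r \<in> {0..T - s}"
    have "((\<lambda>r. s + r) has_vector_derivative 1) (at r within {0..T - s})"
      by (auto intro!: derivative_eq_intros)
    moreover have "(v has_vector_derivative A (s + r) (v (s + r))) (at (s + r) within (\<lambda>r. s + r) ` {0..T - s})"
      by (rule has_vector_derivative_within_subset[OF v]) (use r s in auto)
    ultimately show "((\<lambda>r. v (s + r)) has_vector_derivative A (s + r) (v (s + r))) (at r within {0..T - s})"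
      using vector_diff_chain_within by (fastforce simp: o_def)
    show "norm (A (s + r) (v (s + r))) \<le> L * norm (v (s + r)) + 0"
      using A_bound[of "s + r"] r s by auto
  qed (use L s t True in auto)
  then show ?thesis using s by simp
next
  case False
  have "norm (v (s - (s - t))) \<le> (norm (v (s - 0)) + 0 * (s - t)) * exp (L * (s - t))"
  proof (rule gronwall_vector_derivative[where u="\<lambda>r. v (s - r)" and T=s and b=0])
    fix r assume r: "r \<in> {0..s}"
    have "((\<lambda>r. s - r) has_vector_derivative -1) (at r within {0..s})"
      by (auto intro!: derivative_eq_intros)
    moreover have "(v has_vector_derivative A (s - r) (v (s - r))) (at (s - r) within (\<lambda>r. s - r) ` {0..s})"
      by (rule has_vector_derivative_within_subset[OF v]) (use r s in auto)
    ultimately show "((\<lambda>r. v (s - r)) has_vector_derivative - A (s - r) (v (s - r))) (at r within {0..s})"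
      using vector_diff_chain_within by (fastforce simp: o_def)
    show "norm (- A (s - r) (v (s - r))) \<le> L * norm (v (s - r)) + 0"
      using A_bound[of "s - r"] r s by auto
  qed (use L s t False in auto)
  then show ?thesis using s by simp
qed

end

text \<open>\<open>k t \<theta> z \<epsilon>\<close> is the perturbation, divided by \<epsilon>,
  felt by a solution started at phase \<theta>. \<open>k_mixed\<close> bounds a mixed difference, in
  the phase on one side and in position and \<epsilon> on the other. Without its factor
  \<open>norm a + \<epsilon>\<close> the remainder would depend on \<theta> with a constant of order
  \<epsilon> instead of \<open>\<epsilon>\<^sup>2\<close>, too large after the division by
  \<epsilon>.\<close>

locale perturbed_tube = solution_tube +
  fixes k :: "real \<Rightarrow> real \<Rightarrow> plane \<Rightarrow> real \<Rightarrow> plane" and J :: "real set" and e0 :: real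
  assumes e0: "0 < e0" "e0 \<le> 1"
    and k_bound: "\<And>t \<theta> a \<epsilon>. t \<in> {0..T} \<Longrightarrow> \<theta> \<in> J \<Longrightarrow> norm a \<le> \<rho> \<Longrightarrow> \<epsilon> \<in> {0..e0} \<Longrightarrow>
        norm (k t \<theta> (\<gamma> t + a) \<epsilon>) \<le> L"
    and k_lip: "\<And>t \<theta> a b \<epsilon>. t \<in> {0..T} \<Longrightarrow> \<theta> \<in> J \<Longrightarrow> norm a \<le> \<rho> \<Longrightarrow> norm b \<le> \<rho> \<Longrightarrow> \<epsilon> \<in> {0..e0} \<Longrightarrow>
        norm (k t \<theta> (\<gamma> t + a) \<epsilon> - k t \<theta> (\<gamma> t + b) \<epsilon>) \<le> L * norm (a - b)"
    and k_eps: "\<And>t \<theta> a \<epsilon>. t \<in> {0..T} \<Longrightarrow> \<theta> \<in> J \<Longrightarrow> norm a \<le> \<rho> \<Longrightarrow> \<epsilon> \<in> {0..e0} \<Longrightarrow>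
        norm (k t \<theta> (\<gamma> t + a) \<epsilon> - k t \<theta> (\<gamma> t) 0) \<le> L * (norm a + \<epsilon>)"
    and k_phase: "\<And>t \<theta> \<theta>' a \<epsilon>. t \<in> {0..T} \<Longrightarrow> \<theta> \<in> J \<Longrightarrow> \<theta>' \<in> J \<Longrightarrow> norm a \<le> \<rho> \<Longrightarrow> \<epsilon> \<in> {0..e0} \<Longrightarrow>
        norm (k t \<theta> (\<gamma> t + a) \<epsilon> - k t \<theta>' (\<gamma> t + a) \<epsilon>) \<le> L * \<bar>\<theta> - \<theta>'\<bar>"
    and k_mixed: "\<And>t \<theta> \<theta>' a \<epsilon>. t \<in> {0..T} \<Longrightarrow> \<theta> \<in> J \<Longrightarrow> \<theta>' \<in> J \<Longrightarrow> norm a \<le> \<rho> \<Longrightarrow> \<epsilon> \<in> {0..e0} \<Longrightarrow>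
        norm (k t \<theta> (\<gamma> t + a) \<epsilon> - k t \<theta>' (\<gamma> t + a) \<epsilon> - (k t \<theta> (\<gamma> t) 0 - k t \<theta>' (\<gamma> t) 0))
          \<le> L * (norm a + \<epsilon>) * \<bar>\<theta> - \<theta>'\<bar>"
    and k_cont: "\<And>\<theta> \<epsilon>. \<theta> \<in> J \<Longrightarrow> \<epsilon> \<in> {0..e0} \<Longrightarrow>
        continuous_on ({0..T} \<times> cball 0 \<rho>) (\<lambda>(t, a). k t \<theta> (\<gamma> t + a) \<epsilon>)"
begin

definition rate :: "real \<Rightarrow> real \<Rightarrow> real \<Rightarrow> plane \<Rightarrow> plane" where
  "rate \<epsilon> \<theta> t a = F (\<gamma> t + a) - F (\<gamma> t) + \<epsilon> *\<^sub>R k t \<theta> (\<gamma> t + a) \<epsilon>"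

text \<open>\<open>x\<close> is the deviation from \<open>\<gamma>\<close> of a solution of the perturbed equation with phase \<open>\<theta>\<close>.\<close>

definition deviation :: "real \<Rightarrow> plane \<Rightarrow> real \<Rightarrow> real \<Rightarrow> (real \<Rightarrow> plane) \<Rightarrow> bool" where
  "deviation \<epsilon> \<zeta> \<theta> \<tau> x \<longleftrightarrow> x 0 = \<epsilon> *\<^sub>R \<zeta> \<and>
     (\<forall>t\<in>{0..\<tau>}. norm (x t) \<le> \<rho> \<and> (x has_vector_derivative rate \<epsilon> \<theta> t (x t)) (at t within {0..\<tau>}))"

text \<open>The formal \<epsilon>-derivative of a deviation at 0: the linearized equation along
  \<gamma>, forced by the perturbation evaluated on \<gamma> at \<epsilon> = 0.\<close>

definition variation :: "plane \<Rightarrow> real \<Rightarrow> (real \<Rightarrow> plane) \<Rightarrow> bool" where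
  "variation \<zeta> \<theta> v \<longleftrightarrow> v 0 = \<zeta> \<and>
     (\<forall>t\<in>{0..T}. (v has_vector_derivative A t (v t) + k t \<theta> (\<gamma> t) 0) (at t within {0..T}))"

lemma rate_lip:
  assumes "t \<in> {0..T}" "\<theta> \<in> J" "\<epsilon> \<in> {0..e0}" "norm a \<le> \<rho>" "norm b \<le> \<rho>"
  shows "norm (rate \<epsilon> \<theta> t a - rate \<epsilon> \<theta> t b) \<le> 2 * L * norm (a - b)"
proof -
  have "rate \<epsilon> \<theta> t a - rate \<epsilon> \<theta> t b = (F (\<gamma> t + a) - F (\<gamma> t + b))
      + \<epsilon> *\<^sub>R (k t \<theta> (\<gamma> t + a) \<epsilon> - k t \<theta> (\<gamma> t + b) \<epsilon>)"
    by (simp add: rate_def algebra_simps)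
  also have "norm \<dots> \<le> L * norm (a - b) + \<epsilon> * (L * norm (a - b))"
    using assms F_lip[of t a b] k_lip[of t \<theta> a b \<epsilon>]
    by (intro norm_triangle_le add_mono) (auto intro!: mult_left_mono)
  also have "\<dots> \<le> L * norm (a - b) + 1 * (L * norm (a - b))"
    using assms e0 L by (intro add_left_mono mult_right_mono) auto
  finally show ?thesis by simp
qed

lemma rate_bound:
  assumes "t \<in> {0..T}" "\<theta> \<in> J" "\<epsilon> \<in> {0..e0}" "norm a \<le> \<rho>"
  shows "norm (rate \<epsilon> \<theta> t a) \<le> L * norm a + \<epsilon> * L"
  unfolding rate_def
  using assms rho F_lip[of t a 0] k_bound[of t \<theta> a \<epsilon>]
  by (intro norm_triangle_le add_mono) (auto intro!: mult_left_mono)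

text \<open>Gronwall bound for a deviation divided by \<epsilon>, when the scaled initial value has
  norm at most \<open>B\<close>.\<close>

definition radius :: "real \<Rightarrow> real" where
  "radius B = (B + L * T) * exp (L * T)"

lemma radius_nonneg: "0 \<le> B \<Longrightarrow> 0 \<le> radius B"
  using L T by (simp add: radius_def)

text \<open>The derivative \<open>x'\<close> is left abstract because the bound is needed twice: for
  deviations, and for a truncated equation before its solution is known to remain in the
  tube.\<close>

lemma deviation_bound_gen:
  fixes x :: "real \<Rightarrow> plane"
  assumes \<epsilon>: "\<epsilon> \<in> {0..e0}" and \<tau>: "\<tau> \<le> T" and \<zeta>: "norm \<zeta> \<le> B" and x0: "x 0 = \<epsilon> *\<^sub>R \<zeta>"
    and x: "\<And>t. t \<in> {0..\<tau>} \<Longrightarrow> (x has_vector_derivative x' t) (at t within {0..\<tau>})"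
    and x': "\<And>t. t \<in> {0..\<tau>} \<Longrightarrow> norm (x' t) \<le> L * norm (x t) + \<epsilon> * L"
    and t: "t \<in> {0..\<tau>}"
  shows "norm (x t) \<le> \<epsilon> * radius B"
proof -
  have "norm (x t) \<le> (norm (x 0) + \<epsilon> * L * t) * exp (L * t)"
    by (rule gronwall_vector_derivative[where u=x and u'=x' and T=\<tau>]) (use x x' \<epsilon> L t in auto)
  also have "\<dots> \<le> (\<epsilon> * B + \<epsilon> * L * T) * exp (L * T)"
    using \<epsilon> \<zeta> t \<tau> L norm_ge_zero[of \<zeta>]
    by (intro mult_mono add_mono) (auto simp: x0 intro!: mult_left_mono mult_nonneg_nonneg add_nonneg_nonneg simp del: norm_ge_zero)
  finally show ?thesis by (simp add: radius_def algebra_simps)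
qed

lemma deviation_bound:
  assumes "deviation \<epsilon> \<zeta> \<theta> \<tau> x" "\<epsilon> \<in> {0..e0}" "\<theta> \<in> J" "\<tau> \<le> T" "norm \<zeta> \<le> B" "t \<in> {0..\<tau>}"
  shows "norm (x t) \<le> \<epsilon> * radius B"
  using assms unfolding deviation_def
  by (intro deviation_bound_gen[of \<epsilon> \<tau> \<zeta> B x "\<lambda>t. rate \<epsilon> \<theta> t (x t)"]) (auto intro!: rate_bound)

text \<open>Composition with the nearest-point projection onto the ball of radius \<rho> makes the
  right-hand side globally Lipschitz. The a priori bound holds for the truncated equation as well,
  since the projection does not increase norms, and it shows that the truncation is never
  active.\<close>

lemma deviation_exists:
  assumes \<epsilon>: "\<epsilon> \<in> {0..e0}" and \<theta>: "\<theta> \<in> J" and \<zeta>: "norm \<zeta> \<le> B" and small: "\<epsilon> * radius B \<le> \<rho>"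
  shows "\<exists>x. deviation \<epsilon> \<zeta> \<theta> T x"
proof -
  define P where "P = closest_point (cball (0::plane) \<rho>)"
  have P_in: "norm (P a) \<le> \<rho>" for a
    using closest_point_in_set[of "cball 0 \<rho>" a] rho by (simp add: P_def)
  have P_lip: "norm (P a - P b) \<le> norm (a - b)" for a b
    using closest_point_lipschitz[of "cball 0 \<rho>" a b] rho by (auto simp: P_def dist_norm)
  have P_id: "P a = a" if "norm a \<le> \<rho>" for a
    using that by (simp add: P_def closest_point_self)
  have P_norm: "norm (P a) \<le> norm a" for a
    using P_lip[of a 0] P_id[of 0] rho by simp
  have P_cont: "continuous_on UNIV P"
    unfolding P_def by (rule continuous_on_closest_point) (use rho in auto)
  have "\<exists>x. x 0 = \<epsilon> *\<^sub>R \<zeta> \<and> (\<forall>t\<in>{0..T}. (x has_vector_derivative rate \<epsilon> \<theta> t (P (x t))) (at t within {0..T}))"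
  proof (rule lipschitz_ode_exists)
    have 1: "continuous_on ({0..T} \<times> UNIV) (\<lambda>p. (fst p, P (snd p)))"
      by (intro continuous_intros continuous_on_compose2[OF P_cont, of _ snd]) auto
    have 2: "continuous_on ({0..T} \<times> cball 0 \<rho>) (\<lambda>(t, a). rate \<epsilon> \<theta> t a)"
    proof -
      have "continuous_on ({0..T} \<times> cball 0 \<rho>) (\<lambda>p. F (\<gamma> (fst p)))"
        by (rule continuous_on_compose2[OF F_cont, of _ "\<lambda>p. (fst p, 0)", simplified])
          (use rho in \<open>auto intro!: continuous_intros\<close>)
      then show ?thesis
        using F_cont k_cont[OF \<theta> \<epsilon>] unfolding rate_def case_prod_unfold
        by (intro continuous_intros) 
    qed
    show "continuous_on ({0..T} \<times> UNIV) (\<lambda>(t, x). rate \<epsilon> \<theta> t (P x))"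
    proof -
      have "(\<lambda>p. (fst p, P (snd p))) ` ({0..T} \<times> UNIV) \<subseteq> {0..T} \<times> cball 0 \<rho>"
        using P_in by auto
      from continuous_on_compose2[OF 2 1 this] show ?thesis by (simp add: case_prod_unfold)
    qed
    show "norm (rate \<epsilon> \<theta> t (P a) - rate \<epsilon> \<theta> t (P b)) \<le> 2 * L * norm (a - b)" if "t \<in> {0..T}" for t a b
      using rate_lip[OF that \<theta> \<epsilon> P_in P_in, of a b] mult_left_mono[OF P_lip[of a b], of "2 * L"] L by linarith
  qed (use T L in auto)
  then obtain x where x: "x 0 = \<epsilon> *\<^sub>R \<zeta>"
    "\<And>t. t \<in> {0..T} \<Longrightarrow> (x has_vector_derivative rate \<epsilon> \<theta> t (P (x t))) (at t within {0..T})" by blast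
  have "norm (x t) \<le> \<epsilon> * radius B" if "t \<in> {0..T}" for t
  proof (rule deviation_bound_gen[OF \<epsilon> order_refl \<zeta> x _ that])
    show "norm (rate \<epsilon> \<theta> t (P (x t))) \<le> L * norm (x t) + \<epsilon> * L" if "t \<in> {0..T}" for t
      using rate_bound[OF that \<theta> \<epsilon> P_in, of "x t"] mult_left_mono[OF P_norm[of "x t"], of L] L by linarith
  qed
  with small have "norm (x t) \<le> \<rho>" if "t \<in> {0..T}" for t using that by (meson order_trans)
  then show ?thesis
    using x P_id by (auto simp: deviation_def)
qed

text \<open>The estimate of the derivatives feeds Gronwall's inequality. It is kept as a second
  conclusion because the difference of two deviations will be compared at two different times.
  \<open>2 * L\<close> is a Lipschitz constant of the perturbed field, as \<epsilon> is at most
  1.\<close>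

lemma deviation_diff:
  assumes x: "deviation \<epsilon> \<zeta> \<theta> \<tau> x" and y: "deviation \<epsilon> \<zeta>' \<theta>' \<tau> y"
    and \<epsilon>: "\<epsilon> \<in> {0..e0}" and \<theta>: "\<theta> \<in> J" "\<theta>' \<in> J" and \<tau>: "\<tau> \<le> T" and t: "t \<in> {0..\<tau>}"
  shows "norm (x t - y t) \<le> \<epsilon> * ((1 + L * T) * exp (2 * L * T)) * (norm (\<zeta> - \<zeta>') + \<bar>\<theta> - \<theta>'\<bar>)"
    and "norm (rate \<epsilon> \<theta> t (x t) - rate \<epsilon> \<theta>' t (y t)) \<le> 2 * L * norm (x t - y t) + \<epsilon> * L * \<bar>\<theta> - \<theta>'\<bar>"
proof -
  have r: "norm (rate \<epsilon> \<theta> t (x t) - rate \<epsilon> \<theta>' t (y t)) \<le> 2 * L * norm (x t - y t) + \<epsilon> * L * \<bar>\<theta> - \<theta>'\<bar>"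
    if "t \<in> {0..\<tau>}" for t
  proof -
    have t: "t \<in> {0..T}" and b: "norm (x t) \<le> \<rho>" "norm (y t) \<le> \<rho>"
      using that \<tau> x y by (auto simp: deviation_def)
    have "rate \<epsilon> \<theta> t (x t) - rate \<epsilon> \<theta>' t (y t) = (rate \<epsilon> \<theta> t (x t) - rate \<epsilon> \<theta> t (y t))
        + \<epsilon> *\<^sub>R (k t \<theta> (\<gamma> t + y t) \<epsilon> - k t \<theta>' (\<gamma> t + y t) \<epsilon>)"
      by (simp add: rate_def algebra_simps)
    also have "norm \<dots> \<le> 2 * L * norm (x t - y t) + \<epsilon> * (L * \<bar>\<theta> - \<theta>'\<bar>)"
      using rate_lip[OF t \<theta>(1) \<epsilon> b] k_phase[OF t \<theta> b(2) \<epsilon>] \<epsilon>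
      by (intro norm_triangle_le add_mono) (auto intro!: mult_left_mono)
    finally show ?thesis by simp
  qed
  show "norm (rate \<epsilon> \<theta> t (x t) - rate \<epsilon> \<theta>' t (y t)) \<le> 2 * L * norm (x t - y t) + \<epsilon> * L * \<bar>\<theta> - \<theta>'\<bar>"
    using r[OF t] .
  have "norm (x t - y t) \<le> (norm (x 0 - y 0) + \<epsilon> * L * \<bar>\<theta> - \<theta>'\<bar> * t) * exp (2 * L * t)"
    by (rule gronwall_vector_derivative[OF _ r]) (use x y \<epsilon> L t in \<open>auto simp: deviation_def intro!: derivative_intros\<close>)
  also have "\<dots> \<le> (\<epsilon> * norm (\<zeta> - \<zeta>') + \<epsilon> * L * \<bar>\<theta> - \<theta>'\<bar> * T) * exp (2 * L * T)"
    using x y \<epsilon> L t \<tau>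
    by (intro mult_mono add_mono) (auto simp: deviation_def scaleR_diff_right[symmetric] intro!: mult_left_mono mult_nonneg_nonneg add_nonneg_nonneg)
  \<comment> \<open>Both terms are enlarged to the common factor \<open>1 + L * T\<close>, so that
    initial value and phase enter only through the sum of their distances.\<close>
  also have "\<dots> \<le> (\<epsilon> * (1 + L * T) * norm (\<zeta> - \<zeta>') + \<epsilon> * (1 + L * T) * \<bar>\<theta> - \<theta>'\<bar>) * exp (2 * L * T)"
  proof -
    have "\<epsilon> * L * T * \<bar>\<theta> - \<theta>'\<bar> \<le> \<epsilon> * (1 + L * T) * \<bar>\<theta> - \<theta>'\<bar>" "\<epsilon> * 1 * norm (\<zeta> - \<zeta>') \<le> \<epsilon> * (1 + L * T) * norm (\<zeta> - \<zeta>')"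
      using \<epsilon> L T by (auto intro!: mult_right_mono mult_left_mono simp: algebra_simps)
    then show ?thesis by (intro mult_right_mono) (auto simp: mult_ac)
  qed
  finally show "norm (x t - y t) \<le> \<epsilon> * ((1 + L * T) * exp (2 * L * T)) * (norm (\<zeta> - \<zeta>') + \<bar>\<theta> - \<theta>'\<bar>)"
    by (simp add: algebra_simps)
qed

lemma deviation_unique:
  assumes "deviation \<epsilon> \<zeta> \<theta> \<tau> x" "deviation \<epsilon> \<zeta> \<theta> \<tau> y" "\<epsilon> \<in> {0..e0}" "\<theta> \<in> J" "\<tau> \<le> T" "t \<in> {0..\<tau>}"
  shows "x t = y t"
  using deviation_diff(1)[OF assms(1,2,3,4,4,5,6)] by simp

lemma deviation_restrict:
  assumes "deviation \<epsilon> \<zeta> \<theta> \<tau> x" "\<tau>' \<le> \<tau>"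
  shows "deviation \<epsilon> \<zeta> \<theta> \<tau>' x"
  using assms unfolding deviation_def
  by (auto intro!: has_vector_derivative_within_subset[of x _ _ "{0..\<tau>}" "{0..\<tau>'}"])

lemma variation_exists: "\<theta> \<in> J \<Longrightarrow> \<exists>v. variation \<zeta> \<theta> v"
proof -
  assume "\<theta> \<in> J"
  then have "continuous_on {0..T} (\<lambda>t. k t \<theta> (\<gamma> t) 0)"
    using rho e0 by (intro continuous_on_compose2[OF k_cont, of \<theta> 0 _ "\<lambda>t. (t, 0)", simplified])
      (auto intro!: continuous_intros)
  from linear_ode_exists[OF this] show ?thesis by (simp add: variation_def)
qed

lemma variation_unique:
  assumes "variation \<zeta> \<theta> v" "variation \<zeta> \<theta> w" "t \<in> {0..T}"
  shows "v t = w t"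
proof -
  have "v t - w t = 0"
  proof (rule linear_ode_zero[where v="\<lambda>t. v t - w t" and s=0])
    fix t assume t: "t \<in> {0..T}"
    then have "((\<lambda>t. v t - w t) has_vector_derivative (A t (v t) + k t \<theta> (\<gamma> t) 0) - (A t (w t) + k t \<theta> (\<gamma> t) 0)) (at t within {0..T})"
      using assms by (intro derivative_intros) (auto simp: variation_def)
    then show "((\<lambda>t. v t - w t) has_vector_derivative A t (v t - w t)) (at t within {0..T})"
      using linear_diff[OF A_linear[OF t]] by simp
  qed (use assms T in \<open>auto simp: variation_def\<close>)
  then show ?thesis by simp
qed

definition K_lip :: real where
  "K_lip = (1 + L * T) * exp (2 * L * T)"

lemma K_lip_nonneg: "0 \<le> K_lip"
  using L T by (simp add: K_lip_def)

text \<open>The terms cover both linearization estimates that follow: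
  \<open>(radius B)\<^sup>2\<close> comes from a single solution, the terms with
  \<open>K_lip\<close> from a difference of two, the remaining ones from either.\<close>

definition K_lin :: "real \<Rightarrow> real" where
  "K_lin B = L * (2 * radius B * K_lip + K_lip + (radius B)\<^sup>2 + radius B + 1) * T * exp (L * T)"

lemma K_lin_nonneg: "0 \<le> B \<Longrightarrow> 0 \<le> K_lin B"
  using L T K_lip_nonneg radius_nonneg[of B] by (auto simp: K_lin_def intro!: mult_nonneg_nonneg add_nonneg_nonneg)

text \<open>The defect \<open>u\<close> of the linear approximation starts at 0 and satisfies the
  linearized equation up to an error in which every term carries two factors \<epsilon> and the
  distance of the two data. Gronwall's inequality preserves this form.\<close>

lemma deviation_diff_linear:
  assumes x: "deviation \<epsilon> \<zeta> \<theta> T x" and y: "deviation \<epsilon> \<zeta>' \<theta>' T y"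
    and v: "variation \<zeta> \<theta> v" and w: "variation \<zeta>' \<theta>' w"
    and \<epsilon>: "\<epsilon> \<in> {0..e0}" and \<theta>: "\<theta> \<in> J" "\<theta>' \<in> J" and B: "norm \<zeta> \<le> B" "norm \<zeta>' \<le> B" and t: "t \<in> {0..T}"
  shows "norm (x t - y t - \<epsilon> *\<^sub>R (v t - w t)) \<le> \<epsilon>\<^sup>2 * K_lin B * (norm (\<zeta> - \<zeta>') + \<bar>\<theta> - \<theta>'\<bar>)"
proof -
  define \<delta> where "\<delta> = norm (\<zeta> - \<zeta>') + \<bar>\<theta> - \<theta>'\<bar>"
  have \<delta>: "0 \<le> \<delta>" "\<bar>\<theta> - \<theta>'\<bar> \<le> \<delta>" by (auto simp: \<delta>_def)
  have B0: "0 \<le> B" using B(1) norm_ge_zero order_trans by blast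
  define u where "u t = x t - y t - \<epsilon> *\<^sub>R (v t - w t)" for t
  define u' where "u' t = rate \<epsilon> \<theta> t (x t) - rate \<epsilon> \<theta>' t (y t)
      - \<epsilon> *\<^sub>R ((A t (v t) + k t \<theta> (\<gamma> t) 0) - (A t (w t) + k t \<theta>' (\<gamma> t) 0))" for t
  define C where "C = L * (2 * radius B * K_lip + K_lip + radius B + 1)"
  have "norm (u t) \<le> (norm (u 0) + \<epsilon>\<^sup>2 * C * \<delta> * t) * exp (L * t)"
  proof (rule gronwall_vector_derivative[where u'=u' and T=T])
    fix t assume t: "t \<in> {0..T}"
    show "(u has_vector_derivative u' t) (at t within {0..T})"
      unfolding u_def u'_def using x y v w t
      by (intro derivative_intros bounded_linear.has_vector_derivative[OF bounded_linear_scaleR_right])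
        (auto simp: deviation_def variation_def)
    have xy: "norm (x t) \<le> \<rho>" "norm (y t) \<le> \<rho>"
      using x y t by (auto simp: deviation_def)
    have xB: "norm (x t) \<le> \<epsilon> * radius B" and yB: "norm (y t) \<le> \<epsilon> * radius B"
      using deviation_bound[OF x \<epsilon> \<theta>(1) order_refl B(1) t] deviation_bound[OF y \<epsilon> \<theta>(2) order_refl B(2) t] by auto
    have d: "norm (x t - y t) \<le> \<epsilon> * K_lip * \<delta>"
      using deviation_diff(1)[OF x y \<epsilon> \<theta> order_refl t] by (simp add: K_lip_def \<delta>_def)
    note lin = A_linear[OF t]
    have Au: "A t (u t) = A t (x t - y t) - \<epsilon> *\<^sub>R (A t (v t) - A t (w t))"
      by (simp add: u_def linear_diff[OF lin] linear_scale[OF lin])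
    \<comment> \<open>Changing the position at equal phase, and then the phase at equal position,
      separates the Lipschitz part of \<open>k\<close> from its mixed difference.\<close>
    have eq: "u' t = (F (\<gamma> t + x t) - F (\<gamma> t + y t) - A t (x t - y t)) + A t (u t)
        + \<epsilon> *\<^sub>R ((k t \<theta> (\<gamma> t + x t) \<epsilon> - k t \<theta> (\<gamma> t + y t) \<epsilon>)
          + (k t \<theta> (\<gamma> t + y t) \<epsilon> - k t \<theta>' (\<gamma> t + y t) \<epsilon> - (k t \<theta> (\<gamma> t) 0 - k t \<theta>' (\<gamma> t) 0)))"
      unfolding Au u'_def rate_def by (simp add: algebra_simps)
    have 1: "norm (F (\<gamma> t + x t) - F (\<gamma> t + y t) - A t (x t - y t)) \<le> \<epsilon>\<^sup>2 * (L * 2 * radius B * K_lip) * \<delta>"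
    proof -
      have "norm (F (\<gamma> t + x t) - F (\<gamma> t + y t) - A t (x t - y t)) \<le> L * (norm (x t) + norm (y t)) * norm (x t - y t)"
        by (rule F_A[OF t xy])
      also have "\<dots> \<le> L * (\<epsilon> * radius B + \<epsilon> * radius B) * (\<epsilon> * K_lip * \<delta>)"
        using xB yB d L by (intro mult_mono mult_left_mono add_mono) (auto intro!: mult_nonneg_nonneg add_nonneg_nonneg order_trans[OF norm_ge_zero xB])
      finally show ?thesis by (simp add: power2_eq_square algebra_simps)
    qed
    have 2: "norm (k t \<theta> (\<gamma> t + x t) \<epsilon> - k t \<theta> (\<gamma> t + y t) \<epsilon>) \<le> \<epsilon> * (L * K_lip) * \<delta>"
      using order_trans[OF k_lip[OF t \<theta>(1) xy \<epsilon>] L_mono[OF d]] by (simp add: mult_ac)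
    have 3: "norm (k t \<theta> (\<gamma> t + y t) \<epsilon> - k t \<theta>' (\<gamma> t + y t) \<epsilon> - (k t \<theta> (\<gamma> t) 0 - k t \<theta>' (\<gamma> t) 0))
        \<le> \<epsilon> * (L * (radius B + 1)) * \<delta>"
    proof -
      have "L * (norm (y t) + \<epsilon>) * \<bar>\<theta> - \<theta>'\<bar> \<le> L * (\<epsilon> * radius B + \<epsilon>) * \<delta>"
        using yB \<delta> L \<epsilon> radius_nonneg[OF B0] by (intro mult_mono mult_left_mono add_mono) (auto intro!: mult_nonneg_nonneg add_nonneg_nonneg)
      then show ?thesis
        using k_mixed[OF t \<theta> xy(2) \<epsilon>] by (simp add: algebra_simps)
    qed
    have "norm (u' t) \<le> \<epsilon>\<^sup>2 * (L * 2 * radius B * K_lip) * \<delta> + L * norm (u t)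
        + \<epsilon> * (\<epsilon> * (L * K_lip) * \<delta> + \<epsilon> * (L * (radius B + 1)) * \<delta>)"
      unfolding eq using \<epsilon>
      by (intro norm_triangle_le add_mono 1 A_bound[OF t] order_trans[OF eq_refl[OF norm_scaleR]]
          mult_mono norm_triangle_le[OF add_mono[OF 2 3]]) auto
    then show "norm (u' t) \<le> L * norm (u t) + \<epsilon>\<^sup>2 * C * \<delta>"
      by (simp add: C_def power2_eq_square algebra_simps)
  qed (use L t \<delta> K_lip_nonneg radius_nonneg[OF B0] in \<open>auto simp: C_def intro!: mult_nonneg_nonneg add_nonneg_nonneg\<close>)
  also have "u 0 = 0"
    using x y v w by (simp add: u_def deviation_def variation_def scaleR_diff_right)
  also have "(norm (0::plane) + \<epsilon>\<^sup>2 * C * \<delta> * t) * exp (L * t) \<le> (\<epsilon>\<^sup>2 * C * \<delta> * T) * exp (L * T)"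
    using L t \<delta> K_lip_nonneg radius_nonneg[OF B0]
    by (intro mult_mono) (auto simp: C_def intro!: mult_nonneg_nonneg add_nonneg_nonneg mult_left_mono)
  also have "\<dots> = \<epsilon>\<^sup>2 * (C * T * exp (L * T)) * \<delta>" by simp
  also have "\<dots> \<le> \<epsilon>\<^sup>2 * K_lin B * \<delta>"
    unfolding K_lin_def C_def using L T \<delta>
    by (intro mult_right_mono mult_left_mono) (auto simp: algebra_simps)
  finally show ?thesis by (simp add: u_def \<delta>_def)
qed

text \<open>Not a special case of the difference estimate, since in general the zero function is not
  a deviation. The same comparison is made with a single solution, and \<open>k_eps\<close> takes
  the place of the mixed difference.\<close>

lemma deviation_linear:
  assumes x: "deviation \<epsilon> \<zeta> \<theta> T x" and v: "variation \<zeta> \<theta> v"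
    and \<epsilon>: "\<epsilon> \<in> {0..e0}" and \<theta>: "\<theta> \<in> J" and B: "norm \<zeta> \<le> B" and t: "t \<in> {0..T}"
  shows "norm (x t - \<epsilon> *\<^sub>R v t) \<le> \<epsilon>\<^sup>2 * K_lin B"
proof -
  have B0: "0 \<le> B" using B(1) norm_ge_zero order_trans by blast
  define u where "u t = x t - \<epsilon> *\<^sub>R v t" for t
  define u' where "u' t = rate \<epsilon> \<theta> t (x t) - \<epsilon> *\<^sub>R (A t (v t) + k t \<theta> (\<gamma> t) 0)" for t
  define C where "C = L * ((radius B)\<^sup>2 + radius B + 1)"
  have C: "0 \<le> C" using L radius_nonneg[OF B0] by (simp add: C_def)
  have "norm (u t) \<le> (norm (u 0) + \<epsilon>\<^sup>2 * C * t) * exp (L * t)"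
  proof (rule gronwall_vector_derivative[where u'=u' and T=T])
    fix t assume t: "t \<in> {0..T}"
    show "(u has_vector_derivative u' t) (at t within {0..T})"
      unfolding u_def u'_def using x v t
      by (intro derivative_intros bounded_linear.has_vector_derivative[OF bounded_linear_scaleR_right])
        (auto simp: deviation_def variation_def)
    have xr: "norm (x t) \<le> \<rho>" using x t by (auto simp: deviation_def)
    have xB: "norm (x t) \<le> \<epsilon> * radius B" by (rule deviation_bound[OF x \<epsilon> \<theta> order_refl B t])
    note lin = A_linear[OF t]
    have Au: "A t (u t) = A t (x t) - \<epsilon> *\<^sub>R A t (v t)"
      by (simp add: u_def linear_diff[OF lin] linear_scale[OF lin])
    have eq: "u' t = (F (\<gamma> t + x t) - F (\<gamma> t + 0) - A t (x t - 0)) + A t (u t)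
        + \<epsilon> *\<^sub>R (k t \<theta> (\<gamma> t + x t) \<epsilon> - k t \<theta> (\<gamma> t) 0)"
      unfolding Au u'_def rate_def by (simp add: algebra_simps)
    have 1: "norm (F (\<gamma> t + x t) - F (\<gamma> t + 0) - A t (x t - 0)) \<le> \<epsilon>\<^sup>2 * (L * (radius B)\<^sup>2)"
    proof -
      have "norm (F (\<gamma> t + x t) - F (\<gamma> t + 0) - A t (x t - 0)) \<le> L * (norm (x t) + norm (0::plane)) * norm (x t - 0)"
        by (rule F_A[OF t xr]) (use rho in auto)
      also have "\<dots> \<le> L * (\<epsilon> * radius B) * (\<epsilon> * radius B)"
        using xB L by (intro mult_mono mult_left_mono) (auto intro!: mult_nonneg_nonneg order_trans[OF norm_ge_zero xB])
      finally show ?thesis by (simp add: power2_eq_square algebra_simps)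
    qed
    have 2: "norm (k t \<theta> (\<gamma> t + x t) \<epsilon> - k t \<theta> (\<gamma> t) 0) \<le> \<epsilon> * (L * (radius B + 1))"
      using order_trans[OF k_eps[OF t \<theta> xr \<epsilon>] L_mono[OF add_right_mono[OF xB]]] by (simp add: algebra_simps)
    have "norm (u' t) \<le> \<epsilon>\<^sup>2 * (L * (radius B)\<^sup>2) + L * norm (u t) + \<epsilon> * (\<epsilon> * (L * (radius B + 1)))"
      unfolding eq using 1 A_bound[OF t, of "u t"] \<epsilon>
      by (intro norm_triangle_le add_mono) (auto intro!: mult_left_mono norm_triangle_le add_mono 2)
    then show "norm (u' t) \<le> L * norm (u t) + \<epsilon>\<^sup>2 * C"
      by (simp add: C_def power2_eq_square algebra_simps)
  qed (use L t C in auto)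
  also have "u 0 = 0"
    using x v by (simp add: u_def deviation_def variation_def)
  also have "(norm (0::plane) + \<epsilon>\<^sup>2 * C * t) * exp (L * t) \<le> (\<epsilon>\<^sup>2 * C * T) * exp (L * T)"
    using L t C by (intro mult_mono) (auto intro!: mult_left_mono)
  also have "\<dots> = \<epsilon>\<^sup>2 * (C * T * exp (L * T))" by simp
  also have "\<dots> \<le> \<epsilon>\<^sup>2 * K_lin B"
    unfolding K_lin_def C_def using L T K_lip_nonneg radius_nonneg[OF B0]
    by (intro mult_right_mono mult_left_mono) auto
  finally show ?thesis by (simp add: u_def)
qed

text \<open>The end point at the shifted time \<open>\<sigma> + \<epsilon> * s\<close>, minus
  \<open>\<gamma> \<sigma>\<close> and minus the first-order prediction, to which the time shift
  contributes \<open>s F\<close> and the deviation its variation \<open>v\<close>.\<close>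

definition residue_at :: "real \<Rightarrow> real \<Rightarrow> real \<Rightarrow> (real \<Rightarrow> plane) \<Rightarrow> (real \<Rightarrow> plane) \<Rightarrow> plane" where
  "residue_at \<sigma> \<epsilon> s x v = \<gamma> (\<sigma> + \<epsilon> * s) + x (\<sigma> + \<epsilon> * s) - \<gamma> \<sigma> - \<epsilon> *\<^sub>R (v \<sigma> + s *\<^sub>R F (\<gamma> \<sigma>))"

text \<open>The factors \<open>B + 1\<close> let one constant bound both the residue, where
  \<open>\<bar>s\<bar> \<le> B\<close> multiplies the first two terms, and its Lipschitz constant,
  where it does not.\<close>

definition K_res :: "real \<Rightarrow> real" where
  "K_res B = L\<^sup>2 * B * (B + 1) + L * (radius B + 1) * (B + 1) + (2 * L * K_lip + L) * B + K_lin B"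

text \<open>The time increments involved are of order \<epsilon>, and each function that is
  incremented has a derivative of order \<epsilon>: \<open>\<gamma>\<close> after removal of its
  tangent at \<sigma>, a deviation, and the difference of two deviations. This gives the factor
  \<open>\<epsilon>\<^sup>2\<close>. The part at time \<sigma> itself is covered by the
  linearization estimates.\<close>

lemma residue_estimates:
  assumes \<epsilon>: "\<epsilon> \<in> {0..e0}" and \<sigma>: "\<sigma> - \<epsilon> * B \<ge> 0" "\<sigma> + \<epsilon> * B \<le> T" and small: "L * (\<epsilon> * B) \<le> \<rho>"
    and x: "deviation \<epsilon> \<zeta> \<theta> T x" and v: "variation \<zeta> \<theta> v" and \<theta>: "\<theta> \<in> J"
    and B: "norm \<zeta> \<le> B" and s: "\<bar>s\<bar> \<le> B"
  shows "norm (residue_at \<sigma> \<epsilon> s x v) \<le> \<epsilon>\<^sup>2 * K_res B"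
    and "\<lbrakk>deviation \<epsilon> \<zeta>' \<theta>' T y; variation \<zeta>' \<theta>' w; \<theta>' \<in> J; norm \<zeta>' \<le> B; \<bar>s'\<bar> \<le> B\<rbrakk> \<Longrightarrow>
      norm (residue_at \<sigma> \<epsilon> s x v - residue_at \<sigma> \<epsilon> s' y w)
        \<le> \<epsilon>\<^sup>2 * K_res B * (norm (\<zeta> - \<zeta>') + \<bar>\<theta> - \<theta>'\<bar> + \<bar>s - s'\<bar>)"
proof -
  have B0: "0 \<le> B" using B norm_ge_zero order_trans by blast
  note W = radius_nonneg[OF B0]
  let ?S = "{\<sigma> - \<epsilon> * B..\<sigma> + \<epsilon> * B}"
  have S: "t \<in> {0..T}" "\<bar>t - \<sigma>\<bar> \<le> \<epsilon> * B" if "t \<in> ?S" for t using that \<sigma> by auto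
  have \<sigma>S: "\<sigma> \<in> ?S" using \<epsilon> B0 by auto
  then have \<sigma>T: "\<sigma> \<in> {0..T}" using S by blast
  have sS: "\<sigma> + \<epsilon> * s \<in> ?S" if "\<bar>s\<bar> \<le> B" for s
  proof -
    have "\<bar>\<epsilon> * s\<bar> \<le> \<epsilon> * B" using that \<epsilon> by (simp add: abs_mult mult_left_mono)
    then show ?thesis by auto
  qed
  define g where "g t = \<gamma> t - t *\<^sub>R F (\<gamma> \<sigma>)" for t
  have g: "norm (g t - g t') \<le> L * (L * (\<epsilon> * B)) * \<bar>t - t'\<bar>" if "t \<in> ?S" "t' \<in> ?S" for t t'
  proof (rule vector_derivative_lipschitz[OF _ _ _ that])
    fix t assume t: "t \<in> ?S"
    have "(\<gamma> has_vector_derivative F (\<gamma> t)) (at t within ?S)"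
      by (rule has_vector_derivative_within_subset[OF \<gamma>'[OF S(1)[OF t]]]) (use S(1) in blast)
    then show "(g has_vector_derivative F (\<gamma> t) - F (\<gamma> \<sigma>)) (at t within ?S)"
      unfolding g_def by (auto intro!: derivative_eq_intros)
    have a: "norm (\<gamma> t - \<gamma> \<sigma>) \<le> L * (\<epsilon> * B)"
      using \<gamma>_lip[OF S(1)[OF t] \<sigma>T] L_mono[OF S(2)[OF t]] by (rule order_trans)
    then have "norm (F (\<gamma> \<sigma> + (\<gamma> t - \<gamma> \<sigma>)) - F (\<gamma> \<sigma> + 0)) \<le> L * norm (\<gamma> t - \<gamma> \<sigma> - 0)"
      using small rho by (intro F_lip[OF \<sigma>T]) auto
    also have "\<dots> \<le> L * (L * (\<epsilon> * B))"
      using a L by (simp add: mult_left_mono)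
    finally show "norm (F (\<gamma> t) - F (\<gamma> \<sigma>)) \<le> L * (L * (\<epsilon> * B))" by simp
  qed simp
  have dx: "norm (x t - x t') \<le> \<epsilon> * (L * (radius B + 1)) * \<bar>t - t'\<bar>" if "t \<in> {0..T}" "t' \<in> {0..T}" for t t'
  proof (rule vector_derivative_lipschitz[OF _ _ _ that])
    fix t assume t: "t \<in> {0..T}"
    show "(x has_vector_derivative rate \<epsilon> \<theta> t (x t)) (at t within {0..T})" using x t by (simp add: deviation_def)
    have "norm (rate \<epsilon> \<theta> t (x t)) \<le> L * norm (x t) + \<epsilon> * L"
      using x t by (intro rate_bound[OF t \<theta> \<epsilon>]) (simp add: deviation_def)
    also have "\<dots> \<le> L * (\<epsilon> * radius B) + \<epsilon> * L"
      using deviation_bound[OF x \<epsilon> \<theta> order_refl B t] L by simp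
    finally show "norm (rate \<epsilon> \<theta> t (x t)) \<le> \<epsilon> * (L * (radius B + 1))" by (simp add: algebra_simps)
  qed simp
  have res: "residue_at \<sigma> \<epsilon> s x v = (g (\<sigma> + \<epsilon> * s) - g \<sigma>) + (x (\<sigma> + \<epsilon> * s) - x \<sigma>) + (x \<sigma> - \<epsilon> *\<^sub>R v \<sigma>)" for x s v
    by (simp add: residue_at_def g_def algebra_simps)
  have g': "norm (g (\<sigma> + \<epsilon> * s) - g (\<sigma> + \<epsilon> * s')) \<le> \<epsilon>\<^sup>2 * (L\<^sup>2 * B) * \<bar>s - s'\<bar>" if "\<bar>s\<bar> \<le> B" "\<bar>s'\<bar> \<le> B" for s s'
    using g[OF sS[OF that(1)] sS[OF that(2)]] \<epsilon>
    by (simp add: power2_eq_square abs_mult mult_ac flip: right_diff_distrib)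
  have dx': "norm (x (\<sigma> + \<epsilon> * s) - x (\<sigma> + \<epsilon> * s')) \<le> \<epsilon>\<^sup>2 * (L * (radius B + 1)) * \<bar>s - s'\<bar>" if "\<bar>s\<bar> \<le> B" "\<bar>s'\<bar> \<le> B" for s s'
    using dx[OF S(1)[OF sS[OF that(1)]] S(1)[OF sS[OF that(2)]]] \<epsilon>
    by (simp add: power2_eq_square abs_mult mult_ac flip: right_diff_distrib)
  have "norm (residue_at \<sigma> \<epsilon> s x v) \<le> \<epsilon>\<^sup>2 * (L\<^sup>2 * B) * \<bar>s\<bar> + \<epsilon>\<^sup>2 * (L * (radius B + 1)) * \<bar>s\<bar> + \<epsilon>\<^sup>2 * K_lin B"
    unfolding res using g'[of s 0] dx'[of s 0] s deviation_linear[OF x v \<epsilon> \<theta> B \<sigma>T] B0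
    by (intro norm_triangle_le add_mono) auto
  also have "\<dots> \<le> \<epsilon>\<^sup>2 * (L\<^sup>2 * B) * (B + 1) + \<epsilon>\<^sup>2 * (L * (radius B + 1)) * (B + 1) + \<epsilon>\<^sup>2 * K_lin B"
    using s B0 L W by (intro add_mono mult_left_mono) auto
  also have "\<dots> \<le> \<epsilon>\<^sup>2 * K_res B"
  proof -
    have "0 \<le> \<epsilon>\<^sup>2 * ((2 * L * K_lip + L) * B)" using L K_lip_nonneg B0 by simp
    then show ?thesis by (simp add: K_res_def algebra_simps)
  qed
  finally show "norm (residue_at \<sigma> \<epsilon> s x v) \<le> \<epsilon>\<^sup>2 * K_res B" .
  assume y: "deviation \<epsilon> \<zeta>' \<theta>' T y" and w: "variation \<zeta>' \<theta>' w" and \<theta>': "\<theta>' \<in> J"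
    and B': "norm \<zeta>' \<le> B" and s': "\<bar>s'\<bar> \<le> B"
  define \<delta> where "\<delta> = norm (\<zeta> - \<zeta>') + \<bar>\<theta> - \<theta>'\<bar>"
  have \<delta>: "0 \<le> \<delta>" "\<bar>\<theta> - \<theta>'\<bar> \<le> \<delta>" by (auto simp: \<delta>_def)
  have "norm ((\<lambda>t. x t - y t) (\<sigma> + \<epsilon> * s') - (\<lambda>t. x t - y t) \<sigma>) \<le> \<epsilon> * ((2 * L * K_lip + L) * \<delta>) * \<bar>\<sigma> + \<epsilon> * s' - \<sigma>\<bar>"
  proof (rule vector_derivative_lipschitz[OF _ _ _ S(1)[OF sS[OF s']] \<sigma>T])
    fix t assume t: "t \<in> {0..T}"
    show "((\<lambda>t. x t - y t) has_vector_derivative rate \<epsilon> \<theta> t (x t) - rate \<epsilon> \<theta>' t (y t)) (at t within {0..T})"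
      using x y t by (intro derivative_intros) (auto simp: deviation_def)
    have "norm (rate \<epsilon> \<theta> t (x t) - rate \<epsilon> \<theta>' t (y t)) \<le> 2 * L * norm (x t - y t) + \<epsilon> * L * \<bar>\<theta> - \<theta>'\<bar>"
      by (rule deviation_diff(2)[OF x y \<epsilon> \<theta> \<theta>' order_refl t])
    also have "\<dots> \<le> 2 * L * (\<epsilon> * K_lip * \<delta>) + \<epsilon> * L * \<delta>"
      using deviation_diff(1)[OF x y \<epsilon> \<theta> \<theta>' order_refl t] L \<epsilon> \<delta>
      by (intro add_mono mult_left_mono) (auto simp: K_lip_def \<delta>_def)
    finally show "norm (rate \<epsilon> \<theta> t (x t) - rate \<epsilon> \<theta>' t (y t)) \<le> \<epsilon> * ((2 * L * K_lip + L) * \<delta>)"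
      by (simp add: algebra_simps)
  qed simp
  also have "\<dots> = \<epsilon>\<^sup>2 * ((2 * L * K_lip + L) * \<delta>) * \<bar>s'\<bar>"
    using \<epsilon> by (simp add: abs_mult power2_eq_square)
  also have "\<dots> \<le> \<epsilon>\<^sup>2 * ((2 * L * K_lip + L) * \<delta>) * B"
    using s' L K_lip_nonneg \<delta> by (intro mult_left_mono) auto
  finally have 3: "norm (x (\<sigma> + \<epsilon> * s') - y (\<sigma> + \<epsilon> * s') - (x \<sigma> - y \<sigma>)) \<le> \<epsilon>\<^sup>2 * ((2 * L * K_lip + L) * \<delta>) * B"
    by simp
  have 4: "norm (x \<sigma> - y \<sigma> - \<epsilon> *\<^sub>R (v \<sigma> - w \<sigma>)) \<le> \<epsilon>\<^sup>2 * K_lin B * \<delta>"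
    using deviation_diff_linear[OF x y v w \<epsilon> \<theta> \<theta>' B B' \<sigma>T] by (simp add: \<delta>_def)
  \<comment> \<open>The end time is changed along \<open>x\<close> alone; the two solutions are then
    compared at the common time \<open>\<sigma> + \<epsilon> * s'\<close>, relative to their
    difference at \<sigma>.\<close>
  have eq: "residue_at \<sigma> \<epsilon> s x v - residue_at \<sigma> \<epsilon> s' y w = (g (\<sigma> + \<epsilon> * s) - g (\<sigma> + \<epsilon> * s'))
     + (x (\<sigma> + \<epsilon> * s) - x (\<sigma> + \<epsilon> * s')) + (x (\<sigma> + \<epsilon> * s') - y (\<sigma> + \<epsilon> * s') - (x \<sigma> - y \<sigma>))
     + (x \<sigma> - y \<sigma> - \<epsilon> *\<^sub>R (v \<sigma> - w \<sigma>))"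
    unfolding res by (simp add: algebra_simps)
  have "norm (residue_at \<sigma> \<epsilon> s x v - residue_at \<sigma> \<epsilon> s' y w) \<le>
      \<epsilon>\<^sup>2 * (L\<^sup>2 * B) * \<bar>s - s'\<bar> + \<epsilon>\<^sup>2 * (L * (radius B + 1)) * \<bar>s - s'\<bar>
      + \<epsilon>\<^sup>2 * ((2 * L * K_lip + L) * \<delta>) * B + \<epsilon>\<^sup>2 * K_lin B * \<delta>"
    unfolding eq by (intro norm_triangle_le add_mono g'[OF s s'] dx'[OF s s'] 3 4)
  also have "\<dots> = \<epsilon>\<^sup>2 * (L\<^sup>2 * B + L * (radius B + 1)) * \<bar>s - s'\<bar> + \<epsilon>\<^sup>2 * ((2 * L * K_lip + L) * B + K_lin B) * \<delta>"
    by (simp add: algebra_simps)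
  also have "\<dots> \<le> \<epsilon>\<^sup>2 * K_res B * \<bar>s - s'\<bar> + \<epsilon>\<^sup>2 * K_res B * \<delta>"
  proof (intro add_mono mult_right_mono mult_left_mono)
    have p: "0 \<le> L\<^sup>2 * B * B" "0 \<le> L\<^sup>2 * B" "0 \<le> L * (radius B + 1) * B" "0 \<le> (2 * L * K_lip + L) * B" "0 \<le> K_lin B" "0 \<le> L * (radius B + 1)"
      using L B0 W K_lip_nonneg K_lin_nonneg[OF B0] by auto
    have e: "K_res B = L\<^sup>2 * B * B + L\<^sup>2 * B + L * (radius B + 1) * B + L * (radius B + 1) + (2 * L * K_lip + L) * B + K_lin B"
      by (simp add: K_res_def algebra_simps)
    show "L\<^sup>2 * B + L * (radius B + 1) \<le> K_res B" "(2 * L * K_lip + L) * B + K_lin B \<le> K_res B"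
      unfolding e using p by linarith+
  qed (use \<delta> in auto)
  finally show "norm (residue_at \<sigma> \<epsilon> s x v - residue_at \<sigma> \<epsilon> s' y w)
        \<le> \<epsilon>\<^sup>2 * K_res B * (norm (\<zeta> - \<zeta>') + \<bar>\<theta> - \<theta>'\<bar> + \<bar>s - s'\<bar>)"
    by (simp add: \<delta>_def algebra_simps)
qed

end

section \<open>The flow and its derivative\<close>

context solution_tube
begin

text \<open>The fundamental matrix is kept as a pair of solution columns; its inverse is then given by
  Cramer's rule, from which continuity in \<open>t\<close> is immediate.\<close>

lemma fundamental_solution:
  obtains Y where "\<And>t. t \<in> {0..T} \<Longrightarrow> linear (Y t)" "\<And>t. t \<in> {0..T} \<Longrightarrow> bij (Y t)" "Y 0 = id"
    "\<And>g. continuous_on {0..T} g \<Longrightarrow> continuous_on {0..T} (\<lambda>t. inv (Y t) (g t))"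
    "\<And>g c t. continuous_on {0..T} g \<Longrightarrow> t \<in> {0..T} \<Longrightarrow>
      ((\<lambda>t. Y t (c + integral {0..t} (\<lambda>s. inv (Y s) (g s)))) has_vector_derivative
        A t (Y t (c + integral {0..t} (\<lambda>s. inv (Y s) (g s)))) + g t) (at t within {0..T})"
proof -
  have "\<exists>v. v 0 = c \<and> (\<forall>t\<in>{0..T}. (v has_vector_derivative A t (v t)) (at t within {0..T}))" for c
    using linear_ode_exists[of "\<lambda>_. 0" c] by simp
  then obtain Y1 Y2 where Y1: "Y1 0 = (1, 0)" "\<And>t. t \<in> {0..T} \<Longrightarrow> (Y1 has_vector_derivative A t (Y1 t)) (at t within {0..T})"
    and Y2: "Y2 0 = (0, 1)" "\<And>t. t \<in> {0..T} \<Longrightarrow> (Y2 has_vector_derivative A t (Y2 t)) (at t within {0..T})"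
    by metis
  define Y :: "real \<Rightarrow> plane \<Rightarrow> plane" where "Y t a = fst a *\<^sub>R Y1 t + snd a *\<^sub>R Y2 t" for t a
  \<comment> \<open>The Wronskian of the two columns; \<open>Z\<close> is Cramer's rule for the
    equation \<open>Y t a = w\<close>.\<close>
  define det where "det t = wedge (Y1 t) (Y2 t)" for t
  define Z :: "real \<Rightarrow> plane \<Rightarrow> plane" where "Z t w = (wedge w (Y2 t) / det t, wedge (Y1 t) w / det t)" for t w
  have contY: "continuous_on {0..T} Y1" "continuous_on {0..T} Y2"
    using Y1(2) Y2(2) by (meson continuous_on_eq_continuous_within has_vector_derivative_continuous)+
  have lin: "linear (Y t)" for t
    by (rule linearI) (simp_all add: Y_def algebra_simps)
  have dY: "((\<lambda>t. Y t (c t)) has_vector_derivative A t (Y t (c t)) + Y t c') (at t within {0..T})"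
    if t: "t \<in> {0..T}" and c: "(c has_vector_derivative c') (at t within {0..T})" for t c c'
  proof -
    have c12: "((\<lambda>t. fst (c t)) has_vector_derivative fst c') (at t within {0..T})"
      "((\<lambda>t. snd (c t)) has_vector_derivative snd c') (at t within {0..T})"
      using bounded_linear.has_vector_derivative[OF bounded_linear_fst c]
        bounded_linear.has_vector_derivative[OF bounded_linear_snd c] by auto
    have "((\<lambda>t. Y t (c t)) has_vector_derivative (fst (c t) *\<^sub>R A t (Y1 t) + fst c' *\<^sub>R Y1 t)
        + (snd (c t) *\<^sub>R A t (Y2 t) + snd c' *\<^sub>R Y2 t)) (at t within {0..T})"
      unfolding Y_def using c12 Y1(2)[OF t] Y2(2)[OF t]
      by (intro has_vector_derivative_add has_vector_derivative_scaleR)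
        (auto simp: has_real_derivative_iff_has_vector_derivative)
    then show ?thesis
      by (simp add: Y_def linear_add[OF A_linear[OF t]] linear_scale[OF A_linear[OF t]] algebra_simps)
  qed
  \<comment> \<open>A kernel vector \<open>c\<close> at time \<open>t\<close> would give a solution
    of the linear equation that vanishes at \<open>t\<close>, hence also at 0, where its value is
    \<open>c\<close>.\<close>
  have det: "det t \<noteq> 0" if t: "t \<in> {0..T}" for t
  proof
    assume d: "det t = 0"
    have "\<exists>c. c \<noteq> 0 \<and> Y t c = 0"
    proof (cases "Y1 t = 0")
      case True
      then show ?thesis by (intro exI[of _ "(1, 0)"]) (simp add: Y_def zero_prod_def)
    next
      case False
      then have nz: "fst (Y1 t) \<noteq> 0 \<or> snd (Y1 t) \<noteq> 0" by (simp add: prod_eq_iff)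
      then show ?thesis
      proof
        assume "fst (Y1 t) \<noteq> 0"
        with d show ?thesis
          by (intro exI[of _ "(fst (Y2 t), - fst (Y1 t))"])
            (auto simp: Y_def prod_eq_iff det_def wedge_def mult.commute)
      next
        assume "snd (Y1 t) \<noteq> 0"
        with d show ?thesis
          by (intro exI[of _ "(snd (Y2 t), - snd (Y1 t))"])
            (auto simp: Y_def prod_eq_iff det_def wedge_def mult.commute)
      qed
    qed
    then obtain c where c: "c \<noteq> 0" "Y t c = 0" by blast
    have "Y 0 c = 0"
    proof (rule linear_ode_zero[where v="\<lambda>t. Y t c" and s=t])
      fix r assume r: "r \<in> {0..T}"
      show "((\<lambda>t. Y t c) has_vector_derivative A r (Y r c)) (at r within {0..T})"
        using dY[OF r, of "\<lambda>_. c" 0] by (simp add: linear_0[OF lin])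
    qed (use t c T in auto)
    then have "c = 0" using Y1(1) Y2(1) by (simp add: Y_def prod_eq_iff)
    with c show False by simp
  qed
  have YZ: "Y t (Z t w) = w" if t: "t \<in> {0..T}" for t w
    using det[OF t] by (simp add: Y_def Z_def prod_eq_iff divide_simps) (simp add: det_def wedge_def algebra_simps)
  have ZY: "Z t (Y t c) = c" if t: "t \<in> {0..T}" for t c
    using det[OF t] by (simp add: Y_def Z_def prod_eq_iff divide_simps) (simp add: det_def wedge_def algebra_simps)
  have bij: "bij (Y t)" if t: "t \<in> {0..T}" for t
    using YZ[OF t] ZY[OF t] by (intro o_bij[of "Z t"]) (auto simp: fun_eq_iff)
  have invY: "inv (Y t) = Z t" if t: "t \<in> {0..T}" for t
    using YZ[OF t] ZY[OF t] by (intro inv_equality) auto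
  have contZ: "continuous_on {0..T} (\<lambda>t. inv (Y t) (g t))" if "continuous_on {0..T} g" for g :: "real \<Rightarrow> plane"
  proof -
    have "continuous_on {0..T} (\<lambda>t. Z t (g t))"
      unfolding Z_def wedge_def using det that contY
      by (intro continuous_intros) (auto simp: det_def wedge_def intro!: continuous_intros)
    then show ?thesis by (rule continuous_on_eq) (simp add: invY)
  qed
  show thesis
  proof (rule that[OF lin bij _ contZ])
    show "Y 0 = id" using Y1(1) Y2(1) by (auto simp: Y_def fun_eq_iff)
    fix g :: "real \<Rightarrow> plane" and c t assume g: "continuous_on {0..T} g" and t: "t \<in> {0..T}"
    have "((\<lambda>t. c + integral {0..t} (\<lambda>s. inv (Y s) (g s))) has_vector_derivative inv (Y t) (g t)) (at t within {0..T})"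
      using integral_has_vector_derivative[OF contZ[OF g] t] by (auto intro!: derivative_eq_intros)
    from dY[OF t this] show "((\<lambda>t. Y t (c + integral {0..t} (\<lambda>s. inv (Y s) (g s)))) has_vector_derivative
        A t (Y t (c + integral {0..t} (\<lambda>s. inv (Y s) (g s)))) + g t) (at t within {0..T})"
      using YZ[OF t] by (simp add: invY[OF t])
  qed
qed

end

section \<open>Uniqueness of solutions and dependence of the flow on its initial point\<close>

lemma Ck_on_SucD: "Ck_on (Suc k) f S \<Longrightarrow> Ck_on k f S"
proof (induction k arbitrary: f)
  case 0
  then show ?case
    by (auto intro!: continuous_at_imp_continuous_on differentiable_imp_continuous_within)
next
  case (Suc k)
  then show ?case by auto
qed

lemma Ck_on_continuous: "Ck_on k f S \<Longrightarrow> continuous_on S f"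
  by (induction k) (auto dest: Ck_on_SucD simp del: Ck_on.simps(2))

lemma Ck_on_has_derivative:
  "Ck_on (Suc k) f S \<Longrightarrow> x \<in> S \<Longrightarrow> (f has_derivative frechet_derivative f (at x)) (at x)"
  by (auto simp: frechet_derivative_works)

text \<open>The two trajectories together form a compact subset of \<open>D\<close>, on which
  \<open>F\<close> is Lipschitz.\<close>

lemma ode_solution_unique:
  assumes D: "open D" and F: "Ck_on 1 F D"
    and u: "ode_solution_on F D {0..\<tau>} u" and v: "ode_solution_on F D {0..\<tau>} v" and eq: "u 0 = v 0"
    and t: "t \<in> {0..\<tau>}"
  shows "u t = v t"
proof -
  have cont: "continuous_on {0..\<tau>} w" if "ode_solution_on F D {0..\<tau>} w" for w
    using that unfolding ode_solution_on_def
    by (meson continuous_on_eq_continuous_within has_vector_derivative_continuous)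
  define K where "K = u ` {0..\<tau>} \<union> v ` {0..\<tau>}"
  have "compact K" "K \<subseteq> D"
    using u v unfolding K_def
    by (auto intro!: compact_Un compact_continuous_image cont simp: ode_solution_on_def)
  with D F obtain L where L: "0 \<le> L" "\<And>x y. x \<in> K \<Longrightarrow> y \<in> K \<Longrightarrow> norm (F x - F y) \<le> L * norm (x - y)"
    by (metis C1_lipschitz_on_compact)
  have "norm (u t - v t) \<le> (norm (u 0 - v 0) + 0 * t) * exp (L * t)"
  proof (rule gronwall_vector_derivative[where u'="\<lambda>t. F (u t) - F (v t)" and T=\<tau>])
    fix s assume s: "s \<in> {0..\<tau>}"
    then show "((\<lambda>t. u t - v t) has_vector_derivative F (u s) - F (v s)) (at s within {0..\<tau>})"
      using u v by (intro derivative_intros) (auto simp: ode_solution_on_def)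
    show "norm (F (u s) - F (v s)) \<le> L * norm (u s - v s) + 0"
      using L(2)[of "u s" "v s"] s by (auto simp: K_def)
  qed (use L t in auto)
  then show ?thesis using eq by simp
qed

text \<open>Uniqueness lets the definite description in \<open>flow\<close> be evaluated on any
  known solution.\<close>

lemma flow_eq:
  assumes "open D" "Ck_on 1 F D" "0 \<le> t" "ode_solution_on F D {0..t} u"
  shows "flow F D t (u 0) = u t"
  unfolding flow_def
proof (rule the_equality)
  show "\<exists>w. ode_solution_on F D (closed_segment 0 t) w \<and> w 0 = u 0 \<and> w t = u t"
    using assms by (auto simp: closed_segment_eq_real_ivl)
  show "w = u t" if "\<exists>v. ode_solution_on F D (closed_segment 0 t) v \<and> v 0 = u 0 \<and> v t = w" for w
  proof -
    from that obtain v where v: "ode_solution_on F D {0..t} v" "v 0 = u 0" "v t = w"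
      using assms(3) by (auto simp: closed_segment_eq_real_ivl)
    from ode_solution_unique[OF assms(1,2) v(1) assms(4) v(2), of t] assms(3) v(3)
    show ?thesis by simp
  qed
qed

locale flow_tube = solution_tube +
  fixes D :: "plane set"
  assumes D: "open D" and F_C1: "Ck_on 1 F D"
    and tube: "\<And>t a. t \<in> {0..T} \<Longrightarrow> norm a \<le> \<rho> \<Longrightarrow> \<gamma> t + a \<in> D"
begin

text \<open>With \<open>k = 0\<close> the small parameter only scales the initial displacement, so
  the estimates for perturbed solutions become estimates for the dependence of the flow on its
  initial point.\<close>

lemma unperturbed: "perturbed_tube F A \<gamma> T \<rho> L (\<lambda>_ _ _ _. 0) UNIV 1"
  using L by unfold_locales auto

interpretation N: perturbed_tube F A \<gamma> T \<rho> L "\<lambda>_ _ _ _. 0" UNIV 1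
  by (rule unperturbed)

lemma flow_deviation:
  assumes "N.deviation \<epsilon> \<zeta> \<theta> T x" "t \<in> {0..T}"
  shows "flow F D t (\<gamma> 0 + \<epsilon> *\<^sub>R \<zeta>) = \<gamma> t + x t"
proof -
  have "ode_solution_on F D {0..t} (\<lambda>s. \<gamma> s + x s)"
    unfolding ode_solution_on_def
  proof (intro ballI conjI)
    fix s assume s: "s \<in> {0..t}"
    with assms show "\<gamma> s + x s \<in> D" by (auto simp: N.deviation_def intro!: tube)
    have "((\<lambda>s. \<gamma> s + x s) has_vector_derivative F (\<gamma> s) + (F (\<gamma> s + x s) - F (\<gamma> s))) (at s within {0..T})"
      using assms s \<gamma>' by (intro derivative_intros) (auto simp: N.deviation_def N.rate_def)
    then show "((\<lambda>s. \<gamma> s + x s) has_vector_derivative F (\<gamma> s + x s)) (at s within {0..t})"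
      using has_vector_derivative_within_subset[of _ _ s "{0..T}" "{0..t}"] assms(2) by simp
  qed
  from flow_eq[OF D F_C1 _ this] assms show ?thesis by (auto simp: N.deviation_def)
qed

lemma flow_\<gamma>: "t \<in> {0..T} \<Longrightarrow> flow F D t (\<gamma> 0) = \<gamma> t"
proof -
  assume t: "t \<in> {0..T}"
  have "N.deviation 0 0 0 T (\<lambda>_. 0)"
    using rho by (auto simp: N.deviation_def N.rate_def)
  from flow_deviation[OF this t] show ?thesis by simp
qed

text \<open>With \<epsilon> the length of the displacement and \<zeta> its direction, the
  linearization estimate for deviations reads \<open>norm (x t - \<epsilon> *\<^sub>R v t) \<le>
  \<epsilon>\<^sup>2 * K\<close>, and this is differentiability of the flow at
  \<open>\<gamma> 0\<close>.\<close>

lemma flow_has_derivative: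
  assumes Y: "linear Y" and v: "\<And>\<zeta>. \<exists>v. N.variation \<zeta> 0 v \<and> v t = Y \<zeta>" and t: "t \<in> {0..T}"
  shows "(flow F D t has_derivative Y) (at (\<gamma> 0))"
  unfolding has_derivative_at_alt
proof (intro conjI allI impI)
  show "bounded_linear Y" using Y by (simp add: linear_conv_bounded_linear)
  fix e :: real assume e: "0 < e"
  define K where "K = N.K_lin 1"
  have K: "0 \<le> K" using N.K_lin_nonneg[of 1] by (simp add: K_def)
  \<comment> \<open>The three bounds give \<epsilon> at most 1, a deviation that stays in the tube,
    and a remainder with \<open>\<epsilon> * (K + 1) \<le> e\<close>.\<close>
  define d where "d = min (min 1 (\<rho> / (N.radius 1 + 1))) (e / (K + 1))"
  have R: "0 \<le> N.radius 1" by (simp add: N.radius_nonneg)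
  have d: "0 < d" using e rho K R by (simp add: d_def)
  show "\<exists>d>0. \<forall>y. norm (y - \<gamma> 0) < d \<longrightarrow> norm (flow F D t y - flow F D t (\<gamma> 0) - Y (y - \<gamma> 0)) \<le> e * norm (y - \<gamma> 0)"
  proof (intro exI[of _ d] conjI d allI impI)
    fix y assume y: "norm (y - \<gamma> 0) < d"
    show "norm (flow F D t y - flow F D t (\<gamma> 0) - Y (y - \<gamma> 0)) \<le> e * norm (y - \<gamma> 0)"
    proof (cases "y = \<gamma> 0")
      case True
      then show ?thesis by (simp add: linear_0[OF Y])
    next
      case False
      define \<epsilon> where "\<epsilon> = norm (y - \<gamma> 0)"
      define \<zeta> where "\<zeta> = (y - \<gamma> 0) /\<^sub>R \<epsilon>"
      have \<epsilon>: "0 < \<epsilon>" "\<epsilon> \<in> {0..1}" using False y by (auto simp: \<epsilon>_def d_def)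
      have \<zeta>: "norm \<zeta> \<le> 1" using \<epsilon>(1) by (simp add: \<zeta>_def \<epsilon>_def[symmetric])
      have y_eq: "y = \<gamma> 0 + \<epsilon> *\<^sub>R \<zeta>" using \<epsilon>(1) by (simp add: \<zeta>_def)
      have "\<epsilon> * N.radius 1 \<le> \<epsilon> * (N.radius 1 + 1)" using \<epsilon> by (intro mult_left_mono) auto
      also have "\<dots> \<le> \<rho>" using y R by (simp add: d_def \<epsilon>_def[symmetric] pos_less_divide_eq)
      finally obtain x where x: "N.deviation \<epsilon> \<zeta> 0 T x" using N.deviation_exists[OF \<epsilon>(2) _ \<zeta>] by blast
      obtain v where v: "N.variation \<zeta> 0 v" "v t = Y \<zeta>" using v by blast
      have "norm (x t - \<epsilon> *\<^sub>R v t) \<le> \<epsilon>\<^sup>2 * K"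
        using N.deviation_linear[OF x v(1) \<epsilon>(2) _ \<zeta> t] by (simp add: K_def)
      also have "\<dots> \<le> \<epsilon> * (\<epsilon> * (K + 1))" using \<epsilon> by (simp add: power2_eq_square algebra_simps)
      also have "\<dots> \<le> \<epsilon> * e"
        using y K \<epsilon> by (intro mult_left_mono) (auto simp: d_def \<epsilon>_def[symmetric] pos_less_divide_eq)
      finally have "norm (x t - \<epsilon> *\<^sub>R v t) \<le> e * \<epsilon>" by (simp add: mult.commute)
      moreover have "flow F D t y = \<gamma> t + x t" using flow_deviation[OF x t] y_eq by simp
      moreover have "Y (y - \<gamma> 0) = \<epsilon> *\<^sub>R v t"
        using y_eq v(2) linear_scale[OF Y] by simp
      ultimately show ?thesis
        using flow_\<gamma>[OF t] by (simp add: \<epsilon>_def)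
    qed
  qed
qed

text \<open>Differentiate \<open>snd (flow F D (r x) (x, 0)) = 0\<close> at the initial point of \<open>\<gamma>\<close>.\<close>

lemma return_time_derivative:
  assumes \<gamma>0: "\<gamma> 0 = (x0, 0)" and r: "(r has_real_derivative r') (at x0)" and r0: "r x0 = \<sigma>" "0 < \<sigma>" "\<sigma> < T"
    and ret: "\<forall>\<^sub>F x in at x0. snd (flow F D (r x) (x, 0)) = 0" and q: "snd (\<gamma> \<sigma>) = 0"
    and v: "N.variation (1, 0) 0 v"
  shows "snd (v \<sigma>) + r' * snd (F (\<gamma> \<sigma>)) = 0"
proof -
  \<comment> \<open>With \<epsilon> = \<open>h\<close> and initial displacement
    \<open>(1, 0)\<close>, the return time is \<open>\<sigma> + h * s h\<close>. Only right limits
    are taken, because \<epsilon> has to be nonnegative.\<close>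
  define s where "s h = (r (x0 + h) - r x0) / h" for h
  have s: "(s \<longlongrightarrow> r') (at_right 0)"
    using r unfolding DERIV_def s_def by (rule filterlim_mono) (auto simp: at_within_le_at)
  define B where "B = \<bar>r'\<bar> + 1"
  have B: "1 \<le> B" by (simp add: B_def)
  define d where "d = Min {1, \<sigma> / B, (T - \<sigma>) / B, \<rho> / (L * B), \<rho> / (N.radius B + 1)}"
  have R: "0 \<le> N.radius B" using B by (simp add: N.radius_nonneg)
  have d: "0 < d" using B r0 rho L R by (simp add: d_def)
  have ev1: "\<forall>\<^sub>F h in at_right 0. \<bar>s h - r'\<bar> < 1"
    using tendstoD[OF s, of 1] by (simp add: dist_real_def)
  have ev2: "\<forall>\<^sub>F h in at_right 0. 0 < h \<and> h < d"
    using eventually_at_right_less[of 0] eventually_at_right_real[OF d] by (auto elim: eventually_mono)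
  have ev3: "\<forall>\<^sub>F h in at_right 0. snd (flow F D (r (x0 + h)) (x0 + h, 0)) = 0"
  proof -
    have "\<forall>\<^sub>F h in at 0. snd (flow F D (r (h + x0)) (h + x0, 0)) = 0"
      using ret by (subst (asm) at_to_0) (simp add: eventually_filtermap add.commute)
    then show ?thesis by (simp add: eventually_at_split add.commute)
  qed
  have "((\<lambda>h. snd (v \<sigma>) + s h * snd (F (\<gamma> \<sigma>))) \<longlongrightarrow> 0) (at_right 0)"
  proof (rule Lim_null_comparison)
    show "((\<lambda>h. h * N.K_res B) \<longlongrightarrow> 0) (at_right 0)"
      by (auto intro!: tendsto_eq_intros)
    show "\<forall>\<^sub>F h in at_right 0. norm (snd (v \<sigma>) + s h * snd (F (\<gamma> \<sigma>))) \<le> h * N.K_res B"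
      using ev1 ev2 ev3
    proof eventually_elim
      case (elim h)
      have h: "0 < h" "h \<in> {0..1}" "h * B \<le> \<sigma>" "h * B \<le> T - \<sigma>" "L * (h * B) \<le> \<rho>" "h * (N.radius B + 1) \<le> \<rho>"
        using elim B R L by (auto simp: d_def pos_less_divide_eq mult_ac intro!: less_imp_le)
      have sB: "\<bar>s h\<bar> \<le> B" using elim by (auto simp: B_def)
      have z: "norm (1::real, 0::real) \<le> B" using B by simp
      have "h * N.radius B \<le> \<rho>" using h by (simp add: algebra_simps)
      then obtain x where x: "N.deviation h (1, 0) 0 T x"
        using N.deviation_exists[OF h(2) _ z] by blast
      have rh: "r (x0 + h) = \<sigma> + h * s h" using h r0 by (simp add: s_def)
      have "\<bar>h * s h\<bar> \<le> h * B" using sB h by (simp add: abs_mult)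
      then have "\<sigma> + h * s h \<in> {0..T}" using h by auto
      from flow_deviation[OF x this] have "snd (\<gamma> (\<sigma> + h * s h) + x (\<sigma> + h * s h)) = 0"
        using elim by (simp add: rh \<gamma>0)
      \<comment> \<open>Both end points lie on \<Sigma>, so the second component of the residue is
        minus its first-order part. The residue is of order \<open>h\<^sup>2\<close>, which forces
        the first-order part, divided by \<open>h\<close>, to 0.\<close>
      then have "snd (N.residue_at \<sigma> h (s h) x v) = - h * (snd (v \<sigma>) + s h * snd (F (\<gamma> \<sigma>)))"
        using q by (simp add: N.residue_at_def algebra_simps)
      moreover have "norm (N.residue_at \<sigma> h (s h) x v) \<le> h\<^sup>2 * N.K_res B"
        by (rule N.residue_estimates(1)[OF h(2) _ _ h(5) x v _ z sB]) (use h in auto)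
      moreover have "\<bar>snd (N.residue_at \<sigma> h (s h) x v)\<bar> \<le> norm (N.residue_at \<sigma> h (s h) x v)"
        using norm_snd_le[of "snd (N.residue_at \<sigma> h (s h) x v)" "fst (N.residue_at \<sigma> h (s h) x v)"] by simp
      ultimately have "\<bar>- h * (snd (v \<sigma>) + s h * snd (F (\<gamma> \<sigma>)))\<bar> \<le> h\<^sup>2 * N.K_res B"
        by linarith
      then have "h * \<bar>snd (v \<sigma>) + s h * snd (F (\<gamma> \<sigma>))\<bar> \<le> h * (h * N.K_res B)"
        using h by (simp add: abs_mult power2_eq_square)
      then show ?case using h by simp
    qed
  qed
  moreover have "((\<lambda>h. snd (v \<sigma>) + s h * snd (F (\<gamma> \<sigma>))) \<longlongrightarrow> snd (v \<sigma>) + r' * snd (F (\<gamma> \<sigma>))) (at_right 0)"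
    by (intro tendsto_intros s)
  ultimately show ?thesis
    using tendsto_unique[OF trivial_limit_at_right_real] by blast
qed

end

section \<open>Uniform derivative bounds on compact sets\<close>

lemma frechet_derivative_expand:
  fixes f :: "'a::euclidean_space \<Rightarrow> 'b::euclidean_space"
  assumes "f differentiable (at x)"
  shows "frechet_derivative f (at x) v = (\<Sum>b\<in>Basis. (v \<bullet> b) *\<^sub>R frechet_derivative f (at x) b)"
proof -
  interpret bounded_linear "frechet_derivative f (at x)"
    using assms by (simp add: frechet_derivative_works has_derivative_bounded_linear)
  have "frechet_derivative f (at x) v = frechet_derivative f (at x) (\<Sum>b\<in>Basis. (v \<bullet> b) *\<^sub>R b)"
    by (simp add: euclidean_representation)
  then show ?thesis by (simp only: sum scale)
qed

text \<open>\<open>Ck_on\<close> controls the derivative in each fixed direction; expansion in the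
  basis makes the bound uniform in the direction.\<close>

lemma C1_derivative_bounded:
  fixes f :: "'a::euclidean_space \<Rightarrow> 'b::euclidean_space"
  assumes f: "Ck_on 1 f S" and K: "compact K" "K \<subseteq> S"
  obtains C where "0 \<le> C" "\<And>x v. x \<in> K \<Longrightarrow> norm (frechet_derivative f (at x) v) \<le> C * norm v"
proof -
  have "\<exists>B. \<forall>x\<in>K. norm (frechet_derivative f (at x) b) \<le> B" for b
  proof -
    have "continuous_on K (\<lambda>x. frechet_derivative f (at x) b)"
      using f K(2) by (auto intro: continuous_on_subset)
    from compact_imp_bounded[OF compact_continuous_image[OF this K(1)]] show ?thesis
      by (auto simp: bounded_iff)
  qed
  then obtain B where B: "\<And>b x. x \<in> K \<Longrightarrow> norm (frechet_derivative f (at x) b) \<le> B b" by metis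
  show thesis
  proof (rule that[of "\<Sum>b\<in>Basis. \<bar>B b\<bar>"])
    fix x v assume x: "x \<in> K"
    then have "f differentiable (at x)" using f K by auto
    then have "norm (frechet_derivative f (at x) v) = norm (\<Sum>b\<in>Basis. (v \<bullet> b) *\<^sub>R frechet_derivative f (at x) b)"
      by (simp only: frechet_derivative_expand[of f x v])
    also have "\<dots> \<le> (\<Sum>b\<in>Basis. norm v * \<bar>B b\<bar>)"
    proof (rule sum_norm_le)
      fix b :: 'a assume b: "b \<in> Basis"
      show "norm ((v \<bullet> b) *\<^sub>R frechet_derivative f (at x) b) \<le> norm v * \<bar>B b\<bar>"
        using Basis_le_norm[OF b, of v] B[OF x, of b] by (auto intro!: mult_mono)
    qed
    finally show "norm (frechet_derivative f (at x) v) \<le> (\<Sum>b\<in>Basis. \<bar>B b\<bar>) * norm v"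
      by (simp add: sum_distrib_left mult.commute)
  qed (auto intro: sum_nonneg)
qed

text \<open>The partial derivatives are of class \<open>C\<^sup>1\<close>, hence Lipschitz on the
  compact set. This constant is the source of the quadratic Taylor bound for \<open>F\<close> and of
  the mixed difference bound for the perturbation.\<close>

lemma C2_derivative_lipschitz:
  fixes f :: "'a::euclidean_space \<Rightarrow> 'b::euclidean_space"
  assumes f: "Ck_on 2 f S" and S: "open S" and K: "compact K" "K \<subseteq> S"
  obtains C where "0 \<le> C" "\<And>x y v. x \<in> K \<Longrightarrow> y \<in> K \<Longrightarrow>
    norm (frechet_derivative f (at x) v - frechet_derivative f (at y) v) \<le> C * norm (x - y) * norm v"
proof -
  have diff: "f differentiable (at x)" if "x \<in> S" for x
    using f that by (auto simp: numeral_2_eq_2)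
  have "\<exists>L\<ge>0. \<forall>x\<in>K. \<forall>y\<in>K. norm (frechet_derivative f (at x) b - frechet_derivative f (at y) b) \<le> L * norm (x - y)" for b
  proof -
    have "Ck_on 1 (\<lambda>x. frechet_derivative f (at x) b) S"
      using f by (auto simp: numeral_2_eq_2)
    from C1_lipschitz_on_compact[OF this S K] show ?thesis by metis
  qed
  then obtain L where L: "\<And>b. 0 \<le> L b" "\<And>b x y. x \<in> K \<Longrightarrow> y \<in> K \<Longrightarrow>
      norm (frechet_derivative f (at x) b - frechet_derivative f (at y) b) \<le> L b * norm (x - y)" by metis
  show thesis
  proof (rule that[of "\<Sum>b\<in>Basis. L b"])
    fix x y v assume xy: "x \<in> K" "y \<in> K"
    then have xyS: "f differentiable (at x)" "f differentiable (at y)" using diff K by auto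
    have "frechet_derivative f (at x) v - frechet_derivative f (at y) v
        = (\<Sum>b\<in>Basis. (v \<bullet> b) *\<^sub>R (frechet_derivative f (at x) b - frechet_derivative f (at y) b))"
      by (simp only: frechet_derivative_expand[OF xyS(1), of v] frechet_derivative_expand[OF xyS(2), of v]
          sum_subtractf scaleR_diff_right)
    also have "norm \<dots> \<le> (\<Sum>b\<in>Basis. norm v * (L b * norm (x - y)))"
    proof (rule sum_norm_le)
      fix b :: 'a assume b: "b \<in> Basis"
      show "norm ((v \<bullet> b) *\<^sub>R (frechet_derivative f (at x) b - frechet_derivative f (at y) b)) \<le> norm v * (L b * norm (x - y))"
        using Basis_le_norm[OF b, of v] L(2)[OF xy, of b] by (auto intro!: mult_mono)
    qed
    finally show "norm (frechet_derivative f (at x) v - frechet_derivative f (at y) v) \<le> (\<Sum>b\<in>Basis. L b) * norm (x - y) * norm v"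
      by (simp add: sum_distrib_left sum_distrib_right mult_ac)
  qed (auto intro: sum_nonneg L)
qed

section \<open>Tubes and continuation beyond the return time\<close>

lemma compact_tube:
  fixes u :: "real \<Rightarrow> 'a::euclidean_space"
  assumes "continuous_on {a..b} u"
  shows "compact {u t + c |t c. t \<in> {a..b} \<and> norm c \<le> r}"
proof -
  have "{u t + c |t c. t \<in> {a..b} \<and> norm c \<le> r} = (\<lambda>p. u (fst p) + snd p) ` ({a..b} \<times> cball 0 r)"
    (is "?S = ?I")
  proof (intro subset_antisym subsetI)
    fix x assume "x \<in> ?S"
    then obtain t c where "x = u t + c" "(t, c) \<in> {a..b} \<times> cball 0 r" by auto
    then show "x \<in> ?I" by (intro image_eqI[of _ _ "(t, c)"]) auto
  next
    fix x assume "x \<in> ?I"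
    then obtain p where "x = u (fst p) + snd p" "fst p \<in> {a..b}" "norm (snd p) \<le> r" by auto
    then show "x \<in> ?S" by blast
  qed
  moreover have "compact \<dots>"
    by (intro compact_continuous_image compact_Times continuous_intros continuous_on_compose2[OF assms, of _ fst]) auto
  ultimately show ?thesis by simp
qed

lemma tube_in_open:
  fixes u :: "real \<Rightarrow> 'a::euclidean_space"
  assumes u: "continuous_on {a..b} u" "u ` {a..b} \<subseteq> D" and D: "open D"
  obtains r where "0 < r" "{u t + c |t c. t \<in> {a..b} \<and> norm c \<le> r} \<subseteq> D"
proof -
  obtain e where e: "e > 0" "(\<Union>x\<in>u ` {a..b}. ball x e) \<subseteq> D"
    by (rule compact_subset_open_imp_ball_epsilon_subset[OF compact_continuous_image[OF u(1)] D u(2)]) auto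
  have "u t + c \<in> D" if "t \<in> {a..b}" "norm c \<le> e / 2" for t c
  proof -
    have "u t + c \<in> ball (u t) e" using that e(1) by (simp add: dist_norm)
    then show ?thesis using e(2) that(1) by blast
  qed
  then show thesis using e(1) by (intro that[of "e / 2"]) auto
qed

text \<open>The equation is solved for \<open>F\<close> frozen outside a tube around the given solution.\<close>

lemma ode_solution_extend:
  assumes D: "open D" and F: "Ck_on 1 F D" and \<sigma>: "0 \<le> \<sigma>" and u: "ode_solution_on F D {0..\<sigma>} u"
  obtains \<gamma> T where "\<sigma> < T" "ode_solution_on F D {0..T} \<gamma>" "\<And>t. t \<in> {0..\<sigma>} \<Longrightarrow> \<gamma> t = u t"
proof -
  have cont_u: "continuous_on {0..\<sigma>} u"
    using u unfolding ode_solution_on_def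
    by (meson continuous_on_eq_continuous_within has_vector_derivative_continuous)
  obtain r where r: "0 < r" "{u t + c |t c. t \<in> {0..\<sigma>} \<and> norm c \<le> r} \<subseteq> D"
    by (rule tube_in_open[OF cont_u _ D]) (use u in \<open>auto simp: ode_solution_on_def\<close>)
  define K where "K = {u t + c |t c. t \<in> {0..\<sigma>} \<and> norm c \<le> r}"
  have K: "compact K" "K \<subseteq> D" using compact_tube[OF cont_u] r by (auto simp: K_def)
  have F_cont: "continuous_on K F" using Ck_on_continuous[OF F] K(2) by (rule continuous_on_subset)
  obtain L where L: "0 \<le> L" "\<And>x y. x \<in> K \<Longrightarrow> y \<in> K \<Longrightarrow> norm (F x - F y) \<le> L * norm (x - y)"
    using C1_lipschitz_on_compact[OF F D K] by blast
  obtain M where M: "0 < M" "\<And>x. x \<in> K \<Longrightarrow> norm (F x) \<le> M"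
    using compact_imp_bounded[OF compact_continuous_image[OF F_cont K(1)]] by (auto simp: bounded_pos)
  define P where "P = closest_point (cball (0::plane) r)"
  have P_in: "norm (P a) \<le> r" for a
    using closest_point_in_set[of "cball 0 r" a] r(1) by (simp add: P_def)
  have P_lip: "norm (P a - P b) \<le> norm (a - b)" for a b
    using closest_point_lipschitz[of "cball 0 r" a b] r(1) by (auto simp: P_def dist_norm)
  have P_id: "P a = a" if "norm a \<le> r" for a
    using that by (simp add: P_def closest_point_self)
  have P_cont: "continuous_on UNIV P"
    unfolding P_def by (rule continuous_on_closest_point) (use r in auto)
  \<comment> \<open>On the tube the speed is at most \<open>M\<close>, so in the extra time
    \<open>r / M\<close> the solution moves by at most \<open>r\<close>.\<close>
  define T where "T = \<sigma> + r / M"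
  have T: "\<sigma> < T" "0 \<le> T" using r M \<sigma> by (auto simp: T_def)
  \<comment> \<open>After time \<sigma> the tube is continued around the constant centre
    \<open>u \<sigma>\<close>.\<close>
  define uc where "uc t = u (min t \<sigma>)" for t
  have uc_cont: "continuous_on {0..T} uc"
    unfolding uc_def by (rule continuous_on_compose2[OF cont_u]) (use \<sigma> in \<open>auto intro!: continuous_intros\<close>)
  define Q where "Q t y = uc t + P (y - uc t)" for t y
  have Q: "Q t y \<in> K" if "t \<in> {0..T}" for t y
    unfolding K_def Q_def uc_def mem_Collect_eq
    by (rule exI[of _ "min t \<sigma>"], rule exI[of _ "P (y - u (min t \<sigma>))"]) (use that P_in \<sigma> in auto)
  have "\<exists>y. y 0 = u 0 \<and> (\<forall>t\<in>{0..T}. (y has_vector_derivative F (Q t (y t))) (at t within {0..T}))"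
  proof (rule lipschitz_ode_exists)
    have "continuous_on ({0..T} \<times> UNIV) (\<lambda>p. Q (fst p) (snd p))"
      unfolding Q_def
      by (intro continuous_intros continuous_on_compose2[OF P_cont] continuous_on_compose2[OF uc_cont, of _ fst]) auto
    then have "continuous_on ({0..T} \<times> UNIV) (\<lambda>p. F (Q (fst p) (snd p)))"
      by (rule continuous_on_compose2[OF F_cont]) (use Q in auto)
    then show "continuous_on ({0..T} \<times> UNIV) (\<lambda>(t, y). F (Q t y))" by (simp add: case_prod_unfold)
    show "norm (F (Q t x) - F (Q t y)) \<le> (L + 1) * norm (x - y)" if t: "t \<in> {0..T}" for t x y
    proof -
      have "norm (F (Q t x) - F (Q t y)) \<le> L * norm (Q t x - Q t y)" by (rule L(2)[OF Q[OF t] Q[OF t]])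
      also have "\<dots> \<le> (L + 1) * norm (x - y)"
        using P_lip[of "x - uc t" "y - uc t"] L(1) by (intro mult_mono) (auto simp: Q_def)
      finally show ?thesis .
    qed
  qed (use T L in auto)
  then obtain y where y: "y 0 = u 0" "\<And>t. t \<in> {0..T} \<Longrightarrow> (y has_vector_derivative F (Q t (y t))) (at t within {0..T})" by blast
  have yu: "y t = u t" if t: "t \<in> {0..\<sigma>}" for t
  proof -
    have "norm (y t - u t) \<le> (norm (y 0 - u 0) + 0 * t) * exp (L * t)"
    proof (rule gronwall_vector_derivative[where u'="\<lambda>t. F (Q t (y t)) - F (u t)" and T=\<sigma>])
      fix s assume s: "s \<in> {0..\<sigma>}"
      have sT: "s \<in> {0..T}" using s T by auto
      have "(y has_vector_derivative F (Q s (y s))) (at s within {0..\<sigma>})"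
        by (rule has_vector_derivative_within_subset[OF y(2)[OF sT]]) (use T in auto)
      then show "((\<lambda>t. y t - u t) has_vector_derivative F (Q s (y s)) - F (u s)) (at s within {0..\<sigma>})"
        using u s by (intro derivative_intros) (auto simp: ode_solution_on_def)
      have us: "uc s = u s" using s by (simp add: uc_def)
      have "u s = Q s (u s)" using P_id[of 0] r(1) by (simp add: Q_def us)
      then have "norm (F (Q s (y s)) - F (u s)) \<le> L * norm (Q s (y s) - Q s (u s))"
        using L(2)[OF Q[OF sT] Q[OF sT]] by metis
      also have "\<dots> \<le> L * norm (y s - u s)"
        using P_lip[of "y s - uc s" "u s - uc s"] L(1) by (intro mult_mono) (auto simp: Q_def)
      finally show "norm (F (Q s (y s)) - F (u s)) \<le> L * norm (y s - u s) + 0" by simp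
    qed (use t L in auto)
    then show ?thesis using y by simp
  qed
  have "norm (y t - uc t) \<le> r" if t: "t \<in> {0..T}" for t
  proof (cases "t \<le> \<sigma>")
    case True
    then show ?thesis using yu t r(1) by (simp add: uc_def)
  next
    case False
    have "norm (y t - y \<sigma>) \<le> M * \<bar>t - \<sigma>\<bar>"
      by (rule vector_derivative_lipschitz[OF _ y(2) M(2)[OF Q]]) (use t T \<sigma> in auto)
    also have "\<dots> \<le> M * (r / M)" using False t M by (intro mult_left_mono) (auto simp: T_def)
    finally show ?thesis using False M yu[of \<sigma>] \<sigma> by (simp add: uc_def)
  qed
  then have Qy: "Q t (y t) = y t" if "t \<in> {0..T}" for t using that P_id by (simp add: Q_def)
  have "ode_solution_on F D {0..T} y"
    unfolding ode_solution_on_def using y(2) Qy Q K(2) by (metis subset_iff)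
  with T yu show thesis by (intro that[of T y]) auto
qed

text \<open>Stated for every larger constant \<open>L'\<close>, so that the two perturbations built
  on the same tube can be given one common constant.\<close>

lemma flow_tube_exists:
  assumes D: "open D" and F: "Ck_on 2 F D" and T: "0 < T" and \<gamma>: "ode_solution_on F D {0..T} \<gamma>"
  obtains \<rho> L where "\<And>L'. L \<le> L' \<Longrightarrow> flow_tube F (\<lambda>t. frechet_derivative F (at (\<gamma> t))) \<gamma> T \<rho> L' D"
proof -
  have F1: "Ck_on 1 F D" using F Ck_on_SucD[of 1 F D] by (simp add: numeral_2_eq_2)
  have cont: "continuous_on {0..T} \<gamma>"
    using \<gamma> unfolding ode_solution_on_def
    by (meson continuous_on_eq_continuous_within has_vector_derivative_continuous)
  have \<gamma>D: "\<gamma> t \<in> D" if "t \<in> {0..T}" for t using \<gamma> that by (auto simp: ode_solution_on_def)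
  obtain \<rho> where \<rho>: "0 < \<rho>" "{\<gamma> t + c |t c. t \<in> {0..T} \<and> norm c \<le> \<rho>} \<subseteq> D"
    by (rule tube_in_open[OF cont _ D]) (use \<gamma>D in auto)
  define K where "K = {\<gamma> t + c |t c. t \<in> {0..T} \<and> norm c \<le> \<rho>}"
  have K: "compact K" "K \<subseteq> D" using compact_tube[OF cont] \<rho> by (auto simp: K_def)
  have in_K: "\<gamma> t + c \<in> K" if "t \<in> {0..T}" "norm c \<le> \<rho>" for t c
    unfolding K_def using that by blast
  have \<gamma>K: "\<gamma> t \<in> K" if "t \<in> {0..T}" for t using in_K[OF that, of 0] \<rho>(1) by simp
  have F_cont: "continuous_on K F" using Ck_on_continuous[OF F] K(2) by (rule continuous_on_subset)
  obtain L1 where L1: "0 \<le> L1" "\<And>x y. x \<in> K \<Longrightarrow> y \<in> K \<Longrightarrow> norm (F x - F y) \<le> L1 * norm (x - y)"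
    using C1_lipschitz_on_compact[OF F1 D K] by blast
  obtain L2 where L2: "0 < L2" "\<And>x. x \<in> K \<Longrightarrow> norm (F x) \<le> L2"
    using compact_imp_bounded[OF compact_continuous_image[OF F_cont K(1)]] by (auto simp: bounded_pos)
  obtain L3 where L3: "0 \<le> L3" "\<And>x v. x \<in> K \<Longrightarrow> norm (frechet_derivative F (at x) v) \<le> L3 * norm v"
    using C1_derivative_bounded[OF F1 K] by blast
  obtain L4 where L4: "0 \<le> L4" "\<And>x y v. x \<in> K \<Longrightarrow> y \<in> K \<Longrightarrow>
    norm (frechet_derivative F (at x) v - frechet_derivative F (at y) v) \<le> L4 * norm (x - y) * norm v"
    using C2_derivative_lipschitz[OF F D K] by blast
  have der: "(F has_derivative frechet_derivative F (at x)) (at x)" if "x \<in> D" for x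
    using F1 that by (auto simp: frechet_derivative_works)
  define L where "L = 1 + L1 + L2 + L3 + L4"
  show thesis
  proof (rule that[of L])
    fix L' assume "L \<le> L'"
    then have L': "1 \<le> L'" "L1 \<le> L'" "L2 \<le> L'" "L3 \<le> L'" "L4 \<le> L'"
      using L1(1) L2(1) L3(1) L4(1) by (auto simp: L_def)
    show "flow_tube F (\<lambda>t. frechet_derivative F (at (\<gamma> t))) \<gamma> T \<rho> L' D"
    proof (intro flow_tube.intro solution_tube.intro flow_tube_axioms.intro)
      fix t assume t: "t \<in> {0..T}"
      show "(\<gamma> has_vector_derivative F (\<gamma> t)) (at t within {0..T})" using \<gamma> t by (auto simp: ode_solution_on_def)
      show "norm (F (\<gamma> t)) \<le> L'" using L2(2)[OF \<gamma>K[OF t]] L' by simp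
      show "linear (frechet_derivative F (at (\<gamma> t)))"
        using der[OF \<gamma>D[OF t]] has_derivative_bounded_linear linear_conv_bounded_linear by blast
      show "norm (frechet_derivative F (at (\<gamma> t)) a) \<le> L' * norm a" for a :: plane
        using L3(2)[OF \<gamma>K[OF t], of a] mult_right_mono[OF L'(4), of "norm a"] by simp
      fix a b :: plane assume ab: "norm a \<le> \<rho>" "norm b \<le> \<rho>"
      show "\<gamma> t + a \<in> D" using in_K[OF t ab(1)] K by auto
      show "norm (F (\<gamma> t + a) - F (\<gamma> t + b)) \<le> L' * norm (a - b)"
        using L1(2)[OF in_K[OF t ab(1)] in_K[OF t ab(2)]] mult_right_mono[OF L'(2), of "norm (a - b)"] by simp
      \<comment> \<open>The mean value inequality is applied to \<open>F\<close> minus its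
        derivative at the centre, on the ball of radius \<open>R\<close> about
        \<open>\<gamma> t\<close>; there the derivative of this difference is at most
        \<open>L4 * R\<close>.\<close>
      define R where "R = max (norm a) (norm b)"
      let ?A = "frechet_derivative F (at (\<gamma> t))"
      have R: "R \<le> norm a + norm b" "R \<le> \<rho>" using ab by (auto simp: R_def)
      have inR: "x \<in> K" "norm (x - \<gamma> t) \<le> R" if "x \<in> cball (\<gamma> t) R" for x
      proof -
        show *: "norm (x - \<gamma> t) \<le> R" using that by (simp add: dist_norm norm_minus_commute)
        show "x \<in> K" using in_K[OF t, of "x - \<gamma> t"] * R by simp
      qed
      have lin: "bounded_linear ?A" using der[OF \<gamma>D[OF t]] has_derivative_bounded_linear by blast
      have "norm ((F (\<gamma> t + a) - ?A (\<gamma> t + a)) - (F (\<gamma> t + b) - ?A (\<gamma> t + b))) \<le> (L4 * R) * norm (\<gamma> t + a - (\<gamma> t + b))"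
      proof (rule differentiable_bound[of "cball (\<gamma> t) R" "\<lambda>x. F x - ?A x" "\<lambda>x v. frechet_derivative F (at x) v - ?A v"])
        fix x assume x: "x \<in> cball (\<gamma> t) R"
        then have "x \<in> D" using inR(1) K by blast
        then show "((\<lambda>x. F x - ?A x) has_derivative (\<lambda>v. frechet_derivative F (at x) v - ?A v)) (at x within cball (\<gamma> t) R)"
          by (intro has_derivative_diff has_derivative_at_withinI[OF der] bounded_linear_imp_has_derivative lin)
        show "onorm (\<lambda>v. frechet_derivative F (at x) v - ?A v) \<le> L4 * R"
        proof (rule onorm_le)
          fix v
          have "norm (frechet_derivative F (at x) v - ?A v) \<le> L4 * norm (x - \<gamma> t) * norm v"
            by (rule L4(2)[OF inR(1)[OF x] \<gamma>K[OF t]])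
          also have "\<dots> \<le> L4 * R * norm v"
            using inR(2)[OF x] L4(1) by (intro mult_right_mono mult_left_mono) auto
          finally show "norm (frechet_derivative F (at x) v - ?A v) \<le> L4 * R * norm v" .
        qed
      qed (auto simp: R_def dist_norm)
      also have "\<dots> \<le> (L' * (norm a + norm b)) * norm (a - b)"
        using R L4(1) L' by (simp, intro mult_right_mono mult_mono) (auto simp: R_def le_max_iff_disj)
      also have "(F (\<gamma> t + a) - ?A (\<gamma> t + a)) - (F (\<gamma> t + b) - ?A (\<gamma> t + b)) = F (\<gamma> t + a) - F (\<gamma> t + b) - ?A (a - b)"
        using lin by (simp add: linear_add linear_diff bounded_linear.linear)
      finally show "norm (F (\<gamma> t + a) - F (\<gamma> t + b) - ?A (a - b)) \<le> L' * (norm a + norm b) * norm (a - b)" .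
    next
      show "continuous_on ({0..T} \<times> cball 0 \<rho>) (\<lambda>(t, a). F (\<gamma> t + a))"
      proof -
        have "continuous_on ({0..T} \<times> cball 0 \<rho>) (\<lambda>p. \<gamma> (fst p) + snd p)"
          by (intro continuous_intros continuous_on_compose2[OF cont, of _ fst]) auto
        then have "continuous_on ({0..T} \<times> cball 0 \<rho>) (\<lambda>p. F (\<gamma> (fst p) + snd p))"
          by (rule continuous_on_compose2[OF F_cont]) (rule image_subsetI, simp add: mem_Times_iff in_K)
        then show ?thesis by (simp add: case_prod_unfold)
      qed
      show "continuous_on {0..T} (\<lambda>t. frechet_derivative F (at (\<gamma> t)) c)" for c
      proof (rule continuous_on_compose2[of D "\<lambda>x. frechet_derivative F (at x) c" _ \<gamma>])
        show "continuous_on D (\<lambda>x. frechet_derivative F (at x) c)" using F1 by (cases c) simp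
      qed (use \<gamma>D cont in auto)
    qed (use T \<rho> L' D F1 in auto)
  qed
qed

section \<open>Time-dependent perturbations\<close>

lemma smooth_has_time_derivative:
  assumes G: "smooth_on (\<lambda>(t, z). G t z) (UNIV \<times> D)" and z: "z \<in> D"
  shows "((\<lambda>s. G s z) has_vector_derivative frechet_derivative (\<lambda>(t, z). G t z) (at (s, z)) (1, 0)) (at s within I)"
proof -
  let ?g = "\<lambda>(t, z). G t z"
  have "Ck_on (Suc 0) ?g (UNIV \<times> D)" using G by (simp add: smooth_on_def del: Ck_on.simps)
  then have 1: "(?g has_derivative frechet_derivative ?g (at (s, z))) (at (s, z))"
    by (rule Ck_on_has_derivative) (use z in simp)
  have 2: "((\<lambda>s. (s, z)) has_derivative (\<lambda>h. (h, 0))) (at s within I)"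
    by (auto intro!: derivative_eq_intros)
  have 3: "((\<lambda>s. G s z) has_derivative (\<lambda>h. frechet_derivative ?g (at (s, z)) (h, 0))) (at s within I)"
    using has_derivative_compose[OF 2 1] by simp
  have "(\<lambda>h. frechet_derivative ?g (at (s, z)) (h, 0)) = (\<lambda>h. h *\<^sub>R frechet_derivative ?g (at (s, z)) (1, 0))"
    (is "?D = ?E")
  proof
    show "?D h = ?E h" for h
      using linear_scale[OF has_derivative_linear[OF 1], of h "(1, 0)"]
      by (simp only: scaleR_Pair real_scaleR_def mult_1_right scaleR_zero_right)
  qed
  with 3 show ?thesis by (simp only: has_vector_derivative_def)
qed

lemma norm_Pair3_le: "norm (a, b, c) \<le> norm a + norm b + norm c"
  using norm_Pair_le[of a "(b, c)"] norm_Pair_le[of b c] by simp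

text \<open>\<open>S\<close>, \<open>S'\<close> and \<open>\<kappa>\<close> are the identity and \<open>1\<close> for the lower field, and (up to sign) the reflection
  and \<open>- 1\<close> for the time-reversed upper field.\<close>

lemma perturbed_tube_exists:
  fixes G :: "real \<Rightarrow> plane \<Rightarrow> plane" and H :: "real \<Rightarrow> plane \<Rightarrow> real \<Rightarrow> plane"
  assumes ft: "\<And>L'. L0 \<le> L' \<Longrightarrow> flow_tube F A \<gamma> T \<rho> L' D"
    and G: "smooth_on (\<lambda>(t, z). G t z) (UNIV \<times> D)"
    and H: "smooth_on (\<lambda>(t, z, \<epsilon>). H t z \<epsilon>) (UNIV \<times> D \<times> {-\<epsilon>\<^sub>0<..<\<epsilon>\<^sub>0})"
    and e0: "0 < e0" "e0 \<le> 1" "e0 < \<epsilon>\<^sub>0"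
    and S: "linear S" "\<And>a. norm (S a) = norm a"
    and S': "linear S'" "\<And>a. norm (S' a) = norm a" "\<And>a. a \<in> D \<Longrightarrow> S' a \<in> D"
    and \<kappa>: "\<bar>\<kappa>\<bar> = 1"
  obtains L1 where "\<And>L'. L1 \<le> L' \<Longrightarrow> perturbed_tube F A \<gamma> T \<rho> L'
     (\<lambda>t \<theta> z \<epsilon>. S (G (\<theta> + \<kappa> * t) (S' z) + \<epsilon> *\<^sub>R H (\<theta> + \<kappa> * t) (S' z) \<epsilon>)) (cball \<theta>s 1) e0"
proof -
  interpret flow_tube F A \<gamma> T \<rho> "max 1 L0" D using ft by simp
  let ?g = "\<lambda>(t, z). G t z" and ?h = "\<lambda>(t, z, \<epsilon>). H t z \<epsilon>"
  have cont_\<gamma>: "continuous_on {0..T} \<gamma>"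
    using \<gamma>' by (meson continuous_on_eq_continuous_within has_vector_derivative_continuous)
  define K where "K = S' ` {\<gamma> t + c |t c. t \<in> {0..T} \<and> norm c \<le> \<rho>}"
  have S'_cont: "continuous_on X S'" for X using S'(1) by (simp add: linear_continuous_on linear_conv_bounded_linear)
  have S_cont: "continuous_on X S" for X using S(1) by (simp add: linear_continuous_on linear_conv_bounded_linear)
  have K1: "compact K"
    unfolding K_def by (intro compact_continuous_image S'_cont compact_tube[OF cont_\<gamma>])
  have K2: "K \<subseteq> D"
    using tube S'(3) unfolding K_def by blast
  note K = K1 K2
  \<comment> \<open>A bound for the times \<open>\<theta> + \<kappa> * t\<close> with
    \<open>t\<close> in \<open>{0..T}\<close> and \<theta> within 1 of
    \<open>\<theta>s\<close>.\<close>
  define R where "R = \<bar>\<theta>s\<bar> + 1 + T"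
  have in_K: "S' (\<gamma> t + a) \<in> K" if "t \<in> {0..T}" "norm a \<le> \<rho>" for t a
    using that unfolding K_def by blast
  have in_R: "\<theta> + \<kappa> * t \<in> {-R..R}" if "t \<in> {0..T}" "\<theta> \<in> cball \<theta>s 1" for t \<theta>
  proof -
    have "\<bar>\<kappa> * t\<bar> \<le> T" using that \<kappa> by (simp add: abs_mult)
    moreover have "\<bar>\<theta>\<bar> \<le> \<bar>\<theta>s\<bar> + 1" using that by (auto simp: dist_real_def)
    ultimately show ?thesis by (auto simp: R_def)
  qed
  \<comment> \<open>These compact sets contain the arguments of \<open>G\<close> and
    \<open>H\<close> along the tube, so the constants below are uniform;
    \<open>e0 < \<epsilon>\<^sub>0\<close> keeps \<open>C'\<close> inside the domain of
    \<open>H\<close>.\<close>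
  define C where "C = {-R..R} \<times> K"
  define C' where "C' = {-R..R} \<times> K \<times> {0..e0}"
  have C: "compact C" "C \<subseteq> UNIV \<times> D" "compact C'" "C' \<subseteq> UNIV \<times> D \<times> {-\<epsilon>\<^sub>0<..<\<epsilon>\<^sub>0}"
    using K e0 by (auto simp: C_def C'_def intro!: compact_Times)
  have opn: "open (UNIV \<times> D :: (real \<times> plane) set)" "open (UNIV \<times> D \<times> {-\<epsilon>\<^sub>0<..<\<epsilon>\<^sub>0} :: (real \<times> plane \<times> real) set)"
    using D by (auto intro!: open_Times)
  have g1: "Ck_on 1 ?g (UNIV \<times> D)" and g2: "Ck_on 2 ?g (UNIV \<times> D)" and g0: "continuous_on (UNIV \<times> D) ?g"
    using G Ck_on_continuous by (auto simp: smooth_on_def simp del: Ck_on.simps)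
  have h1: "Ck_on 1 ?h (UNIV \<times> D \<times> {-\<epsilon>\<^sub>0<..<\<epsilon>\<^sub>0})" and h0: "continuous_on (UNIV \<times> D \<times> {-\<epsilon>\<^sub>0<..<\<epsilon>\<^sub>0}) ?h"
    using H Ck_on_continuous by (auto simp: smooth_on_def simp del: Ck_on.simps)
  obtain Lg where Lg: "0 \<le> Lg" "\<And>p q. p \<in> C \<Longrightarrow> q \<in> C \<Longrightarrow> norm (?g p - ?g q) \<le> Lg * norm (p - q)"
    using C1_lipschitz_on_compact[OF g1 opn(1) C(1,2)] by blast
  obtain Lh where Lh: "0 \<le> Lh" "\<And>p q. p \<in> C' \<Longrightarrow> q \<in> C' \<Longrightarrow> norm (?h p - ?h q) \<le> Lh * norm (p - q)"
    using C1_lipschitz_on_compact[OF h1 opn(2) C(3,4)] by blast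
  obtain Ld where Ld: "0 \<le> Ld" "\<And>p q v. p \<in> C \<Longrightarrow> q \<in> C \<Longrightarrow>
      norm (frechet_derivative ?g (at p) v - frechet_derivative ?g (at q) v) \<le> Ld * norm (p - q) * norm v"
    using C2_derivative_lipschitz[OF g2 opn(1) C(1,2)] by blast
  obtain Bg where Bg: "0 < Bg" "\<And>p. p \<in> C \<Longrightarrow> norm (?g p) \<le> Bg"
    using compact_imp_bounded[OF compact_continuous_image[OF continuous_on_subset[OF g0 C(2)] C(1)]]
    unfolding bounded_pos by blast
  obtain Bh where Bh: "0 < Bh" "\<And>p. p \<in> C' \<Longrightarrow> norm (?h p) \<le> Bh"
    using compact_imp_bounded[OF compact_continuous_image[OF continuous_on_subset[OF h0 C(4)] C(3)]]
    unfolding bounded_pos by blast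
  have gz: "norm (G s z - G s z') \<le> Lg * norm (z - z')" if "s \<in> {-R..R}" "z \<in> K" "z' \<in> K" for s z z'
    using Lg(2)[of "(s, z)" "(s, z')"] that by (simp add: C_def norm_Pair)
  have gt: "norm (G s z - G s' z) \<le> Lg * \<bar>s - s'\<bar>" if "s \<in> {-R..R}" "s' \<in> {-R..R}" "z \<in> K" for s s' z
    using Lg(2)[of "(s, z)" "(s', z)"] that by (simp add: C_def norm_Pair)
  have hz: "norm (H s z \<epsilon> - H s z' \<epsilon>) \<le> Lh * norm (z - z')" if "s \<in> {-R..R}" "z \<in> K" "z' \<in> K" "\<epsilon> \<in> {0..e0}" for s z z' \<epsilon>
    using Lh(2)[of "(s, z, \<epsilon>)" "(s, z', \<epsilon>)"] that by (simp add: C'_def norm_Pair)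
  have ht: "norm (H s z \<epsilon> - H s' z \<epsilon>) \<le> Lh * \<bar>s - s'\<bar>" if "s \<in> {-R..R}" "s' \<in> {-R..R}" "z \<in> K" "\<epsilon> \<in> {0..e0}" for s s' z \<epsilon>
    using Lh(2)[of "(s, z, \<epsilon>)" "(s', z, \<epsilon>)"] that by (simp add: C'_def norm_Pair zero_prod_def[symmetric])
  \<comment> \<open>A mixed difference is the time increment of \<open>G s z - G s z'\<close>. The
    time derivative of this function is small with \<open>norm (z - z')\<close> because the
    derivative of \<open>G\<close> is Lipschitz.\<close>
  have gm: "norm (G s z - G s' z - (G s z' - G s' z')) \<le> Ld * norm (z - z') * \<bar>s - s'\<bar>"
    if "s \<in> {-R..R}" "s' \<in> {-R..R}" "z \<in> K" "z' \<in> K" for s s' z z'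
  proof -
    have "norm ((\<lambda>s. G s z - G s z') s - (\<lambda>s. G s z - G s z') s') \<le> (Ld * norm (z - z')) * \<bar>s - s'\<bar>"
    proof (rule vector_derivative_lipschitz[OF _ _ _ that(1,2)])
      fix r assume r: "r \<in> {-R..R}"
      let ?d = "\<lambda>z. frechet_derivative ?g (at (r, z)) (1, 0)"
      show "((\<lambda>s. G s z - G s z') has_vector_derivative ?d z - ?d z') (at r within {-R..R})"
        using that K by (intro has_vector_derivative_diff smooth_has_time_derivative[OF G]) auto
      show "norm (?d z - ?d z') \<le> Ld * norm (z - z')"
        using Ld(2)[of "(r, z)" "(r, z')" "(1, 0)"] r that by (simp add: C_def norm_Pair)
    qed simp
    then show ?thesis by (simp add: algebra_simps)
  qed
  define L1 where "L1 = max 1 L0 + Lg + Lh + Ld + Bg + Bh"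
  let ?k = "\<lambda>t \<theta> z \<epsilon>. S (G (\<theta> + \<kappa> * t) (S' z) + \<epsilon> *\<^sub>R H (\<theta> + \<kappa> * t) (S' z) \<epsilon>)"
  show thesis
  proof (rule that[of L1])
    fix L' assume "L1 \<le> L'"
    then have L': "L0 \<le> L'" "0 \<le> L'" "Lg + Lh \<le> L'" "Bg + Bh \<le> L'" "Lg \<le> L'" "Lh \<le> L'" "Bh \<le> L'" "Ld \<le> L'"
      using Lg(1) Lh(1) Ld(1) Bg(1) Bh(1) by (auto simp: L1_def)
    have st: "solution_tube F A \<gamma> T \<rho> L'" using ft[OF L'(1)] by (rule flow_tube.axioms(1))
    show "perturbed_tube F A \<gamma> T \<rho> L' ?k (cball \<theta>s 1) e0"
    proof (intro perturbed_tube.intro st perturbed_tube_axioms.intro e0(1,2))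
      fix t \<theta> \<epsilon> :: real and a :: plane
      assume t: "t \<in> {0..T}" and \<theta>: "\<theta> \<in> cball \<theta>s 1" and a: "norm a \<le> \<rho>" and \<epsilon>: "\<epsilon> \<in> {0..e0}"
      let ?s = "\<theta> + \<kappa> * t"
      note ka = in_K[OF t a] and k0 = in_K[OF t, of 0, simplified, OF less_imp_le[OF rho]] and r = in_R[OF t \<theta>]
      have \<epsilon>1: "0 \<le> \<epsilon>" "\<epsilon> \<le> 1" using \<epsilon> e0 by auto
      have \<epsilon>le: "\<epsilon> * c \<le> c" if "0 \<le> c" for c using \<epsilon>1 that by (simp add: mult_left_le_one_le)
      have Sd: "norm (S x - S y) = norm (x - y)" for x y
        by (simp add: linear_diff[OF S(1), symmetric] S(2))
      have S'd: "norm (S' x - S' y) = norm (x - y)" for x y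
        by (simp add: linear_diff[OF S'(1), symmetric] S'(2))
      show "norm (?k t \<theta> (\<gamma> t + a) \<epsilon>) \<le> L'"
      proof -
        have "norm (?k t \<theta> (\<gamma> t + a) \<epsilon>) \<le> Bg + \<epsilon> * Bh"
          unfolding S(2) using Bg(2)[of "(?s, S' (\<gamma> t + a))"] Bh(2)[of "(?s, S' (\<gamma> t + a), \<epsilon>)"] ka r \<epsilon>
          by (intro norm_triangle_le add_mono) (auto simp: C_def C'_def intro!: mult_left_mono)
        then show ?thesis using \<epsilon>le[of Bh] Bh(1) L'(4) by linarith
      qed
      show "norm (?k t \<theta> (\<gamma> t + a) \<epsilon> - ?k t \<theta> (\<gamma> t) 0) \<le> L' * (norm a + \<epsilon>)"
      proof -
        have "norm (G ?s (S' (\<gamma> t + a)) - G ?s (S' (\<gamma> t)) + \<epsilon> *\<^sub>R H ?s (S' (\<gamma> t + a)) \<epsilon>) \<le> Lg * norm a + \<epsilon> * Bh"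
          using gz[OF r ka k0] Bh(2)[of "(?s, S' (\<gamma> t + a), \<epsilon>)"] ka r \<epsilon>
          by (intro norm_triangle_le add_mono) (auto simp: C'_def S'd intro!: mult_left_mono)
        also have "\<dots> \<le> L' * norm a + \<epsilon> * L'" using L' \<epsilon>1 by (intro add_mono mult_left_mono mult_right_mono) auto
        finally show ?thesis by (simp add: Sd algebra_simps)
      qed
      fix b :: plane assume b: "norm b \<le> \<rho>"
      show "norm (?k t \<theta> (\<gamma> t + a) \<epsilon> - ?k t \<theta> (\<gamma> t + b) \<epsilon>) \<le> L' * norm (a - b)"
      proof -
        have "norm ((G ?s (S' (\<gamma> t + a)) - G ?s (S' (\<gamma> t + b))) + \<epsilon> *\<^sub>R (H ?s (S' (\<gamma> t + a)) \<epsilon> - H ?s (S' (\<gamma> t + b)) \<epsilon>))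
            \<le> Lg * norm (a - b) + \<epsilon> * (Lh * norm (a - b))"
          using gz[OF r ka in_K[OF t b]] hz[OF r ka in_K[OF t b] \<epsilon>] \<epsilon>1
          by (intro norm_triangle_le add_mono) (auto simp: S'd intro!: mult_left_mono)
        also have "\<dots> \<le> (Lg + Lh) * norm (a - b)" using \<epsilon>le[OF mult_nonneg_nonneg[OF Lh(1) norm_ge_zero[of "a - b"]]] unfolding distrib_right by linarith
        also have "\<dots> \<le> L' * norm (a - b)" using L' by (intro mult_right_mono) auto
        finally show ?thesis by (simp add: Sd algebra_simps)
      qed
    next
      fix t \<theta> \<theta>' \<epsilon> :: real and a :: plane
      assume t: "t \<in> {0..T}" and \<theta>: "\<theta> \<in> cball \<theta>s 1" and \<theta>': "\<theta>' \<in> cball \<theta>s 1" and a: "norm a \<le> \<rho>" and \<epsilon>: "\<epsilon> \<in> {0..e0}"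
      let ?s = "\<theta> + \<kappa> * t" and ?s' = "\<theta>' + \<kappa> * t"
      note ka = in_K[OF t a] and k0 = in_K[OF t, of 0, simplified, OF less_imp_le[OF rho]] and r = in_R[OF t \<theta>] and r' = in_R[OF t \<theta>']
      have \<epsilon>1: "0 \<le> \<epsilon>" "\<epsilon> \<le> 1" using \<epsilon> e0 by auto
      have \<epsilon>le: "\<epsilon> * c \<le> c" if "0 \<le> c" for c using \<epsilon>1 that by (simp add: mult_left_le_one_le)
      have S'd: "norm (S' x - S' y) = norm (x - y)" for x y
        by (simp add: linear_diff[OF S'(1), symmetric] S'(2))
      note Sl = linear_diff[OF S(1), symmetric] S(2)
      have h: "norm (\<epsilon> *\<^sub>R (H ?s (S' (\<gamma> t + a)) \<epsilon> - H ?s' (S' (\<gamma> t + a)) \<epsilon>)) \<le> \<epsilon> * (Lh * \<bar>\<theta> - \<theta>'\<bar>)"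
        using ht[OF r r' ka \<epsilon>] \<epsilon>1 by (auto intro!: mult_left_mono)
      show "norm (?k t \<theta> (\<gamma> t + a) \<epsilon> - ?k t \<theta>' (\<gamma> t + a) \<epsilon>) \<le> L' * \<bar>\<theta> - \<theta>'\<bar>"
      proof -
        have "norm ((G ?s (S' (\<gamma> t + a)) - G ?s' (S' (\<gamma> t + a))) + \<epsilon> *\<^sub>R (H ?s (S' (\<gamma> t + a)) \<epsilon> - H ?s' (S' (\<gamma> t + a)) \<epsilon>))
            \<le> Lg * \<bar>\<theta> - \<theta>'\<bar> + \<epsilon> * (Lh * \<bar>\<theta> - \<theta>'\<bar>)"
          using gt[OF r r' ka] by (intro norm_triangle_le add_mono h) simp
        also have "\<dots> \<le> (Lg + Lh) * \<bar>\<theta> - \<theta>'\<bar>" using \<epsilon>le[OF mult_nonneg_nonneg[OF Lh(1) abs_ge_zero[of "\<theta> - \<theta>'"]]] unfolding distrib_right by linarith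
        also have "\<dots> \<le> L' * \<bar>\<theta> - \<theta>'\<bar>" using L' by (intro mult_right_mono) auto
        finally show ?thesis by (simp add: Sl algebra_simps)
      qed
      show "norm (?k t \<theta> (\<gamma> t + a) \<epsilon> - ?k t \<theta>' (\<gamma> t + a) \<epsilon> - (?k t \<theta> (\<gamma> t) 0 - ?k t \<theta>' (\<gamma> t) 0))
          \<le> L' * (norm a + \<epsilon>) * \<bar>\<theta> - \<theta>'\<bar>"
      proof -
        have "norm ((G ?s (S' (\<gamma> t + a)) - G ?s' (S' (\<gamma> t + a)) - (G ?s (S' (\<gamma> t)) - G ?s' (S' (\<gamma> t))))
              + \<epsilon> *\<^sub>R (H ?s (S' (\<gamma> t + a)) \<epsilon> - H ?s' (S' (\<gamma> t + a)) \<epsilon>))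
            \<le> Ld * norm a * \<bar>\<theta> - \<theta>'\<bar> + \<epsilon> * (Lh * \<bar>\<theta> - \<theta>'\<bar>)"
          using gm[OF r r' ka k0] by (intro norm_triangle_le add_mono h) (simp add: S'd)
        also have "\<dots> \<le> L' * norm a * \<bar>\<theta> - \<theta>'\<bar> + \<epsilon> * (L' * \<bar>\<theta> - \<theta>'\<bar>)"
          using L' \<epsilon>1 by (intro add_mono mult_left_mono mult_right_mono) auto
        finally show ?thesis by (simp add: Sl algebra_simps)
      qed
    next
      fix \<theta> \<epsilon> assume \<theta>: "\<theta> \<in> cball \<theta>s 1" and \<epsilon>: "\<epsilon> \<in> {0..e0}"
      have 1: "continuous_on ({0..T} \<times> cball 0 \<rho>) (\<lambda>p. S' (\<gamma> (fst p) + snd p))"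
        by (intro continuous_on_compose2[OF S'_cont] continuous_intros continuous_on_compose2[OF cont_\<gamma>, of _ fst]) auto
      have 2: "S' (\<gamma> (fst p) + snd p) \<in> D" if "p \<in> {0..T} \<times> cball 0 \<rho>" for p
        using that in_K[of "fst p" "snd p"] K by auto
      have "continuous_on ({0..T} \<times> cball 0 \<rho>) (\<lambda>p. ?g (\<theta> + \<kappa> * fst p, S' (\<gamma> (fst p) + snd p)))"
        by (rule continuous_on_compose2[OF g0]) (use 2 in \<open>auto intro!: continuous_intros 1\<close>)
      moreover have "continuous_on ({0..T} \<times> cball 0 \<rho>) (\<lambda>p. ?h (\<theta> + \<kappa> * fst p, S' (\<gamma> (fst p) + snd p), \<epsilon>))"
        by (rule continuous_on_compose2[OF h0]) (use 2 \<epsilon> e0 in \<open>auto intro!: continuous_intros 1\<close>)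
      ultimately show "continuous_on ({0..T} \<times> cball 0 \<rho>) (\<lambda>(t, a). ?k t \<theta> (\<gamma> t + a) \<epsilon>)"
        unfolding case_prod_unfold
        by (intro continuous_on_compose2[OF S_cont[of UNIV]] continuous_intros) auto
    qed
  qed
qed

section \<open>The bifurcation equations\<close>

text \<open>A single constant bounds the size, which keeps the Newton step inside its domain, and
  the Lipschitz constant, which makes it contract; in the application both are of order
  \<epsilon>.\<close>

definition small_remainder :: "real \<Rightarrow> real \<Rightarrow> real \<Rightarrow> (real \<Rightarrow> real \<Rightarrow> real \<Rightarrow> real) \<Rightarrow> bool" where
  "small_remainder B \<theta>s c e \<longleftrightarrow>
     (\<forall>s \<xi> \<theta>. \<bar>s\<bar> \<le> B \<and> \<bar>\<xi>\<bar> \<le> B \<and> \<bar>\<theta> - \<theta>s\<bar> \<le> 1 \<longrightarrow> \<bar>e s \<xi> \<theta>\<bar> \<le> c) \<and>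
     (\<forall>s \<xi> \<theta> s' \<xi>' \<theta>'. \<bar>s\<bar> \<le> B \<and> \<bar>\<xi>\<bar> \<le> B \<and> \<bar>\<theta> - \<theta>s\<bar> \<le> 1 \<and> \<bar>s'\<bar> \<le> B \<and> \<bar>\<xi>'\<bar> \<le> B \<and> \<bar>\<theta>' - \<theta>s\<bar> \<le> 1 \<longrightarrow>
        \<bar>e s \<xi> \<theta> - e s' \<xi>' \<theta>'\<bar> \<le> c * (\<bar>s - s'\<bar> + \<bar>\<xi> - \<xi>'\<bar> + \<bar>\<theta> - \<theta>'\<bar>))"

lemma small_remainderD:
  assumes "small_remainder B \<theta>s c e" "\<bar>s\<bar> \<le> B" "\<bar>\<xi>\<bar> \<le> B" "\<bar>\<theta> - \<theta>s\<bar> \<le> 1"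
  shows "\<bar>e s \<xi> \<theta>\<bar> \<le> c"
    and "\<bar>s'\<bar> \<le> B \<Longrightarrow> \<bar>\<xi>'\<bar> \<le> B \<Longrightarrow> \<bar>\<theta>' - \<theta>s\<bar> \<le> 1 \<Longrightarrow>
      \<bar>e s \<xi> \<theta> - e s' \<xi>' \<theta>'\<bar> \<le> c * (\<bar>s - s'\<bar> + \<bar>\<xi> - \<xi>'\<bar> + \<bar>\<theta> - \<theta>'\<bar>)"
  using assms unfolding small_remainder_def by simp_all

lemma abs_le_dist3:
  fixes p q \<theta> :: real
  shows "dist (p, q, \<theta>) (p', q', \<theta>') \<le> \<bar>p - p'\<bar> + \<bar>q - q'\<bar> + \<bar>\<theta> - \<theta>'\<bar>"
    and "\<bar>p - p'\<bar> + \<bar>q - q'\<bar> + \<bar>\<theta> - \<theta>'\<bar> \<le> 3 * dist (p, q, \<theta>) (p', q', \<theta>')"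
proof -
  let ?u = "(p - p', q - q', \<theta> - \<theta>')"
  have d: "dist (p, q, \<theta>) (p', q', \<theta>') = norm ?u" by (simp add: dist_norm)
  show "dist (p, q, \<theta>) (p', q', \<theta>') \<le> \<bar>p - p'\<bar> + \<bar>q - q'\<bar> + \<bar>\<theta> - \<theta>'\<bar>"
    using norm_Pair3_le[of "p - p'" "q - q'" "\<theta> - \<theta>'"] d by simp
  have "\<bar>p - p'\<bar> \<le> norm ?u" "norm (q - q', \<theta> - \<theta>') \<le> norm ?u"
    using norm_fst_le[of "p - p'" "(q - q', \<theta> - \<theta>')"] norm_snd_le[of "(q - q', \<theta> - \<theta>')" "p - p'"] by auto
  moreover have "\<bar>q - q'\<bar> \<le> norm (q - q', \<theta> - \<theta>')" "\<bar>\<theta> - \<theta>'\<bar> \<le> norm (q - q', \<theta> - \<theta>')"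
    using norm_fst_le[of "q - q'" "\<theta> - \<theta>'"] norm_snd_le[of "\<theta> - \<theta>'" "q - q'"] by auto
  ultimately show "\<bar>p - p'\<bar> + \<bar>q - q'\<bar> + \<bar>\<theta> - \<theta>'\<bar> \<le> 3 * dist (p, q, \<theta>) (p', q', \<theta>')"
    unfolding d by linarith
qed

text \<open>In the unknowns \<open>p = s + \<alpha> \<theta> / c1\<close> and \<open>q = \<xi> + \<beta> \<theta> / c2\<close> the unperturbed system is diagonal,
  and a simplified Newton step is a contraction.\<close>

lemma perturbed_system:
  fixes \<alpha> \<beta> M :: "real \<Rightarrow> real" and c1 c2 M' \<Lambda> \<theta>s d0 :: real
  assumes c: "c1 \<noteq> 0" "c2 \<noteq> 0" "M' \<noteq> 0" and \<Lambda>: "0 \<le> \<Lambda>"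
    and \<alpha>: "\<And>\<theta> \<theta>'. \<bar>\<theta> - \<theta>s\<bar> \<le> 1 \<Longrightarrow> \<bar>\<theta>' - \<theta>s\<bar> \<le> 1 \<Longrightarrow> \<bar>\<alpha> \<theta> - \<alpha> \<theta>'\<bar> \<le> \<Lambda> * \<bar>\<theta> - \<theta>'\<bar>"
    and \<beta>: "\<And>\<theta> \<theta>'. \<bar>\<theta> - \<theta>s\<bar> \<le> 1 \<Longrightarrow> \<bar>\<theta>' - \<theta>s\<bar> \<le> 1 \<Longrightarrow> \<bar>\<beta> \<theta> - \<beta> \<theta>'\<bar> \<le> \<Lambda> * \<bar>\<theta> - \<theta>'\<bar>"
    and M0: "M \<theta>s = 0" and d0: "0 < d0"
    and M': "\<And>\<theta> \<theta>'. \<bar>\<theta> - \<theta>s\<bar> \<le> d0 \<Longrightarrow> \<bar>\<theta>' - \<theta>s\<bar> \<le> d0 \<Longrightarrow>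
        \<bar>M \<theta> - M \<theta>' - M' * (\<theta> - \<theta>')\<bar> \<le> \<bar>M'\<bar> / 12 * \<bar>\<theta> - \<theta>'\<bar>"
  obtains B c0 C where "0 \<le> B" "0 < c0" "0 \<le> C"
    "\<And>c e1 e2 e3. 0 \<le> c \<Longrightarrow> c \<le> c0 \<Longrightarrow> small_remainder B \<theta>s c e1 \<Longrightarrow> small_remainder B \<theta>s c e2 \<Longrightarrow>
      small_remainder B \<theta>s c e3 \<Longrightarrow>
      \<exists>s \<xi> \<theta>. \<bar>s\<bar> \<le> B \<and> \<bar>\<xi>\<bar> \<le> B \<and> \<bar>\<theta> - \<theta>s\<bar> \<le> 1 \<and> \<bar>\<theta> - \<theta>s\<bar> \<le> C * c \<and>
        c1 * s + \<alpha> \<theta> + e1 s \<xi> \<theta> = 0 \<and> c2 * \<xi> + \<beta> \<theta> + e2 s \<xi> \<theta> = 0 \<and> M \<theta> + e3 s \<xi> \<theta> = 0 \<and>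
        (\<exists>r>0. \<forall>s' \<xi>' \<theta>'. \<bar>s' - s\<bar> < r \<and> \<bar>\<xi>' - \<xi>\<bar> < r \<and> \<bar>\<theta>' - \<theta>\<bar> < r \<longrightarrow>
           \<bar>s'\<bar> \<le> B \<and> \<bar>\<xi>'\<bar> \<le> B \<and> \<bar>\<theta>' - \<theta>s\<bar> \<le> 1 \<and>
           (c1 * s' + \<alpha> \<theta>' + e1 s' \<xi>' \<theta>' = 0 \<and> c2 * \<xi>' + \<beta> \<theta>' + e2 s' \<xi>' \<theta>' = 0 \<and> M \<theta>' + e3 s' \<xi>' \<theta>' = 0 \<longrightarrow>
             s' = s \<and> \<xi>' = \<xi> \<and> \<theta>' = \<theta>))"
proof -
  define d where "d = min d0 1"
  have d: "0 < d" "d \<le> 1" "d \<le> d0" using d0 by (auto simp: d_def)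
  \<comment> \<open>An upper bound for \<open>s\<close> and \<xi> when the new unknowns
    \<open>p\<close>, \<open>q\<close> are at most 1 in modulus and \<theta> is within 1 of
    \<open>\<theta>s\<close>.\<close>
  define B where "B = (\<bar>\<alpha> \<theta>s\<bar> + \<Lambda>) / \<bar>c1\<bar> + (\<bar>\<beta> \<theta>s\<bar> + \<Lambda>) / \<bar>c2\<bar> + 1"
  \<comment> \<open>Bounds the inverses of the three pivots \<open>c1\<close>, \<open>c2\<close>,
    \<open>M'\<close>. Below, \<open>P\<close> is a Lipschitz constant of the change of
    unknowns.\<close>
  define A where "A = 1 / \<bar>c1\<bar> + 1 / \<bar>c2\<bar> + 1 / \<bar>M'\<bar>"
  define P where "P = 1 + \<Lambda> / \<bar>c1\<bar> + \<Lambda> / \<bar>c2\<bar>"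
  have A: "0 < A" "1 / \<bar>c1\<bar> \<le> A" "1 / \<bar>c2\<bar> \<le> A" "1 / \<bar>M'\<bar> \<le> A" using c by (auto simp: A_def intro!: add_pos_pos)
  have P: "1 \<le> P" using \<Lambda> by (simp add: P_def)
  \<comment> \<open>The first bound makes the remainders contribute at most 1/12 to the contraction
    constant; the second limits the displacement they cause to \<open>d / 4\<close>, so that the
    step maps the box \<open>U\<close> into itself.\<close>
  define c0 where "c0 = min (1 / (12 * P * A)) (d / (4 * A))"
  have c0: "0 < c0" using A P d by (simp add: c0_def)
  show thesis
  proof (rule that[of B c0 "2 * A"])
    show "0 \<le> B" using \<Lambda> by (simp add: B_def)
    show "0 < c0" "0 \<le> 2 * A" using c0 A by auto
    fix cc e1 e2 e3
    assume cc: "0 \<le> cc" "cc \<le> c0" and e1: "small_remainder B \<theta>s cc e1" and e2: "small_remainder B \<theta>s cc e2"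
      and e3: "small_remainder B \<theta>s cc e3"
    have ccPA: "cc * P * A \<le> 1 / 12" "cc * A \<le> d / 4"
      using cc(2) A P by (auto simp: c0_def field_simps)
    have ccA: "cc * A \<le> 1 / 4" using ccPA(2) d by simp
    define sf where "sf p \<theta> = p - \<alpha> \<theta> / c1" for p \<theta>
    define xf where "xf q \<theta> = q - \<beta> \<theta> / c2" for q \<theta>
    have sfB: "\<bar>sf p \<theta>\<bar> \<le> B" if "\<bar>p\<bar> \<le> 1" "\<bar>\<theta> - \<theta>s\<bar> \<le> 1" for p \<theta>
    proof -
      have "\<bar>\<alpha> \<theta>\<bar> \<le> \<bar>\<alpha> \<theta>s\<bar> + \<Lambda>" using \<alpha>[of \<theta> \<theta>s] that \<Lambda> mult_left_mono[OF that(2) \<Lambda>] by auto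
      then have "\<bar>\<alpha> \<theta> / c1\<bar> \<le> (\<bar>\<alpha> \<theta>s\<bar> + \<Lambda>) / \<bar>c1\<bar>" by (simp add: divide_right_mono)
      moreover have "0 \<le> (\<bar>\<beta> \<theta>s\<bar> + \<Lambda>) / \<bar>c2\<bar>" using \<Lambda> by simp
      ultimately show ?thesis using that unfolding sf_def B_def by linarith
    qed
    have xfB: "\<bar>xf p \<theta>\<bar> \<le> B" if "\<bar>p\<bar> \<le> 1" "\<bar>\<theta> - \<theta>s\<bar> \<le> 1" for p \<theta>
    proof -
      have "\<bar>\<beta> \<theta>\<bar> \<le> \<bar>\<beta> \<theta>s\<bar> + \<Lambda>" using \<beta>[of \<theta> \<theta>s] that \<Lambda> mult_left_mono[OF that(2) \<Lambda>] by auto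
      then have "\<bar>\<beta> \<theta> / c2\<bar> \<le> (\<bar>\<beta> \<theta>s\<bar> + \<Lambda>) / \<bar>c2\<bar>" by (simp add: divide_right_mono)
      moreover have "0 \<le> (\<bar>\<alpha> \<theta>s\<bar> + \<Lambda>) / \<bar>c1\<bar>" using \<Lambda> by simp
      ultimately show ?thesis using that unfolding xf_def B_def by linarith
    qed
    define E where "E e p q \<theta> = e (sf p \<theta>) (xf q \<theta>) \<theta>" for e :: "real \<Rightarrow> real \<Rightarrow> real \<Rightarrow> real" and p q \<theta>
    have E_bound: "\<bar>E e p q \<theta>\<bar> \<le> cc" if "small_remainder B \<theta>s cc e" "\<bar>p\<bar> \<le> 1" "\<bar>q\<bar> \<le> 1" "\<bar>\<theta> - \<theta>s\<bar> \<le> 1" for e p q \<theta>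
      unfolding E_def by (rule small_remainderD(1)[OF that(1) sfB[OF that(2,4)] xfB[OF that(3,4)] that(4)])
    have E_lip: "\<bar>E e p q \<theta> - E e p' q' \<theta>'\<bar> \<le> cc * P * (\<bar>p - p'\<bar> + \<bar>q - q'\<bar> + \<bar>\<theta> - \<theta>'\<bar>)"
      if e: "small_remainder B \<theta>s cc e" and 1: "\<bar>p\<bar> \<le> 1" "\<bar>q\<bar> \<le> 1" "\<bar>\<theta> - \<theta>s\<bar> \<le> 1" and 2: "\<bar>p'\<bar> \<le> 1" "\<bar>q'\<bar> \<le> 1" "\<bar>\<theta>' - \<theta>s\<bar> \<le> 1"
      for e p q \<theta> p' q' \<theta>'
    proof -
      have "\<bar>E e p q \<theta> - E e p' q' \<theta>'\<bar> \<le> cc * (\<bar>sf p \<theta> - sf p' \<theta>'\<bar> + \<bar>xf q \<theta> - xf q' \<theta>'\<bar> + \<bar>\<theta> - \<theta>'\<bar>)"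
        unfolding E_def
        by (rule small_remainderD(2)[OF e sfB[OF 1(1,3)] xfB[OF 1(2,3)] 1(3) sfB[OF 2(1,3)] xfB[OF 2(2,3)] 2(3)])
      also have "\<dots> \<le> cc * (P * (\<bar>p - p'\<bar> + \<bar>q - q'\<bar> + \<bar>\<theta> - \<theta>'\<bar>))"
      proof (rule mult_left_mono[OF _ cc(1)])
        have a: "\<bar>sf p \<theta> - sf p' \<theta>'\<bar> \<le> \<bar>p - p'\<bar> + \<Lambda> / \<bar>c1\<bar> * \<bar>\<theta> - \<theta>'\<bar>"
        proof -
          have "\<bar>(\<alpha> \<theta> - \<alpha> \<theta>') / c1\<bar> \<le> \<Lambda> / \<bar>c1\<bar> * \<bar>\<theta> - \<theta>'\<bar>"
            using \<alpha>[OF 1(3) 2(3)] c by (simp add: divide_right_mono)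
          then show ?thesis unfolding sf_def diff_divide_distrib by linarith
        qed
        have b: "\<bar>xf q \<theta> - xf q' \<theta>'\<bar> \<le> \<bar>q - q'\<bar> + \<Lambda> / \<bar>c2\<bar> * \<bar>\<theta> - \<theta>'\<bar>"
        proof -
          have "\<bar>(\<beta> \<theta> - \<beta> \<theta>') / c2\<bar> \<le> \<Lambda> / \<bar>c2\<bar> * \<bar>\<theta> - \<theta>'\<bar>"
            using \<beta>[OF 1(3) 2(3)] c by (simp add: divide_right_mono)
          then show ?thesis unfolding xf_def diff_divide_distrib by linarith
        qed
        have "1 * (\<bar>p - p'\<bar> + \<bar>q - q'\<bar>) \<le> P * (\<bar>p - p'\<bar> + \<bar>q - q'\<bar>)" using P by (intro mult_right_mono) auto
        with a b show "\<bar>sf p \<theta> - sf p' \<theta>'\<bar> + \<bar>xf q \<theta> - xf q' \<theta>'\<bar> + \<bar>\<theta> - \<theta>'\<bar> \<le> P * (\<bar>p - p'\<bar> + \<bar>q - q'\<bar> + \<bar>\<theta> - \<theta>'\<bar>)"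
          by (simp add: P_def algebra_simps)
      qed
      finally show ?thesis by (simp add: mult.assoc)
    qed
    \<comment> \<open>The Newton step with the fixed slopes \<open>c1\<close>, \<open>c2\<close>,
      \<open>M'\<close>: its fixed points are exactly the solutions, and the remainders enter
      through their values only.\<close>
    define N where "N u = (case u of (p, q, \<theta>) \<Rightarrow>
       (- E e1 p q \<theta> / c1, - E e2 p q \<theta> / c2, \<theta> - (M \<theta> + E e3 p q \<theta>) / M'))" for u
    define U where "U = {-1..1::real} \<times> {-1..1::real} \<times> {\<theta>s - d..\<theta>s + d}"
    have U: "(p, q, \<theta>) \<in> U \<longleftrightarrow> \<bar>p\<bar> \<le> 1 \<and> \<bar>q\<bar> \<le> 1 \<and> \<bar>\<theta> - \<theta>s\<bar> \<le> d" for p q \<theta>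
      by (auto simp: U_def)
    have fix_iff: "N (p, q, \<theta>) = (p, q, \<theta>) \<longleftrightarrow> c1 * sf p \<theta> + \<alpha> \<theta> + e1 (sf p \<theta>) (xf q \<theta>) \<theta> = 0 \<and>
        c2 * xf q \<theta> + \<beta> \<theta> + e2 (sf p \<theta>) (xf q \<theta>) \<theta> = 0 \<and> M \<theta> + e3 (sf p \<theta>) (xf q \<theta>) \<theta> = 0" for p q \<theta>
      using c by (auto simp: N_def E_def sf_def xf_def field_simps)
    have M1: "\<bar>(\<theta> - M \<theta> / M') - (\<theta>' - M \<theta>' / M')\<bar> \<le> 1 / 12 * \<bar>\<theta> - \<theta>'\<bar>"
      if "\<bar>\<theta> - \<theta>s\<bar> \<le> d" "\<bar>\<theta>' - \<theta>s\<bar> \<le> d" for \<theta> \<theta>'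
    proof -
      have "(\<theta> - M \<theta> / M') - (\<theta>' - M \<theta>' / M') = - (M \<theta> - M \<theta>' - M' * (\<theta> - \<theta>')) / M'"
        using c by (simp add: field_simps)
      also have "\<bar>\<dots>\<bar> \<le> (\<bar>M'\<bar> / 12 * \<bar>\<theta> - \<theta>'\<bar>) / \<bar>M'\<bar>"
        using M'[of \<theta> \<theta>'] that d unfolding abs_divide abs_minus_cancel by (intro divide_right_mono) auto
      finally show ?thesis using c by simp
    qed
    have e_over: "\<bar>x / c1\<bar> \<le> y * (1 / \<bar>c1\<bar>)" "\<bar>x / c2\<bar> \<le> y * (1 / \<bar>c2\<bar>)" "\<bar>x / M'\<bar> \<le> y * (1 / \<bar>M'\<bar>)" if "\<bar>x\<bar> \<le> y" for x y
      using that by (auto simp: divide_right_mono)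
    have N3: "\<bar>\<theta> - (M \<theta> + E e3 p q \<theta>) / M' - \<theta>s\<bar> \<le> 1 / 12 * \<bar>\<theta> - \<theta>s\<bar> + cc * A" if "(p, q, \<theta>) \<in> U" for p q \<theta>
    proof -
      have u: "\<bar>p\<bar> \<le> 1" "\<bar>q\<bar> \<le> 1" "\<bar>\<theta> - \<theta>s\<bar> \<le> d" using that by (auto simp: U)
      have "\<bar>E e3 p q \<theta> / M'\<bar> \<le> cc * (1 / \<bar>M'\<bar>)"
        using u d by (intro e_over E_bound[OF e3]) auto
      also have "\<dots> \<le> cc * A" using A cc by (intro mult_left_mono) auto
      finally have "\<bar>E e3 p q \<theta> / M'\<bar> \<le> cc * A" .
      moreover have "\<bar>\<theta> - M \<theta> / M' - \<theta>s\<bar> \<le> 1 / 12 * \<bar>\<theta> - \<theta>s\<bar>"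
        using M1[of \<theta> \<theta>s] u d M0 by simp
      ultimately show ?thesis unfolding add_divide_distrib by linarith
    qed
    have maps: "N u \<in> U" if "u \<in> U" for u
    proof -
      obtain p q \<theta> where u: "u = (p, q, \<theta>)" by (cases u)
      with that have pq: "\<bar>p\<bar> \<le> 1" "\<bar>q\<bar> \<le> 1" "\<bar>\<theta> - \<theta>s\<bar> \<le> d" by (auto simp: U)
      have "\<bar>- E e1 p q \<theta> / c1\<bar> \<le> cc * (1 / \<bar>c1\<bar>)" "\<bar>- E e2 p q \<theta> / c2\<bar> \<le> cc * (1 / \<bar>c2\<bar>)"
        using E_bound[OF e1, of p q \<theta>] E_bound[OF e2, of p q \<theta>] pq d
        by (auto intro!: e_over simp del: times_divide_eq_right abs_divide divide_minus_left mult_1_right)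
      moreover have "cc * (1 / \<bar>c1\<bar>) \<le> cc * A" "cc * (1 / \<bar>c2\<bar>) \<le> cc * A"
        using A cc by (auto intro!: mult_left_mono simp del: times_divide_eq_right)
      moreover have "1 / 12 * \<bar>\<theta> - \<theta>s\<bar> + cc * A \<le> d" using pq(3) ccPA(2) d(1) by (simp add: field_simps)
      ultimately show ?thesis
        using N3[of p q \<theta>] that ccA unfolding u N_def by (auto simp: U simp del: times_divide_eq_right)
    qed
    \<comment> \<open>In the sum norm, \<open>M\<close> and the remainders contribute 1/12 each;
      passing to \<open>dist\<close> costs a factor 3, and 3 * (1/12 + 1/12) = 1/2. This is the
      origin of the constant 12.\<close>
    have contr: "dist (N u) (N v) \<le> 1 / 2 * dist u v" if uU: "u \<in> U" and vU: "v \<in> U" for u v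
    proof -
      obtain p q \<theta> p' q' \<theta>' where uv: "u = (p, q, \<theta>)" "v = (p', q', \<theta>')" by (cases u, cases v)
      have 1: "\<bar>p\<bar> \<le> 1" "\<bar>q\<bar> \<le> 1" "\<bar>\<theta> - \<theta>s\<bar> \<le> d" and 2: "\<bar>p'\<bar> \<le> 1" "\<bar>q'\<bar> \<le> 1" "\<bar>\<theta>' - \<theta>s\<bar> \<le> d"
        using uU vU uv by (auto simp: U)
      define \<delta> where "\<delta> = \<bar>p - p'\<bar> + \<bar>q - q'\<bar> + \<bar>\<theta> - \<theta>'\<bar>"
      have \<delta>: "0 \<le> \<delta>" "\<bar>\<theta> - \<theta>'\<bar> \<le> \<delta>" "\<delta> \<le> 3 * dist u v"
        using abs_le_dist3(2)[of p p' q q' \<theta> \<theta>'] by (auto simp: \<delta>_def uv)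
      have L: "\<bar>E e p q \<theta> - E e p' q' \<theta>'\<bar> \<le> cc * P * \<delta>" if "small_remainder B \<theta>s cc e" for e
        unfolding \<delta>_def using 1 2 d by (intro E_lip[OF that]) auto
      have d1: "\<bar>- E e1 p q \<theta> / c1 - - E e1 p' q' \<theta>' / c1\<bar> \<le> cc * P * \<delta> * (1 / \<bar>c1\<bar>)"
        using e_over(1)[OF L[OF e1]] by (simp add: diff_divide_distrib[symmetric] abs_minus_commute)
      have d2: "\<bar>- E e2 p q \<theta> / c2 - - E e2 p' q' \<theta>' / c2\<bar> \<le> cc * P * \<delta> * (1 / \<bar>c2\<bar>)"
        using e_over(2)[OF L[OF e2]] by (simp add: diff_divide_distrib[symmetric] abs_minus_commute)
      have d3: "\<bar>(\<theta> - (M \<theta> + E e3 p q \<theta>) / M') - (\<theta>' - (M \<theta>' + E e3 p' q' \<theta>') / M')\<bar> \<le> 1 / 12 * \<delta> + cc * P * \<delta> * (1 / \<bar>M'\<bar>)"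
      proof -
        have eq: "(\<theta> - (M \<theta> + E e3 p q \<theta>) / M') - (\<theta>' - (M \<theta>' + E e3 p' q' \<theta>') / M')
            = ((\<theta> - M \<theta> / M') - (\<theta>' - M \<theta>' / M')) - (E e3 p q \<theta> - E e3 p' q' \<theta>') / M'"
          by (simp add: add_divide_distrib diff_divide_distrib)
        have "1 / 12 * \<bar>\<theta> - \<theta>'\<bar> \<le> 1 / 12 * \<delta>" using \<delta>(2) by simp
        then show ?thesis
          unfolding eq by (intro order_trans[OF abs_triangle_ineq4] add_mono e_over(3)[OF L[OF e3]] order_trans[OF M1[OF 1(3) 2(3)]])
      qed
      have "dist (N u) (N v) \<le> cc * P * \<delta> * (1 / \<bar>c1\<bar>) + cc * P * \<delta> * (1 / \<bar>c2\<bar>) + (1 / 12 * \<delta> + cc * P * \<delta> * (1 / \<bar>M'\<bar>))"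
        unfolding uv N_def prod.case using d1 d2 d3 by (intro order_trans[OF abs_le_dist3(1)] add_mono)
      also have "\<dots> = (cc * P * A) * \<delta> + 1 / 12 * \<delta>" by (simp add: A_def algebra_simps)
      also have "\<dots> \<le> 1 / 12 * \<delta> + 1 / 12 * \<delta>" using ccPA(1) \<delta>(1) by (intro add_right_mono mult_right_mono)
      also have "\<dots> \<le> 1 / 2 * dist u v" using \<delta>(3) by simp
      finally show ?thesis .
    qed
    have "\<exists>!u. u \<in> U \<and> N u = u"
    proof (rule Banach_fix[of U "1 / 2" N])
      show "complete U" unfolding U_def by (intro compact_imp_complete compact_Times) auto
      have "(0, 0, \<theta>s) \<in> U" using d by (simp add: U)
      then show "U \<noteq> {}" by blast
    qed (use maps contr in auto)
    then obtain u where uU: "u \<in> U" and Nu: "N u = u" and uniq: "\<And>v. v \<in> U \<Longrightarrow> N v = v \<Longrightarrow> v = u" by blast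
    obtain p q \<theta> where u: "u = (p, q, \<theta>)" by (cases u)
    have pq: "\<bar>p\<bar> \<le> 1" "\<bar>q\<bar> \<le> 1" "\<bar>\<theta> - \<theta>s\<bar> \<le> d" using uU by (auto simp: u U)
    have p_eq: "p = - E e1 p q \<theta> / c1" and q_eq: "q = - E e2 p q \<theta> / c2" and \<theta>_eq: "\<theta> = \<theta> - (M \<theta> + E e3 p q \<theta>) / M'"
      using Nu unfolding u N_def prod.case by (simp_all only: prod.inject)
    have "\<bar>p\<bar> \<le> cc * (1 / \<bar>c1\<bar>)" "\<bar>q\<bar> \<le> cc * (1 / \<bar>c2\<bar>)"
    proof -
      have "\<bar>- E e1 p q \<theta>\<bar> \<le> cc" "\<bar>- E e2 p q \<theta>\<bar> \<le> cc"
        using E_bound[OF e1, of p q \<theta>] E_bound[OF e2, of p q \<theta>] pq d by auto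
      from e_over(1)[OF this(1)] e_over(2)[OF this(2)]
      show "\<bar>p\<bar> \<le> cc * (1 / \<bar>c1\<bar>)" "\<bar>q\<bar> \<le> cc * (1 / \<bar>c2\<bar>)"
        unfolding p_eq[symmetric] q_eq[symmetric] .
    qed
    moreover have "cc * (1 / \<bar>c1\<bar>) \<le> cc * A" "cc * (1 / \<bar>c2\<bar>) \<le> cc * A"
      using A cc by (auto intro!: mult_left_mono simp del: times_divide_eq_right)
    ultimately have small: "\<bar>p\<bar> \<le> 1 / 4" "\<bar>q\<bar> \<le> 1 / 4" using ccA by linarith+
    \<comment> \<open>At the fixed point the bound \<open>N3\<close> contains the distance on both
      sides and is solved for it. This gives the closeness of order \<epsilon> of the phase.\<close>
    have \<theta>_close: "\<bar>\<theta> - \<theta>s\<bar> \<le> 12 / 11 * (cc * A)"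
      using N3[OF uU[unfolded u]] unfolding \<theta>_eq[symmetric] by (simp add: field_simps)
    then have \<theta>_close': "\<bar>\<theta> - \<theta>s\<bar> \<le> 2 * A * cc" "\<bar>\<theta> - \<theta>s\<bar> \<le> 3 / 11 * d"
    proof -
      have "0 \<le> cc * A" using cc A by simp
      with \<theta>_close have "\<bar>\<theta> - \<theta>s\<bar> \<le> 2 * (cc * A)" by simp
      then show "\<bar>\<theta> - \<theta>s\<bar> \<le> 2 * A * cc" by (simp add: mult_ac)
      show "\<bar>\<theta> - \<theta>s\<bar> \<le> 3 / 11 * d" using \<theta>_close ccPA(2) by simp
    qed
    \<comment> \<open>The solution has \<open>p\<close> and \<open>q\<close> at most 1/4 in modulus
      and \<theta> within \<open>3 / 11 * d\<close> of \<open>\<theta>s\<close>, so it lies well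
      inside \<open>U\<close>. Points of the original unknowns within \<open>r\<close> of it still
      correspond to points of \<open>U\<close>, where the fixed point is unique.\<close>
    define r where "r = min (d / 2) (1 / (2 * P))"
    have r: "0 < r" using d P by (simp add: r_def)
    have rP: "r * P \<le> 1 / 2" using P by (simp add: r_def min_def field_simps)
    show "\<exists>s \<xi> \<theta>. \<bar>s\<bar> \<le> B \<and> \<bar>\<xi>\<bar> \<le> B \<and> \<bar>\<theta> - \<theta>s\<bar> \<le> 1 \<and> \<bar>\<theta> - \<theta>s\<bar> \<le> 2 * A * cc \<and>
        c1 * s + \<alpha> \<theta> + e1 s \<xi> \<theta> = 0 \<and> c2 * \<xi> + \<beta> \<theta> + e2 s \<xi> \<theta> = 0 \<and> M \<theta> + e3 s \<xi> \<theta> = 0 \<and>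
        (\<exists>r>0. \<forall>s' \<xi>' \<theta>'. \<bar>s' - s\<bar> < r \<and> \<bar>\<xi>' - \<xi>\<bar> < r \<and> \<bar>\<theta>' - \<theta>\<bar> < r \<longrightarrow>
           \<bar>s'\<bar> \<le> B \<and> \<bar>\<xi>'\<bar> \<le> B \<and> \<bar>\<theta>' - \<theta>s\<bar> \<le> 1 \<and>
           (c1 * s' + \<alpha> \<theta>' + e1 s' \<xi>' \<theta>' = 0 \<and> c2 * \<xi>' + \<beta> \<theta>' + e2 s' \<xi>' \<theta>' = 0 \<and> M \<theta>' + e3 s' \<xi>' \<theta>' = 0 \<longrightarrow>
             s' = s \<and> \<xi>' = \<xi> \<and> \<theta>' = \<theta>))"
    proof (rule exI[of _ "sf p \<theta>"], rule exI[of _ "xf q \<theta>"], rule exI[of _ \<theta>], intro conjI exI[of _ r] r allI impI)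
      show "\<bar>sf p \<theta>\<bar> \<le> B" "\<bar>xf q \<theta>\<bar> \<le> B" "\<bar>\<theta> - \<theta>s\<bar> \<le> 1" "\<bar>\<theta> - \<theta>s\<bar> \<le> 2 * A * cc"
        using sfB[OF pq(1)] xfB[OF pq(2)] pq(3) d(2) \<theta>_close'(1) by simp_all
      show "c1 * sf p \<theta> + \<alpha> \<theta> + e1 (sf p \<theta>) (xf q \<theta>) \<theta> = 0" "c2 * xf q \<theta> + \<beta> \<theta> + e2 (sf p \<theta>) (xf q \<theta>) \<theta> = 0"
        "M \<theta> + e3 (sf p \<theta>) (xf q \<theta>) \<theta> = 0"
        using Nu fix_iff[of p q \<theta>] by (auto simp: u)
      fix s' \<xi>' \<theta>' assume n: "\<bar>s' - sf p \<theta>\<bar> < r \<and> \<bar>\<xi>' - xf q \<theta>\<bar> < r \<and> \<bar>\<theta>' - \<theta>\<bar> < r"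
      define p' where "p' = s' + \<alpha> \<theta>' / c1"
      define q' where "q' = \<xi>' + \<beta> \<theta>' / c2"
      have s'_eq: "s' = sf p' \<theta>'" "\<xi>' = xf q' \<theta>'" by (simp_all add: p'_def q'_def sf_def xf_def)
      have \<theta>'d: "\<bar>\<theta>' - \<theta>s\<bar> \<le> d" 
      proof -
        have "\<bar>\<theta>' - \<theta>\<bar> \<le> d / 2" using n by (simp add: r_def)
        moreover have "\<theta>' - \<theta>s = (\<theta>' - \<theta>) + (\<theta> - \<theta>s)" by simp
        ultimately show ?thesis using \<theta>_close'(2) d(1) abs_triangle_ineq[of "\<theta>' - \<theta>" "\<theta> - \<theta>s"] by simp
      qed
      have rr: "r + \<Lambda> / \<bar>c1\<bar> * r \<le> 1 / 2" "r + \<Lambda> / \<bar>c2\<bar> * r \<le> 1 / 2"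
      proof -
        have "r * P = r + \<Lambda> / \<bar>c1\<bar> * r + \<Lambda> / \<bar>c2\<bar> * r" by (simp add: P_def algebra_simps)
        moreover have "0 \<le> \<Lambda> / \<bar>c1\<bar> * r" "0 \<le> \<Lambda> / \<bar>c2\<bar> * r" using \<Lambda> r by auto
        ultimately show "r + \<Lambda> / \<bar>c1\<bar> * r \<le> 1 / 2" "r + \<Lambda> / \<bar>c2\<bar> * r \<le> 1 / 2" using rP by linarith+
      qed
      have *: "\<bar>(\<alpha> \<theta>' - \<alpha> \<theta>) / c1\<bar> \<le> \<Lambda> * r * (1 / \<bar>c1\<bar>)"
        using \<alpha>[of \<theta>' \<theta>] \<theta>'d pq d n mult_left_mono[of "\<bar>\<theta>' - \<theta>\<bar>" r, OF _ \<Lambda>] by (intro e_over) auto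
      have p1: "\<bar>p'\<bar> \<le> 1"
      proof -
        have "p' = (s' - sf p \<theta>) + (\<alpha> \<theta>' - \<alpha> \<theta>) / c1 + p"
          by (simp add: p'_def sf_def diff_divide_distrib)
        then have "\<bar>p'\<bar> \<le> \<bar>s' - sf p \<theta>\<bar> + \<bar>(\<alpha> \<theta>' - \<alpha> \<theta>) / c1\<bar> + \<bar>p\<bar>"
          using abs_triangle_ineq[of "s' - sf p \<theta>" "(\<alpha> \<theta>' - \<alpha> \<theta>) / c1"]
            abs_triangle_ineq[of "(s' - sf p \<theta>) + (\<alpha> \<theta>' - \<alpha> \<theta>) / c1" p] by linarith
        also have "\<dots> \<le> r + \<Lambda> * r * (1 / \<bar>c1\<bar>) + 1 / 4"
          using * n small(1) by (intro add_mono) auto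
        also have "\<dots> \<le> 1" using rr(1) by simp
        finally show ?thesis .
      qed
      have *: "\<bar>(\<beta> \<theta>' - \<beta> \<theta>) / c2\<bar> \<le> \<Lambda> * r * (1 / \<bar>c2\<bar>)"
        using \<beta>[of \<theta>' \<theta>] \<theta>'d pq d n mult_left_mono[of "\<bar>\<theta>' - \<theta>\<bar>" r, OF _ \<Lambda>] by (intro e_over) auto
      have q1: "\<bar>q'\<bar> \<le> 1"
      proof -
        have "q' = (\<xi>' - xf q \<theta>) + (\<beta> \<theta>' - \<beta> \<theta>) / c2 + q"
          by (simp add: q'_def xf_def diff_divide_distrib)
        then have "\<bar>q'\<bar> \<le> \<bar>\<xi>' - xf q \<theta>\<bar> + \<bar>(\<beta> \<theta>' - \<beta> \<theta>) / c2\<bar> + \<bar>q\<bar>"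
          using abs_triangle_ineq[of "\<xi>' - xf q \<theta>" "(\<beta> \<theta>' - \<beta> \<theta>) / c2"]
            abs_triangle_ineq[of "(\<xi>' - xf q \<theta>) + (\<beta> \<theta>' - \<beta> \<theta>) / c2" q] by linarith
        also have "\<dots> \<le> r + \<Lambda> * r * (1 / \<bar>c2\<bar>) + 1 / 4"
          using * n small(2) by (intro add_mono) auto
        also have "\<dots> \<le> 1" using rr(2) by simp
        finally show ?thesis .
      qed
      show "\<bar>\<theta>' - \<theta>s\<bar> \<le> 1" using \<theta>'d d by simp
      then show "\<bar>s'\<bar> \<le> B" "\<bar>\<xi>'\<bar> \<le> B"
        using sfB[OF p1] xfB[OF q1] unfolding s'_eq by simp_all
      assume eq: "c1 * s' + \<alpha> \<theta>' + e1 s' \<xi>' \<theta>' = 0 \<and> c2 * \<xi>' + \<beta> \<theta>' + e2 s' \<xi>' \<theta>' = 0 \<and> M \<theta>' + e3 s' \<xi>' \<theta>' = 0"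
      then have "N (p', q', \<theta>') = (p', q', \<theta>')" unfolding fix_iff s'_eq .
      then have "(p', q', \<theta>') = (p, q, \<theta>)" using uniq[of "(p', q', \<theta>')"] p1 q1 \<theta>'d by (simp add: U u)
      then show "s' = sf p \<theta>" "\<xi>' = xf q \<theta>" "\<theta>' = \<theta>" using s'_eq by auto
    qed
  qed
qed

section \<open>Matching the end points of the two halves\<close>

lemma wedge_linear: "wedge a (b + c) = wedge a b + wedge a c" "wedge a (b - c) = wedge a b - wedge a c"
  "wedge a (r *\<^sub>R b) = r * wedge a b" "wedge a a = 0"
  by (simp_all add: wedge_def algebra_simps)

lemma abs_fst_le_norm: "\<bar>fst (a :: plane)\<bar> \<le> norm a" and abs_snd_le_norm: "\<bar>snd (a :: plane)\<bar> \<le> norm a"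
  using norm_fst_le[of "fst a" "snd a"] norm_snd_le[of "snd a" "fst a"] by simp_all

lemma abs_wedge_le: "\<bar>wedge a b\<bar> \<le> 2 * (norm a * norm b)"
proof -
  have "\<bar>wedge a b\<bar> \<le> \<bar>snd a\<bar> * \<bar>fst b\<bar> + \<bar>fst a\<bar> * \<bar>snd b\<bar>"
    unfolding wedge_def by (simp add: abs_mult[symmetric])
  also have "\<dots> \<le> norm a * norm b + norm a * norm b"
    by (intro add_mono mult_mono abs_fst_le_norm abs_snd_le_norm) auto
  finally show ?thesis by simp
qed

text \<open>\<open>mm\<close> and \<open>mp\<close> are the values at \<sigma> of the variations
  with zero initial value, and \<open>Y\<close> is the common fundamental matrix at time \<sigma>,
  so initial value and phase enter the first-order end points additively. \<open>M_diff\<close> is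
  strict differentiability of the Melnikov function with the constant that the fixed point argument
  requires.\<close>

locale melnikov =
  m: perturbed_tube F A \<gamma> T \<rho> L km "cball \<theta>s 1" e0 + p: perturbed_tube F A \<gamma> T \<rho> L kp "cball \<theta>s 1" e0
  for F A \<gamma> T \<rho> L km kp \<theta>s e0 +
  fixes \<sigma> :: real and Y :: "plane \<Rightarrow> plane" and mm mp :: "real \<Rightarrow> plane" and \<Lambda> M' d0 :: real
  assumes \<sigma>: "0 < \<sigma>" "\<sigma> < T"
    and Y: "linear Y"
    and vm: "\<And>\<zeta> \<theta> v. \<theta> \<in> cball \<theta>s 1 \<Longrightarrow> m.variation \<zeta> \<theta> v \<Longrightarrow> v \<sigma> = Y \<zeta> + mm \<theta>"
    and vp: "\<And>\<zeta> \<theta> v. \<theta> \<in> cball \<theta>s 1 \<Longrightarrow> p.variation \<zeta> \<theta> v \<Longrightarrow> v \<sigma> = Y \<zeta> + mp \<theta>"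
    and \<Lambda>: "0 \<le> \<Lambda>"
    and mm_lip: "\<And>\<theta> \<theta>'. \<theta> \<in> cball \<theta>s 1 \<Longrightarrow> \<theta>' \<in> cball \<theta>s 1 \<Longrightarrow> norm (mm \<theta> - mm \<theta>') \<le> \<Lambda> * \<bar>\<theta> - \<theta>'\<bar>"
    and mp_lip: "\<And>\<theta> \<theta>'. \<theta> \<in> cball \<theta>s 1 \<Longrightarrow> \<theta>' \<in> cball \<theta>s 1 \<Longrightarrow> norm (mp \<theta> - mp \<theta>') \<le> \<Lambda> * \<bar>\<theta> - \<theta>'\<bar>"
    and Y_snd: "snd (Y (1, 0)) \<noteq> 0"
    and q: "snd (\<gamma> \<sigma>) = 0" "snd (F (\<gamma> \<sigma>)) \<noteq> 0"
    and M0: "wedge (F (\<gamma> \<sigma>)) (mm \<theta>s - mp \<theta>s) = 0"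
    and M': "M' \<noteq> 0" and d0: "0 < d0"
    and M_diff: "\<And>\<theta> \<theta>'. \<bar>\<theta> - \<theta>s\<bar> \<le> d0 \<Longrightarrow> \<bar>\<theta>' - \<theta>s\<bar> \<le> d0 \<Longrightarrow>
        \<bar>wedge (F (\<gamma> \<sigma>)) (mm \<theta> - mp \<theta>) - wedge (F (\<gamma> \<sigma>)) (mm \<theta>' - mp \<theta>') - M' * (\<theta> - \<theta>')\<bar>
          \<le> \<bar>M'\<bar> / 12 * \<bar>\<theta> - \<theta>'\<bar>"
begin

text \<open>The solution below \<open>\<Sigma>\<close>, run for time \<open>\<sigma> + \<epsilon> * s\<close>, and the reflected solution above \<open>\<Sigma>\<close>,
  run backwards for the complementary time \<open>\<sigma> - \<epsilon> * s\<close>, reach the same point of \<open>\<Sigma>\<close>.\<close>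

definition matched :: "real \<Rightarrow> real \<Rightarrow> real \<Rightarrow> real \<Rightarrow> bool" where
  "matched \<epsilon> s \<xi> \<theta> \<longleftrightarrow> (\<exists>x y. m.deviation \<epsilon> (\<xi>, 0) \<theta> T x \<and> p.deviation \<epsilon> (\<xi>, 0) \<theta> T y \<and>
     \<gamma> (\<sigma> + \<epsilon> * s) + x (\<sigma> + \<epsilon> * s) = \<gamma> (\<sigma> - \<epsilon> * s) + y (\<sigma> - \<epsilon> * s) \<and>
     snd (\<gamma> (\<sigma> + \<epsilon> * s) + x (\<sigma> + \<epsilon> * s)) = 0)"

theorem matching:
  obtains B \<epsilon>1 C where "0 \<le> B" "0 < \<epsilon>1" "0 \<le> C"
    "\<And>\<epsilon>. 0 < \<epsilon> \<Longrightarrow> \<epsilon> \<le> \<epsilon>1 \<Longrightarrow> \<epsilon> * B \<le> \<sigma> \<and> \<sigma> + \<epsilon> * B \<le> T \<and> \<epsilon> \<le> e0 \<and> \<epsilon> * m.radius B \<le> \<rho> \<and>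
      (\<exists>s \<xi> \<theta>. \<bar>s\<bar> \<le> B \<and> \<bar>\<xi>\<bar> \<le> B \<and> \<bar>\<theta> - \<theta>s\<bar> \<le> 1 \<and> \<bar>\<theta> - \<theta>s\<bar> \<le> C * \<epsilon> \<and> matched \<epsilon> s \<xi> \<theta> \<and>
        (\<exists>r>0. \<forall>s' \<xi>' \<theta>'. \<bar>s' - s\<bar> < r \<and> \<bar>\<xi>' - \<xi>\<bar> < r \<and> \<bar>\<theta>' - \<theta>\<bar> < r \<longrightarrow>
           \<bar>s'\<bar> \<le> B \<and> \<bar>\<xi>'\<bar> \<le> B \<and> \<bar>\<theta>' - \<theta>s\<bar> \<le> 1 \<and>
           (matched \<epsilon> s' \<xi>' \<theta>' \<longrightarrow> s' = s \<and> \<xi>' = \<xi> \<and> \<theta>' = \<theta>)))"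
proof -
  define Fq where "Fq = F (\<gamma> \<sigma>)"
  have \<sigma>T: "\<sigma> \<in> {0..T}" using \<sigma> by simp
  have Fq: "snd Fq \<noteq> 0" "norm Fq \<le> L" using q m.F_bound[OF \<sigma>T] by (auto simp: Fq_def)
  have L: "1 \<le> L" by (rule m.L)
  have J: "\<theta> \<in> cball \<theta>s 1 \<longleftrightarrow> \<bar>\<theta> - \<theta>s\<bar> \<le> 1" for \<theta> by (simp add: dist_real_def abs_minus_commute)
  define M where "M \<theta> = wedge Fq (mm \<theta> - mp \<theta>)" for \<theta>
  define \<alpha> where "\<alpha> \<theta> = snd (mm \<theta> - mp \<theta>)" for \<theta>
  define \<beta> where "\<beta> \<theta> = snd (mm \<theta> + mp \<theta>)" for \<theta>
  have m_lip: "\<bar>snd (mm \<theta> - mm \<theta>')\<bar> \<le> \<Lambda> * \<bar>\<theta> - \<theta>'\<bar>" "\<bar>snd (mp \<theta> - mp \<theta>')\<bar> \<le> \<Lambda> * \<bar>\<theta> - \<theta>'\<bar>"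
    if "\<bar>\<theta> - \<theta>s\<bar> \<le> 1" "\<bar>\<theta>' - \<theta>s\<bar> \<le> 1" for \<theta> \<theta>'
    using that by (auto intro!: order_trans[OF abs_snd_le_norm] mm_lip mp_lip simp only: J)
  have \<alpha>: "\<bar>\<alpha> \<theta> - \<alpha> \<theta>'\<bar> \<le> 2 * \<Lambda> * \<bar>\<theta> - \<theta>'\<bar>" and \<beta>: "\<bar>\<beta> \<theta> - \<beta> \<theta>'\<bar> \<le> 2 * \<Lambda> * \<bar>\<theta> - \<theta>'\<bar>"
    if "\<bar>\<theta> - \<theta>s\<bar> \<le> 1" "\<bar>\<theta>' - \<theta>s\<bar> \<le> 1" for \<theta> \<theta>'
    using m_lip[OF that] unfolding \<alpha>_def \<beta>_def by (simp_all add: abs_le_iff)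
  have sys: "2 * snd Fq \<noteq> 0" "2 * snd (Y (1, 0)) \<noteq> 0" "0 \<le> 2 * \<Lambda>" "M \<theta>s = 0"
    "\<And>\<theta> \<theta>'. \<bar>\<theta> - \<theta>s\<bar> \<le> d0 \<Longrightarrow> \<bar>\<theta>' - \<theta>s\<bar> \<le> d0 \<Longrightarrow>
        \<bar>M \<theta> - M \<theta>' - M' * (\<theta> - \<theta>')\<bar> \<le> \<bar>M'\<bar> / 12 * \<bar>\<theta> - \<theta>'\<bar>"
    using Fq(1) Y_snd \<Lambda> M0 M_diff by (simp_all add: M_def Fq_def del: divide_le_eq)
  obtain B c0 C where B: "0 \<le> B" and c0: "0 < c0" and C: "0 \<le> C" and sol:
    "\<And>c e1 e2 e3. 0 \<le> c \<Longrightarrow> c \<le> c0 \<Longrightarrow> small_remainder B \<theta>s c e1 \<Longrightarrow> small_remainder B \<theta>s c e2 \<Longrightarrow>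
      small_remainder B \<theta>s c e3 \<Longrightarrow>
      \<exists>s \<xi> \<theta>. \<bar>s\<bar> \<le> B \<and> \<bar>\<xi>\<bar> \<le> B \<and> \<bar>\<theta> - \<theta>s\<bar> \<le> 1 \<and> \<bar>\<theta> - \<theta>s\<bar> \<le> C * c \<and>
        2 * snd Fq * s + \<alpha> \<theta> + e1 s \<xi> \<theta> = 0 \<and> 2 * snd (Y (1, 0)) * \<xi> + \<beta> \<theta> + e2 s \<xi> \<theta> = 0 \<and> M \<theta> + e3 s \<xi> \<theta> = 0 \<and>
        (\<exists>r>0. \<forall>s' \<xi>' \<theta>'. \<bar>s' - s\<bar> < r \<and> \<bar>\<xi>' - \<xi>\<bar> < r \<and> \<bar>\<theta>' - \<theta>\<bar> < r \<longrightarrow>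
           \<bar>s'\<bar> \<le> B \<and> \<bar>\<xi>'\<bar> \<le> B \<and> \<bar>\<theta>' - \<theta>s\<bar> \<le> 1 \<and>
           (2 * snd Fq * s' + \<alpha> \<theta>' + e1 s' \<xi>' \<theta>' = 0 \<and> 2 * snd (Y (1, 0)) * \<xi>' + \<beta> \<theta>' + e2 s' \<xi>' \<theta>' = 0 \<and> M \<theta>' + e3 s' \<xi>' \<theta>' = 0 \<longrightarrow>
             s' = s \<and> \<xi>' = \<xi> \<and> \<theta>' = \<theta>))"
    by (rule perturbed_system[of "2 * snd Fq" "2 * snd (Y (1, 0))" M' "2 * \<Lambda>" \<theta>s \<alpha> \<beta> M d0,
          OF sys(1) sys(2) M' sys(3) \<alpha> \<beta> sys(4) d0 sys(5)]) (assumption | rule that)+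
  define K where "K = m.K_res B"
  have K: "0 \<le> K"
    unfolding K_def m.K_res_def using L B m.radius_nonneg[OF B] m.K_lip_nonneg m.K_lin_nonneg[OF B]
    by (intro add_nonneg_nonneg mult_nonneg_nonneg) auto
  define R where "R = m.radius B"
  have R: "0 \<le> R" using m.radius_nonneg[OF B] by (simp add: R_def)
  define \<epsilon>1 where "\<epsilon>1 = Min {e0, \<sigma> / (B + 1), (T - \<sigma>) / (B + 1), \<rho> / (L * (B + 1)), \<rho> / (R + 1), c0 / (4 * L * K + 1)}"
  have pos: "0 < B + 1" "0 < L * (B + 1)" "0 < R + 1" "0 < 4 * L * K + 1"
    using B L R K by (auto intro!: add_nonneg_pos mult_pos_pos)
  have \<epsilon>1: "0 < \<epsilon>1" using m.e0(1) \<sigma> m.rho c0 pos by (simp add: \<epsilon>1_def)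
  show thesis
  proof (rule that[of B \<epsilon>1 "C * (4 * L * K)"])
    show "0 \<le> B" "0 < \<epsilon>1" "0 \<le> C * (4 * L * K)" using B \<epsilon>1 C L K by auto
    fix \<epsilon> assume \<epsilon>0: "0 < \<epsilon>" and "\<epsilon> \<le> \<epsilon>1"
    have le: "\<epsilon> \<le> e0" "\<epsilon> \<le> \<sigma> / (B + 1)" "\<epsilon> \<le> (T - \<sigma>) / (B + 1)" "\<epsilon> \<le> \<rho> / (L * (B + 1))"
      "\<epsilon> \<le> \<rho> / (R + 1)" "\<epsilon> \<le> c0 / (4 * L * K + 1)"
      by (rule order_trans[OF \<open>\<epsilon> \<le> \<epsilon>1\<close>], simp only: \<epsilon>1_def, rule Min_le, simp, simp)+
    have \<epsilon>b: "\<epsilon> \<le> e0" "\<epsilon> * (B + 1) \<le> \<sigma>" "\<epsilon> * (B + 1) \<le> T - \<sigma>" "\<epsilon> * (L * (B + 1)) \<le> \<rho>" "\<epsilon> * (R + 1) \<le> \<rho>" "\<epsilon> * (4 * L * K + 1) \<le> c0"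
      using le by (simp_all only: pos_le_divide_eq[OF pos(1)] pos_le_divide_eq[OF pos(2)]
          pos_le_divide_eq[OF pos(3)] pos_le_divide_eq[OF pos(4)])
    have \<epsilon>: "\<epsilon> \<in> {0..e0}" using \<epsilon>0 \<epsilon>b by simp
    have \<epsilon>B: "\<epsilon> * B \<le> \<sigma>" "\<epsilon> * B \<le> T - \<sigma>" "L * (\<epsilon> * B) \<le> \<rho>" "\<epsilon> * R \<le> \<rho>" "\<epsilon> * (4 * L * K) \<le> c0"
    proof -
      have "0 \<le> L * \<epsilon>" using L \<epsilon>0 by simp
      then show "\<epsilon> * B \<le> \<sigma>" "\<epsilon> * B \<le> T - \<sigma>" "L * (\<epsilon> * B) \<le> \<rho>" "\<epsilon> * R \<le> \<rho>" "\<epsilon> * (4 * L * K) \<le> c0"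
        using \<epsilon>b \<epsilon>0 by (simp_all add: algebra_simps)
    qed
    have n: "norm (\<xi>, 0::real) \<le> B" if "\<bar>\<xi>\<bar> \<le> B" for \<xi> :: real using that by simp
    \<comment> \<open>Uniqueness makes the relevant values independent of the choice. Naming one
      solution for each parameter turns the remainders into functions of
      \<open>(s, \<xi>, \<theta>)\<close>.\<close>
    define xm where "xm \<xi> \<theta> = (SOME x. m.deviation \<epsilon> (\<xi>, 0) \<theta> T x)" for \<xi> \<theta>
    define xp where "xp \<xi> \<theta> = (SOME x. p.deviation \<epsilon> (\<xi>, 0) \<theta> T x)" for \<xi> \<theta>
    define um where "um \<xi> \<theta> = (SOME v. m.variation (\<xi>, 0) \<theta> v)" for \<xi> \<theta>
    define up where "up \<xi> \<theta> = (SOME v. p.variation (\<xi>, 0) \<theta> v)" for \<xi> \<theta>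
    have xm: "m.deviation \<epsilon> (\<xi>, 0) \<theta> T (xm \<xi> \<theta>)" and xp: "p.deviation \<epsilon> (\<xi>, 0) \<theta> T (xp \<xi> \<theta>)"
      if "\<bar>\<xi>\<bar> \<le> B" "\<bar>\<theta> - \<theta>s\<bar> \<le> 1" for \<xi> \<theta>
      unfolding xm_def xp_def
      using someI_ex[OF m.deviation_exists[OF \<epsilon> J[THEN iffD2, OF that(2)] n[OF that(1)] \<epsilon>B(4)[unfolded R_def]]]
        someI_ex[OF p.deviation_exists[OF \<epsilon> J[THEN iffD2, OF that(2)] n[OF that(1)] \<epsilon>B(4)[unfolded R_def]]] .
    have um: "m.variation (\<xi>, 0) \<theta> (um \<xi> \<theta>)" and up: "p.variation (\<xi>, 0) \<theta> (up \<xi> \<theta>)"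
      if "\<bar>\<theta> - \<theta>s\<bar> \<le> 1" for \<xi> \<theta>
      unfolding um_def up_def
      using someI_ex[OF m.variation_exists[OF J[THEN iffD2, OF that]]]
        someI_ex[OF p.variation_exists[OF J[THEN iffD2, OF that]]] .
    define Rm where "Rm s \<xi> \<theta> = (1 / \<epsilon>) *\<^sub>R m.residue_at \<sigma> \<epsilon> s (xm \<xi> \<theta>) (um \<xi> \<theta>)" for s \<xi> \<theta>
    define Rp where "Rp s \<xi> \<theta> = (1 / \<epsilon>) *\<^sub>R p.residue_at \<sigma> \<epsilon> (- s) (xp \<xi> \<theta>) (up \<xi> \<theta>)" for s \<xi> \<theta>
    have scale: "norm ((1 / \<epsilon>) *\<^sub>R a) \<le> \<epsilon> * K * c" if "norm a \<le> \<epsilon>\<^sup>2 * K * c" for a :: plane and c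
      using that \<epsilon>0 by (simp add: field_simps power2_eq_square)
    have Rb: "norm (Rm s \<xi> \<theta>) \<le> \<epsilon> * K * 1" "norm (Rp s \<xi> \<theta>) \<le> \<epsilon> * K * 1"
      if "\<bar>s\<bar> \<le> B" "\<bar>\<xi>\<bar> \<le> B" "\<bar>\<theta> - \<theta>s\<bar> \<le> 1" for s \<xi> \<theta>
    proof -
      have "norm (m.residue_at \<sigma> \<epsilon> s (xm \<xi> \<theta>) (um \<xi> \<theta>)) \<le> \<epsilon>\<^sup>2 * K"
        unfolding K_def
        by (rule m.residue_estimates(1)[OF \<epsilon> _ _ \<epsilon>B(3) xm um _ n]) (use that \<epsilon>B in \<open>auto simp: J simp del: mem_cball\<close>)
      then show "norm (Rm s \<xi> \<theta>) \<le> \<epsilon> * K * 1" unfolding Rm_def by (intro scale) simp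
      have "norm (p.residue_at \<sigma> \<epsilon> (- s) (xp \<xi> \<theta>) (up \<xi> \<theta>)) \<le> \<epsilon>\<^sup>2 * K"
        unfolding K_def
        by (rule p.residue_estimates(1)[OF \<epsilon> _ _ \<epsilon>B(3) xp up _ n]) (use that \<epsilon>B in \<open>auto simp: J simp del: mem_cball\<close>)
      then show "norm (Rp s \<xi> \<theta>) \<le> \<epsilon> * K * 1" unfolding Rp_def by (intro scale) simp
    qed
    have Rl: "norm (Rm s \<xi> \<theta> - Rm s' \<xi>' \<theta>') \<le> \<epsilon> * K * (\<bar>s - s'\<bar> + \<bar>\<xi> - \<xi>'\<bar> + \<bar>\<theta> - \<theta>'\<bar>)"
      "norm (Rp s \<xi> \<theta> - Rp s' \<xi>' \<theta>') \<le> \<epsilon> * K * (\<bar>s - s'\<bar> + \<bar>\<xi> - \<xi>'\<bar> + \<bar>\<theta> - \<theta>'\<bar>)"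
      if 1: "\<bar>s\<bar> \<le> B" "\<bar>\<xi>\<bar> \<le> B" "\<bar>\<theta> - \<theta>s\<bar> \<le> 1" and 2: "\<bar>s'\<bar> \<le> B" "\<bar>\<xi>'\<bar> \<le> B" "\<bar>\<theta>' - \<theta>s\<bar> \<le> 1"
      for s \<xi> \<theta> s' \<xi>' \<theta>'
    proof -
      have J1: "\<theta> \<in> cball \<theta>s 1" and J2: "\<theta>' \<in> cball \<theta>s 1" using 1 2 J by auto
      have nd: "norm ((\<xi>, 0) - (\<xi>', 0::real)) = \<bar>\<xi> - \<xi>'\<bar>" by simp
      have b: "0 \<le> \<sigma> - \<epsilon> * B" "\<sigma> + \<epsilon> * B \<le> T" "\<bar>- s\<bar> \<le> B" "\<bar>- s'\<bar> \<le> B" using \<epsilon>B 1 2 by auto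
      have "norm (m.residue_at \<sigma> \<epsilon> s (xm \<xi> \<theta>) (um \<xi> \<theta>) - m.residue_at \<sigma> \<epsilon> s' (xm \<xi>' \<theta>') (um \<xi>' \<theta>'))
          \<le> \<epsilon>\<^sup>2 * K * (\<bar>s - s'\<bar> + \<bar>\<xi> - \<xi>'\<bar> + \<bar>\<theta> - \<theta>'\<bar>)"
        using m.residue_estimates(2)[OF \<epsilon> b(1,2) \<epsilon>B(3) xm[OF 1(2,3)] um[OF 1(3)] J1 n[OF 1(2)] 1(1)
           xm[OF 2(2,3)] um[OF 2(3)] J2 n[OF 2(2)] 2(1)] unfolding nd K_def by (simp add: algebra_simps)
      then show "norm (Rm s \<xi> \<theta> - Rm s' \<xi>' \<theta>') \<le> \<epsilon> * K * (\<bar>s - s'\<bar> + \<bar>\<xi> - \<xi>'\<bar> + \<bar>\<theta> - \<theta>'\<bar>)"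
        unfolding Rm_def scaleR_diff_right[symmetric] by (rule scale)
      have "norm (p.residue_at \<sigma> \<epsilon> (- s) (xp \<xi> \<theta>) (up \<xi> \<theta>) - p.residue_at \<sigma> \<epsilon> (- s') (xp \<xi>' \<theta>') (up \<xi>' \<theta>'))
          \<le> \<epsilon>\<^sup>2 * K * (\<bar>s - s'\<bar> + \<bar>\<xi> - \<xi>'\<bar> + \<bar>\<theta> - \<theta>'\<bar>)"
        using p.residue_estimates(2)[OF \<epsilon> b(1,2) \<epsilon>B(3) xp[OF 1(2,3)] up[OF 1(3)] J1 n[OF 1(2)] b(3)
           xp[OF 2(2,3)] up[OF 2(3)] J2 n[OF 2(2)] b(4)] unfolding nd K_def by (simp add: algebra_simps abs_minus_commute)
      then show "norm (Rp s \<xi> \<theta> - Rp s' \<xi>' \<theta>') \<le> \<epsilon> * K * (\<bar>s - s'\<bar> + \<bar>\<xi> - \<xi>'\<bar> + \<bar>\<theta> - \<theta>'\<bar>)"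
        unfolding Rp_def scaleR_diff_right[symmetric] by (rule scale)
    qed
    \<comment> \<open>A difference of two residues costs a factor 2, and the wedge with
      \<open>Fq\<close>, of norm at most \<open>L\<close>, a factor \<open>2 * L\<close>.\<close>
    define c where "c = \<epsilon> * (4 * L * K)"
    have c: "0 \<le> c" "c \<le> c0" using \<epsilon>0 L K \<epsilon>B by (auto simp: c_def)
    define e1 where "e1 s \<xi> \<theta> = snd (Rm s \<xi> \<theta> - Rp s \<xi> \<theta>)" for s \<xi> \<theta>
    define e2 where "e2 s \<xi> \<theta> = snd (Rm s \<xi> \<theta> + Rp s \<xi> \<theta>)" for s \<xi> \<theta>
    define e3 where "e3 s \<xi> \<theta> = wedge Fq (Rm s \<xi> \<theta> - Rp s \<xi> \<theta>)" for s \<xi> \<theta>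
    have le_c: "2 * (\<epsilon> * K * x) \<le> c * x" "4 * L * (\<epsilon> * K * x) \<le> c * x" if "0 \<le> x" for x
    proof -
      have "1 * (\<epsilon> * K * x) \<le> L * (\<epsilon> * K * x)" using L \<epsilon>0 K that by (intro mult_right_mono) auto
      moreover have "0 \<le> \<epsilon> * K * x" using \<epsilon>0 K that by simp
      moreover have "c * x = 4 * (L * (\<epsilon> * K * x))" by (simp add: c_def)
      ultimately show "2 * (\<epsilon> * K * x) \<le> c * x" "4 * L * (\<epsilon> * K * x) \<le> c * x" by linarith+
    qed
    have abs_e: "\<bar>snd (a - b)\<bar> \<le> c * x" "\<bar>snd (a + b)\<bar> \<le> c * x" "\<bar>wedge Fq (a - b)\<bar> \<le> c * x"
      if "norm a \<le> \<epsilon> * K * x" "norm b \<le> \<epsilon> * K * x" "0 \<le> x" for a b x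
    proof -
      have n1: "norm (a - b) \<le> 2 * (\<epsilon> * K * x)" "norm (a + b) \<le> 2 * (\<epsilon> * K * x)"
        using that norm_triangle_ineq4[of a b] norm_triangle_ineq[of a b] by auto
      show "\<bar>snd (a - b)\<bar> \<le> c * x" using abs_snd_le_norm[of "a - b"] n1(1) le_c(1)[OF that(3)] by linarith
      show "\<bar>snd (a + b)\<bar> \<le> c * x" using abs_snd_le_norm[of "a + b"] n1(2) le_c(1)[OF that(3)] by linarith
      have "\<bar>wedge Fq (a - b)\<bar> \<le> 2 * (norm Fq * norm (a - b))" by (rule abs_wedge_le)
      also have "\<dots> \<le> 2 * (L * (2 * (\<epsilon> * K * x)))" using n1(1) Fq(2) L by (intro mult_left_mono mult_mono) auto
      finally show "\<bar>wedge Fq (a - b)\<bar> \<le> c * x" using le_c(2)[OF that(3)] by (simp add: mult_ac)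
    qed
    have e_diff: "e1 s \<xi> \<theta> - e1 s' \<xi>' \<theta>' = snd ((Rm s \<xi> \<theta> - Rm s' \<xi>' \<theta>') - (Rp s \<xi> \<theta> - Rp s' \<xi>' \<theta>'))"
      "e2 s \<xi> \<theta> - e2 s' \<xi>' \<theta>' = snd ((Rm s \<xi> \<theta> - Rm s' \<xi>' \<theta>') + (Rp s \<xi> \<theta> - Rp s' \<xi>' \<theta>'))"
      "e3 s \<xi> \<theta> - e3 s' \<xi>' \<theta>' = wedge Fq ((Rm s \<xi> \<theta> - Rm s' \<xi>' \<theta>') - (Rp s \<xi> \<theta> - Rp s' \<xi>' \<theta>'))" for s \<xi> \<theta> s' \<xi>' \<theta>'
      by (simp_all add: e1_def e2_def e3_def wedge_linear)
    have small1: "small_remainder B \<theta>s c e1"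
      unfolding small_remainder_def e_diff using abs_e(1)[OF Rb] abs_e(1)[OF Rl] by (simp add: e1_def)
    have small2: "small_remainder B \<theta>s c e2"
      unfolding small_remainder_def e_diff using abs_e(2)[OF Rb] abs_e(2)[OF Rl] by (simp add: e2_def)
    have small3: "small_remainder B \<theta>s c e3"
      unfolding small_remainder_def e_diff using abs_e(3)[OF Rb] abs_e(3)[OF Rl] by (simp add: e3_def)
    have iff: "matched \<epsilon> s \<xi> \<theta> \<longleftrightarrow> 2 * snd Fq * s + \<alpha> \<theta> + e1 s \<xi> \<theta> = 0 \<and> 2 * snd (Y (1, 0)) * \<xi> + \<beta> \<theta> + e2 s \<xi> \<theta> = 0 \<and> M \<theta> + e3 s \<xi> \<theta> = 0"
      if b: "\<bar>s\<bar> \<le> B" "\<bar>\<xi>\<bar> \<le> B" "\<bar>\<theta> - \<theta>s\<bar> \<le> 1" for s \<xi> \<theta>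
    proof -
      have J1: "\<theta> \<in> cball \<theta>s 1" using b(3) J by simp
      have "\<bar>\<epsilon> * s\<bar> \<le> \<epsilon> * B" using b \<epsilon>0 by (simp add: abs_mult)
      then have t: "\<sigma> + \<epsilon> * s \<in> {0..T}" "\<sigma> - \<epsilon> * s \<in> {0..T}" using \<epsilon>B by auto
      define zm where "zm = \<gamma> (\<sigma> + \<epsilon> * s) + xm \<xi> \<theta> (\<sigma> + \<epsilon> * s)"
      define zp where "zp = \<gamma> (\<sigma> - \<epsilon> * s) + xp \<xi> \<theta> (\<sigma> - \<epsilon> * s)"
      have 1: "matched \<epsilon> s \<xi> \<theta> \<longleftrightarrow> zm = zp \<and> snd zm = 0"
      proof
        assume "matched \<epsilon> s \<xi> \<theta>"
        then obtain x y where xy: "m.deviation \<epsilon> (\<xi>, 0) \<theta> T x" "p.deviation \<epsilon> (\<xi>, 0) \<theta> T y"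
          "\<gamma> (\<sigma> + \<epsilon> * s) + x (\<sigma> + \<epsilon> * s) = \<gamma> (\<sigma> - \<epsilon> * s) + y (\<sigma> - \<epsilon> * s)"
          "snd (\<gamma> (\<sigma> + \<epsilon> * s) + x (\<sigma> + \<epsilon> * s)) = 0"
          unfolding matched_def by blast
        have "x (\<sigma> + \<epsilon> * s) = xm \<xi> \<theta> (\<sigma> + \<epsilon> * s)" "y (\<sigma> - \<epsilon> * s) = xp \<xi> \<theta> (\<sigma> - \<epsilon> * s)"
          using m.deviation_unique[OF xy(1) xm[OF b(2,3)] \<epsilon> J1 order_refl t(1)]
            p.deviation_unique[OF xy(2) xp[OF b(2,3)] \<epsilon> J1 order_refl t(2)] by auto
        with xy show "zm = zp \<and> snd zm = 0" by (simp add: zm_def zp_def)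
      next
        assume "zm = zp \<and> snd zm = 0"
        then show "matched \<epsilon> s \<xi> \<theta>"
          unfolding matched_def zm_def zp_def using xm[OF b(2,3)] xp[OF b(2,3)] by blast
      qed
      \<comment> \<open>The exact displacements of the two end points from
        \<open>\<gamma> \<sigma>\<close>, divided by \<epsilon>. The upper half runs for the time
        \<open>\<sigma> - \<epsilon> * s\<close>, hence the opposite sign of
        \<open>s\<close>.\<close>
      define am where "am = \<xi> *\<^sub>R Y (1, 0) + mm \<theta> + s *\<^sub>R Fq + Rm s \<xi> \<theta>"
      define ap where "ap = \<xi> *\<^sub>R Y (1, 0) + mp \<theta> - s *\<^sub>R Fq + Rp s \<xi> \<theta>"
      have Y\<xi>: "Y (\<xi>, 0) = \<xi> *\<^sub>R Y (1, 0)" using linear_scale[OF Y, of \<xi> "(1, 0)"] by simp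
      have zm: "zm = \<gamma> \<sigma> + \<epsilon> *\<^sub>R am" and zp: "zp = \<gamma> \<sigma> + \<epsilon> *\<^sub>R ap"
        using \<epsilon>0 unfolding zm_def zp_def am_def ap_def Rm_def Rp_def m.residue_at_def p.residue_at_def
          vm[OF J1 um[OF b(3)]] vp[OF J1 up[OF b(3)]] Y\<xi> Fq_def
        by (simp_all add: algebra_simps)
      define \<Delta> where "\<Delta> = am - ap"
      have "zm = zp \<longleftrightarrow> \<Delta> = 0" using \<epsilon>0 by (simp add: zm zp \<Delta>_def)
      \<comment> \<open>The second component of \<open>Fq\<close> is nonzero, so a vector parallel
        to \<open>Fq\<close> whose second component vanishes is zero. In these two coordinates of
        \<Delta> the system is triangular.\<close>
      also have "\<dots> \<longleftrightarrow> snd \<Delta> = 0 \<and> wedge Fq \<Delta> = 0"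
        using Fq(1) by (auto simp: wedge_def prod_eq_iff)
      also have "snd \<Delta> = 2 * snd Fq * s + \<alpha> \<theta> + e1 s \<xi> \<theta>"
        by (simp add: \<Delta>_def am_def ap_def \<alpha>_def e1_def algebra_simps)
      also have "wedge Fq \<Delta> = M \<theta> + e3 s \<xi> \<theta>"
        by (simp add: \<Delta>_def am_def ap_def M_def e3_def wedge_linear)
      finally have 2: "zm = zp \<longleftrightarrow> 2 * snd Fq * s + \<alpha> \<theta> + e1 s \<xi> \<theta> = 0 \<and> M \<theta> + e3 s \<xi> \<theta> = 0" .
      have "snd zm = 0 \<longleftrightarrow> snd am = 0" using \<epsilon>0 q(1) by (simp add: zm)
      \<comment> \<open>Once the end points agree, the condition of lying on \<Sigma> may be
        replaced by its sum over both halves, from which \<open>s\<close> drops out.\<close>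
      moreover have "2 * snd am = (2 * snd (Y (1, 0)) * \<xi> + \<beta> \<theta> + e2 s \<xi> \<theta>) + snd \<Delta>"
        by (simp add: \<Delta>_def am_def ap_def \<beta>_def e2_def algebra_simps)
      moreover have "snd \<Delta> = 0" if "zm = zp" using that \<epsilon>0 by (simp add: zm zp \<Delta>_def)
      ultimately have 3: "snd zm = 0 \<longleftrightarrow> 2 * snd (Y (1, 0)) * \<xi> + \<beta> \<theta> + e2 s \<xi> \<theta> = 0" if "zm = zp"
        using that by (metis add.right_neutral mult_eq_0_iff zero_neq_numeral)
      show ?thesis using 1 2 3 by blast
    qed
    from sol[OF c small1 small2 small3] obtain s \<xi> \<theta> r where s: "\<bar>s\<bar> \<le> B" "\<bar>\<xi>\<bar> \<le> B" "\<bar>\<theta> - \<theta>s\<bar> \<le> 1" "\<bar>\<theta> - \<theta>s\<bar> \<le> C * c"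
      "2 * snd Fq * s + \<alpha> \<theta> + e1 s \<xi> \<theta> = 0 \<and> 2 * snd (Y (1, 0)) * \<xi> + \<beta> \<theta> + e2 s \<xi> \<theta> = 0 \<and> M \<theta> + e3 s \<xi> \<theta> = 0"
      and r: "r > 0" "\<And>s' \<xi>' \<theta>'. \<bar>s' - s\<bar> < r \<and> \<bar>\<xi>' - \<xi>\<bar> < r \<and> \<bar>\<theta>' - \<theta>\<bar> < r \<Longrightarrow>
           \<bar>s'\<bar> \<le> B \<and> \<bar>\<xi>'\<bar> \<le> B \<and> \<bar>\<theta>' - \<theta>s\<bar> \<le> 1 \<and>
           (2 * snd Fq * s' + \<alpha> \<theta>' + e1 s' \<xi>' \<theta>' = 0 \<and> 2 * snd (Y (1, 0)) * \<xi>' + \<beta> \<theta>' + e2 s' \<xi>' \<theta>' = 0 \<and> M \<theta>' + e3 s' \<xi>' \<theta>' = 0 \<longrightarrow>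
             s' = s \<and> \<xi>' = \<xi> \<and> \<theta>' = \<theta>)" by blast
    have match: "matched \<epsilon> s \<xi> \<theta>" using iff[OF s(1-3)] s(5) by blast
    have uniq: "\<bar>s'\<bar> \<le> B \<and> \<bar>\<xi>'\<bar> \<le> B \<and> \<bar>\<theta>' - \<theta>s\<bar> \<le> 1 \<and> (matched \<epsilon> s' \<xi>' \<theta>' \<longrightarrow> s' = s \<and> \<xi>' = \<xi> \<and> \<theta>' = \<theta>)"
      if "\<bar>s' - s\<bar> < r \<and> \<bar>\<xi>' - \<xi>\<bar> < r \<and> \<bar>\<theta>' - \<theta>\<bar> < r" for s' \<xi>' \<theta>'
      using r(2)[OF that] iff[of s' \<xi>' \<theta>'] by blast
    have "\<bar>\<theta> - \<theta>s\<bar> \<le> C * (4 * L * K) * \<epsilon>" using s(4) by (simp add: c_def mult_ac)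
    with s(1-3) match uniq r(1) have "\<exists>s \<xi> \<theta>. \<bar>s\<bar> \<le> B \<and> \<bar>\<xi>\<bar> \<le> B \<and> \<bar>\<theta> - \<theta>s\<bar> \<le> 1 \<and> \<bar>\<theta> - \<theta>s\<bar> \<le> C * (4 * L * K) * \<epsilon> \<and> matched \<epsilon> s \<xi> \<theta> \<and>
        (\<exists>r>0. \<forall>s' \<xi>' \<theta>'. \<bar>s' - s\<bar> < r \<and> \<bar>\<xi>' - \<xi>\<bar> < r \<and> \<bar>\<theta>' - \<theta>\<bar> < r \<longrightarrow>
           \<bar>s'\<bar> \<le> B \<and> \<bar>\<xi>'\<bar> \<le> B \<and> \<bar>\<theta>' - \<theta>s\<bar> \<le> 1 \<and>
           (matched \<epsilon> s' \<xi>' \<theta>' \<longrightarrow> s' = s \<and> \<xi>' = \<xi> \<and> \<theta>' = \<theta>))" by blast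
    then show "\<epsilon> * B \<le> \<sigma> \<and> \<sigma> + \<epsilon> * B \<le> T \<and> \<epsilon> \<le> e0 \<and> \<epsilon> * m.radius B \<le> \<rho> \<and>
      (\<exists>s \<xi> \<theta>. \<bar>s\<bar> \<le> B \<and> \<bar>\<xi>\<bar> \<le> B \<and> \<bar>\<theta> - \<theta>s\<bar> \<le> 1 \<and> \<bar>\<theta> - \<theta>s\<bar> \<le> C * (4 * L * K) * \<epsilon> \<and> matched \<epsilon> s \<xi> \<theta> \<and>
        (\<exists>r>0. \<forall>s' \<xi>' \<theta>'. \<bar>s' - s\<bar> < r \<and> \<bar>\<xi>' - \<xi>\<bar> < r \<and> \<bar>\<theta>' - \<theta>\<bar> < r \<longrightarrow>
           \<bar>s'\<bar> \<le> B \<and> \<bar>\<xi>'\<bar> \<le> B \<and> \<bar>\<theta>' - \<theta>s\<bar> \<le> 1 \<and>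
           (matched \<epsilon> s' \<xi>' \<theta>' \<longrightarrow> s' = s \<and> \<xi>' = \<xi> \<and> \<theta>' = \<theta>)))"
      using \<epsilon>B \<epsilon>b(1) by (simp only: R_def) simp
  qed
qed

end

section \<open>Periodic orbits of the switching system\<close>

lemma lipschitz_imp_absolutely_continuous:
  assumes f: "C-lipschitz_on S f"
  shows "absolutely_continuous_on S f"
  unfolding absolutely_continuous_on_def
proof (intro allI impI)
  fix e :: real assume e: "e > 0"
  have C: "0 \<le> C" using f by (rule lipschitz_on_nonneg)
  show "\<exists>d>0. \<forall>P. finite P \<and> (\<forall>(a, b)\<in>P. a < b \<and> {a..b} \<subseteq> S) \<and>
        pairwise (\<lambda>(a, b) (a', b'). {a<..<b} \<inter> {a'<..<b'} = {}) P \<and> (\<Sum>(a, b)\<in>P. b - a) < d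
        \<longrightarrow> (\<Sum>(a, b)\<in>P. dist (f a) (f b)) < e"
  proof (intro exI[of _ "e / (C + 1)"] conjI allI impI; (elim conjE)?)
    show "0 < e / (C + 1)" using e C by simp
    fix P assume P: "finite P" "\<forall>(a, b)\<in>P. a < b \<and> {a..b} \<subseteq> S" "(\<Sum>(a, b)\<in>P. b - a) < e / (C + 1)"
    have "(\<Sum>(a, b)\<in>P. dist (f a) (f b)) \<le> (\<Sum>(a, b)\<in>P. C * (b - a))"
    proof (rule sum_mono, clarify)
      fix a b assume "(a, b) \<in> P"
      with P(2) have ab: "a < b" "{a..b} \<subseteq> S" by auto
      then have "a \<in> S" "b \<in> S" by auto
      from lipschitz_onD[OF f this] ab show "dist (f a) (f b) \<le> C * (b - a)" by (simp add: dist_real_def)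
    qed
    also have "\<dots> = C * (\<Sum>(a, b)\<in>P. b - a)" by (simp add: sum_distrib_left case_prod_unfold)
    also have "\<dots> \<le> C * (e / (C + 1))" using P(3) C by (intro mult_left_mono) auto
    also have "\<dots> < e" using e C by (simp add: field_simps)
    finally show "(\<Sum>(a, b)\<in>P. dist (f a) (f b)) < e" .
  qed
qed

lemma common_lower_bound:
  fixes S :: "real set"
  assumes "finite S" "\<And>x. x \<in> S \<Longrightarrow> 0 < x"
  shows "\<exists>m>0. \<forall>x\<in>S. m \<le> x"
proof (cases "S = {}")
  case True
  then show ?thesis by (auto intro: exI[of _ 1])
next
  case False
  then show ?thesis using assms by (intro exI[of _ "Min S"]) (simp add: Min_le)
qed

lemma has_vector_derivative_shift:
  assumes "(f has_vector_derivative f') (at (t + c) within {a + c..b + c})"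
  shows "((\<lambda>s. f (s + c)) has_vector_derivative f') (at t within {a..b})"
proof -
  have 1: "((\<lambda>s. s + c) has_vector_derivative 1) (at t within {a..b})" by (auto intro!: derivative_eq_intros)
  have "(\<lambda>s. s + c) ` {a..b} = {a + c..b + c}" by simp
  with vector_diff_chain_within[OF 1, of f f'] assms show ?thesis by (simp add: o_def)
qed

text \<open>On \<Sigma> and off it, the admissible velocities lie in the segment between the two
  fields, so a bound common to both fields passes to each of them.\<close>

lemma filippov_set_snd_bounds:
  assumes "v \<in> filippov_set Xp Xm p"
  shows "snd (Xm (fst p) (snd p)) \<le> c \<Longrightarrow> snd (Xp (fst p) (snd p)) \<le> c \<Longrightarrow> snd (snd v) \<le> c"
    and "c \<le> snd (Xm (fst p) (snd p)) \<Longrightarrow> c \<le> snd (Xp (fst p) (snd p)) \<Longrightarrow> c \<le> snd (snd v)"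
    and "fst v = 1"
proof -
  have "v \<in> closed_segment (ext_field Xm p) (ext_field Xp p)"
    using assms by (auto simp: filippov_set_def split: if_splits)
  then obtain u where u: "0 \<le> u" "u \<le> 1" "v = (1 - u) *\<^sub>R ext_field Xm p + u *\<^sub>R ext_field Xp p"
    by (auto simp: closed_segment_def)
  show "fst v = 1" using u by (simp add: ext_field_def)
  have v: "snd (snd v) = (1 - u) * snd (Xm (fst p) (snd p)) + u * snd (Xp (fst p) (snd p))"
    using u by (simp add: ext_field_def)
  show "snd (Xm (fst p) (snd p)) \<le> c \<Longrightarrow> snd (Xp (fst p) (snd p)) \<le> c \<Longrightarrow> snd (snd v) \<le> c"
    unfolding v using u by (intro convex_bound_le) auto
  assume "c \<le> snd (Xm (fst p) (snd p))" "c \<le> snd (Xp (fst p) (snd p))"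
  then have "(1 - u) * (- snd (Xm (fst p) (snd p))) + u * (- snd (Xp (fst p) (snd p))) \<le> - c"
    using u by (intro convex_bound_le) auto
  then show "c \<le> snd (snd v)" unfolding v by simp
qed

text \<open>Replaces the inclusion that holds almost everywhere by a velocity \<open>V\<close>
  defined at every time and integrating to the increments of \<open>w\<close>. Absolute continuity
  of a given solution is exploited here; the later arguments work with the integral.\<close>

lemma filippov_solution_integral:
  assumes "filippov_solution D Xp Xm w"
  obtains V N where "negligible N" "\<And>s. s \<notin> N \<Longrightarrow> V s \<in> filippov_set Xp Xm (w s)" "\<And>s. fst (V s) = 1"
    "\<And>a b. a \<le> b \<Longrightarrow> (V has_integral (w b - w a)) {a..b}" "\<And>S. continuous_on S w"
proof -
  have "AE s in lebesgue. \<exists>v\<in>filippov_set Xp Xm (w s). (w has_vector_derivative v) (at s)"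
    using assms by (simp add: filippov_solution_def)
  then obtain N where N: "N \<in> null_sets lebesgue"
    "{s \<in> space lebesgue. \<not> (\<exists>v\<in>filippov_set Xp Xm (w s). (w has_vector_derivative v) (at s))} \<subseteq> N"
    by (auto simp: eventually_ae_filter)
  \<comment> \<open>On the exceptional set the value \<open>(1, 0)\<close> is prescribed, so that
    the time component of \<open>V\<close> is 1 without exception.\<close>
  have "\<forall>s. \<exists>v. (s \<notin> N \<longrightarrow> v \<in> filippov_set Xp Xm (w s) \<and> (w has_vector_derivative v) (at s)) \<and> (s \<in> N \<longrightarrow> v = (1, 0))"
  proof
    fix s
    show "\<exists>v. (s \<notin> N \<longrightarrow> v \<in> filippov_set Xp Xm (w s) \<and> (w has_vector_derivative v) (at s)) \<and> (s \<in> N \<longrightarrow> v = (1, 0))"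
    proof (cases "s \<in> N")
      case False
      have "\<exists>v\<in>filippov_set Xp Xm (w s). (w has_vector_derivative v) (at s)"
      proof (rule ccontr)
        assume "\<not> ?thesis"
        then have "s \<in> {s \<in> space lebesgue. \<not> (\<exists>v\<in>filippov_set Xp Xm (w s). (w has_vector_derivative v) (at s))}" by simp
        with N(2) False show False by blast
      qed
      then show ?thesis using False by blast
    qed blast
  qed
  then obtain V where V: "\<And>s. s \<notin> N \<Longrightarrow> V s \<in> filippov_set Xp Xm (w s)" "\<And>s. s \<notin> N \<Longrightarrow> (w has_vector_derivative V s) (at s)"
    "\<And>s. s \<in> N \<Longrightarrow> V s = (1, 0)" by metis
  have negN: "negligible N" using N(1) by (simp add: negligible_iff_null_sets)
  have int: "(V has_integral (w b - w a)) {a..b}" if "a \<le> b" for a b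
  proof (rule absolutely_continuous_has_integral[OF that _ negN])
    show "absolutely_continuous_on {a..b} w" using assms by (simp add: filippov_solution_def)
    show "(w has_vector_derivative V t) (at t within {a..b})" if "t \<in> {a..b} - N" for t
      using V(2)[of t] that by (auto intro: has_vector_derivative_at_within)
  qed
  have "isCont w t" for t
  proof -
    have "continuous_on {t - 1..t + 1} (\<lambda>x. w (t - 1) + integral {t - 1..x} V)"
      using int[of "t - 1" "t + 1"] by (intro continuous_intros indefinite_integral_continuous_1) auto
    moreover have "w (t - 1) + integral {t - 1..x} V = w x" if "x \<in> {t - 1..t + 1}" for x
      using int[of "t - 1" x] that by (simp add: integral_unique)
    ultimately have "continuous_on {t - 1..t + 1} w" by (rule continuous_on_eq)
    then show ?thesis by (rule continuous_on_interior) simp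
  qed
  then have cont: "continuous_on S w" for S by (simp add: continuous_at_imp_continuous_on)
  have "fst (V s) = 1" for s
    using V(1)[of s] V(3)[of s] filippov_set_snd_bounds(3) by (cases "s \<in> N") fastforce+
  then show thesis using that[OF negN V(1) _ int cont] by blast
qed

text \<open>In the open interval the velocity is forced to be \<open>X\<close> along
  \<open>w\<close>, a continuous function of time. The integral formula then upgrades the derivative
  from almost everywhere to everywhere, one-sided at the end points, where \<open>w\<close> may lie
  on \<Sigma>.\<close>

lemma filippov_solution_classical:
  assumes w: "filippov_solution D Xp Xm w" and X: "continuous_on (UNIV \<times> D) (\<lambda>(t, z). X t z)"
    and one: "\<And>s. a < s \<Longrightarrow> s < b \<Longrightarrow> filippov_set Xp Xm (w s) = {ext_field X (w s)}" and s: "s \<in> {a..b}"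
  shows "(w has_vector_derivative ext_field X (w s)) (at s within {a..b})"
proof -
  obtain V N where N: "negligible N" and V: "\<And>s. s \<notin> N \<Longrightarrow> V s \<in> filippov_set Xp Xm (w s)"
    and int: "\<And>a b. a \<le> b \<Longrightarrow> (V has_integral (w b - w a)) {a..b}" and w_cont: "\<And>S. continuous_on S w"
    by (rule filippov_solution_integral[OF w]) blast
  have wD: "snd (w r) \<in> D" for r using w by (simp add: filippov_solution_def)
  have cont: "continuous_on {a..b} (\<lambda>r. ext_field X (w r))"
  proof -
    have "continuous_on {a..b} (\<lambda>r. case w r of (t, z) \<Rightarrow> X t z)"
      by (rule continuous_on_compose2[OF X w_cont]) (rule image_subsetI, simp add: mem_Times_iff wD)
    then show ?thesis unfolding ext_field_def case_prod_unfold by (intro continuous_intros)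
  qed
  have eq: "w a + integral {a..t} (\<lambda>r. ext_field X (w r)) = w t" if t: "t \<in> {a..b}" for t
  proof -
    have "((\<lambda>r. ext_field X (w r)) has_integral (w t - w a)) {a..t}"
    proof (rule has_integral_spike[of "N \<union> {a, b}"])
      show "negligible (N \<union> {a, b})" using N by (intro negligible_Un) auto
      show "(V has_integral (w t - w a)) {a..t}" using int t by simp
      show "ext_field X (w r) = V r" if "r \<in> {a..t} - (N \<union> {a, b})" for r
        using V[of r] one[of r] that t by auto
    qed
    then show ?thesis by (simp add: integral_unique)
  qed
  have "((\<lambda>t. w a + integral {a..t} (\<lambda>r. ext_field X (w r))) has_vector_derivative 0 + ext_field X (w s)) (at s within {a..b})"
    by (intro has_vector_derivative_add has_vector_derivative_const integral_has_vector_derivative[OF cont s])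
  then have "((\<lambda>t. w a + integral {a..t} (\<lambda>r. ext_field X (w r))) has_vector_derivative ext_field X (w s)) (at s within {a..b})"
    by (simp only: add_0_left)
  then show ?thesis
    by (rule has_vector_derivative_transform[OF s, rotated]) (rule eq[symmetric])
qed

text \<open>Where the second components of both fields obey the same bound, so does the rate of
  change of the height, whatever velocity the inclusion selects. This controls a solution near a
  crossing point without knowing on which side of \<Sigma> it lies.\<close>

lemma filippov_solution_slope:
  assumes w: "filippov_solution D Xp Xm w" and ab: "a \<le> b"
  shows "(\<And>s. s \<in> {a..b} \<Longrightarrow> snd (Xm (fst (w s)) (snd (w s))) \<le> c \<and> snd (Xp (fst (w s)) (snd (w s))) \<le> c) \<Longrightarrow>
      snd (snd (w b)) - snd (snd (w a)) \<le> c * (b - a)"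
    and "(\<And>s. s \<in> {a..b} \<Longrightarrow> c \<le> snd (Xm (fst (w s)) (snd (w s))) \<and> c \<le> snd (Xp (fst (w s)) (snd (w s)))) \<Longrightarrow>
      c * (b - a) \<le> snd (snd (w b)) - snd (snd (w a))"
proof -
  obtain V N where N: "negligible N" and V: "\<And>s. s \<notin> N \<Longrightarrow> V s \<in> filippov_set Xp Xm (w s)"
    and int: "\<And>a b. a \<le> b \<Longrightarrow> (V has_integral (w b - w a)) {a..b}"
    by (rule filippov_solution_integral[OF w]) blast
  have lin: "bounded_linear (\<lambda>v :: real \<times> plane. snd (snd v))"
    by (intro bounded_linear_compose[OF bounded_linear_snd] bounded_linear_snd)
  have V': "((\<lambda>s. snd (snd (V s))) has_integral (snd (snd (w b)) - snd (snd (w a)))) {a..b}"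
    using has_integral_linear[OF int[OF ab] lin] by (simp add: o_def)
  have const: "((\<lambda>_. c) has_integral c * (b - a)) {a..b}"
    using has_integral_const_real[of c a b] ab by (simp add: mult.commute)
  have spike: "((\<lambda>s. if s \<in> N then c else snd (snd (V s))) has_integral (snd (snd (w b)) - snd (snd (w a)))) {a..b}"
    by (rule has_integral_spike[OF N _ V']) auto
  show "snd (snd (w b)) - snd (snd (w a)) \<le> c * (b - a)"
    if h: "\<And>s. s \<in> {a..b} \<Longrightarrow> snd (Xm (fst (w s)) (snd (w s))) \<le> c \<and> snd (Xp (fst (w s)) (snd (w s))) \<le> c"
  proof (rule has_integral_le[OF spike const])
    show "(if s \<in> N then c else snd (snd (V s))) \<le> c" if "s \<in> {a..b}" for s
      using filippov_set_snd_bounds(1)[OF V, of s c] h[OF that] by simp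
  qed
  show "c * (b - a) \<le> snd (snd (w b)) - snd (snd (w a))"
    if h: "\<And>s. s \<in> {a..b} \<Longrightarrow> c \<le> snd (Xm (fst (w s)) (snd (w s))) \<and> c \<le> snd (Xp (fst (w s)) (snd (w s)))"
  proof (rule has_integral_le[OF const spike])
    show "c \<le> (if s \<in> N then c else snd (snd (V s)))" if "s \<in> {a..b}" for s
      using filippov_set_snd_bounds(2)[OF V, of s c] h[OF that] by simp
  qed
qed

lemma filippov_solution_time:
  assumes "filippov_solution D Xp Xm w"
  shows "fst (w s) = fst (w 0) + s"
proof -
  obtain V :: "real \<Rightarrow> real \<times> plane" and N where V: "\<And>s. fst (V s) = 1" and int: "\<And>a b. a \<le> b \<Longrightarrow> (V has_integral (w b - w a)) {a..b}"
    by (rule filippov_solution_integral[OF assms]) blast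
  have "fst (w b) - fst (w a) = b - a" if "a \<le> b" for a b
  proof -
    have "((\<lambda>s. 1) has_integral (fst (w b) - fst (w a))) {a..b}"
      using has_integral_linear[OF int[OF that] bounded_linear_fst] by (simp add: o_def V)
    moreover have "((\<lambda>s. 1) has_integral (b - a)) {a..b}"
      using has_integral_const_real[of "1::real" a b] that by simp
    ultimately show ?thesis by (rule has_integral_unique)
  qed
  from this[of 0 s] this[of s 0] show ?thesis by (cases "0 \<le> s") auto
qed

text \<open>Two classical arcs, the lower one on \<open>{0..\<tau>}\<close> and the upper one on the
  preceding interval \<open>{\<tau> - 2 * \<sigma>..0}\<close>, that close up after one period.
  Placing the upper arc at negative times matches its origin as a time-reversed solution started at
  the same point. The crossing is downwards at 0 and upwards at \<tau>.\<close>

locale switching_orbit =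
  fixes D :: "plane set" and Xm Xp :: "real \<Rightarrow> plane \<Rightarrow> plane" and \<sigma> \<theta>0 \<tau> :: real and zm zp :: "real \<Rightarrow> plane"
  assumes D: "open D"
    and Xm_cont: "continuous_on (UNIV \<times> D) (\<lambda>(t, z). Xm t z)" and Xp_cont: "continuous_on (UNIV \<times> D) (\<lambda>(t, z). Xp t z)"
    and Xm_per: "\<And>t z. z \<in> D \<Longrightarrow> Xm (t + 2 * \<sigma>) z = Xm t z" and Xp_per: "\<And>t z. z \<in> D \<Longrightarrow> Xp (t + 2 * \<sigma>) z = Xp t z"
    and \<tau>: "0 < \<tau>" "\<tau> < 2 * \<sigma>"
    and zm: "\<And>t. t \<in> {0..\<tau>} \<Longrightarrow> zm t \<in> D" "\<And>t. t \<in> {0..\<tau>} \<Longrightarrow> (zm has_vector_derivative Xm (\<theta>0 + t) (zm t)) (at t within {0..\<tau>})"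
    and zp: "\<And>t. t \<in> {\<tau> - 2 * \<sigma>..0} \<Longrightarrow> zp t \<in> D"
      "\<And>t. t \<in> {\<tau> - 2 * \<sigma>..0} \<Longrightarrow> (zp has_vector_derivative Xp (\<theta>0 + t) (zp t)) (at t within {\<tau> - 2 * \<sigma>..0})"
    and glue: "zp 0 = zm 0" "zp (\<tau> - 2 * \<sigma>) = zm \<tau>" "snd (zm 0) = 0" "snd (zm \<tau>) = 0"
    and neg: "\<And>t. 0 < t \<Longrightarrow> t < \<tau> \<Longrightarrow> snd (zm t) < 0" and pos: "\<And>t. \<tau> - 2 * \<sigma> < t \<Longrightarrow> t < 0 \<Longrightarrow> snd (zp t) > 0"
    and cross0: "snd (Xm \<theta>0 (zm 0)) < 0" "snd (Xp \<theta>0 (zm 0)) < 0"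
    and cross1: "snd (Xm (\<theta>0 + \<tau>) (zm \<tau>)) > 0" "snd (Xp (\<theta>0 + \<tau>) (zm \<tau>)) > 0"
begin

lemma per_int:
  assumes "z \<in> D"
  shows "Xm (t + 2 * \<sigma> * of_int n) z = Xm t z" and "Xp (t + 2 * \<sigma> * of_int n) z = Xp t z"
proof -
  have nat: "X (t + 2 * \<sigma> * of_nat k) z = X t z" if "\<And>t. X (t + 2 * \<sigma>) z = X t z" for X :: "real \<Rightarrow> plane \<Rightarrow> plane" and t k
  proof (induction k)
    case (Suc k)
    have "t + 2 * \<sigma> * of_nat (Suc k) = (t + 2 * \<sigma> * of_nat k) + 2 * \<sigma>" by (simp add: algebra_simps)
    then show ?case using that[of "t + 2 * \<sigma> * of_nat k"] Suc by (simp only:)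
  qed simp
  have int: "X (t + 2 * \<sigma> * of_int n) z = X t z" if X: "\<And>t. X (t + 2 * \<sigma>) z = X t z" for X :: "real \<Rightarrow> plane \<Rightarrow> plane"
  proof (cases n)
    case (nonneg k)
    then show ?thesis using nat[of X, OF X] by simp
  next
    case (neg k)
    have "X (t + 2 * \<sigma> * of_int n) z = X ((t + 2 * \<sigma> * of_int n) + 2 * \<sigma> * of_nat (Suc k)) z"
      using nat[of X, OF X, of "t + 2 * \<sigma> * of_int n" "Suc k"] by simp
    also have "(t + 2 * \<sigma> * of_int n) + 2 * \<sigma> * of_nat (Suc k) = t"
    proof -
      have "real_of_int n = - real (Suc k)" using neg by simp
      then show ?thesis by (simp del: of_nat_Suc)
    qed
    finally show ?thesis .
  qed
  show "Xm (t + 2 * \<sigma> * of_int n) z = Xm t z" "Xp (t + 2 * \<sigma> * of_int n) z = Xp t z"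
    using int[of Xm] int[of Xp] Xm_per[OF assms] Xp_per[OF assms] by auto
qed

definition base :: "real \<Rightarrow> plane" where
  "base t = (if 0 \<le> t then zm t else zp t)"

text \<open>Index of the translate of \<open>{\<tau> - 2 * \<sigma>..<\<tau>}\<close> by a multiple
  of the period that contains \<open>t\<close>.\<close>

definition cell :: "real \<Rightarrow> int" where
  "cell t = \<lfloor>(t - (\<tau> - 2 * \<sigma>)) / (2 * \<sigma>)\<rfloor>"

definition Z :: "real \<Rightarrow> plane" where
  "Z t = base (t - 2 * \<sigma> * of_int (cell t))"

lemma \<sigma>_pos: "0 < \<sigma>" using \<tau> by simp

lemma cell_bounds: "\<tau> - 2 * \<sigma> \<le> t - 2 * \<sigma> * of_int (cell t)" "t - 2 * \<sigma> * of_int (cell t) < \<tau>"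
proof -
  let ?x = "(t - (\<tau> - 2 * \<sigma>)) / (2 * \<sigma>)"
  have "of_int \<lfloor>?x\<rfloor> \<le> ?x" "?x < of_int \<lfloor>?x\<rfloor> + 1" by linarith+
  then have "of_int \<lfloor>?x\<rfloor> * (2 * \<sigma>) \<le> t - (\<tau> - 2 * \<sigma>)" "t - (\<tau> - 2 * \<sigma>) < (of_int \<lfloor>?x\<rfloor> + 1) * (2 * \<sigma>)"
    using \<sigma>_pos by (simp_all only: pos_le_divide_eq pos_divide_less_eq mult_pos_pos zero_less_numeral)
  then show "\<tau> - 2 * \<sigma> \<le> t - 2 * \<sigma> * of_int (cell t)" "t - 2 * \<sigma> * of_int (cell t) < \<tau>"
    by (simp_all add: cell_def algebra_simps)
qed

lemma Z_period: "Z (t + 2 * \<sigma>) = Z t"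
proof -
  have "(t + 2 * \<sigma> - (\<tau> - 2 * \<sigma>)) / (2 * \<sigma>) = (t - (\<tau> - 2 * \<sigma>)) / (2 * \<sigma>) + 1"
    using \<sigma>_pos by (simp add: field_simps)
  then have "cell (t + 2 * \<sigma>) = cell t + 1" by (simp add: cell_def)
  then show ?thesis by (simp add: Z_def algebra_simps)
qed

lemma cell_eq:
  assumes "\<tau> - 2 * \<sigma> \<le> t - 2 * \<sigma> * of_int n" "t - 2 * \<sigma> * of_int n < \<tau>"
  shows "cell t = n"
  unfolding cell_def
proof (rule floor_unique)
  show "of_int n \<le> (t - (\<tau> - 2 * \<sigma>)) / (2 * \<sigma>)" "(t - (\<tau> - 2 * \<sigma>)) / (2 * \<sigma>) < of_int n + 1"
    using assms \<sigma>_pos by (simp_all add: field_simps)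
qed

text \<open>The right end \<tau> belongs to the next cell, but
  \<open>zp (\<tau> - 2 * \<sigma>) = zm \<tau>\<close> makes both formulas agree, so closed cells
  may be used.\<close>

lemma Z_cell:
  assumes "t - 2 * \<sigma> * of_int n \<in> {\<tau> - 2 * \<sigma>..\<tau>}"
  shows "Z t = base (t - 2 * \<sigma> * of_int n)"
proof (cases "t - 2 * \<sigma> * of_int n = \<tau>")
  case True
  then have "cell t = n + 1" using \<sigma>_pos by (intro cell_eq) (auto simp: algebra_simps)
  moreover have "t - 2 * \<sigma> * of_int (n + 1) = \<tau> - 2 * \<sigma>" using True by (simp add: algebra_simps)
  ultimately have "Z t = base (\<tau> - 2 * \<sigma>)" by (simp only: Z_def)
  then show ?thesis unfolding True using \<tau> glue by (simp add: base_def)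
next
  case False
  then have "cell t = n" using assms by (intro cell_eq) auto
  then show ?thesis by (simp add: Z_def)
qed

lemma Z_zm: "t \<in> {0..\<tau>} \<Longrightarrow> Z t = zm t" and Z_zp: "t \<in> {\<tau> - 2 * \<sigma>..0} \<Longrightarrow> Z t = zp t"
  using Z_cell[of t 0] \<tau> glue by (auto simp: base_def)

lemma Z_in_D: "Z t \<in> D"
  using cell_bounds[of t] zm(1) zp(1) unfolding Z_def base_def by auto

lemma field_path_cont:
  assumes "continuous_on (UNIV \<times> D) (\<lambda>(t, z). X t z)" "continuous_on S (u :: real \<Rightarrow> plane)" "u ` S \<subseteq> D"
  shows "continuous_on S (\<lambda>t. X (c + t) (u t) :: plane)"
  by (rule continuous_on_compose2[OF assms(1), of S "\<lambda>t. (c + t, u t)", simplified])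
    (use assms in \<open>auto intro!: continuous_intros\<close>)

lemma base_lipschitz: "\<exists>C. C-lipschitz_on {\<tau> - 2 * \<sigma>..\<tau>} base"
proof -
  have piece: "\<exists>C. C-lipschitz_on {a..b} u"
    if X: "continuous_on (UNIV \<times> D) (\<lambda>(t, z). X t z)" and u: "\<And>t. t \<in> {a..b} \<Longrightarrow> u t \<in> D"
      "\<And>t. t \<in> {a..b} \<Longrightarrow> (u has_vector_derivative X (\<theta>0 + t) (u t)) (at t within {a..b})"
    for X :: "real \<Rightarrow> plane \<Rightarrow> plane" and u a b
  proof -
    have "continuous_on {a..b} u"
      using u(2) by (meson continuous_on_eq_continuous_within has_vector_derivative_continuous)
    from field_path_cont[OF X this] u(1) have "continuous_on {a..b} (\<lambda>t. X (\<theta>0 + t) (u t))" by blast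
    from compact_imp_bounded[OF compact_continuous_image[OF this]] obtain C where
      C: "0 < C" "\<And>t. t \<in> {a..b} \<Longrightarrow> norm (X (\<theta>0 + t) (u t)) \<le> C" unfolding bounded_pos by auto
    show ?thesis
      using vector_derivative_lipschitz[OF _ u(2) C(2)] C(1)
      by (intro exI[of _ C] lipschitz_onI) (auto simp: dist_norm)
  qed
  obtain C1 where C1: "C1-lipschitz_on {0..\<tau>} zm" using piece[OF Xm_cont zm] by blast
  obtain C2 where C2: "C2-lipschitz_on {\<tau> - 2 * \<sigma>..0} zp" using piece[OF Xp_cont zp] by blast
  have "(max C2 C1)-lipschitz_on {\<tau> - 2 * \<sigma>..\<tau>} (\<lambda>x. if x \<le> 0 then zp x else zm x)"
    by (rule lipschitz_on_concat_max[OF C2 C1 glue(1)])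
  moreover have "(if x \<le> 0 then zp x else zm x) = base x" for x using glue(1) by (auto simp: base_def)
  ultimately show ?thesis by auto
qed

text \<open>All cells share the Lipschitz constant of one period, and finitely many of them cover an
  interval. Continuity and absolute continuity of the orbit both come from this.\<close>

lemma Z_lipschitz: "\<exists>C. \<forall>a b. C-lipschitz_on {a..b} Z"
proof -
  obtain C where C: "C-lipschitz_on {\<tau> - 2 * \<sigma>..\<tau>} base" using base_lipschitz by blast
  have "C-lipschitz_on {a..b} Z" for a b
  proof (rule lipschitz_on_closed_Union[where I="{cell a..cell b}" and U="\<lambda>n. {\<tau> - 2 * \<sigma> + 2 * \<sigma> * of_int n..\<tau> + 2 * \<sigma> * of_int n}"])
    show "C-lipschitz_on {\<tau> - 2 * \<sigma> + 2 * \<sigma> * of_int n..\<tau> + 2 * \<sigma> * of_int n} Z" for n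
    proof (rule lipschitz_onI)
      fix x y assume xy: "x \<in> {\<tau> - 2 * \<sigma> + 2 * \<sigma> * of_int n..\<tau> + 2 * \<sigma> * of_int n}" "y \<in> {\<tau> - 2 * \<sigma> + 2 * \<sigma> * of_int n..\<tau> + 2 * \<sigma> * of_int n}"
      then have "x - 2 * \<sigma> * of_int n \<in> {\<tau> - 2 * \<sigma>..\<tau>}" "y - 2 * \<sigma> * of_int n \<in> {\<tau> - 2 * \<sigma>..\<tau>}" by auto
      from lipschitz_onD[OF C this] Z_cell[OF this(1)] Z_cell[OF this(2)] show "dist (Z x) (Z y) \<le> C * dist x y"
        by (simp add: dist_real_def)
    qed (rule lipschitz_on_nonneg[OF C])
    show "0 \<le> C" by (rule lipschitz_on_nonneg[OF C])
    show "{a..b} \<subseteq> (\<Union>n\<in>{cell a..cell b}. {\<tau> - 2 * \<sigma> + 2 * \<sigma> * of_int n..\<tau> + 2 * \<sigma> * of_int n})"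
    proof
      fix t assume t: "t \<in> {a..b}"
      have "cell a \<le> cell t" "cell t \<le> cell b"
        unfolding cell_def using t \<sigma>_pos by (auto intro!: floor_mono divide_right_mono)
      moreover have "t \<in> {\<tau> - 2 * \<sigma> + 2 * \<sigma> * of_int (cell t)..\<tau> + 2 * \<sigma> * of_int (cell t)}"
        using cell_bounds[of t] by auto
      ultimately show "t \<in> (\<Union>n\<in>{cell a..cell b}. {\<tau> - 2 * \<sigma> + 2 * \<sigma> * of_int n..\<tau> + 2 * \<sigma> * of_int n})" by auto
    qed
  qed auto
  then show ?thesis by blast
qed

lemma Z_cont: "continuous_on S Z"
proof -
  obtain C where C: "\<And>a b. C-lipschitz_on {a..b} Z" using Z_lipschitz by blast
  have "isCont Z t" for t
    using lipschitz_on_continuous_on[OF C, of "t - 1" "t + 1"] by (rule continuous_on_interior) simp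
  then show ?thesis by (simp add: continuous_at_imp_continuous_on)
qed

lemma Z_derivative:
  assumes "snd (Z t) \<noteq> 0"
  shows "(Z has_vector_derivative (if snd (Z t) < 0 then Xm else Xp) (\<theta>0 + t) (Z t)) (at t)"
proof -
  define r where "r = t - 2 * \<sigma> * of_int (cell t)"
  have Zr: "Z t = base r" by (simp add: Z_def r_def)
  have r: "\<tau> - 2 * \<sigma> \<le> r" "r < \<tau>" using cell_bounds[of t] by (auto simp: r_def)
  have r0: "r \<noteq> 0" "r \<noteq> \<tau> - 2 * \<sigma>"
    using assms glue \<tau> by (auto simp: Zr base_def)
  \<comment> \<open>At an interior point of an arc the derivative is two-sided; it is transported to
    the cell of \<open>t\<close>, where periodicity of the field gives the phase
    \<open>\<theta>0 + t\<close>.\<close>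
  have der: "(Z has_vector_derivative X (\<theta>0 + t) (Z t)) (at t)"
    if u: "(u has_vector_derivative X (\<theta>0 + r) (u r)) (at r within {a..b})" and ab: "a < r" "r < b" "\<tau> - 2 * \<sigma> \<le> a" "b \<le> \<tau>"
      and ub: "\<And>s. s \<in> {a..b} \<Longrightarrow> base s = u s" and X: "X (\<theta>0 + t) (u r) = X (\<theta>0 + r) (u r)"
    for u X a b
  proof -
    have u': "(u has_vector_derivative X (\<theta>0 + r) (u r)) (at r)"
      using u ab at_within_interior[of r "{a..b}"] by simp
    have 1: "((\<lambda>s. s - 2 * \<sigma> * of_int (cell t)) has_vector_derivative 1) (at t)"
      by (auto intro!: derivative_eq_intros)
    have "((\<lambda>s. u (s - 2 * \<sigma> * of_int (cell t))) has_vector_derivative X (\<theta>0 + r) (u r)) (at t)"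
      using vector_diff_chain_at[OF 1, of u] u' by (simp add: o_def r_def)
    then have "(Z has_vector_derivative X (\<theta>0 + r) (u r)) (at t)"
    proof (rule has_vector_derivative_transform_within_open[where S="{a + 2 * \<sigma> * of_int (cell t)<..<b + 2 * \<sigma> * of_int (cell t)}"])
      show "u (s - 2 * \<sigma> * of_int (cell t)) = Z s" if "s \<in> {a + 2 * \<sigma> * of_int (cell t)<..<b + 2 * \<sigma> * of_int (cell t)}" for s
        using Z_cell[of s "cell t"] ub[of "s - 2 * \<sigma> * of_int (cell t)"] that ab by auto
    qed (use ab in \<open>auto simp: r_def\<close>)
    moreover have "Z t = u r" using ub[of r] ab by (simp add: Zr)
    ultimately show ?thesis using X by simp
  qed
  have tr: "\<theta>0 + t = (\<theta>0 + r) + 2 * \<sigma> * of_int (cell t)" by (simp add: r_def)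
  show ?thesis
  proof (cases "0 < r")
    case True
    then have "Z t = zm r" "snd (Z t) < 0" using neg[of r] r by (auto simp: Zr base_def)
    moreover have "(Z has_vector_derivative Xm (\<theta>0 + t) (Z t)) (at t)"
      by (rule der[of zm Xm 0 \<tau>, OF zm(2)]) (use r True \<sigma>_pos \<tau> zm(1)[of r] in \<open>auto simp: base_def tr per_int\<close>)
    ultimately show ?thesis by simp
  next
    case False
    then have "Z t = zp r" "snd (Z t) > 0" using pos[of r] r r0 by (auto simp: Zr base_def)
    moreover have "(Z has_vector_derivative Xp (\<theta>0 + t) (Z t)) (at t)"
      by (rule der[of zp Xp "\<tau> - 2 * \<sigma>" 0, OF zp(2)]) (use r r0 False \<sigma>_pos \<tau> zp(1)[of r] glue in \<open>auto simp: base_def tr per_int\<close>)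
    ultimately show ?thesis by simp
  qed
qed

lemma Z_zero:
  assumes "snd (Z t) = 0"
  obtains n where "t = 2 * \<sigma> * of_int n" | n where "t = \<tau> + 2 * \<sigma> * of_int n"
proof -
  define r where "r = t - 2 * \<sigma> * of_int (cell t)"
  have Zr: "Z t = base r" by (simp add: Z_def r_def)
  have r: "\<tau> - 2 * \<sigma> \<le> r" "r < \<tau>" using cell_bounds[of t] by (auto simp: r_def)
  have "r = 0 \<or> r = \<tau> - 2 * \<sigma>"
    using assms neg[of r] pos[of r] r by (force simp: Zr base_def split: if_splits)
  then show thesis
  proof
    assume "r = 0"
    then show thesis using that(1)[of "cell t"] by (simp add: r_def)
  next
    assume "r = \<tau> - 2 * \<sigma>"
    then have "t = \<tau> + 2 * \<sigma> * of_int (cell t - 1)" by (simp add: r_def algebra_simps)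
    then show thesis by (rule that(2))
  qed
qed

definition orbit :: "real \<Rightarrow> real \<times> plane" where
  "orbit s = (\<theta>0 + s, Z s)"

lemma crossing_near:
  shows "\<exists>\<kappa>>0. \<exists>c>0. \<forall>t z. \<bar>t - \<theta>0\<bar> \<le> \<kappa> \<and> norm (z - zm 0) \<le> \<kappa> \<longrightarrow> z \<in> D \<and> snd (Xm t z) \<le> - c \<and> snd (Xp t z) \<le> - c"
    and "\<exists>\<kappa>>0. \<exists>c>0. \<forall>t z. \<bar>t - (\<theta>0 + \<tau>)\<bar> \<le> \<kappa> \<and> norm (z - zm \<tau>) \<le> \<kappa> \<longrightarrow> z \<in> D \<and> snd (Xm t z) \<ge> c \<and> snd (Xp t z) \<ge> c"
proof -
  have near: "\<exists>\<kappa>>0. \<forall>t z. \<bar>t - t0\<bar> \<le> \<kappa> \<and> norm (z - z0) \<le> \<kappa> \<longrightarrow> z \<in> D \<and> \<bar>snd (X t z) - snd (X t0 z0)\<bar> < c"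
    if X: "continuous_on (UNIV \<times> D) (\<lambda>(t, z). X t z)" and z0: "z0 \<in> D" and c: "0 < c"
    for X :: "real \<Rightarrow> plane \<Rightarrow> plane" and t0 z0 c
  proof -
    have "isCont (\<lambda>(t, z). X t z) (t0, z0)"
      using X z0 D by (auto simp: continuous_on_eq_continuous_at open_Times)
    then obtain d where d: "d > 0" "\<And>p. dist p (t0, z0) < d \<Longrightarrow> dist (case p of (t, z) \<Rightarrow> X t z) (X t0 z0) < c"
      using c unfolding continuous_at_eps_delta by force
    obtain e where e: "e > 0" "ball z0 e \<subseteq> D" using D z0 open_contains_ball by blast
    define \<kappa> where "\<kappa> = min d e / 3"
    have \<kappa>: "0 < \<kappa>" "3 * \<kappa> \<le> d" "3 * \<kappa> \<le> e" using d e by (auto simp: \<kappa>_def)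
    show ?thesis
    proof (intro exI[of _ \<kappa>] conjI \<kappa>(1) allI impI)
      fix t z assume tz: "\<bar>t - t0\<bar> \<le> \<kappa> \<and> norm (z - z0) \<le> \<kappa>"
      have "dist (t, z) (t0, z0) \<le> \<bar>t - t0\<bar> + norm (z - z0)"
        using norm_Pair_le[of "t - t0" "z - z0"] by (simp add: dist_norm)
      then have "dist (t, z) (t0, z0) < d" using tz \<kappa> by linarith
      from d(2)[OF this] have "norm (X t z - X t0 z0) < c" by (simp add: dist_norm)
      then show "\<bar>snd (X t z) - snd (X t0 z0)\<bar> < c" using abs_snd_le_norm[of "X t z - X t0 z0"] by simp
      have "z \<in> ball z0 e" using tz \<kappa> by (simp add: dist_norm norm_minus_commute)
      then show "z \<in> D" using e by blast
    qed
  qed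
  \<comment> \<open>The factor \<open>r\<close>, which is 1 or -1, treats upward and downward
    crossings at once.\<close>
  have both: "\<exists>\<kappa>>0. \<exists>c>0. \<forall>t z. \<bar>t - t0\<bar> \<le> \<kappa> \<and> norm (z - z0) \<le> \<kappa> \<longrightarrow> z \<in> D \<and> c \<le> r * snd (Xm t z) \<and> c \<le> r * snd (Xp t z)"
    if z0: "z0 \<in> D" and r: "\<bar>r\<bar> = 1" and s: "0 < r * snd (Xm t0 z0)" "0 < r * snd (Xp t0 z0)" for t0 z0 r
  proof -
    define c where "c = min (r * snd (Xm t0 z0)) (r * snd (Xp t0 z0)) / 2"
    have c: "0 < c" "2 * c \<le> r * snd (Xm t0 z0)" "2 * c \<le> r * snd (Xp t0 z0)" using s by (auto simp: c_def)
    obtain k1 where k1: "k1 > 0" "\<And>t z. \<bar>t - t0\<bar> \<le> k1 \<and> norm (z - z0) \<le> k1 \<Longrightarrow> z \<in> D \<and> \<bar>snd (Xm t z) - snd (Xm t0 z0)\<bar> < c"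
      using near[OF Xm_cont z0 c(1)] by blast
    obtain k2 where k2: "k2 > 0" "\<And>t z. \<bar>t - t0\<bar> \<le> k2 \<and> norm (z - z0) \<le> k2 \<Longrightarrow> z \<in> D \<and> \<bar>snd (Xp t z) - snd (Xp t0 z0)\<bar> < c"
      using near[OF Xp_cont z0 c(1)] by blast
    have sgn: "c \<le> r * y" if "\<bar>y - x\<bar> < c" "2 * c \<le> r * x" for x y
    proof -
      have "\<bar>r * y - r * x\<bar> = \<bar>y - x\<bar>" using r by (simp add: right_diff_distrib[symmetric] abs_mult)
      then show ?thesis using that by linarith
    qed
    show ?thesis
    proof (rule exI[of _ "min k1 k2"], intro conjI exI[of _ c] c(1) allI impI)
      show "0 < min k1 k2" using k1 k2 by simp
      fix t z assume tz: "\<bar>t - t0\<bar> \<le> min k1 k2 \<and> norm (z - z0) \<le> min k1 k2"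
      show "z \<in> D" "c \<le> r * snd (Xm t z)" "c \<le> r * snd (Xp t z)"
        using k1(2)[of t z] k2(2)[of t z] tz sgn[OF _ c(2)] sgn[OF _ c(3)] by simp_all
    qed
  qed
  have z0: "zm 0 \<in> D" "zm \<tau> \<in> D" using zm(1) \<tau> by auto
  from both[OF z0(1), of "-1" \<theta>0] cross0
  show "\<exists>\<kappa>>0. \<exists>c>0. \<forall>t z. \<bar>t - \<theta>0\<bar> \<le> \<kappa> \<and> norm (z - zm 0) \<le> \<kappa> \<longrightarrow> z \<in> D \<and> snd (Xm t z) \<le> - c \<and> snd (Xp t z) \<le> - c"
    by (simp add: le_minus_iff)
  from both[OF z0(2), of 1 "\<theta>0 + \<tau>"] cross1
  show "\<exists>\<kappa>>0. \<exists>c>0. \<forall>t z. \<bar>t - (\<theta>0 + \<tau>)\<bar> \<le> \<kappa> \<and> norm (z - zm \<tau>) \<le> \<kappa> \<longrightarrow> z \<in> D \<and> snd (Xm t z) \<ge> c \<and> snd (Xp t z) \<ge> c"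
    by simp
qed

lemma orbit_crossing_periodic: "crossing_periodic \<sigma> D Xp Xm orbit"
  unfolding crossing_periodic_def filippov_solution_def
proof (intro conjI allI impI)
  show "snd (orbit s) \<in> D" for s by (simp add: orbit_def Z_in_D)
  show "orbit (s + 2 * \<sigma>) = orbit s + (2 * \<sigma>, 0)" for s by (simp add: orbit_def Z_period)
  show "absolutely_continuous_on {a..b} orbit" for a b
  proof -
    obtain C where C: "C-lipschitz_on {a..b} Z" using Z_lipschitz by blast
    have "1-lipschitz_on {a..b} (\<lambda>s. \<theta>0 + s)" by (rule lipschitz_onI) (auto simp: dist_real_def)
    from lipschitz_on_Pair[OF this C] show ?thesis
      unfolding orbit_def[abs_def] by (rule lipschitz_imp_absolutely_continuous)
  qed
  \<comment> \<open>A derivative may be missing only at the crossing times, which form a countable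
    and hence null set.\<close>
  define N where "N = range (\<lambda>n::int. 2 * \<sigma> * of_int n) \<union> range (\<lambda>n::int. \<tau> + 2 * \<sigma> * of_int n)"
  show "AE s in lebesgue. \<exists>v\<in>filippov_set Xp Xm (orbit s). (orbit has_vector_derivative v) (at s)"
  proof (rule AE_I'[of N])
    have "countable N" by (auto simp: N_def)
    then show "N \<in> null_sets lebesgue" by (intro null_sets_completionI countable_imp_null_set_lborel)
    show "{s \<in> space lebesgue. \<not> (\<exists>v\<in>filippov_set Xp Xm (orbit s). (orbit has_vector_derivative v) (at s))} \<subseteq> N"
    proof (rule subsetI, rule ccontr)
      fix s assume s: "s \<in> {s \<in> space lebesgue. \<not> (\<exists>v\<in>filippov_set Xp Xm (orbit s). (orbit has_vector_derivative v) (at s))}" "s \<notin> N"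
      have Zs: "snd (Z s) \<noteq> 0"
      proof
        assume "snd (Z s) = 0"
        then show False by (rule Z_zero) (use s(2) in \<open>auto simp: N_def\<close>)
      qed
      define X where "X = (if snd (Z s) < 0 then Xm else Xp)"
      have "(orbit has_vector_derivative ext_field X (orbit s)) (at s)"
        using Z_derivative[OF Zs] unfolding has_vector_derivative_def orbit_def[abs_def] ext_field_def X_def
        by (auto intro!: derivative_eq_intros)
      moreover have "ext_field X (orbit s) \<in> filippov_set Xp Xm (orbit s)"
        using Zs by (auto simp: filippov_set_def orbit_def X_def)
      ultimately show False using s(1) by blast
    qed
  qed
  fix s assume "snd (snd (orbit s)) = 0"
  then have Zs: "snd (Z s) = 0" by (simp add: orbit_def)
  then show "crossing_point Xp Xm (orbit s)"
  proof (rule Z_zero)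
    fix n assume n: "s = 2 * \<sigma> * of_int n"
    have "Z s = zm 0" using Z_cell[of s n] n \<tau> by (simp add: base_def)
    then show ?thesis
      using Zs per_int[of "zm 0" \<theta>0 n] zm(1)[of 0] \<tau> cross0
      by (simp add: crossing_point_def orbit_def n mult_neg_neg)
  next
    fix n assume n: "s = \<tau> + 2 * \<sigma> * of_int n"
    have "Z s = zm \<tau>" using Z_cell[of s n] n \<tau> by (simp add: base_def)
    then show ?thesis
      using Zs per_int[of "zm \<tau>" "\<theta>0 + \<tau>" n] zm(1)[of \<tau>] \<tau> cross1
      by (simp add: crossing_point_def orbit_def n add.assoc)
  qed
qed

text \<open>Away from the crossing times the given orbit has a positive distance from \<Sigma>, so a
  close curve lies on the same side. Near a crossing time both fields have second components of one
  sign on a whole neighbourhood, so the height of the close curve is strictly monotone and vanishes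
  once. Between its zeros the curve is a classical solution of one field. Writing it over the phase
  removes the freedom of time translation.\<close>

lemma nearby_crossing_orbit:
  assumes \<kappa>: "0 < \<kappa>"
  shows "\<exists>\<delta>>0. \<delta> \<le> \<kappa> \<and>
    (\<forall>w. crossing_periodic \<sigma> D Xp Xm w \<and> (\<forall>s. norm (snd (w s) - Z (fst (w s) - \<theta>0)) < \<delta>) \<longrightarrow>
      (\<exists>Z' t0 t1. range w = range (\<lambda>t. (\<theta>0 + t, Z' t)) \<and> (\<forall>t. Z' (t + 2 * \<sigma>) = Z' t) \<and>
        (\<forall>t. norm (Z' t - Z t) < \<delta>) \<and> (\<forall>t. Z' t \<in> D) \<and> \<bar>t0\<bar> < \<kappa> \<and> \<bar>t1 - \<tau>\<bar> < \<kappa> \<and> t0 < t1 \<and> t1 < t0 + 2 * \<sigma> \<and>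
        snd (Z' t0) = 0 \<and> snd (Z' t1) = 0 \<and>
        (\<forall>t\<in>{t0..t1}. (Z' has_vector_derivative Xm (\<theta>0 + t) (Z' t)) (at t within {t0..t1})) \<and>
        (\<forall>t\<in>{t1 - 2 * \<sigma>..t0}. (Z' has_vector_derivative Xp (\<theta>0 + t) (Z' t)) (at t within {t1 - 2 * \<sigma>..t0}))))"
proof -
  obtain k1 c1 where k1: "0 < k1" and c1: "0 < c1" and near0:
    "\<And>t z. \<bar>t - \<theta>0\<bar> \<le> k1 \<and> norm (z - zm 0) \<le> k1 \<Longrightarrow> z \<in> D \<and> snd (Xm t z) \<le> - c1 \<and> snd (Xp t z) \<le> - c1"
    using crossing_near(1) by blast
  obtain k2 c2 where k2: "0 < k2" and c2: "0 < c2" and near1: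
    "\<And>t z. \<bar>t - (\<theta>0 + \<tau>)\<bar> \<le> k2 \<and> norm (z - zm \<tau>) \<le> k2 \<Longrightarrow> z \<in> D \<and> snd (Xm t z) \<ge> c2 \<and> snd (Xp t z) \<ge> c2"
    using crossing_near(2) by blast
  have isC: "isCont Z t" for t using Z_cont[of UNIV] by (simp add: continuous_on_eq_continuous_at)
  have "\<exists>d>0. \<forall>t. \<bar>t - 0\<bar> < d \<longrightarrow> norm (Z t - Z 0) < k1 / 2"
    using isC[of 0, unfolded continuous_at_eps_delta, rule_format, of "k1 / 2"] k1
    by (simp add: dist_norm)
  then obtain d1 where d1: "0 < d1" "\<And>t. \<bar>t\<bar> < d1 \<Longrightarrow> norm (Z t - Z 0) < k1 / 2" by auto
  have "\<exists>d>0. \<forall>t. \<bar>t - \<tau>\<bar> < d \<longrightarrow> norm (Z t - Z \<tau>) < k2 / 2"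
    using isC[of \<tau>, unfolded continuous_at_eps_delta, rule_format, of "k2 / 2"] k2
    by (simp add: dist_norm)
  then obtain d2 where d2: "0 < d2" "\<And>t. \<bar>t - \<tau>\<bar> < d2 \<Longrightarrow> norm (Z t - Z \<tau>) < k2 / 2" by auto
  \<comment> \<open>The factor 3 keeps the windows of half-width \<eta> about 0 and \<tau> inside
    the neighbourhoods where the slopes are controlled, and apart from each other and from the next
    period.\<close>
  have "\<exists>\<eta>>0. \<forall>x\<in>{\<kappa> / 3, k1 / 3, k2 / 3, d1 / 3, d2 / 3, \<tau> / 3, (2 * \<sigma> - \<tau>) / 3}. \<eta> \<le> x"
    by (rule common_lower_bound) (use \<kappa> k1 k2 d1(1) d2(1) \<tau> in auto)
  then obtain \<eta> where \<eta>: "0 < \<eta>" and "\<forall>x\<in>{\<kappa> / 3, k1 / 3, k2 / 3, d1 / 3, d2 / 3, \<tau> / 3, (2 * \<sigma> - \<tau>) / 3}. \<eta> \<le> x"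
    by blast
  then have \<eta>3: "3 * \<eta> \<le> \<kappa>" "3 * \<eta> \<le> k1" "3 * \<eta> \<le> k2" "3 * \<eta> \<le> d1" "3 * \<eta> \<le> d2" "3 * \<eta> \<le> \<tau>" "3 * \<eta> \<le> 2 * \<sigma> - \<tau>"
    by simp_all
  have Z0: "Z 0 = zm 0" "Z \<tau> = zm \<tau>" using Z_zm \<tau> by auto
  obtain \<mu>1 where \<mu>1: "0 < \<mu>1" "\<And>t. t \<in> {\<eta>..\<tau> - \<eta>} \<Longrightarrow> snd (Z t) \<le> - \<mu>1"
  proof -
    have "{\<eta>..\<tau> - \<eta>} \<noteq> {}" using \<eta>3 \<eta> by auto
    from continuous_attains_sup[OF compact_Icc this continuous_on_snd[OF Z_cont]]
    obtain x where x: "x \<in> {\<eta>..\<tau> - \<eta>}" "\<And>t. t \<in> {\<eta>..\<tau> - \<eta>} \<Longrightarrow> snd (Z t) \<le> snd (Z x)" by blast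
    have "snd (Z x) < 0" using x(1) \<eta> neg[of x] Z_zm[of x] by auto
    then show thesis using x by (intro that[of "- snd (Z x)"]) auto
  qed
  obtain \<mu>2 where \<mu>2: "0 < \<mu>2" "\<And>t. t \<in> {\<tau> - 2 * \<sigma> + \<eta>..- \<eta>} \<Longrightarrow> \<mu>2 \<le> snd (Z t)"
  proof -
    have "{\<tau> - 2 * \<sigma> + \<eta>..- \<eta>} \<noteq> {}" using \<eta>3 \<eta> by auto
    from continuous_attains_inf[OF compact_Icc this continuous_on_snd[OF Z_cont]]
    obtain x where x: "x \<in> {\<tau> - 2 * \<sigma> + \<eta>..- \<eta>}" "\<And>t. t \<in> {\<tau> - 2 * \<sigma> + \<eta>..- \<eta>} \<Longrightarrow> snd (Z x) \<le> snd (Z t)" by blast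
    have "snd (Z x) > 0" using x(1) \<eta> pos[of x] Z_zp[of x] by auto
    then show thesis using x by (intro that[of "snd (Z x)"]) auto
  qed
  \<comment> \<open>\<open>\<mu>1\<close> and \<open>\<mu>2\<close> preserve the sign away from the
    crossings; taking half of \<open>k1\<close> and \<open>k2\<close> leaves the other half for the
    motion of \<open>Z\<close> itself.\<close>
  have "\<exists>\<delta>>0. \<forall>x\<in>{\<kappa>, k1 / 2, k2 / 2, \<mu>1, \<mu>2}. \<delta> \<le> x"
    by (rule common_lower_bound) (use \<kappa> k1 k2 \<mu>1(1) \<mu>2(1) in auto)
  then obtain \<delta> where \<delta>: "0 < \<delta>" and "\<forall>x\<in>{\<kappa>, k1 / 2, k2 / 2, \<mu>1, \<mu>2}. \<delta> \<le> x" by blast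
  then have \<delta>_le: "\<delta> \<le> \<kappa>" "\<delta> \<le> k1 / 2" "\<delta> \<le> k2 / 2" "\<delta> \<le> \<mu>1" "\<delta> \<le> \<mu>2" by simp_all
  show ?thesis
  proof (intro exI[of _ \<delta>] conjI \<delta> \<delta>_le(1) allI impI; elim conjE)
    fix w assume w: "crossing_periodic \<sigma> D Xp Xm w" and close': "\<forall>s. norm (snd (w s) - Z (fst (w s) - \<theta>0)) < \<delta>"
    note close = close'[rule_format]
    have fil: "filippov_solution D Xp Xm w" using w by (simp add: crossing_periodic_def)
    obtain w_cont: "\<And>S. continuous_on S w" by (rule filippov_solution_integral[OF fil]) blast
    \<comment> \<open>\<open>w\<close> may start anywhere on its orbit. \<open>d\<close> is its time
      offset, and \<open>Z'\<close> is the same curve parametrized by the phase relative to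
      \<open>\<theta>0\<close>.\<close>
    define d where "d = fst (w 0) - \<theta>0"
    have fst_w: "fst (w s) = \<theta>0 + (s + d)" for s using filippov_solution_time[OF fil, of s] by (simp add: d_def)
    define Z' where "Z' t = snd (w (t - d))" for t
    have w_eq: "w s = (\<theta>0 + (s + d), Z' (s + d))" for s using fst_w[of s] by (simp add: Z'_def prod_eq_iff)
    have w_eq': "w (t - d) = (\<theta>0 + t, Z' t)" for t using w_eq[of "t - d"] by simp
    have Z'_close: "norm (Z' t - Z t) < \<delta>" for t using close[of "t - d"] by (simp add: w_eq')
    have Z'_cont: "continuous_on S Z'" for S
      unfolding Z'_def by (intro continuous_intros continuous_on_compose2[OF w_cont[of UNIV]]) auto
    have Z'_D: "Z' t \<in> D" for t using fil by (simp add: Z'_def filippov_solution_def)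
    have Z'_per: "Z' (t + 2 * \<sigma>) = Z' t" for t
    proof -
      have "w ((t - d) + 2 * \<sigma>) = w (t - d) + (2 * \<sigma>, 0)" using w by (simp add: crossing_periodic_def)
      moreover have "(t - d) + 2 * \<sigma> = (t + 2 * \<sigma>) - d" by simp
      ultimately show ?thesis unfolding Z'_def by (metis add.right_neutral snd_add snd_conv)
    qed
    have range: "range w = range (\<lambda>t. (\<theta>0 + t, Z' t))"
    proof (intro equalityI subsetI)
      fix p assume "p \<in> range w"
      then show "p \<in> range (\<lambda>t. (\<theta>0 + t, Z' t))" using w_eq by auto
    next
      fix p assume "p \<in> range (\<lambda>t. (\<theta>0 + t, Z' t))"
      then obtain t where "p = w (t - d)" using w_eq' by auto
      then show "p \<in> range w" by blast
    qed
    have snd_close: "\<bar>snd (Z' t) - snd (Z t)\<bar> < \<delta>" for t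
      using abs_snd_le_norm[of "Z' t - Z t"] Z'_close[of t] by simp
    have dec: "snd (Z' b) - snd (Z' a) \<le> - c1 * (b - a)" if "a \<le> b" "- \<eta> \<le> a" "b \<le> \<eta>" for a b
    proof -
      have "snd (snd (w (b - d))) - snd (snd (w (a - d))) \<le> - c1 * ((b - d) - (a - d))"
      proof (rule filippov_solution_slope(1)[OF fil])
        fix s assume "s \<in> {a - d..b - d}"
        then have s: "\<bar>s + d\<bar> \<le> \<eta>" using that by auto
        have "norm (Z (s + d) - Z 0) < k1 / 2" using s \<eta>3(4) \<eta> by (intro d1(2)) auto
        then have "norm (Z' (s + d) - zm 0) \<le> k1"
          using Z'_close[of "s + d"] \<delta>_le(2) norm_triangle_ineq[of "Z' (s + d) - Z (s + d)" "Z (s + d) - Z 0"] Z0 by simp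
        moreover have "\<bar>\<theta>0 + (s + d) - \<theta>0\<bar> \<le> k1" using s \<eta>3(2) \<eta> by simp
        ultimately show "snd (Xm (fst (w s)) (snd (w s))) \<le> - c1 \<and> snd (Xp (fst (w s)) (snd (w s))) \<le> - c1"
          using near0[of "\<theta>0 + (s + d)" "Z' (s + d)"] unfolding w_eq[of s] fst_conv snd_conv by blast
      qed (use that in simp)
      then show ?thesis by (simp add: w_eq')
    qed
    have inc: "c2 * (b - a) \<le> snd (Z' b) - snd (Z' a)" if "a \<le> b" "\<tau> - \<eta> \<le> a" "b \<le> \<tau> + \<eta>" for a b
    proof -
      have "c2 * ((b - d) - (a - d)) \<le> snd (snd (w (b - d))) - snd (snd (w (a - d)))"
      proof (rule filippov_solution_slope(2)[OF fil])
        fix s assume "s \<in> {a - d..b - d}"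
        then have s: "\<bar>s + d - \<tau>\<bar> \<le> \<eta>" using that by auto
        have "norm (Z (s + d) - Z \<tau>) < k2 / 2" using s \<eta>3(5) \<eta> by (intro d2(2)) auto
        then have "norm (Z' (s + d) - zm \<tau>) \<le> k2"
          using Z'_close[of "s + d"] \<delta>_le(3) norm_triangle_ineq[of "Z' (s + d) - Z (s + d)" "Z (s + d) - Z \<tau>"] Z0 by simp
        moreover have "\<bar>\<theta>0 + (s + d) - (\<theta>0 + \<tau>)\<bar> \<le> k2" using s \<eta>3(3) \<eta> by simp
        ultimately show "c2 \<le> snd (Xm (fst (w s)) (snd (w s))) \<and> c2 \<le> snd (Xp (fst (w s)) (snd (w s)))"
          using near1[of "\<theta>0 + (s + d)" "Z' (s + d)"] unfolding w_eq[of s] fst_conv snd_conv by blast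
      qed (use that in simp)
      then show ?thesis by (simp add: w_eq')
    qed
    have mid_neg: "snd (Z' t) < 0" if "t \<in> {\<eta>..\<tau> - \<eta>}" for t
      using \<mu>1(2)[OF that] snd_close[of t] \<delta>_le(4) by linarith
    have mid_pos: "0 < snd (Z' t)" if "t \<in> {\<tau> - 2 * \<sigma> + \<eta>..- \<eta>}" for t
      using \<mu>2(2)[OF that] snd_close[of t] \<delta>_le(5) by linarith
    have Z'_end: "snd (Z' \<eta>) < 0" "0 < snd (Z' (- \<eta>))" "snd (Z' (\<tau> - \<eta>)) < 0" "0 < snd (Z' (\<tau> + \<eta>))"
    proof -
      show "snd (Z' \<eta>) < 0" "0 < snd (Z' (- \<eta>))" "snd (Z' (\<tau> - \<eta>)) < 0"
        using \<eta>3 \<eta> by (auto intro!: mid_neg mid_pos)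
      \<comment> \<open>The time \<open>\<tau> + \<eta>\<close> lies beyond the period under
        consideration, so the sign is read off one period earlier, in the range of
        \<open>mid_pos\<close>.\<close>
      have "0 < snd (Z' (\<tau> - 2 * \<sigma> + \<eta>))" using \<eta>3 \<eta> by (auto intro!: mid_pos)
      also have "Z' (\<tau> - 2 * \<sigma> + \<eta>) = Z' (\<tau> + \<eta>)" using Z'_per[of "\<tau> - 2 * \<sigma> + \<eta>"] by (simp add: algebra_simps)
      finally show "0 < snd (Z' (\<tau> + \<eta>))" .
    qed
    obtain t0 where t0: "- \<eta> \<le> t0" "t0 \<le> \<eta>" "snd (Z' t0) = 0"
      using IVT2'[of "\<lambda>t. snd (Z' t)" \<eta> 0 "- \<eta>"] Z'_end \<eta> Z'_cont by (auto intro!: continuous_intros)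
    obtain t1 where t1: "\<tau> - \<eta> \<le> t1" "t1 \<le> \<tau> + \<eta>" "snd (Z' t1) = 0"
      using IVT'[of "\<lambda>t. snd (Z' t)" "\<tau> - \<eta>" 0 "\<tau> + \<eta>"] Z'_end \<eta> Z'_cont by (auto intro!: continuous_intros)
    have neg': "snd (Z' t) < 0" if t: "t0 < t" "t < t1" for t
    proof -
      consider "t \<le> \<eta>" | "t \<in> {\<eta>..\<tau> - \<eta>}" | "\<tau> - \<eta> \<le> t" by fastforce
      then show ?thesis
      proof cases
        case 1
        have "0 < c1 * (t - t0)" using c1 t by simp
        then show ?thesis using dec[of t0 t] t0 t 1 by simp
      next
        case 3
        have "0 < c2 * (t1 - t)" using c2 t by simp
        then show ?thesis using inc[of t t1] t1 t 3 by simp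
      qed (rule mid_neg)
    qed
    have pos': "0 < snd (Z' t)" if t: "t1 - 2 * \<sigma> < t" "t < t0" for t
    proof -
      consider "- \<eta> \<le> t" | "t \<in> {\<tau> - 2 * \<sigma> + \<eta>..- \<eta>}" | "t \<le> \<tau> - 2 * \<sigma> + \<eta>" by fastforce
      then show ?thesis
      proof cases
        case 1
        have "0 < c1 * (t0 - t)" using c1 t by simp
        then show ?thesis using dec[of t t0] t0 t 1 by simp
      next
        case 3
        have "0 < c2 * (t + 2 * \<sigma> - t1)" using c2 t by simp
        then show ?thesis using inc[of t1 "t + 2 * \<sigma>"] t1 t 3 Z'_per[of t] by simp
      qed (rule mid_pos)
    qed
    have order: "t0 < t1" "t1 < t0 + 2 * \<sigma>" using t0 t1 \<eta>3 \<eta> by auto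
    have lift: "(Z' has_vector_derivative X (\<theta>0 + t) (Z' t)) (at t within {a..b})"
      if X: "continuous_on (UNIV \<times> D) (\<lambda>(t, z). X t z)" and t: "t \<in> {a..b}"
        and one: "\<And>r. a < r \<Longrightarrow> r < b \<Longrightarrow> filippov_set Xp Xm (\<theta>0 + r, Z' r) = {ext_field X (\<theta>0 + r, Z' r)}" for X a b t
    proof -
      have "(w has_vector_derivative ext_field X (w (t - d))) (at (t - d) within {a - d..b - d})"
      proof (rule filippov_solution_classical[OF fil X])
        show "filippov_set Xp Xm (w s) = {ext_field X (w s)}" if "a - d < s" "s < b - d" for s
          using one[of "s + d"] that by (simp add: w_eq[of s])
      qed (use t in auto)
      then have "(w has_vector_derivative ext_field X (w (t - d))) (at (t + - d) within {a + - d..b + - d})" by simp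
      from has_vector_derivative_shift[OF this]
      have "((\<lambda>s. snd (w (s + - d))) has_vector_derivative snd (ext_field X (w (t - d)))) (at t within {a..b})"
        by (rule bounded_linear.has_vector_derivative[OF bounded_linear_snd])
      then show ?thesis by (simp add: Z'_def[abs_def] ext_field_def fst_w)
    qed
    have m: "(Z' has_vector_derivative Xm (\<theta>0 + t) (Z' t)) (at t within {t0..t1})" if "t \<in> {t0..t1}" for t
      by (rule lift[OF Xm_cont that]) (use neg' in \<open>auto simp: filippov_set_def dest!: neg'\<close>)
    have p: "(Z' has_vector_derivative Xp (\<theta>0 + t) (Z' t)) (at t within {t1 - 2 * \<sigma>..t0})" if "t \<in> {t1 - 2 * \<sigma>..t0}" for t
      by (rule lift[OF Xp_cont that]) (auto simp: filippov_set_def dest!: pos')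
    have "\<bar>t0\<bar> < \<kappa>" "\<bar>t1 - \<tau>\<bar> < \<kappa>" using t0 t1 \<eta>3(1) \<eta> by (auto simp: abs_le_iff)
    then show "\<exists>Z' t0 t1. range w = range (\<lambda>t. (\<theta>0 + t, Z' t)) \<and> (\<forall>t. Z' (t + 2 * \<sigma>) = Z' t) \<and>
        (\<forall>t. norm (Z' t - Z t) < \<delta>) \<and> (\<forall>t. Z' t \<in> D) \<and> \<bar>t0\<bar> < \<kappa> \<and> \<bar>t1 - \<tau>\<bar> < \<kappa> \<and> t0 < t1 \<and> t1 < t0 + 2 * \<sigma> \<and>
        snd (Z' t0) = 0 \<and> snd (Z' t1) = 0 \<and>
        (\<forall>t\<in>{t0..t1}. (Z' has_vector_derivative Xm (\<theta>0 + t) (Z' t)) (at t within {t0..t1})) \<and>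
        (\<forall>t\<in>{t1 - 2 * \<sigma>..t0}. (Z' has_vector_derivative Xp (\<theta>0 + t) (Z' t)) (at t within {t1 - 2 * \<sigma>..t0}))"
      using range Z'_per Z'_close Z'_D order t0(3) t1(3) m p by blast
  qed
qed

end

section \<open>Signs of a deviation between its crossings\<close>

lemma slope_upper_bound:
  fixes u :: "real \<Rightarrow> real"
  assumes "a \<le> b" "\<And>t. t \<in> {a..b} \<Longrightarrow> (u has_vector_derivative u' t) (at t within {a..b})" "\<And>t. t \<in> {a..b} \<Longrightarrow> u' t \<le> c"
  shows "u b - u a \<le> c * (b - a)"
proof -
  have "(u' has_integral (u b - u a)) {a..b}" by (rule fundamental_theorem_of_calculus) (use assms in auto)
  moreover have "((\<lambda>_. c) has_integral c * (b - a)) {a..b}"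
    using has_integral_const_real[of c a b] assms(1) by (simp add: mult.commute)
  ultimately show ?thesis by (rule has_integral_le) (rule assms(3))
qed

lemma slope_lower_bound:
  fixes u :: "real \<Rightarrow> real"
  assumes "a \<le> b" "\<And>t. t \<in> {a..b} \<Longrightarrow> (u has_vector_derivative u' t) (at t within {a..b})" "\<And>t. t \<in> {a..b} \<Longrightarrow> c \<le> u' t"
  shows "c * (b - a) \<le> u b - u a"
proof -
  have "- u b - - u a \<le> - c * (b - a)"
    by (rule slope_upper_bound[OF assms(1), of "\<lambda>t. - u t" "\<lambda>t. - u' t"])
      (use assms(2,3) in \<open>auto intro!: has_vector_derivative_minus\<close>)
  then show ?thesis by simp
qed

context perturbed_tube
begin

lemma full_rate:
  assumes "deviation \<epsilon> \<zeta> \<theta> \<tau> x" "\<tau> \<le> T" "t \<in> {0..\<tau>}"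
  shows "((\<lambda>t. \<gamma> t + x t) has_vector_derivative F (\<gamma> t + x t) + \<epsilon> *\<^sub>R k t \<theta> (\<gamma> t + x t) \<epsilon>) (at t within {0..\<tau>})"
proof -
  have "(\<gamma> has_vector_derivative F (\<gamma> t)) (at t within {0..\<tau>})"
    by (rule has_vector_derivative_within_subset[OF \<gamma>']) (use assms in auto)
  moreover have "(x has_vector_derivative rate \<epsilon> \<theta> t (x t)) (at t within {0..\<tau>})"
    using assms by (simp add: deviation_def)
  ultimately have "((\<lambda>t. \<gamma> t + x t) has_vector_derivative F (\<gamma> t) + rate \<epsilon> \<theta> t (x t)) (at t within {0..\<tau>})"
    by (rule has_vector_derivative_add)
  then show ?thesis by (simp add: rate_def)
qed

text \<open>Near 0 and near \<sigma> the second component of the velocity is farther from 0 than the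
  perturbation can move it, so starting, or ending, on \<Sigma> fixes the sign of the height. In
  between, \<gamma> lies below \<Sigma> by at least \<mu> and the deviation is smaller. The
  threshold \<open>\<epsilon>2\<close> is uniform in the phase, the scaled initial value and the end
  time.\<close>

lemma deviation_sign:
  assumes \<sigma>: "0 < \<sigma>" "\<sigma> < T" and B: "0 \<le> B" and ends: "snd (\<gamma> 0) = 0"
    and signs: "snd (F (\<gamma> 0)) < 0" "0 < snd (F (\<gamma> \<sigma>))" and neg: "\<And>t. 0 < t \<Longrightarrow> t < \<sigma> \<Longrightarrow> snd (\<gamma> t) < 0"
  shows "\<exists>\<epsilon>2>0. \<forall>\<epsilon> \<zeta> \<theta> x \<tau>. 0 < \<epsilon> \<and> \<epsilon> \<le> \<epsilon>2 \<and> \<epsilon> \<in> {0..e0} \<and> \<theta> \<in> J \<and> norm \<zeta> \<le> B \<and> snd \<zeta> = 0 \<and> deviation \<epsilon> \<zeta> \<theta> T x \<and>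
      \<bar>\<tau> - \<sigma>\<bar> \<le> \<epsilon> * B \<and> snd (\<gamma> \<tau> + x \<tau>) = 0 \<longrightarrow>
      (\<forall>t. 0 < t \<and> t < \<tau> \<longrightarrow> snd (\<gamma> t + x t) < 0) \<and>
      snd (F (\<gamma> 0 + x 0) + \<epsilon> *\<^sub>R k 0 \<theta> (\<gamma> 0 + x 0) \<epsilon>) < 0 \<and> 0 < snd (F (\<gamma> \<tau> + x \<tau>) + \<epsilon> *\<^sub>R k \<tau> \<theta> (\<gamma> \<tau> + x \<tau>) \<epsilon>)"
proof -
  define f where "f t = snd (F (\<gamma> t))" for t
  have f_cont: "continuous_on {0..T} f"
    unfolding f_def
    by (intro continuous_on_snd continuous_on_compose2[OF F_cont, of _ "\<lambda>t. (t, 0)", simplified])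
      (use rho in \<open>auto intro!: continuous_intros\<close>)
  have \<gamma>_cont: "continuous_on {0..T} \<gamma>"
    using \<gamma>' by (meson continuous_on_eq_continuous_within has_vector_derivative_continuous)
  define c where "c = min (- f 0) (f \<sigma>) / 2"
  have c: "0 < c" "f 0 \<le> - 2 * c" "2 * c \<le> f \<sigma>" using signs by (auto simp: c_def f_def)
  have near: "\<exists>d>0. \<forall>t\<in>{0..T}. \<bar>t - t0\<bar> < d \<longrightarrow> \<bar>f t - f t0\<bar> < c" if "t0 \<in> {0..T}" for t0
    using f_cont[unfolded continuous_on_iff, rule_format, OF that c(1)] by (simp add: dist_real_def)
  have zT: "0 \<in> {0..T}" "\<sigma> \<in> {0..T}" using \<sigma> by auto
  obtain d1 where d1: "0 < d1" "\<And>t. t \<in> {0..T} \<Longrightarrow> \<bar>t - 0\<bar> < d1 \<Longrightarrow> \<bar>f t - f 0\<bar> < c" using near[OF zT(1)] by blast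
  obtain d2 where d2: "0 < d2" "\<And>t. t \<in> {0..T} \<Longrightarrow> \<bar>t - \<sigma>\<bar> < d2 \<Longrightarrow> \<bar>f t - f \<sigma>\<bar> < c" using near[OF zT(2)] by blast
  have "\<exists>\<kappa>>0. \<forall>x\<in>{d1 / 2, d2 / 2, \<sigma> / 3, T - \<sigma>}. \<kappa> \<le> x"
    by (rule common_lower_bound) (use d1 d2 \<sigma> in auto)
  then obtain \<kappa> where \<kappa>: "0 < \<kappa>" "\<kappa> \<le> d1 / 2" "\<kappa> \<le> d2 / 2" "\<kappa> \<le> \<sigma> / 3" "\<kappa> \<le> T - \<sigma>" by auto
  have f0: "f t \<le> - c" if "t \<in> {0..T}" "t \<le> \<kappa>" for t
    using d1(2)[OF that(1)] that \<kappa> d1(1) c(2) by (auto simp: abs_less_iff)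
  have f1: "c \<le> f t" if "t \<in> {0..T}" "\<bar>t - \<sigma>\<bar> \<le> \<kappa>" for t
  proof -
    have "\<bar>t - \<sigma>\<bar> < d2" using that(2) \<kappa>(1,3) by linarith
    from d2(2)[OF that(1) this] c(3) show ?thesis by linarith
  qed
  obtain \<mu> where \<mu>: "0 < \<mu>" "\<And>t. t \<in> {\<kappa>..\<sigma> - \<kappa>} \<Longrightarrow> snd (\<gamma> t) \<le> - \<mu>"
  proof -
    have ne: "{\<kappa>..\<sigma> - \<kappa>} \<noteq> {}" using \<kappa> by auto
    have "continuous_on {\<kappa>..\<sigma> - \<kappa>} \<gamma>" by (rule continuous_on_subset[OF \<gamma>_cont]) (use \<kappa> \<sigma> in auto)
    from continuous_attains_sup[OF compact_Icc ne continuous_on_snd[OF this]]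
    obtain x where x: "x \<in> {\<kappa>..\<sigma> - \<kappa>}" "\<And>t. t \<in> {\<kappa>..\<sigma> - \<kappa>} \<Longrightarrow> snd (\<gamma> t) \<le> snd (\<gamma> x)" by blast
    have "snd (\<gamma> x) < 0" using x(1) \<kappa> neg[of x] by auto
    then show thesis using x by (intro that[of "- snd (\<gamma> x)"]) auto
  qed
  define W where "W = radius B"
  have W: "0 \<le> W" using radius_nonneg[OF B] by (simp add: W_def)
  have LW: "0 < L * (W + 1)" using L W by (intro mult_pos_pos) auto
  \<comment> \<open>\<open>c / 2\<close> limits the change of the velocity, \<open>\<mu> / 2\<close>
    that of the position, and \<kappa> the shift of the end time.\<close>
  have "\<exists>\<epsilon>2>0. \<forall>x\<in>{c / 2 / (L * (W + 1)), \<mu> / 2 / (W + 1), \<kappa> / (B + 1)}. \<epsilon>2 \<le> x"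
    by (rule common_lower_bound) (use c \<mu> \<kappa> W B LW in \<open>auto intro!: divide_pos_pos\<close>)
  then obtain \<epsilon>2 where \<epsilon>2: "0 < \<epsilon>2" "\<epsilon>2 \<le> c / 2 / (L * (W + 1))" "\<epsilon>2 \<le> \<mu> / 2 / (W + 1)" "\<epsilon>2 \<le> \<kappa> / (B + 1)" by auto
  show ?thesis
  proof (rule exI[of _ \<epsilon>2], rule conjI[OF \<epsilon>2(1)], intro allI impI, elim conjE, intro conjI)
    fix \<epsilon> \<zeta> \<theta> x \<tau>
    assume \<epsilon>0: "0 < \<epsilon>" "\<epsilon> \<le> \<epsilon>2" and \<epsilon>: "\<epsilon> \<in> {0..e0}" and \<theta>: "\<theta> \<in> J" and \<zeta>: "norm \<zeta> \<le> B" "snd \<zeta> = 0" and x: "deviation \<epsilon> \<zeta> \<theta> T x"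
      and \<tau>: "\<bar>\<tau> - \<sigma>\<bar> \<le> \<epsilon> * B" and x\<tau>: "snd (\<gamma> \<tau> + x \<tau>) = 0"
    have \<epsilon>b: "\<epsilon> * (L * (W + 1)) \<le> c / 2" "\<epsilon> * (W + 1) \<le> \<mu> / 2" "\<epsilon> * (B + 1) \<le> \<kappa>"
    proof -
      have "\<epsilon> \<le> c / 2 / (L * (W + 1))" "\<epsilon> \<le> \<mu> / 2 / (W + 1)" "\<epsilon> \<le> \<kappa> / (B + 1)" using \<epsilon>0 \<epsilon>2 by linarith+
      then show "\<epsilon> * (L * (W + 1)) \<le> c / 2" "\<epsilon> * (W + 1) \<le> \<mu> / 2" "\<epsilon> * (B + 1) \<le> \<kappa>"
        using LW W B by (simp_all only: pos_le_divide_eq add_nonneg_pos zero_less_one)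
    qed
    have "\<epsilon> * B \<le> \<kappa>" using \<epsilon>b(3) \<epsilon>0 by (simp add: algebra_simps)
    with \<tau> have \<tau>\<kappa>: "\<bar>\<tau> - \<sigma>\<bar> \<le> \<kappa>" by simp
    then have \<tau>T: "\<tau> \<in> {0..T}" "\<sigma> - \<kappa> \<le> \<tau>" using \<kappa> \<sigma> by (auto simp: abs_le_iff)
    define h where "h t = snd (\<gamma> t + x t)" for t
    define g where "g t = snd (F (\<gamma> t + x t) + \<epsilon> *\<^sub>R k t \<theta> (\<gamma> t + x t) \<epsilon>)" for t
    have xb: "norm (x t) \<le> \<epsilon> * W" if "t \<in> {0..T}" for t
      using deviation_bound[OF x \<epsilon> \<theta> order_refl \<zeta>(1) that] by (simp add: W_def)
    have h': "(h has_vector_derivative g t) (at t within {a..b})" if "t \<in> {a..b}" "0 \<le> a" "b \<le> T" for t a b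
    proof -
      have "(h has_vector_derivative g t) (at t within {0..T})"
        unfolding h_def g_def using that
        by (intro bounded_linear.has_vector_derivative[OF bounded_linear_snd] full_rate[OF x order_refl]) auto
      then show ?thesis by (rule has_vector_derivative_within_subset) (use that in auto)
    qed
    have gf: "\<bar>g t - f t\<bar> \<le> c / 2" if t: "t \<in> {0..T}" for t
    proof -
      have "g t - f t = snd (rate \<epsilon> \<theta> t (x t))" by (simp add: g_def f_def rate_def)
      then have "\<bar>g t - f t\<bar> \<le> norm (rate \<epsilon> \<theta> t (x t))" using abs_snd_le_norm by simp
      also have "\<dots> \<le> L * norm (x t) + \<epsilon> * L"
        using x t by (intro rate_bound[OF t \<theta> \<epsilon>]) (simp add: deviation_def)
      also have "\<dots> \<le> L * (\<epsilon> * W) + \<epsilon> * L" using L_mono[OF xb[OF t]] by simp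
      also have "\<dots> \<le> c / 2" using \<epsilon>b(1) by (simp add: algebra_simps)
      finally show ?thesis .
    qed
    have g0: "g t \<le> - (c / 2)" if "t \<in> {0..T}" "t \<le> \<kappa>" for t
      using gf[OF that(1)] f0[OF that] by linarith
    have g1: "c / 2 \<le> g t" if "t \<in> {0..T}" "\<bar>t - \<sigma>\<bar> \<le> \<kappa>" for t
      using gf[OF that(1)] f1[OF that] by linarith
    have h0: "h 0 = 0" using x ends \<zeta>(2) by (simp add: h_def deviation_def)
    have h\<tau>: "h \<tau> = 0" using x\<tau> by (simp add: h_def)
    show "\<forall>t. 0 < t \<and> t < \<tau> \<longrightarrow> snd (\<gamma> t + x t) < 0"
    proof (intro allI impI, elim conjE)
      fix t assume t: "0 < t" "t < \<tau>"
      consider "t \<le> \<kappa>" | "t \<in> {\<kappa>..\<sigma> - \<kappa>}" | "\<sigma> - \<kappa> \<le> t" by fastforce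
      then have "h t < 0"
      proof cases
        case 1
        have "h t - h 0 \<le> - (c / 2) * (t - 0)"
          by (rule slope_upper_bound[where u'=g]) (use t \<tau>T 1 in \<open>auto intro!: h' g0\<close>)
        also have "\<dots> < 0" using c t by simp
        finally show ?thesis using h0 by simp
      next
        case 2
        then have "t \<in> {0..T}" using t \<tau>T by auto
        from xb[OF this] have "\<bar>snd (x t)\<bar> \<le> \<epsilon> * W" using abs_snd_le_norm[of "x t"] by simp
        moreover have "\<epsilon> * W \<le> \<mu> / 2" using \<epsilon>b(2) \<epsilon>0 by (simp add: algebra_simps)
        ultimately show ?thesis using \<mu>(2)[OF 2] \<mu>(1) by (simp add: h_def)
      next
        case 3
        have "c / 2 * (\<tau> - t) \<le> h \<tau> - h t"
        proof (rule slope_lower_bound[where u'=g])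
          fix r assume r: "r \<in> {t..\<tau>}"
          show "(h has_vector_derivative g r) (at r within {t..\<tau>})" by (rule h') (use r t \<tau>T in auto)
          have "\<bar>r - \<sigma>\<bar> \<le> \<kappa>" using r 3 \<tau>\<kappa> by (simp add: abs_le_iff)
          then show "c / 2 \<le> g r" using r t \<tau>T by (intro g1) auto
        qed (use t in simp)
        moreover have "0 < c / 2 * (\<tau> - t)" using c t by simp
        ultimately show ?thesis using h\<tau> by simp
      qed
      then show "snd (\<gamma> t + x t) < 0" by (simp add: h_def)
    qed
    show "snd (F (\<gamma> 0 + x 0) + \<epsilon> *\<^sub>R k 0 \<theta> (\<gamma> 0 + x 0) \<epsilon>) < 0"
      using g0[of 0] c \<sigma> \<kappa>(1) by (simp add: g_def)
    show "0 < snd (F (\<gamma> \<tau> + x \<tau>) + \<epsilon> *\<^sub>R k \<tau> \<theta> (\<gamma> \<tau> + x \<tau>) \<epsilon>)"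
      using g1[OF \<tau>T(1) \<tau>\<kappa>] c by (simp add: g_def)
  qed
qed

end

section \<open>Reflection of the upper half and assembly of the orbit\<close>

lemma reflect_simps [simp]: "reflect (reflect z) = z" "fst (reflect z) = fst z" "snd (reflect z) = - snd z"
  by (simp_all add: reflect_def)

lemma reflect_fixed: "snd z = 0 \<Longrightarrow> reflect z = z"
  by (simp add: reflect_def prod_eq_iff)

lemma reflect_linear: "linear reflect"
  by (rule linearI) (simp_all add: reflect_def)

lemma norm_reflect [simp]: "norm (reflect z) = norm z"
  by (simp add: reflect_def norm_prod_def)

lemma reflect_diff: "reflect a - reflect b = reflect (a - b)"
  by (simp add: reflect_def)

lemma reflected_reversed_derivative:
  assumes u: "(u has_vector_derivative v) (at (- t) within {- b..- a})"
  shows "((\<lambda>s. reflect (u (- s))) has_vector_derivative - reflect v) (at t within {a..b})"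
proof -
  have 1: "((\<lambda>s. - s) has_vector_derivative - 1) (at t within {a..b})" by (auto intro!: derivative_eq_intros)
  have "(\<lambda>s. - s) ` {a..b} = {- b..- a}" by simp
  with vector_diff_chain_within[OF 1, of u v] u
  have "((\<lambda>s. u (- s)) has_vector_derivative - v) (at t within {a..b})" by (simp add: o_def)
  from bounded_linear.has_vector_derivative[OF _ this, of reflect] reflect_linear
  show ?thesis by (simp add: linear_conv_bounded_linear linear_neg[OF reflect_linear])
qed

text \<open>\<open>Xp_eq\<close> is the reversal: in reflected position and reversed time the upper
  field becomes \<open>F\<close> plus the perturbation \<open>kp\<close>, seen at phase
  \<open>\<theta> - t\<close>. The conditions \<open>signs\<close> say that \<gamma> leaves \<Sigma>
  downwards and returns to it from below.\<close>

locale bifurcation = melnikov +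
  fixes D :: "plane set" and Xm Xp :: "real \<Rightarrow> real \<Rightarrow> plane \<Rightarrow> plane"
  assumes D: "open D" and D_reflect: "\<And>z. z \<in> D \<Longrightarrow> reflect z \<in> D"
    and tube: "\<And>t a. t \<in> {0..T} \<Longrightarrow> norm a \<le> \<rho> \<Longrightarrow> \<gamma> t + a \<in> D"
    and start: "snd (\<gamma> 0) = 0" and signs: "snd (F (\<gamma> 0)) < 0" "0 < snd (F (\<gamma> \<sigma>))"
    and neg: "\<And>t. 0 < t \<Longrightarrow> t < \<sigma> \<Longrightarrow> snd (\<gamma> t) < 0"
    and Xm_eq: "\<And>z \<epsilon> t \<theta>. z \<in> D \<Longrightarrow> \<epsilon> \<in> {0..e0} \<Longrightarrow> Xm \<epsilon> (\<theta> + t) z = F z + \<epsilon> *\<^sub>R km t \<theta> z \<epsilon>"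
    and Xp_eq: "\<And>z \<epsilon> t \<theta>. z \<in> D \<Longrightarrow> \<epsilon> \<in> {0..e0} \<Longrightarrow> Xp \<epsilon> (\<theta> - t) (reflect z) = - reflect (F z + \<epsilon> *\<^sub>R kp t \<theta> z \<epsilon>)"
    and Xm_cont: "\<And>\<epsilon>. \<epsilon> \<in> {0..e0} \<Longrightarrow> continuous_on (UNIV \<times> D) (\<lambda>(t, z). Xm \<epsilon> t z)"
    and Xp_cont: "\<And>\<epsilon>. \<epsilon> \<in> {0..e0} \<Longrightarrow> continuous_on (UNIV \<times> D) (\<lambda>(t, z). Xp \<epsilon> t z)"
    and Xm_per: "\<And>\<epsilon> t z. \<epsilon> \<in> {0..e0} \<Longrightarrow> z \<in> D \<Longrightarrow> Xm \<epsilon> (t + 2 * \<sigma>) z = Xm \<epsilon> t z"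
    and Xp_per: "\<And>\<epsilon> t z. \<epsilon> \<in> {0..e0} \<Longrightarrow> z \<in> D \<Longrightarrow> Xp \<epsilon> (t + 2 * \<sigma>) z = Xp \<epsilon> t z"
begin

text \<open>A crossing periodic orbit in a thin tube around the constructed one decomposes into a lower and
  an upper solution between its two crossings, hence solves the bifurcation equations.\<close>

lemma isolated_orbit:
  assumes \<epsilon>: "0 < \<epsilon>" "\<epsilon> \<le> e0" and B: "\<epsilon> * B < \<sigma>" "\<epsilon> * B < T - \<sigma>" "\<epsilon> * m.radius B \<le> \<rho> / 2"
    and \<theta>: "\<theta> \<in> cball \<theta>s 1" and \<xi>: "\<bar>\<xi>\<bar> \<le> B" and s: "\<bar>s\<bar> \<le> B"
    and x: "m.deviation \<epsilon> (\<xi>, 0) \<theta> T x" and y: "p.deviation \<epsilon> (\<xi>, 0) \<theta> T y"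
    and match: "\<gamma> (\<sigma> + \<epsilon> * s) + x (\<sigma> + \<epsilon> * s) = \<gamma> (\<sigma> - \<epsilon> * s) + y (\<sigma> - \<epsilon> * s)" "snd (\<gamma> (\<sigma> + \<epsilon> * s) + x (\<sigma> + \<epsilon> * s)) = 0"
    and r: "0 < r" and uniq: "\<And>s' \<xi>' \<theta>'. \<bar>s' - s\<bar> < r \<Longrightarrow> \<bar>\<xi>' - \<xi>\<bar> < r \<Longrightarrow> \<bar>\<theta>' - \<theta>\<bar> < r \<Longrightarrow>
        \<bar>s'\<bar> \<le> B \<and> \<bar>\<xi>'\<bar> \<le> B \<and> \<bar>\<theta>' - \<theta>s\<bar> \<le> 1 \<and> (matched \<epsilon> s' \<xi>' \<theta>' \<longrightarrow> s' = s \<and> \<xi>' = \<xi> \<and> \<theta>' = \<theta>)"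
    and xneg: "\<And>t. 0 < t \<Longrightarrow> t < \<sigma> + \<epsilon> * s \<Longrightarrow> snd (\<gamma> t + x t) < 0"
      "snd (F (\<gamma> 0 + x 0) + \<epsilon> *\<^sub>R km 0 \<theta> (\<gamma> 0 + x 0) \<epsilon>) < 0"
      "0 < snd (F (\<gamma> (\<sigma> + \<epsilon> * s) + x (\<sigma> + \<epsilon> * s)) + \<epsilon> *\<^sub>R km (\<sigma> + \<epsilon> * s) \<theta> (\<gamma> (\<sigma> + \<epsilon> * s) + x (\<sigma> + \<epsilon> * s)) \<epsilon>)"
    and yneg: "\<And>t. 0 < t \<Longrightarrow> t < \<sigma> - \<epsilon> * s \<Longrightarrow> snd (\<gamma> t + y t) < 0"
      "snd (F (\<gamma> 0 + y 0) + \<epsilon> *\<^sub>R kp 0 \<theta> (\<gamma> 0 + y 0) \<epsilon>) < 0"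
      "0 < snd (F (\<gamma> (\<sigma> - \<epsilon> * s) + y (\<sigma> - \<epsilon> * s)) + \<epsilon> *\<^sub>R kp (\<sigma> - \<epsilon> * s) \<theta> (\<gamma> (\<sigma> - \<epsilon> * s) + y (\<sigma> - \<epsilon> * s)) \<epsilon>)"
  shows "\<exists>w. isolated_crossing_periodic \<sigma> D (Xp \<epsilon>) (Xm \<epsilon>) w \<and> w 0 = (\<theta>, \<gamma> 0 + \<epsilon> *\<^sub>R (\<xi>, 0))"
proof -
  have \<epsilon>e: "\<epsilon> \<in> {0..e0}" using \<epsilon> by simp
  define \<tau> where "\<tau> = \<sigma> + \<epsilon> * s"
  define \<tau>2 where "\<tau>2 = \<sigma> - \<epsilon> * s"
  have \<tau>2_eq: "\<tau>2 = 2 * \<sigma> - \<tau>" by (simp add: \<tau>_def \<tau>2_def)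
  have es: "\<bar>\<epsilon> * s\<bar> \<le> \<epsilon> * B" using s \<epsilon> by (simp add: abs_mult)
  have \<tau>: "0 < \<tau>" "\<tau> < T" "0 < \<tau>2" "\<tau>2 < T" using es B by (auto simp: \<tau>_def \<tau>2_def)
  have n\<xi>: "norm (\<xi>, 0::real) \<le> B" using \<xi> by simp
  have xr: "norm (x t) \<le> \<rho> / 2" and yr: "norm (y t) \<le> \<rho> / 2" if "t \<in> {0..T}" for t
    using m.deviation_bound[OF x \<epsilon>e \<theta> order_refl n\<xi> that] p.deviation_bound[OF y \<epsilon>e \<theta> order_refl n\<xi> that] B(3) by auto
  have xD: "\<gamma> t + x t \<in> D" and yD: "\<gamma> t + y t \<in> D" if "t \<in> {0..T}" for t
    using tube[OF that] xr[OF that] yr[OF that] m.rho by auto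
  define zm where "zm t = \<gamma> t + x t" for t
  \<comment> \<open>Undoes the reflection and the time reversal of the upper half; its time runs
    over \<open>{- \<tau>2..0}\<close>, which is \<open>{\<tau> - 2 * \<sigma>..0}\<close>.\<close>
  define zp where "zp t = reflect (\<gamma> (- t) + y (- t))" for t
  have x0: "x 0 = \<epsilon> *\<^sub>R (\<xi>, 0)" "y 0 = \<epsilon> *\<^sub>R (\<xi>, 0)" using x y by (auto simp: m.deviation_def p.deviation_def)
  have zp0: "zp 0 = zm 0" using start by (simp add: zp_def zm_def x0 reflect_fixed)
  have snd_zm\<tau>: "snd (zm \<tau>) = 0" using match(2) by (simp add: zm_def \<tau>_def)
  have y\<tau>2: "\<gamma> \<tau>2 + y \<tau>2 = zm \<tau>" using match(1) by (simp add: zm_def \<tau>_def \<tau>2_def)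
  have zp\<tau>: "zp (\<tau> - 2 * \<sigma>) = zm \<tau>" using y\<tau>2 snd_zm\<tau> by (simp add: zp_def \<tau>2_eq reflect_fixed)
  have orbit: "switching_orbit D (Xm \<epsilon>) (Xp \<epsilon>) \<sigma> \<theta> \<tau> zm zp"
  proof
    show "open D" by (rule D)
    show "continuous_on (UNIV \<times> D) (\<lambda>(t, z). Xm \<epsilon> t z)" "continuous_on (UNIV \<times> D) (\<lambda>(t, z). Xp \<epsilon> t z)"
      by (rule Xm_cont[OF \<epsilon>e], rule Xp_cont[OF \<epsilon>e])
    show "Xm \<epsilon> (t + 2 * \<sigma>) z = Xm \<epsilon> t z" "Xp \<epsilon> (t + 2 * \<sigma>) z = Xp \<epsilon> t z" if "z \<in> D" for t z
      by (rule Xm_per[OF \<epsilon>e that], rule Xp_per[OF \<epsilon>e that])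
    show "0 < \<tau>" "\<tau> < 2 * \<sigma>" using \<tau> \<tau>2_eq by auto
    show "zm t \<in> D" if "t \<in> {0..\<tau>}" for t using xD[of t] that \<tau> by (simp add: zm_def)
    show "(zm has_vector_derivative Xm \<epsilon> (\<theta> + t) (zm t)) (at t within {0..\<tau>})" if t: "t \<in> {0..\<tau>}" for t
    proof -
      have tT: "t \<in> {0..T}" using t \<tau> by auto
      have "(zm has_vector_derivative F (zm t) + \<epsilon> *\<^sub>R km t \<theta> (zm t) \<epsilon>) (at t within {0..\<tau>})"
        unfolding zm_def using m.full_rate[OF m.deviation_restrict[OF x] _ t] \<tau> by simp
      then show ?thesis using Xm_eq[OF xD[OF tT] \<epsilon>e] by (simp add: zm_def)
    qed
    show "zp t \<in> D" if "t \<in> {\<tau> - 2 * \<sigma>..0}" for t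
      unfolding zp_def by (rule D_reflect, rule yD) (use that \<tau> \<tau>2_eq in auto)
    show "(zp has_vector_derivative Xp \<epsilon> (\<theta> + t) (zp t)) (at t within {\<tau> - 2 * \<sigma>..0})" if t: "t \<in> {\<tau> - 2 * \<sigma>..0}" for t
    proof -
      have t': "- t \<in> {0..\<tau>2}" "- t \<in> {0..T}" using t \<tau>2_eq \<tau> by auto
      have "((\<lambda>t. \<gamma> t + y t) has_vector_derivative F (\<gamma> (- t) + y (- t)) + \<epsilon> *\<^sub>R kp (- t) \<theta> (\<gamma> (- t) + y (- t)) \<epsilon>) (at (- t) within {0..\<tau>2})"
        using p.full_rate[OF p.deviation_restrict[OF y] _ t'(1)] \<tau> by simp
      then have "((\<lambda>t. \<gamma> t + y t) has_vector_derivative F (\<gamma> (- t) + y (- t)) + \<epsilon> *\<^sub>R kp (- t) \<theta> (\<gamma> (- t) + y (- t)) \<epsilon>) (at (- t) within {- 0..- (\<tau> - 2 * \<sigma>)})"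
        by (simp add: \<tau>2_eq)
      from reflected_reversed_derivative[OF this] show ?thesis
        using Xp_eq[OF yD[OF t'(2)] \<epsilon>e, of \<theta> "- t"] by (simp add: zp_def[abs_def])
    qed
    show "zp 0 = zm 0" "zp (\<tau> - 2 * \<sigma>) = zm \<tau>" "snd (zm \<tau>) = 0" by fact+
    show "snd (zm 0) = 0" using start by (simp add: zm_def x0)
    show "snd (zm t) < 0" if "0 < t" "t < \<tau>" for t using xneg(1) that by (simp add: zm_def \<tau>_def)
    show "0 < snd (zp t)" if "\<tau> - 2 * \<sigma> < t" "t < 0" for t
      using yneg(1)[of "- t"] that \<tau>2_eq by (simp add: zp_def \<tau>2_def)
    show "snd (Xm \<epsilon> \<theta> (zm 0)) < 0" using Xm_eq[OF xD[of 0] \<epsilon>e, of \<theta> 0] xneg(2) \<tau> by (simp add: zm_def)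
    show "snd (Xp \<epsilon> \<theta> (zm 0)) < 0"
      using Xp_eq[OF yD[of 0] \<epsilon>e, of \<theta> 0] yneg(2) \<tau> zp0 by (simp add: zp_def)
    show "0 < snd (Xm \<epsilon> (\<theta> + \<tau>) (zm \<tau>))" using Xm_eq[OF xD[of \<tau>] \<epsilon>e, of \<theta> \<tau>] xneg(3) \<tau> by (simp add: zm_def \<tau>_def)
    \<comment> \<open>The end of the lower arc is the start of the upper arc one period later, so
      the phases \<open>\<theta> + \<tau>\<close> and \<open>\<theta> - \<tau>2\<close> are
      identified by periodicity.\<close>
    have "Xp \<epsilon> (\<theta> + \<tau>) (zm \<tau>) = Xp \<epsilon> (\<theta> - \<tau>2) (zm \<tau>)"
      using Xp_per[OF \<epsilon>e, of "zm \<tau>" "\<theta> - \<tau>2"] xD[of \<tau>] \<tau> by (simp add: zm_def \<tau>2_eq)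
    also have "\<dots> = - reflect (F (zm \<tau>) + \<epsilon> *\<^sub>R kp \<tau>2 \<theta> (zm \<tau>) \<epsilon>)"
      using Xp_eq[OF xD[of \<tau>] \<epsilon>e, of \<theta> \<tau>2] \<tau> snd_zm\<tau> by (simp add: zm_def reflect_fixed)
    finally show "0 < snd (Xp \<epsilon> (\<theta> + \<tau>) (zm \<tau>))"
      using yneg(3) y\<tau>2 by (simp add: \<tau>2_def)
  qed
  interpret O: switching_orbit D "Xm \<epsilon>" "Xp \<epsilon>" \<sigma> \<theta> \<tau> zm zp by (rule orbit)
  obtain C where C: "\<And>a b. C-lipschitz_on {a..b} O.Z" using O.Z_lipschitz by blast
  have C0: "0 \<le> C" using C lipschitz_on_nonneg by blast
  have Z_lip: "norm (O.Z a - O.Z b) \<le> C * \<bar>a - b\<bar>" for a b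
    using lipschitz_onD[OF C[of "min a b" "max a b"], of a b] by (simp add: dist_norm)
  have L: "1 \<le> L" by (rule m.L)
  have pos: "0 < 3 + C" "0 < 2 * (1 + 3 * C + 2 * L)" using C0 L by auto
  have "\<exists>\<kappa>>0. \<forall>x\<in>{\<epsilon> * r / (3 + C), r, \<rho> / (2 * (1 + 3 * C + 2 * L)), (T - \<tau>) / 2, (T - \<tau>2) / 2}. \<kappa> \<le> x"
    by (rule common_lower_bound) (use \<epsilon> r pos m.rho \<tau> in \<open>auto intro!: divide_pos_pos mult_pos_pos\<close>)
  then obtain \<kappa> where \<kappa>: "0 < \<kappa>" "\<kappa> \<le> \<epsilon> * r / (3 + C)" "\<kappa> \<le> r" "\<kappa> \<le> \<rho> / (2 * (1 + 3 * C + 2 * L))" "\<kappa> \<le> (T - \<tau>) / 2" "\<kappa> \<le> (T - \<tau>2) / 2"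
    by auto
  have \<kappa>C: "\<kappa> * (3 + C) \<le> \<epsilon> * r" "\<kappa> * (2 * (1 + 3 * C + 2 * L)) \<le> \<rho>"
    using \<kappa>(2,4) by (simp_all only: pos_le_divide_eq[OF pos(1)] pos_le_divide_eq[OF pos(2)])
  \<comment> \<open>The arcs of a close orbit may last up to \<open>2 * \<kappa>\<close> longer than
    those of the given one. Beyond the end \<open>t1\<close>, the curves \<open>u\<close> and
    \<gamma> are controlled through their Lipschitz constants, which gives the factor
    \<open>C + L\<close>.\<close>
  have tube_near: "norm (u' t - \<gamma> t) \<le> \<rho>"
    if ux: "\<And>t. t \<in> {0..t1} \<Longrightarrow> u t = \<gamma> t + z t \<and> norm (z t) \<le> \<rho> / 2" and u: "\<And>a b. norm (u a - u b) \<le> C * \<bar>a - b\<bar>"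
      and t1: "0 < t1" "t1 < T" "\<kappa> \<le> (T - t1) / 2" and u': "norm (u' t - u t) \<le> \<kappa> + C * \<kappa>" and t: "t \<in> {0..t1 + 2 * \<kappa>}"
    for u z u' t t1
  proof -
    have "norm (u t - \<gamma> t) \<le> \<rho> / 2 + 2 * \<kappa> * (C + L)"
    proof (cases "t \<le> t1")
      case True
      have "0 \<le> 2 * \<kappa> * (C + L)" using \<kappa>(1) C0 L by simp
      with ux[of t] True t show ?thesis by simp
    next
      case False
      have tT: "t \<in> {0..T}" "t1 \<in> {0..T}" using t t1 by auto
      have eq: "u t - \<gamma> t = (u t - u t1) + z t1 - (\<gamma> t - \<gamma> t1)" using ux[of t1] t1 by simp
      have "norm (u t - \<gamma> t) \<le> norm (u t - u t1) + norm (z t1) + norm (\<gamma> t - \<gamma> t1)"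
        unfolding eq by (intro order_trans[OF norm_triangle_ineq4] add_right_mono norm_triangle_ineq)
      also have "\<dots> \<le> C * (2 * \<kappa>) + \<rho> / 2 + L * (2 * \<kappa>)"
      proof (intro add_mono)
        have tt: "\<bar>t - t1\<bar> \<le> 2 * \<kappa>" using False t by auto
        show "norm (u t - u t1) \<le> C * (2 * \<kappa>)" using u[of t t1] mult_left_mono[OF tt C0] by (rule order_trans)
        show "norm (z t1) \<le> \<rho> / 2" using ux[of t1] t1 by simp
        show "norm (\<gamma> t - \<gamma> t1) \<le> L * (2 * \<kappa>)" using m.\<gamma>_lip[OF tT] m.L_mono[OF tt] by (rule order_trans)
      qed
      finally show ?thesis by (simp add: algebra_simps)
    qed
    then have "norm (u' t - \<gamma> t) \<le> (\<kappa> + C * \<kappa>) + (\<rho> / 2 + 2 * \<kappa> * (C + L))"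
      using u' norm_triangle_ineq[of "u' t - u t" "u t - \<gamma> t"] by simp
    also have "\<dots> \<le> \<rho>" using \<kappa>C(2) by (simp add: algebra_simps)
    finally show ?thesis .
  qed
  obtain \<delta> where \<delta>: "0 < \<delta>" "\<delta> \<le> \<kappa>" and near:
    "\<And>w. crossing_periodic \<sigma> D (Xp \<epsilon>) (Xm \<epsilon>) w \<and> (\<forall>s. norm (snd (w s) - O.Z (fst (w s) - \<theta>)) < \<delta>) \<Longrightarrow>
      \<exists>Z' t0 t1. range w = range (\<lambda>t. (\<theta> + t, Z' t)) \<and> (\<forall>t. Z' (t + 2 * \<sigma>) = Z' t) \<and>
        (\<forall>t. norm (Z' t - O.Z t) < \<delta>) \<and> (\<forall>t. Z' t \<in> D) \<and> \<bar>t0\<bar> < \<kappa> \<and> \<bar>t1 - \<tau>\<bar> < \<kappa> \<and> t0 < t1 \<and> t1 < t0 + 2 * \<sigma> \<and>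
        snd (Z' t0) = 0 \<and> snd (Z' t1) = 0 \<and>
        (\<forall>t\<in>{t0..t1}. (Z' has_vector_derivative Xm \<epsilon> (\<theta> + t) (Z' t)) (at t within {t0..t1})) \<and>
        (\<forall>t\<in>{t1 - 2 * \<sigma>..t0}. (Z' has_vector_derivative Xp \<epsilon> (\<theta> + t) (Z' t)) (at t within {t1 - 2 * \<sigma>..t0}))"
    using O.nearby_crossing_orbit[OF \<kappa>(1)] by (elim exE conjE) (rule that, assumption+, blast)
  \<comment> \<open>A tube around the orbit in the extended phase space; periodicity of
    \<open>O.Z\<close> makes it invariant under the deck transformation.\<close>
  define U where "U = {p :: real \<times> plane. norm (snd p - O.Z (fst p - \<theta>)) < \<delta>}"
  have "isolated_crossing_periodic \<sigma> D (Xp \<epsilon>) (Xm \<epsilon>) O.orbit"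
    unfolding isolated_crossing_periodic_def
  proof (intro conjI exI[of _ U] allI impI)
    show "crossing_periodic \<sigma> D (Xp \<epsilon>) (Xm \<epsilon>) O.orbit" by (rule O.orbit_crossing_periodic)
    have "continuous_on UNIV (\<lambda>p :: real \<times> plane. norm (snd p - O.Z (fst p - \<theta>)))"
      by (intro continuous_intros continuous_on_compose2[OF O.Z_cont[of UNIV]]) auto
    then show "open U" unfolding U_def by (rule open_Collect_less[OF _ continuous_on_const])
    show "(p + (2 * \<sigma>, 0) \<in> U) = (p \<in> U)" for p
    proof -
      have "fst p + 2 * \<sigma> - \<theta> = (fst p - \<theta>) + 2 * \<sigma>" by simp
      then have "O.Z (fst p + 2 * \<sigma> - \<theta>) = O.Z (fst p - \<theta>)" by (simp only: O.Z_period)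
      then show ?thesis by (simp add: U_def)
    qed
    show "range O.orbit \<subseteq> U" using \<delta>(1) by (auto simp: U_def O.orbit_def)
    fix w assume w: "crossing_periodic \<sigma> D (Xp \<epsilon>) (Xm \<epsilon>) w \<and> range w \<subseteq> U"
    then have "norm (snd (w s) - O.Z (fst (w s) - \<theta>)) < \<delta>" for s by (auto simp: U_def)
    with w have "\<exists>Z' t0 t1. range w = range (\<lambda>t. (\<theta> + t, Z' t)) \<and> (\<forall>t. Z' (t + 2 * \<sigma>) = Z' t) \<and>
        (\<forall>t. norm (Z' t - O.Z t) < \<delta>) \<and> (\<forall>t. Z' t \<in> D) \<and> \<bar>t0\<bar> < \<kappa> \<and> \<bar>t1 - \<tau>\<bar> < \<kappa> \<and> t0 < t1 \<and> t1 < t0 + 2 * \<sigma> \<and>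
        snd (Z' t0) = 0 \<and> snd (Z' t1) = 0 \<and>
        (\<forall>t\<in>{t0..t1}. (Z' has_vector_derivative Xm \<epsilon> (\<theta> + t) (Z' t)) (at t within {t0..t1})) \<and>
        (\<forall>t\<in>{t1 - 2 * \<sigma>..t0}. (Z' has_vector_derivative Xp \<epsilon> (\<theta> + t) (Z' t)) (at t within {t1 - 2 * \<sigma>..t0}))"
      by (intro near) simp
    then obtain Z' t0 t1 where range_w: "range w = range (\<lambda>t. (\<theta> + t, Z' t))" and Z'_per': "\<forall>t. Z' (t + 2 * \<sigma>) = Z' t"
      and Z'_close': "\<forall>t. norm (Z' t - O.Z t) < \<delta>" and Z'_D': "\<forall>t. Z' t \<in> D" and t0: "\<bar>t0\<bar> < \<kappa>" and t1: "\<bar>t1 - \<tau>\<bar> < \<kappa>"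
      and t01: "t0 < t1" "t1 < t0 + 2 * \<sigma>" and zero: "snd (Z' t0) = 0" "snd (Z' t1) = 0"
      and lower': "\<forall>t\<in>{t0..t1}. (Z' has_vector_derivative Xm \<epsilon> (\<theta> + t) (Z' t)) (at t within {t0..t1})"
      and upper': "\<forall>t\<in>{t1 - 2 * \<sigma>..t0}. (Z' has_vector_derivative Xp \<epsilon> (\<theta> + t) (Z' t)) (at t within {t1 - 2 * \<sigma>..t0})"
      by (elim exE conjE) (rule that, assumption+)
    note Z'_per = Z'_per'[rule_format] and Z'_close = Z'_close'[rule_format] and Z'_D = Z'_D'[rule_format]
      and lower = bspec[OF lower'] and upper = bspec[OF upper']
    \<comment> \<open>The data of the close orbit are read off at its own crossings: duration of the
      lower arc, point of the downward crossing, and phase there.\<close>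
    define \<tau>' where "\<tau>' = t1 - t0"
    define s' where "s' = (\<tau>' - \<sigma>) / \<epsilon>"
    define \<xi>' where "\<xi>' = (fst (Z' t0) - fst (\<gamma> 0)) / \<epsilon>"
    define \<theta>' where "\<theta>' = \<theta> + t0"
    have \<tau>': "\<sigma> + \<epsilon> * s' = \<tau>'" "\<sigma> - \<epsilon> * s' = 2 * \<sigma> - \<tau>'" using \<epsilon> by (simp_all add: s'_def)
    have Z0: "O.Z 0 = \<gamma> 0 + \<epsilon> *\<^sub>R (\<xi>, 0)" using O.Z_zm[of 0] \<tau> by (simp add: zm_def x0)
    have shift: "norm (Z' (t0 + t) - O.Z t) \<le> \<kappa> + C * \<kappa>" for t
    proof -
      have "norm (O.Z (t0 + t) - O.Z t) \<le> C * \<bar>t0\<bar>" using Z_lip[of "t0 + t" t] by simp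
      also have "\<dots> \<le> C * \<kappa>" using t0 C0 by (intro mult_left_mono) auto
      finally show ?thesis
        using Z'_close[of "t0 + t"] \<delta>(2) norm_triangle_ineq[of "Z' (t0 + t) - O.Z (t0 + t)" "O.Z (t0 + t) - O.Z t"] by simp
    qed
    have s'r: "\<bar>s' - s\<bar> < r"
    proof -
      have "\<epsilon> * (s' - s) = (t1 - \<tau>) - t0" using \<epsilon> by (simp add: s'_def \<tau>'_def \<tau>_def field_simps)
      then have "\<epsilon> * \<bar>s' - s\<bar> = \<bar>(t1 - \<tau>) - t0\<bar>" using \<epsilon> by (metis abs_mult abs_of_pos)
      also have "\<dots> < 2 * \<kappa>" using t0 t1 by linarith
      also have "\<dots> \<le> \<kappa> * (3 + C)" using \<kappa>(1) C0 by (simp add: algebra_simps)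
      also have "\<dots> \<le> \<epsilon> * r" by (rule \<kappa>C)
      finally show ?thesis using \<epsilon> by simp
    qed
    have \<xi>'r: "\<bar>\<xi>' - \<xi>\<bar> < r"
    proof -
      have "\<epsilon> * (\<xi>' - \<xi>) = fst (Z' (t0 + 0) - O.Z 0)" using \<epsilon> Z0 by (simp add: \<xi>'_def field_simps)
      then have "\<epsilon> * \<bar>\<xi>' - \<xi>\<bar> = \<bar>fst (Z' (t0 + 0) - O.Z 0)\<bar>" using \<epsilon> by (metis abs_mult abs_of_pos)
      also have "\<dots> \<le> \<kappa> + C * \<kappa>" using abs_fst_le_norm shift order_trans by blast
      also have "\<dots> < \<kappa> * (3 + C)" using \<kappa>(1) by (simp add: algebra_simps)
      also have "\<dots> \<le> \<epsilon> * r" by (rule \<kappa>C)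
      finally show ?thesis using \<epsilon> by simp
    qed
    have \<theta>'r: "\<bar>\<theta>' - \<theta>\<bar> < r" using t0 \<kappa>(3) by (simp add: \<theta>'_def)
    note u = uniq[OF s'r \<xi>'r \<theta>'r]
    have \<theta>': "\<theta>' \<in> cball \<theta>s 1" using u by (simp add: dist_real_def abs_minus_commute)
    have n\<xi>': "norm (\<xi>', 0::real) \<le> B" using u by simp
    have \<epsilon>R: "\<epsilon> * m.radius B \<le> \<rho>" using B(3) m.rho by simp
    \<comment> \<open>\<open>matched\<close> asks for deviations on all of \<open>{0..T}\<close>,
      whereas an arc of \<open>Z'\<close> obeys one field only up to the next crossing. Full
      deviations come from existence and are identified with the arcs by uniqueness.\<close>
    obtain X where X: "m.deviation \<epsilon> (\<xi>', 0) \<theta>' T X" using m.deviation_exists[OF \<epsilon>e \<theta>' n\<xi>' \<epsilon>R] by blast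
    obtain Y' where Y': "p.deviation \<epsilon> (\<xi>', 0) \<theta>' T Y'" using p.deviation_exists[OF \<epsilon>e \<theta>' n\<xi>' \<epsilon>R] by blast
    have Z't0: "Z' t0 - \<gamma> 0 = \<epsilon> *\<^sub>R (\<xi>', 0)" using \<epsilon> zero start by (simp add: \<xi>'_def prod_eq_iff)
    have \<tau>'T: "0 < \<tau>'" "\<tau>' \<le> \<tau> + 2 * \<kappa>" "\<tau>' \<le> T" and \<tau>2'T: "0 < 2 * \<sigma> - \<tau>'" "2 * \<sigma> - \<tau>' \<le> \<tau>2 + 2 * \<kappa>" "2 * \<sigma> - \<tau>' \<le> T"
      using t0 t1 t01 \<kappa>(5,6) by (auto simp: \<tau>'_def \<tau>2_eq)
    have devm: "m.deviation \<epsilon> (\<xi>', 0) \<theta>' \<tau>' (\<lambda>t. Z' (t0 + t) - \<gamma> t)"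
      unfolding m.deviation_def
    proof (intro conjI ballI)
      show "Z' (t0 + 0) - \<gamma> 0 = \<epsilon> *\<^sub>R (\<xi>', 0)" using Z't0 by simp
      fix t assume t: "t \<in> {0..\<tau>'}"
      show "norm (Z' (t0 + t) - \<gamma> t) \<le> \<rho>"
        by (rule tube_near[where u=O.Z and z=x and u'="\<lambda>t. Z' (t0 + t)" and ?t1.0=\<tau>])
          (use O.Z_zm xr \<tau> Z_lip \<kappa>(5) shift t \<tau>'T in \<open>auto simp: zm_def\<close>)
      have "(Z' has_vector_derivative Xm \<epsilon> (\<theta> + (t + t0)) (Z' (t + t0))) (at (t + t0) within {0 + t0..\<tau>' + t0})"
        using lower[of "t + t0"] t by (simp add: \<tau>'_def)
      from has_vector_derivative_shift[OF this]
      have "((\<lambda>t. Z' (t0 + t)) has_vector_derivative Xm \<epsilon> (\<theta> + (t + t0)) (Z' (t + t0))) (at t within {0..\<tau>'})"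
        by (simp add: add.commute)
      moreover have "(\<gamma> has_vector_derivative F (\<gamma> t)) (at t within {0..\<tau>'})"
        by (rule has_vector_derivative_within_subset[OF m.\<gamma>']) (use t \<tau>'T in auto)
      ultimately have "((\<lambda>t. Z' (t0 + t) - \<gamma> t) has_vector_derivative Xm \<epsilon> (\<theta> + (t + t0)) (Z' (t + t0)) - F (\<gamma> t)) (at t within {0..\<tau>'})"
        by (rule has_vector_derivative_diff)
      moreover have "Xm \<epsilon> (\<theta> + (t + t0)) (Z' (t + t0)) = F (Z' (t0 + t)) + \<epsilon> *\<^sub>R km t \<theta>' (Z' (t0 + t)) \<epsilon>"
        using Xm_eq[OF Z'_D \<epsilon>e, of \<theta>' t "t + t0"] by (simp add: \<theta>'_def algebra_simps)
      ultimately show "((\<lambda>t. Z' (t0 + t) - \<gamma> t) has_vector_derivative m.rate \<epsilon> \<theta>' t (Z' (t0 + t) - \<gamma> t)) (at t within {0..\<tau>'})"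
        by (simp add: m.rate_def algebra_simps)
    qed
    have devp: "p.deviation \<epsilon> (\<xi>', 0) \<theta>' (2 * \<sigma> - \<tau>') (\<lambda>t. reflect (Z' (t0 - t)) - \<gamma> t)"
      unfolding p.deviation_def
    proof (intro conjI ballI)
      show "reflect (Z' (t0 - 0)) - \<gamma> 0 = \<epsilon> *\<^sub>R (\<xi>', 0)" using Z't0 zero by (simp add: reflect_fixed)
      fix t assume t: "t \<in> {0..2 * \<sigma> - \<tau>'}"
      show "norm (reflect (Z' (t0 - t)) - \<gamma> t) \<le> \<rho>"
      proof (rule tube_near[where u="\<lambda>t. reflect (O.Z (- t))" and z=y and u'="\<lambda>t. reflect (Z' (t0 - t))" and ?t1.0=\<tau>2])
        show "reflect (O.Z (- t)) = \<gamma> t + y t \<and> norm (y t) \<le> \<rho> / 2" if "t \<in> {0..\<tau>2}" for t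
          using O.Z_zp[of "- t"] that yr[of t] \<tau> \<tau>2_eq by (simp add: zp_def)
        show "norm (reflect (O.Z (- a)) - reflect (O.Z (- b))) \<le> C * \<bar>a - b\<bar>" for a b
          using Z_lip[of "- a" "- b"] by (simp add: reflect_diff abs_minus_commute)
        show "norm (reflect (Z' (t0 - t)) - reflect (O.Z (- t))) \<le> \<kappa> + C * \<kappa>"
          using shift[of "- t"] by (simp add: reflect_diff)
      qed (use \<tau> \<kappa>(6) t \<tau>2'T in auto)
      have "(Z' has_vector_derivative Xp \<epsilon> (\<theta> + (- t + t0)) (Z' (- t + t0))) (at (- t + t0) within {- (2 * \<sigma> - \<tau>') + t0..- 0 + t0})"
        using upper[of "- t + t0"] t by (simp add: \<tau>'_def algebra_simps)
      from reflected_reversed_derivative[OF has_vector_derivative_shift[OF this]]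
      have "((\<lambda>t. reflect (Z' (t0 - t))) has_vector_derivative - reflect (Xp \<epsilon> (\<theta> + (- t + t0)) (Z' (- t + t0)))) (at t within {0..2 * \<sigma> - \<tau>'})"
        by simp
      moreover have "(\<gamma> has_vector_derivative F (\<gamma> t)) (at t within {0..2 * \<sigma> - \<tau>'})"
        by (rule has_vector_derivative_within_subset[OF m.\<gamma>']) (use t \<tau>2'T in auto)
      ultimately have "((\<lambda>t. reflect (Z' (t0 - t)) - \<gamma> t) has_vector_derivative - reflect (Xp \<epsilon> (\<theta> + (- t + t0)) (Z' (- t + t0))) - F (\<gamma> t)) (at t within {0..2 * \<sigma> - \<tau>'})"
        by (rule has_vector_derivative_diff)
      moreover have "- reflect (Xp \<epsilon> (\<theta> + (- t + t0)) (Z' (- t + t0))) = F (reflect (Z' (t0 - t))) + \<epsilon> *\<^sub>R kp t \<theta>' (reflect (Z' (t0 - t))) \<epsilon>"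
      proof -
        have phase: "\<theta> + (- t + t0) = \<theta>' - t" by (simp add: \<theta>'_def)
        show ?thesis
          unfolding phase using Xp_eq[OF D_reflect[OF Z'_D[of "t0 - t"]] \<epsilon>e, of \<theta>' t] by (simp add: linear_neg[OF reflect_linear])
      qed
      ultimately show "((\<lambda>t. reflect (Z' (t0 - t)) - \<gamma> t) has_vector_derivative p.rate \<epsilon> \<theta>' t (reflect (Z' (t0 - t)) - \<gamma> t)) (at t within {0..2 * \<sigma> - \<tau>'})"
        by (simp add: p.rate_def algebra_simps)
    qed
    have X_eq: "\<gamma> t + X t = Z' (t0 + t)" if "t \<in> {0..\<tau>'}" for t
      using m.deviation_unique[OF m.deviation_restrict[OF X \<tau>'T(3)] devm \<epsilon>e \<theta>' \<tau>'T(3) that] by simp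
    have Y_eq: "\<gamma> t + Y' t = reflect (Z' (t0 - t))" if "t \<in> {0..2 * \<sigma> - \<tau>'}" for t
      using p.deviation_unique[OF p.deviation_restrict[OF Y' \<tau>2'T(3)] devp \<epsilon>e \<theta>' \<tau>2'T(3) that] by simp
    have "matched \<epsilon> s' \<xi>' \<theta>'"
      unfolding matched_def \<tau>'
    proof (intro exI conjI)
      show "m.deviation \<epsilon> (\<xi>', 0) \<theta>' T X" "p.deviation \<epsilon> (\<xi>', 0) \<theta>' T Y'" by fact+
      have 1: "\<gamma> \<tau>' + X \<tau>' = Z' t1" using X_eq[of \<tau>'] \<tau>'T by (simp add: \<tau>'_def)
      have "t0 - (2 * \<sigma> - \<tau>') + 2 * \<sigma> = t1" by (simp add: \<tau>'_def)
      then have "Z' (t0 - (2 * \<sigma> - \<tau>')) = Z' t1" using Z'_per[of "t0 - (2 * \<sigma> - \<tau>')"] by simp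
      then have "\<gamma> (2 * \<sigma> - \<tau>') + Y' (2 * \<sigma> - \<tau>') = Z' t1"
        using Y_eq[of "2 * \<sigma> - \<tau>'"] \<tau>2'T zero by (simp add: reflect_fixed)
      with 1 show "\<gamma> \<tau>' + X \<tau>' = \<gamma> (2 * \<sigma> - \<tau>') + Y' (2 * \<sigma> - \<tau>')" by simp
      show "snd (\<gamma> \<tau>' + X \<tau>') = 0" unfolding 1 by (rule zero)
    qed
    \<comment> \<open>Equal phases give \<open>t0 = 0\<close>, equal \<open>s\<close> gives equal
      durations, and uniqueness of deviations then identifies both arcs.\<close>
    with u have eqs: "s' = s" "\<xi>' = \<xi>" "\<theta>' = \<theta>" by auto
    have t00: "t0 = 0" using eqs(3) by (simp add: \<theta>'_def)
    have \<tau>'\<tau>: "\<tau>' = \<tau>" using \<tau>'(1) eqs(1) by (simp add: \<tau>_def)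
    have 1: "Z' t = O.Z t" if t: "t \<in> {0..\<tau>}" for t
    proof -
      have "t \<in> {0..T}" using t \<tau> by auto
      from m.deviation_unique[OF X[unfolded eqs] x \<epsilon>e \<theta> order_refl this] show ?thesis
        using X_eq[of t] t t00 \<tau>'\<tau> O.Z_zm[OF t] by (simp add: zm_def)
    qed
    have 2: "Z' t = O.Z t" if t: "t \<in> {\<tau> - 2 * \<sigma>..0}" for t
    proof -
      have "- t \<in> {0..T}" using t \<tau> \<tau>2_eq by auto
      from p.deviation_unique[OF Y'[unfolded eqs] y \<epsilon>e \<theta> order_refl this]
      have "reflect (reflect (Z' t)) = O.Z t"
        using Y_eq[of "- t"] t t00 \<tau>'\<tau> O.Z_zp[OF t] by (simp add: zp_def)
      then show ?thesis by simp
    qed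
    have per: "Z' (t + 2 * \<sigma> * of_nat n) = Z' t" for t n
    proof (induction n)
      case (Suc n)
      have "t + 2 * \<sigma> * of_nat (Suc n) = (t + 2 * \<sigma> * of_nat n) + 2 * \<sigma>" by (simp add: algebra_simps)
      then show ?case using Z'_per Suc by (simp only:)
    qed simp
    have per_int: "Z' (t + 2 * \<sigma> * of_int n) = Z' t" for t n
    proof (cases n)
      case (nonneg k)
      then show ?thesis using per by simp
    next
      case (neg k)
      have "real_of_int n = - real (Suc k)" using neg by simp
      then have e: "(t + 2 * \<sigma> * of_int n) + 2 * \<sigma> * of_nat (Suc k) = t" by (simp del: of_nat_Suc)
      show ?thesis using per[of "t + 2 * \<sigma> * of_int n" "Suc k"] unfolding e by simp
    qed
    have "Z' t = O.Z t" for t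
    proof -
      define q where "q = t - 2 * \<sigma> * of_int (O.cell t)"
      have q: "\<tau> - 2 * \<sigma> \<le> q" "q < \<tau>" using O.cell_bounds[of t] by (simp_all add: q_def)
      have "Z' t = Z' q" using per_int[of q "O.cell t"] by (simp add: q_def)
      also have "\<dots> = O.Z q" using 1[of q] 2[of q] q by (cases "0 \<le> q") auto
      also have "O.Z q = O.base q" using O.Z_cell[of q 0] q by simp
      also have "\<dots> = O.Z t" using O.Z_cell[of t "O.cell t"] q by (simp add: q_def)
      finally show ?thesis .
    qed
    then have "Z' = O.Z" by (rule ext)
    then show "range w = range O.orbit" using range_w by (simp add: O.orbit_def[abs_def])
  qed
  moreover have "O.orbit 0 = (\<theta>, \<gamma> 0 + \<epsilon> *\<^sub>R (\<xi>, 0))"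
    using O.Z_zm[of 0] \<tau> by (simp add: O.orbit_def zm_def x0)
  ultimately show ?thesis by blast
qed

theorem isolated_orbits_exist:
  "\<exists>C. \<exists>\<epsilon>1. 0 < \<epsilon>1 \<and> \<epsilon>1 \<le> e0 \<and> (\<forall>\<epsilon>. 0 < \<epsilon> \<and> \<epsilon> < \<epsilon>1 \<longrightarrow>
     (\<exists>w. isolated_crossing_periodic \<sigma> D (Xp \<epsilon>) (Xm \<epsilon>) w \<and> dist (w 0) (\<theta>s, \<gamma> 0) \<le> C * \<epsilon>))"
proof -
  obtain B \<epsilon>1 C where B: "0 \<le> B" and \<epsilon>1: "0 < \<epsilon>1" and C: "0 \<le> C" and sol:
    "\<And>\<epsilon>. 0 < \<epsilon> \<Longrightarrow> \<epsilon> \<le> \<epsilon>1 \<Longrightarrow> \<epsilon> * B \<le> \<sigma> \<and> \<sigma> + \<epsilon> * B \<le> T \<and> \<epsilon> \<le> e0 \<and> \<epsilon> * m.radius B \<le> \<rho> \<and>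
      (\<exists>s \<xi> \<theta>. \<bar>s\<bar> \<le> B \<and> \<bar>\<xi>\<bar> \<le> B \<and> \<bar>\<theta> - \<theta>s\<bar> \<le> 1 \<and> \<bar>\<theta> - \<theta>s\<bar> \<le> C * \<epsilon> \<and> matched \<epsilon> s \<xi> \<theta> \<and>
        (\<exists>r>0. \<forall>s' \<xi>' \<theta>'. \<bar>s' - s\<bar> < r \<and> \<bar>\<xi>' - \<xi>\<bar> < r \<and> \<bar>\<theta>' - \<theta>\<bar> < r \<longrightarrow>
           \<bar>s'\<bar> \<le> B \<and> \<bar>\<xi>'\<bar> \<le> B \<and> \<bar>\<theta>' - \<theta>s\<bar> \<le> 1 \<and>
           (matched \<epsilon> s' \<xi>' \<theta>' \<longrightarrow> s' = s \<and> \<xi>' = \<xi> \<and> \<theta>' = \<theta>)))"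
    by (rule matching) (assumption | rule that)+
  obtain \<epsilon>m where \<epsilon>m: "0 < \<epsilon>m" "\<And>\<epsilon> \<zeta> \<theta> x \<tau>. 0 < \<epsilon> \<and> \<epsilon> \<le> \<epsilon>m \<and> \<epsilon> \<in> {0..e0} \<and> \<theta> \<in> cball \<theta>s 1 \<and> norm \<zeta> \<le> B \<and> snd \<zeta> = 0 \<and> m.deviation \<epsilon> \<zeta> \<theta> T x \<and>
      \<bar>\<tau> - \<sigma>\<bar> \<le> \<epsilon> * B \<and> snd (\<gamma> \<tau> + x \<tau>) = 0 \<Longrightarrow>
      (\<forall>t. 0 < t \<and> t < \<tau> \<longrightarrow> snd (\<gamma> t + x t) < 0) \<and>
      snd (F (\<gamma> 0 + x 0) + \<epsilon> *\<^sub>R km 0 \<theta> (\<gamma> 0 + x 0) \<epsilon>) < 0 \<and> 0 < snd (F (\<gamma> \<tau> + x \<tau>) + \<epsilon> *\<^sub>R km \<tau> \<theta> (\<gamma> \<tau> + x \<tau>) \<epsilon>)"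
    using m.deviation_sign[OF \<sigma> B start signs neg] by blast
  obtain \<epsilon>p where \<epsilon>p: "0 < \<epsilon>p" "\<And>\<epsilon> \<zeta> \<theta> x \<tau>. 0 < \<epsilon> \<and> \<epsilon> \<le> \<epsilon>p \<and> \<epsilon> \<in> {0..e0} \<and> \<theta> \<in> cball \<theta>s 1 \<and> norm \<zeta> \<le> B \<and> snd \<zeta> = 0 \<and> p.deviation \<epsilon> \<zeta> \<theta> T x \<and>
      \<bar>\<tau> - \<sigma>\<bar> \<le> \<epsilon> * B \<and> snd (\<gamma> \<tau> + x \<tau>) = 0 \<Longrightarrow>
      (\<forall>t. 0 < t \<and> t < \<tau> \<longrightarrow> snd (\<gamma> t + x t) < 0) \<and>
      snd (F (\<gamma> 0 + x 0) + \<epsilon> *\<^sub>R kp 0 \<theta> (\<gamma> 0 + x 0) \<epsilon>) < 0 \<and> 0 < snd (F (\<gamma> \<tau> + x \<tau>) + \<epsilon> *\<^sub>R kp \<tau> \<theta> (\<gamma> \<tau> + x \<tau>) \<epsilon>)"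
    using p.deviation_sign[OF \<sigma> B start signs neg] by blast
  define W where "W = m.radius B"
  have W: "0 \<le> W" using m.radius_nonneg[OF B] by (simp add: W_def)
  \<comment> \<open>Strict room below \<sigma> and \<open>T - \<sigma>\<close>, and half of the tube
    radius, are reserved for close orbits, whose arcs are slightly longer and displaced.\<close>
  have "\<exists>\<epsilon>2>0. \<forall>x\<in>{\<epsilon>1, \<epsilon>m, \<epsilon>p, e0, \<sigma> / (B + 1), (T - \<sigma>) / (B + 1), \<rho> / 2 / (W + 1)}. \<epsilon>2 \<le> x"
    by (rule common_lower_bound) (use \<epsilon>1 \<epsilon>m(1) \<epsilon>p(1) m.e0(1) \<sigma> B W m.rho in \<open>auto intro!: divide_pos_pos\<close>)
  then obtain \<epsilon>2 where \<epsilon>2: "0 < \<epsilon>2" "\<epsilon>2 \<le> \<epsilon>1" "\<epsilon>2 \<le> \<epsilon>m" "\<epsilon>2 \<le> \<epsilon>p" "\<epsilon>2 \<le> e0" "\<epsilon>2 \<le> \<sigma> / (B + 1)" "\<epsilon>2 \<le> (T - \<sigma>) / (B + 1)" "\<epsilon>2 \<le> \<rho> / 2 / (W + 1)"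
    by auto
  show ?thesis
  proof (rule exI[of _ "C + B"], rule exI[of _ \<epsilon>2], intro conjI \<epsilon>2(1,5) allI impI)
    fix \<epsilon> assume e: "0 < \<epsilon> \<and> \<epsilon> < \<epsilon>2"
    then have \<epsilon>: "0 < \<epsilon>" "\<epsilon> \<le> \<epsilon>1" "\<epsilon> \<le> \<epsilon>m" "\<epsilon> \<le> \<epsilon>p" "\<epsilon> \<le> e0" "\<epsilon> \<in> {0..e0}" using \<epsilon>2 by auto
    have "\<epsilon> < \<sigma> / (B + 1)" "\<epsilon> < (T - \<sigma>) / (B + 1)" "\<epsilon> \<le> \<rho> / 2 / (W + 1)" using e \<epsilon>2 by linarith+
    then have "\<epsilon> * (B + 1) < \<sigma>" "\<epsilon> * (B + 1) < T - \<sigma>" "\<epsilon> * (W + 1) \<le> \<rho> / 2"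
      using B W by (simp_all only: pos_less_divide_eq pos_le_divide_eq add_nonneg_pos zero_less_one)
    then have \<epsilon>B: "\<epsilon> * B < \<sigma>" "\<epsilon> * B < T - \<sigma>" "\<epsilon> * m.radius B \<le> \<rho> / 2" using \<epsilon>(1) by (simp_all add: algebra_simps W_def)
    from sol[OF \<epsilon>(1,2)] obtain s \<xi> \<theta> r where s: "\<bar>s\<bar> \<le> B" and \<xi>: "\<bar>\<xi>\<bar> \<le> B" and \<theta>: "\<bar>\<theta> - \<theta>s\<bar> \<le> 1" "\<bar>\<theta> - \<theta>s\<bar> \<le> C * \<epsilon>"
      and m: "matched \<epsilon> s \<xi> \<theta>" and r: "0 < r"
      and uniq: "\<And>s' \<xi>' \<theta>'. \<bar>s' - s\<bar> < r \<and> \<bar>\<xi>' - \<xi>\<bar> < r \<and> \<bar>\<theta>' - \<theta>\<bar> < r \<Longrightarrow>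
           \<bar>s'\<bar> \<le> B \<and> \<bar>\<xi>'\<bar> \<le> B \<and> \<bar>\<theta>' - \<theta>s\<bar> \<le> 1 \<and> (matched \<epsilon> s' \<xi>' \<theta>' \<longrightarrow> s' = s \<and> \<xi>' = \<xi> \<and> \<theta>' = \<theta>)" by blast
    from m obtain x y where x: "m.deviation \<epsilon> (\<xi>, 0) \<theta> T x" and y: "p.deviation \<epsilon> (\<xi>, 0) \<theta> T y"
      and xy: "\<gamma> (\<sigma> + \<epsilon> * s) + x (\<sigma> + \<epsilon> * s) = \<gamma> (\<sigma> - \<epsilon> * s) + y (\<sigma> - \<epsilon> * s)" "snd (\<gamma> (\<sigma> + \<epsilon> * s) + x (\<sigma> + \<epsilon> * s)) = 0"
      unfolding matched_def by blast
    have J: "\<theta> \<in> cball \<theta>s 1" using \<theta>(1) by (simp add: dist_real_def abs_minus_commute)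
    have n: "norm (\<xi>, 0::real) \<le> B" using \<xi> by simp
    have es: "\<bar>\<sigma> + \<epsilon> * s - \<sigma>\<bar> \<le> \<epsilon> * B" "\<bar>\<sigma> - \<epsilon> * s - \<sigma>\<bar> \<le> \<epsilon> * B" using s \<epsilon>(1) by (simp_all add: abs_mult)
    have xneg: "(\<forall>t. 0 < t \<and> t < \<sigma> + \<epsilon> * s \<longrightarrow> snd (\<gamma> t + x t) < 0) \<and>
      snd (F (\<gamma> 0 + x 0) + \<epsilon> *\<^sub>R km 0 \<theta> (\<gamma> 0 + x 0) \<epsilon>) < 0 \<and>
      0 < snd (F (\<gamma> (\<sigma> + \<epsilon> * s) + x (\<sigma> + \<epsilon> * s)) + \<epsilon> *\<^sub>R km (\<sigma> + \<epsilon> * s) \<theta> (\<gamma> (\<sigma> + \<epsilon> * s) + x (\<sigma> + \<epsilon> * s)) \<epsilon>)"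
      by (rule \<epsilon>m(2)[of \<epsilon> \<theta> "(\<xi>, 0)"]) (intro conjI \<epsilon> J n x es xy(2), simp)
    have yneg: "(\<forall>t. 0 < t \<and> t < \<sigma> - \<epsilon> * s \<longrightarrow> snd (\<gamma> t + y t) < 0) \<and>
      snd (F (\<gamma> 0 + y 0) + \<epsilon> *\<^sub>R kp 0 \<theta> (\<gamma> 0 + y 0) \<epsilon>) < 0 \<and>
      0 < snd (F (\<gamma> (\<sigma> - \<epsilon> * s) + y (\<sigma> - \<epsilon> * s)) + \<epsilon> *\<^sub>R kp (\<sigma> - \<epsilon> * s) \<theta> (\<gamma> (\<sigma> - \<epsilon> * s) + y (\<sigma> - \<epsilon> * s)) \<epsilon>)"
      by (rule \<epsilon>p(2)[of \<epsilon> \<theta> "(\<xi>, 0)"]) (intro conjI \<epsilon> J n y es xy(2)[unfolded xy(1)], simp)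
    obtain w where w: "isolated_crossing_periodic \<sigma> D (Xp \<epsilon>) (Xm \<epsilon>) w" "w 0 = (\<theta>, \<gamma> 0 + \<epsilon> *\<^sub>R (\<xi>, 0))"
      using isolated_orbit[OF \<epsilon>(1,5) \<epsilon>B J \<xi> s x y xy r] uniq xneg yneg by blast
    \<comment> \<open>The phase contributes at most \<open>C * \<epsilon>\<close>, and the initial
      point, displaced by \<open>\<epsilon> * \<xi>\<close> along \<Sigma>, at most
      \<open>\<epsilon> * B\<close>.\<close>
    have "dist (w 0) (\<theta>s, \<gamma> 0) = norm (\<theta> - \<theta>s, \<epsilon> *\<^sub>R (\<xi>, 0::real))" by (simp add: w(2) dist_norm)
    also have "\<dots> \<le> \<bar>\<theta> - \<theta>s\<bar> + norm (\<epsilon> *\<^sub>R (\<xi>, 0::real))" using norm_Pair_le[of "\<theta> - \<theta>s" "\<epsilon> *\<^sub>R (\<xi>, 0::real)"] by (simp only: real_norm_def)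
    also have "norm (\<epsilon> *\<^sub>R (\<xi>, 0::real)) = \<epsilon> * \<bar>\<xi>\<bar>" using \<epsilon>(1) by (simp add: abs_mult)
    also have "\<bar>\<theta> - \<theta>s\<bar> + \<epsilon> * \<bar>\<xi>\<bar> \<le> C * \<epsilon> + \<epsilon> * B" using \<theta>(2) \<xi> \<epsilon>(1) by (intro add_mono mult_left_mono) auto
    finally have "dist (w 0) (\<theta>s, \<gamma> 0) \<le> (C + B) * \<epsilon>" by (simp add: algebra_simps)
    with w(1) show "\<exists>w. isolated_crossing_periodic \<sigma> D (Xp \<epsilon>) (Xm \<epsilon>) w \<and> dist (w 0) (\<theta>s, \<gamma> 0) \<le> (C + B) * \<epsilon>" by blast
  qed
qed

end

section \<open>The Melnikov function as a parameter integral\<close>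

context perturbed_tube
begin

text \<open>Only the forcing depends on the phase, with Lipschitz constant \<open>L\<close>. By
  Gronwall's inequality this supplies the Lipschitz constant of \<open>mm\<close> and
  \<open>mp\<close>.\<close>

lemma variation_phase_lipschitz:
  assumes v: "variation \<zeta> \<theta> v" and w: "variation \<zeta> \<theta>' w" and \<theta>: "\<theta> \<in> J" "\<theta>' \<in> J" and t: "t \<in> {0..T}"
  shows "norm (v t - w t) \<le> L * T * exp (L * T) * \<bar>\<theta> - \<theta>'\<bar>"
proof -
  let ?u' = "\<lambda>t. (A t (v t) + k t \<theta> (\<gamma> t) 0) - (A t (w t) + k t \<theta>' (\<gamma> t) 0)"
  have "norm (v t - w t) \<le> (norm (v 0 - w 0) + L * \<bar>\<theta> - \<theta>'\<bar> * t) * exp (L * t)"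
  proof (rule gronwall_vector_derivative[where u'="?u'" and T=T])
    fix t assume t: "t \<in> {0..T}"
    show "((\<lambda>t. v t - w t) has_vector_derivative ?u' t) (at t within {0..T})"
      using v w t by (intro derivative_intros) (auto simp: variation_def)
    have "?u' t = A t (v t - w t) + (k t \<theta> (\<gamma> t) 0 - k t \<theta>' (\<gamma> t) 0)"
      using linear_diff[OF A_linear[OF t]] by simp
    also have "norm \<dots> \<le> L * norm (v t - w t) + L * \<bar>\<theta> - \<theta>'\<bar>"
      using k_phase[OF t \<theta>, of 0 0] rho e0 by (intro norm_triangle_le add_mono A_bound[OF t]) auto
    finally show "norm (?u' t) \<le> L * norm (v t - w t) + L * \<bar>\<theta> - \<theta>'\<bar>" .
  qed (use L t in auto)
  also have "v 0 - w 0 = 0" using v w by (simp add: variation_def)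
  also have "(norm (0::plane) + L * \<bar>\<theta> - \<theta>'\<bar> * t) * exp (L * t) \<le> (L * \<bar>\<theta> - \<theta>'\<bar> * T) * exp (L * T)"
    using t L by (intro mult_mono) (auto intro!: mult_left_mono)
  finally show ?thesis by (simp add: mult_ac)
qed

lemma forcing_cont: "\<theta> \<in> J \<Longrightarrow> continuous_on {0..T} (\<lambda>t. k t \<theta> (\<gamma> t) 0)"
  using rho e0 by (intro continuous_on_compose2[OF k_cont, of \<theta> 0 _ "\<lambda>t. (t, 0)", simplified])
    (auto intro!: continuous_intros)

end

context flow_tube
begin

interpretation N: perturbed_tube F A \<gamma> T \<rho> L "\<lambda>_ _ _ _. 0" UNIV 1
  by (rule unperturbed)

text \<open>Joins two descriptions of one matrix: as fundamental solution, for which variation of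
  constants holds, and as derivative of the flow, in which the Melnikov function is written. With
  zero forcing the variation from \<zeta> is \<open>Y t \<zeta>\<close>, which links it to the
  differentiability of the flow and to the return time identity.\<close>

lemma flow_deriv_fundamental:
  obtains Y where "\<And>t. t \<in> {0..T} \<Longrightarrow> linear (Y t)" "\<And>t. t \<in> {0..T} \<Longrightarrow> bij (Y t)" "Y 0 = id"
    "\<And>g. continuous_on {0..T} g \<Longrightarrow> continuous_on {0..T} (\<lambda>t. inv (Y t) (g t))"
    "\<And>g c t. continuous_on {0..T} g \<Longrightarrow> t \<in> {0..T} \<Longrightarrow>
      ((\<lambda>t. Y t (c + integral {0..t} (\<lambda>s. inv (Y s) (g s)))) has_vector_derivative
        A t (Y t (c + integral {0..t} (\<lambda>s. inv (Y s) (g s)))) + g t) (at t within {0..T})"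
    "\<And>t. t \<in> {0..T} \<Longrightarrow> flow_deriv F D t (\<gamma> 0) = Y t"
    "\<And>x0 r r' \<sigma>. \<gamma> 0 = (x0, 0) \<Longrightarrow> (r has_real_derivative r') (at x0) \<Longrightarrow> r x0 = \<sigma> \<Longrightarrow> 0 < \<sigma> \<Longrightarrow> \<sigma> < T \<Longrightarrow>
      \<forall>\<^sub>F x in at x0. snd (flow F D (r x) (x, 0)) = 0 \<Longrightarrow> snd (\<gamma> \<sigma>) = 0 \<Longrightarrow>
      snd (Y \<sigma> (1, 0)) + r' * snd (F (\<gamma> \<sigma>)) = 0"
proof -
  obtain Y where lin: "\<And>t. t \<in> {0..T} \<Longrightarrow> linear (Y t)" and bij: "\<And>t. t \<in> {0..T} \<Longrightarrow> bij (Y t)" and Y0: "Y 0 = id"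
    and cont: "\<And>g. continuous_on {0..T} g \<Longrightarrow> continuous_on {0..T} (\<lambda>t. inv (Y t) (g t))"
    and var: "\<And>g c t. continuous_on {0..T} g \<Longrightarrow> t \<in> {0..T} \<Longrightarrow>
      ((\<lambda>t. Y t (c + integral {0..t} (\<lambda>s. inv (Y s) (g s)))) has_vector_derivative
        A t (Y t (c + integral {0..t} (\<lambda>s. inv (Y s) (g s)))) + g t) (at t within {0..T})"
    by (rule fundamental_solution) blast
  have inv0: "inv (Y s) 0 = 0" if "s \<in> {0..T}" for s
    using bij[OF that] linear_0[OF lin[OF that]] by (metis bij_is_inj inv_f_f)
  have int0: "integral {0..t} (\<lambda>s. inv (Y s) 0) = 0" if "t \<in> {0..T}" for t
    by (rule trans[OF integral_cong[where g="\<lambda>_. 0"]]) (use that in \<open>auto simp: inv0\<close>)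
  have homo: "N.variation \<zeta> \<theta> (\<lambda>t. Y t \<zeta>)" for \<zeta> \<theta>
    unfolding N.variation_def
  proof (intro conjI ballI)
    show "Y 0 \<zeta> = \<zeta>" by (simp add: Y0)
    fix t assume t: "t \<in> {0..T}"
    have "((\<lambda>t. Y t (\<zeta> + integral {0..t} (\<lambda>s. inv (Y s) 0))) has_vector_derivative A t (Y t \<zeta>) + 0) (at t within {0..T})"
      using var[of "\<lambda>_. 0" t \<zeta>] t int0[OF t] by simp
    then show "((\<lambda>t. Y t \<zeta>) has_vector_derivative A t (Y t \<zeta>) + 0) (at t within {0..T})"
      by (rule has_vector_derivative_transform[OF t, rotated]) (simp add: int0)
  qed
  show thesis
  proof (rule that[OF lin bij Y0 cont var])
    show "flow_deriv F D t (\<gamma> 0) = Y t" if t: "t \<in> {0..T}" for t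
      unfolding flow_deriv_def
      by (rule frechet_derivative_at[symmetric], rule flow_has_derivative[OF lin[OF t] _ t]) (use homo in blast)
    show "snd (Y \<sigma> (1, 0)) + r' * snd (F (\<gamma> \<sigma>)) = 0"
      if "\<gamma> 0 = (x0, 0)" "(r has_real_derivative r') (at x0)" "r x0 = \<sigma>" "0 < \<sigma>" "\<sigma> < T"
        "\<forall>\<^sub>F x in at x0. snd (flow F D (r x) (x, 0)) = 0" "snd (\<gamma> \<sigma>) = 0" for x0 r r' \<sigma>
      by (rule return_time_derivative[OF that homo])
  qed
qed

end

lemma wedge_bounded_linear: "linear Y \<Longrightarrow> bounded_linear (\<lambda>w. wedge a (Y w))" for Y :: "plane \<Rightarrow> plane"
  unfolding linear_conv_bounded_linear[symmetric]
  by (rule linearI) (simp_all add: wedge_linear linear_add linear_scale)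

lemma linear_inv_of_bij:
  assumes f: "linear f" "bij f"
  shows "linear (inv f)"
proof (rule linearI)
  note s = surj_f_inv_f[OF bij_is_surj[OF f(2)]]
  show "inv f (a + b) = inv f a + inv f b" for a b
    by (rule inv_f_eq[OF bij_is_inj[OF f(2)]]) (simp add: linear_add[OF f(1)] s)
  show "inv f (r *\<^sub>R a) = r *\<^sub>R inv f a" for r a
    by (rule inv_f_eq[OF bij_is_inj[OF f(2)]]) (simp add: linear_scale[OF f(1)] s)
qed

lemma smooth_on_continuous: "smooth_on f S \<Longrightarrow> continuous_on S f"
  unfolding smooth_on_def by (blast intro: Ck_on_continuous)

text \<open>Differentiation under the integral shows that \<open>M\<close> is continuously
  differentiable. The mean value inequality for \<open>M\<close> minus its tangent then gives a
  two-point estimate, which a derivative at the single point \<open>\<theta>s\<close> would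
  not.\<close>

lemma integral_strictly_differentiable:
  fixes \<psi> \<psi>' :: "real \<Rightarrow> real \<Rightarrow> real"
  assumes der: "\<And>\<theta> t. t \<in> {a..b} \<Longrightarrow> ((\<lambda>\<theta>. \<psi> \<theta> t) has_vector_derivative \<psi>' \<theta> t) (at \<theta>)"
    and int: "\<And>\<theta>. \<psi> \<theta> integrable_on {a..b}"
    and cont: "continuous_on (UNIV \<times> {a..b}) (\<lambda>(\<theta>, t). \<psi>' \<theta> t)"
    and M: "\<And>\<theta>. M \<theta> = integral {a..b} (\<psi> \<theta>)" and nz: "deriv M \<theta>s \<noteq> 0"
  obtains d where "0 < d" "\<And>\<theta> \<theta>'. \<bar>\<theta> - \<theta>s\<bar> \<le> d \<Longrightarrow> \<bar>\<theta>' - \<theta>s\<bar> \<le> d \<Longrightarrow>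
    \<bar>M \<theta> - M \<theta>' - deriv M \<theta>s * (\<theta> - \<theta>')\<bar> \<le> \<bar>deriv M \<theta>s\<bar> / 12 * \<bar>\<theta> - \<theta>'\<bar>"
proof -
  define M1 where "M1 \<theta> = integral {a..b} (\<psi>' \<theta>)" for \<theta>
  have M1: "(M has_vector_derivative M1 \<theta>) (at \<theta>)" for \<theta>
    using leibniz_rule_vector_derivative[of UNIV a b \<psi> \<psi>' \<theta>] der int cont
    by (simp add: M[abs_def] M1_def)
  have "continuous_on UNIV M1"
    using integral_continuous_on_param[of UNIV a b \<psi>'] cont by (simp add: M1_def[abs_def])
  then have isC: "isCont M1 \<theta>s" by (simp add: continuous_on_eq_continuous_at)
  have eq: "deriv M \<theta>s = M1 \<theta>s"
    using M1[of \<theta>s] by (simp add: DERIV_imp_deriv has_real_derivative_iff_has_vector_derivative)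
  define c where "c = \<bar>M1 \<theta>s\<bar> / 12"
  have c: "0 < c" using nz by (simp add: c_def eq)
  obtain d where d: "0 < d" "\<And>\<theta>. \<bar>\<theta> - \<theta>s\<bar> < d \<Longrightarrow> \<bar>M1 \<theta> - M1 \<theta>s\<bar> < c"
    using isC[unfolded continuous_at_eps_delta, rule_format, OF c] by (auto simp: dist_real_def)
  show thesis
  proof (rule that[of "d / 2"])
    show "0 < d / 2" using d by simp
    fix \<theta> \<theta>' assume \<theta>: "\<bar>\<theta> - \<theta>s\<bar> \<le> d / 2" "\<bar>\<theta>' - \<theta>s\<bar> \<le> d / 2"
    have "norm ((\<lambda>\<theta>. M \<theta> - M1 \<theta>s * \<theta>) \<theta> - (\<lambda>\<theta>. M \<theta> - M1 \<theta>s * \<theta>) \<theta>') \<le> c * \<bar>\<theta> - \<theta>'\<bar>"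
    proof (rule vector_derivative_lipschitz[where S="cball \<theta>s (d / 2)" and u'="\<lambda>\<theta>. M1 \<theta> - M1 \<theta>s"])
      fix x assume x: "x \<in> cball \<theta>s (d / 2)"
      have "((\<lambda>\<theta>. M \<theta> - M1 \<theta>s * \<theta>) has_real_derivative M1 x - M1 \<theta>s) (at x within cball \<theta>s (d / 2))"
        using M1[of x, THEN has_vector_derivative_at_within, of "cball \<theta>s (d / 2)"]
        by (auto intro!: derivative_eq_intros simp: has_real_derivative_iff_has_vector_derivative[symmetric])
      then show "((\<lambda>\<theta>. M \<theta> - M1 \<theta>s * \<theta>) has_vector_derivative M1 x - M1 \<theta>s) (at x within cball \<theta>s (d / 2))"
        by (simp add: has_real_derivative_iff_has_vector_derivative)
      have "\<bar>x - \<theta>s\<bar> < d" using x d(1) by (simp add: dist_real_def abs_minus_commute)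
      from d(2)[OF this] show "norm (M1 x - M1 \<theta>s) \<le> c" by simp
    qed (use \<theta> in \<open>auto simp: dist_real_def abs_minus_commute\<close>)
    then show "\<bar>M \<theta> - M \<theta>' - deriv M \<theta>s * (\<theta> - \<theta>')\<bar> \<le> \<bar>deriv M \<theta>s\<bar> / 12 * \<bar>\<theta> - \<theta>'\<bar>"
      by (simp add: eq c_def algebra_simps)
  qed
qed

lemma upper_field_reflect: "upper_field F (reflect z) = - reflect (F z)"
  by (simp add: upper_field_def)

lemma pert_field_cont:
  assumes F: "continuous_on D F" and G: "smooth_on (\<lambda>(t, z). G t z) (UNIV \<times> D)"
    and H: "smooth_on (\<lambda>(t, z, \<epsilon>). H t z \<epsilon>) (UNIV \<times> D \<times> {-\<epsilon>\<^sub>0<..<\<epsilon>\<^sub>0})" and \<epsilon>: "\<epsilon> \<in> {-\<epsilon>\<^sub>0<..<\<epsilon>\<^sub>0}"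
  shows "continuous_on (UNIV \<times> D) (\<lambda>(t, z). pert_field F G H \<epsilon> t z)"
proof -
  have G0: "continuous_on (UNIV \<times> D) (\<lambda>p. G (fst p) (snd p))"
    using smooth_on_continuous[OF G] by (simp add: case_prod_unfold)
  have H0: "continuous_on (UNIV \<times> D \<times> {-\<epsilon>\<^sub>0<..<\<epsilon>\<^sub>0}) (\<lambda>(t, z, \<epsilon>). H t z \<epsilon>)"
    by (rule smooth_on_continuous[OF H])
  have "continuous_on (UNIV \<times> D) (\<lambda>p. case (fst p, snd p, \<epsilon>) of (t, z, \<epsilon>) \<Rightarrow> H t z \<epsilon>)"
    by (rule continuous_on_compose2[OF H0]) (use \<epsilon> in \<open>auto intro!: continuous_intros\<close>)
  then have H1: "continuous_on (UNIV \<times> D) (\<lambda>p. H (fst p) (snd p) \<epsilon>)" by simp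
  have F1: "continuous_on (UNIV \<times> D) (\<lambda>p :: real \<times> plane. F (snd p))"
    by (rule continuous_on_compose2[OF F]) (auto intro!: continuous_intros)
  show ?thesis
    unfolding pert_field_def case_prod_unfold by (intro continuous_intros G0 H1 F1)
qed

theorem theoremA:
  fixes D :: "plane set"
    and F :: "plane \<Rightarrow> plane"
    and Gp Gm :: "real \<Rightarrow> plane \<Rightarrow> plane"
    and Hp Hm :: "real \<Rightarrow> plane \<Rightarrow> real \<Rightarrow> plane"
    and \<sigma>bar :: "real \<Rightarrow> real"
    and \<sigma> x\<^sub>i x\<^sub>v x\<^sub>\<sigma> \<theta>s \<epsilon>\<^sub>0 :: real
  assumes D: "open D" "bounded D" "reflect ` D = D"
    and F: "Ck_on 2 F D"
    and h1: "fold_hyp F D x\<^sub>i x\<^sub>v"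
    and h2: "return_hyp F D x\<^sub>i x\<^sub>v \<sigma>bar"
    and sbar: "\<sigma>bar differentiable_on {x\<^sub>i<..x\<^sub>v}" "bdd_above (\<sigma>bar ` {x\<^sub>i<..x\<^sub>v})"
    and eps0: "\<epsilon>\<^sub>0 > 0"
    and G_smooth: "smooth_on (\<lambda>(t, z). Gp t z) (UNIV \<times> D)"
                  "smooth_on (\<lambda>(t, z). Gm t z) (UNIV \<times> D)"
    and H_smooth: "smooth_on (\<lambda>(t, z, \<epsilon>). Hp t z \<epsilon>) (UNIV \<times> D \<times> {-\<epsilon>\<^sub>0<..<\<epsilon>\<^sub>0})"
                  "smooth_on (\<lambda>(t, z, \<epsilon>). Hm t z \<epsilon>) (UNIV \<times> D \<times> {-\<epsilon>\<^sub>0<..<\<epsilon>\<^sub>0})"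
    and sigma: "\<sigma> \<in> {0..Sup (\<sigma>bar ` {x\<^sub>i<..x\<^sub>v})}"
    and x_sigma: "x\<^sub>\<sigma> \<in> {x\<^sub>i<..<x\<^sub>v}" "\<sigma>bar x\<^sub>\<sigma> = \<sigma>" "deriv \<sigma>bar x\<^sub>\<sigma> \<noteq> 0"
    and G_periodic: "\<And>t z. z \<in> D \<Longrightarrow> Gp (t + 2 * \<sigma>) z = Gp t z \<and> Gm (t + 2 * \<sigma>) z = Gm t z"
    and H_periodic: "\<And>t z \<epsilon>. z \<in> D \<Longrightarrow> \<epsilon> \<in> {-\<epsilon>\<^sub>0<..<\<epsilon>\<^sub>0} \<Longrightarrow>
                       Hp (t + 2 * \<sigma>) z \<epsilon> = Hp t z \<epsilon> \<and> Hm (t + 2 * \<sigma>) z \<epsilon> = Hm t z \<epsilon>"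
    and M_zero: "Melnikov F D \<sigma>bar Gm Gp \<theta>s x\<^sub>\<sigma> = 0"
    and M_deriv: "deriv (\<lambda>\<theta>. Melnikov F D \<sigma>bar Gm Gp \<theta> x\<^sub>\<sigma>) \<theta>s \<noteq> 0"
  shows "\<exists>C. \<exists>\<epsilon>\<^sub>1. 0 < \<epsilon>\<^sub>1 \<and> \<epsilon>\<^sub>1 \<le> \<epsilon>\<^sub>0 \<and>
           (\<forall>\<epsilon>. 0 < \<epsilon> \<and> \<epsilon> < \<epsilon>\<^sub>1 \<longrightarrow>
             (\<exists>w. isolated_crossing_periodic \<sigma> D
                    (pert_field (upper_field F) Gp Hp \<epsilon>) (pert_field F Gm Hm \<epsilon>) w \<and>
                  dist (w 0) (\<theta>s, (x\<^sub>\<sigma>, 0)) \<le> C * \<epsilon>))"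
proof -
  have F1: "Ck_on 1 F D" using F Ck_on_SucD[of 1 F D] by (simp add: numeral_2_eq_2)
  have DR: "reflect z \<in> D" if "z \<in> D" for z using D(3) that by blast
  have x: "x\<^sub>i < x\<^sub>\<sigma>" "x\<^sub>\<sigma> \<le> x\<^sub>v" "x\<^sub>\<sigma> < x\<^sub>v" using x_sigma by auto
  have ret: "0 < \<sigma>bar x" "flow_exists F D (\<sigma>bar x) (x, 0)" "\<And>t. 0 < t \<Longrightarrow> t < \<sigma>bar x \<Longrightarrow> snd (flow F D t (x, 0)) < 0"
      "snd (flow F D (\<sigma>bar x) (x, 0)) = 0" "snd (F (flow F D (\<sigma>bar x) (x, 0))) \<noteq> 0" if "x\<^sub>i < x" "x \<le> x\<^sub>v" for x
    using h2 that unfolding return_hyp_def by blast+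
  have \<sigma>0: "0 < \<sigma>" using ret(1)[OF x(1,2)] x_sigma(2) by simp
  obtain u where u: "ode_solution_on F D {0..\<sigma>} u" "u 0 = (x\<^sub>\<sigma>, 0)"
    using ret(2)[OF x(1,2)] \<sigma>0 unfolding flow_exists_def x_sigma(2) by (auto simp: closed_segment_eq_real_ivl)
  \<comment> \<open>The halves of the perturbed orbit last \<open>\<sigma> + \<epsilon> * s\<close>
    and \<open>\<sigma> - \<epsilon> * s\<close>, one of which may exceed \<sigma>; so the solution
    is continued past its return.\<close>
  obtain \<gamma> T where T: "\<sigma> < T" and \<gamma>: "ode_solution_on F D {0..T} \<gamma>" and \<gamma>u: "\<And>t. t \<in> {0..\<sigma>} \<Longrightarrow> \<gamma> t = u t"
    using ode_solution_extend[OF D(1) F1 less_imp_le[OF \<sigma>0] u(1)] by blast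
  have \<gamma>0: "\<gamma> 0 = (x\<^sub>\<sigma>, 0)" using \<gamma>u[of 0] u \<sigma>0 by simp
  have T0: "0 < T" using T \<sigma>0 by simp
  define A where "A t = frechet_derivative F (at (\<gamma> t))" for t
  obtain \<rho> L0 where ft: "\<And>L'. L0 \<le> L' \<Longrightarrow> flow_tube F A \<gamma> T \<rho> L' D"
    unfolding A_def by (rule flow_tube_exists[OF D(1) F T0 \<gamma>]) blast
  \<comment> \<open>A closed range of \<epsilon> inside the domain of \<open>Hp\<close> and
    \<open>Hm\<close>, so that compactness applies.\<close>
  define e0 where "e0 = min 1 (\<epsilon>\<^sub>0 / 2)"
  have e0: "0 < e0" "e0 \<le> 1" "e0 < \<epsilon>\<^sub>0" using eps0 by (auto simp: e0_def)
  \<comment> \<open>The perturbation of the lower field, divided by \<epsilon>; \<open>kp\<close> is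
    that of the upper field in reflected position and reversed time, the reversal contributing the
    minus sign and the phase \<open>\<theta> - t\<close>.\<close>
  define km where "km t \<theta> z \<epsilon> = Gm (\<theta> + 1 * t) z + \<epsilon> *\<^sub>R Hm (\<theta> + 1 * t) z \<epsilon>" for t \<theta> z \<epsilon>
  define kp where "kp t \<theta> z \<epsilon> = - reflect (Gp (\<theta> + (- 1) * t) (reflect z) + \<epsilon> *\<^sub>R Hp (\<theta> + (- 1) * t) (reflect z) \<epsilon>)" for t \<theta> z \<epsilon>
  have neg_lin: "linear (\<lambda>z. - reflect z)"
    by (rule linearI) (simp_all add: linear_add[OF reflect_linear] linear_scale[OF reflect_linear])
  obtain Lm where Lm: "\<And>L'. Lm \<le> L' \<Longrightarrow> perturbed_tube F A \<gamma> T \<rho> L' km (cball \<theta>s 1) e0"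
    unfolding km_def
    by (rule perturbed_tube_exists[OF ft G_smooth(2) H_smooth(2) e0, where S="\<lambda>z. z" and S'="\<lambda>z. z" and \<kappa>=1 and \<theta>s=\<theta>s])
      (auto simp: linear_ident)
  obtain Lp where Lp: "\<And>L'. Lp \<le> L' \<Longrightarrow> perturbed_tube F A \<gamma> T \<rho> L' kp (cball \<theta>s 1) e0"
    unfolding kp_def
    by (rule perturbed_tube_exists[OF ft G_smooth(1) H_smooth(1) e0, where S="\<lambda>z. - reflect z" and S'=reflect and \<kappa>="-1" and \<theta>s=\<theta>s])
      (auto simp: neg_lin reflect_linear DR)
  define L where "L = max L0 (max Lm Lp)"
  interpret FT: flow_tube F A \<gamma> T \<rho> L D by (rule ft) (simp add: L_def)
  have pm: "perturbed_tube F A \<gamma> T \<rho> L km (cball \<theta>s 1) e0" by (rule Lm) (simp add: L_def)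
  have pp: "perturbed_tube F A \<gamma> T \<rho> L kp (cball \<theta>s 1) e0" by (rule Lp) (simp add: L_def)
  interpret m: perturbed_tube F A \<gamma> T \<rho> L km "cball \<theta>s 1" e0 by (rule pm)
  interpret p: perturbed_tube F A \<gamma> T \<rho> L kp "cball \<theta>s 1" e0 by (rule pp)
  have flow: "flow F D t (x\<^sub>\<sigma>, 0) = \<gamma> t" if "t \<in> {0..T}" for t using FT.flow_\<gamma>[OF that] by (simp add: \<gamma>0)
  have \<sigma>T: "\<sigma> \<in> {0..T}" using \<sigma>0 T by simp
  have \<gamma>_neg: "snd (\<gamma> t) < 0" if "0 < t" "t < \<sigma>" for t
    using ret(3)[OF x(1,2), of t] that T flow[of t] x_sigma(2) by simp
  have q: "snd (\<gamma> \<sigma>) = 0" "snd (F (\<gamma> \<sigma>)) \<noteq> 0"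
    using ret(4,5)[OF x(1,2)] flow[OF \<sigma>T] x_sigma(2) by auto
  have \<gamma>_cont: "continuous_on {0..T} \<gamma>"
    using FT.\<gamma>' by (meson continuous_on_eq_continuous_within has_vector_derivative_continuous)
  have snd_der: "((\<lambda>t. snd (\<gamma> t)) has_real_derivative snd (F (\<gamma> t))) (at t within {0..T})" if "t \<in> {0..T}" for t
    using bounded_linear.has_vector_derivative[OF bounded_linear_snd FT.\<gamma>'[OF that]]
    by (simp add: has_real_derivative_iff_has_vector_derivative)
  \<comment> \<open>The fold hypothesis makes the second component of \<open>F\<close> nonzero at
    the start and the return hypothesis at the end; the signs follow because \<gamma> lies below
    \<Sigma> in between.\<close>
  have signs: "snd (F (\<gamma> 0)) < 0" "0 < snd (F (\<gamma> \<sigma>))"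
  proof -
    have "snd (F (\<gamma> 0)) \<noteq> 0" using h1 x by (auto simp: fold_hyp_def \<gamma>0)
    moreover have "\<not> 0 < snd (F (\<gamma> 0))"
    proof
      assume "0 < snd (F (\<gamma> 0))"
      from has_real_derivative_pos_inc_right[OF snd_der this] T0 obtain d where d: "0 < d"
        "\<And>h. 0 < h \<Longrightarrow> 0 + h \<in> {0..T} \<Longrightarrow> h < d \<Longrightarrow> snd (\<gamma> 0) < snd (\<gamma> (0 + h))" by auto
      define h where "h = min d \<sigma> / 2"
      have "0 < h" "h < d" "h < \<sigma>" using d \<sigma>0 by (auto simp: h_def)
      then show False using d(2)[of h] \<gamma>_neg[of h] T \<gamma>0 by simp
    qed
    ultimately show "snd (F (\<gamma> 0)) < 0" by simp
    have "\<not> snd (F (\<gamma> \<sigma>)) < 0"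
    proof
      assume "snd (F (\<gamma> \<sigma>)) < 0"
      from has_real_derivative_neg_dec_left[OF snd_der[OF \<sigma>T] this] obtain d where d: "0 < d"
        "\<And>h. 0 < h \<Longrightarrow> \<sigma> - h \<in> {0..T} \<Longrightarrow> h < d \<Longrightarrow> snd (\<gamma> \<sigma>) < snd (\<gamma> (\<sigma> - h))" by auto
      define h where "h = min d \<sigma> / 2"
      have "0 < h" "h < d" "h < \<sigma>" using d \<sigma>0 by (auto simp: h_def)
      then show False using d(2)[of h] \<gamma>_neg[of "\<sigma> - h"] T q by simp
    qed
    then show "0 < snd (F (\<gamma> \<sigma>))" using q by simp
  qed
  obtain Y where Y_lin: "\<And>t. t \<in> {0..T} \<Longrightarrow> linear (Y t)" and Y_bij: "\<And>t. t \<in> {0..T} \<Longrightarrow> bij (Y t)" and Y0: "Y 0 = id"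
    and Y_cont: "\<And>g. continuous_on {0..T} g \<Longrightarrow> continuous_on {0..T} (\<lambda>t. inv (Y t) (g t))"
    and Y_var: "\<And>g c t. continuous_on {0..T} g \<Longrightarrow> t \<in> {0..T} \<Longrightarrow>
      ((\<lambda>t. Y t (c + integral {0..t} (\<lambda>s. inv (Y s) (g s)))) has_vector_derivative
        A t (Y t (c + integral {0..t} (\<lambda>s. inv (Y s) (g s)))) + g t) (at t within {0..T})"
    and Y_flow: "\<And>t. t \<in> {0..T} \<Longrightarrow> flow_deriv F D t (\<gamma> 0) = Y t"
    and Y_ret: "\<And>x0 r r' \<sigma>. \<gamma> 0 = (x0, 0) \<Longrightarrow> (r has_real_derivative r') (at x0) \<Longrightarrow> r x0 = \<sigma> \<Longrightarrow> 0 < \<sigma> \<Longrightarrow> \<sigma> < T \<Longrightarrow>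
      \<forall>\<^sub>F x in at x0. snd (flow F D (r x) (x, 0)) = 0 \<Longrightarrow> snd (\<gamma> \<sigma>) = 0 \<Longrightarrow>
      snd (Y \<sigma> (1, 0)) + r' * snd (F (\<gamma> \<sigma>)) = 0"
    by (rule FT.flow_deriv_fundamental) blast
  \<comment> \<open>By the return time identity this number is minus the derivative of the return
    time, multiplied by the second component of \<open>F\<close> at the return point. As
    \<open>x\<^sub>\<sigma>\<close> is interior, differentiability of \<open>\<sigma>bar\<close> on
    the half-open interval is two-sided there.\<close>
  have Y_snd: "snd (Y \<sigma> (1, 0)) \<noteq> 0"
  proof -
    have "\<sigma>bar differentiable (at x\<^sub>\<sigma> within {x\<^sub>i<..x\<^sub>v})" using sbar(1) x by (simp add: differentiable_on_def)
    then have "\<sigma>bar differentiable (at x\<^sub>\<sigma> within {x\<^sub>i<..<x\<^sub>v})"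
      by (rule differentiable_within_subset) auto
    then have "\<sigma>bar differentiable (at x\<^sub>\<sigma>)"
      using x at_within_open[of x\<^sub>\<sigma> "{x\<^sub>i<..<x\<^sub>v}"] by simp
    then have der: "(\<sigma>bar has_real_derivative deriv \<sigma>bar x\<^sub>\<sigma>) (at x\<^sub>\<sigma>)"
      by (simp add: real_differentiable_def DERIV_deriv_iff_real_differentiable)
    have "\<forall>\<^sub>F x in at x\<^sub>\<sigma>. x \<in> {x\<^sub>i<..<x\<^sub>v}"
      using x by (intro eventually_at_in_open') auto
    then have "\<forall>\<^sub>F x in at x\<^sub>\<sigma>. snd (flow F D (\<sigma>bar x) (x, 0)) = 0"
      by eventually_elim (use ret(4) in auto)
    from Y_ret[OF \<gamma>0 der x_sigma(2) \<sigma>0 T this q(1)] show ?thesis using x_sigma(3) q(2) by auto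
  qed
  have inv_lin: "linear (inv (Y t))" if "t \<in> {0..T}" for t
    by (rule linear_inv_of_bij[OF Y_lin[OF that] Y_bij[OF that]])
  \<comment> \<open>Variation of constants at time \<sigma> with zero initial value.\<close>
  define mm where "mm \<theta> = Y \<sigma> (integral {0..\<sigma>} (\<lambda>t. inv (Y t) (km t \<theta> (\<gamma> t) 0)))" for \<theta>
  define mp where "mp \<theta> = Y \<sigma> (integral {0..\<sigma>} (\<lambda>t. inv (Y t) (kp t \<theta> (\<gamma> t) 0)))" for \<theta>
  have formula: "Y 0 (\<zeta> + integral {0..0} h) = \<zeta>" for \<zeta> and h :: "real \<Rightarrow> plane" by (simp add: Y0)
  have vm: "v \<sigma> = Y \<sigma> \<zeta> + mm \<theta>" if \<theta>: "\<theta> \<in> cball \<theta>s 1" and v: "m.variation \<zeta> \<theta> v" for \<zeta> \<theta> v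
  proof -
    have "m.variation \<zeta> \<theta> (\<lambda>t. Y t (\<zeta> + integral {0..t} (\<lambda>s. inv (Y s) (km s \<theta> (\<gamma> s) 0))))"
      unfolding m.variation_def using Y_var[OF m.forcing_cont[OF \<theta>]] formula by blast
    from m.variation_unique[OF v this \<sigma>T] show ?thesis by (simp add: mm_def linear_add[OF Y_lin[OF \<sigma>T]])
  qed
  have vp: "v \<sigma> = Y \<sigma> \<zeta> + mp \<theta>" if \<theta>: "\<theta> \<in> cball \<theta>s 1" and v: "p.variation \<zeta> \<theta> v" for \<zeta> \<theta> v
  proof -
    have "p.variation \<zeta> \<theta> (\<lambda>t. Y t (\<zeta> + integral {0..t} (\<lambda>s. inv (Y s) (kp s \<theta> (\<gamma> s) 0))))"
      unfolding p.variation_def using Y_var[OF p.forcing_cont[OF \<theta>]] formula by blast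
    from p.variation_unique[OF v this \<sigma>T] show ?thesis by (simp add: mp_def linear_add[OF Y_lin[OF \<sigma>T]])
  qed
  define \<Lambda> where "\<Lambda> = L * T * exp (L * T)"
  have \<Lambda>: "0 \<le> \<Lambda>" using FT.L T0 by (simp add: \<Lambda>_def)
  have mm_lip: "norm (mm \<theta> - mm \<theta>') \<le> \<Lambda> * \<bar>\<theta> - \<theta>'\<bar>" if \<theta>: "\<theta> \<in> cball \<theta>s 1" "\<theta>' \<in> cball \<theta>s 1" for \<theta> \<theta>'
  proof -
    obtain v w where vw: "m.variation 0 \<theta> v" "m.variation 0 \<theta>' w" using m.variation_exists \<theta> by metis
    from m.variation_phase_lipschitz[OF vw \<theta> \<sigma>T] vm[OF \<theta>(1) vw(1)] vm[OF \<theta>(2) vw(2)] show ?thesis by (simp add: \<Lambda>_def)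
  qed
  have mp_lip: "norm (mp \<theta> - mp \<theta>') \<le> \<Lambda> * \<bar>\<theta> - \<theta>'\<bar>" if \<theta>: "\<theta> \<in> cball \<theta>s 1" "\<theta>' \<in> cball \<theta>s 1" for \<theta> \<theta>'
  proof -
    obtain v w where vw: "p.variation 0 \<theta> v" "p.variation 0 \<theta>' w" using p.variation_exists \<theta> by metis
    from p.variation_phase_lipschitz[OF vw \<theta> \<sigma>T] vp[OF \<theta>(1) vw(1)] vp[OF \<theta>(2) vw(2)] show ?thesis by (simp add: \<Lambda>_def)
  qed
  have \<gamma>D: "\<gamma> t \<in> D" if "t \<in> {0..T}" for t using FT.tube[OF that, of 0] FT.rho by simp
  have \<sigma>_sub: "{0..\<sigma>} \<subseteq> {0..T}" using T by auto
  \<comment> \<open>The bracket of \<open>Gm\<close> and \<open>Gp\<close> along \<gamma>. It is the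
    difference of the two forcings: the minus sign in \<open>kp\<close> turns this difference into
    the sum of \<open>pert_bracket\<close>.\<close>
  define b where "b \<theta> t = Gm (\<theta> + t) (\<gamma> t) + reflect (Gp (\<theta> - t) (reflect (\<gamma> t)))" for \<theta> t
  have b_eq: "b \<theta> t = km t \<theta> (\<gamma> t) 0 - kp t \<theta> (\<gamma> t) 0" for \<theta> t by (simp add: b_def km_def kp_def)
  have G_cont: "continuous_on (UNIV \<times> D) (\<lambda>(t, z). Gp t z)" "continuous_on (UNIV \<times> D) (\<lambda>(t, z). Gm t z)"
    using G_smooth by (simp_all only: smooth_on_continuous)
  have reflect_cont: "continuous_on S reflect" for S
    using reflect_linear by (simp add: linear_continuous_on linear_conv_bounded_linear)
  have R\<gamma>_cont: "continuous_on {0..T} (\<lambda>t. reflect (\<gamma> t))"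
    by (rule continuous_on_compose2[OF reflect_cont[of UNIV] \<gamma>_cont]) simp
  have gm_cont: "continuous_on {0..T} (\<lambda>t. km t \<theta> (\<gamma> t) 0)" and gp_cont: "continuous_on {0..T} (\<lambda>t. kp t \<theta> (\<gamma> t) 0)" for \<theta>
  proof -
    have "continuous_on {0..T} (\<lambda>t. case (\<theta> + t, \<gamma> t) of (t, z) \<Rightarrow> Gm t z)"
      by (rule continuous_on_compose2[OF G_cont(2)]) (use \<gamma>D in \<open>auto intro!: continuous_intros \<gamma>_cont\<close>)
    then show "continuous_on {0..T} (\<lambda>t. km t \<theta> (\<gamma> t) 0)" by (simp add: km_def)
    have "continuous_on {0..T} (\<lambda>t. case (\<theta> - t, reflect (\<gamma> t)) of (t, z) \<Rightarrow> Gp t z)"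
      by (rule continuous_on_compose2[OF G_cont(1)], intro continuous_intros R\<gamma>_cont)
        (rule image_subsetI, simp add: DR \<gamma>D)
    then have "continuous_on {0..T} (\<lambda>t. reflect (Gp (\<theta> - t) (reflect (\<gamma> t))))"
      by (intro continuous_on_compose2[OF reflect_cont[of UNIV]]) auto
    then show "continuous_on {0..T} (\<lambda>t. kp t \<theta> (\<gamma> t) 0)" by (simp add: kp_def continuous_on_minus)
  qed
  have int_m: "(\<lambda>t. inv (Y t) (km t \<theta> (\<gamma> t) 0)) integrable_on {0..\<sigma>}" for \<theta>
    by (intro integrable_continuous_real continuous_on_subset[OF Y_cont[OF gm_cont] \<sigma>_sub])
  have int_p: "(\<lambda>t. inv (Y t) (kp t \<theta> (\<gamma> t) 0)) integrable_on {0..\<sigma>}" for \<theta>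
    by (intro integrable_continuous_real continuous_on_subset[OF Y_cont[OF gp_cont] \<sigma>_sub])
  \<comment> \<open>Moving the wedge and \<open>Y \<sigma>\<close> under the integral turns the
    Melnikov function into a scalar integral with parameter \<theta>.\<close>
  define \<psi> where "\<psi> \<theta> t = wedge (F (\<gamma> \<sigma>)) (Y \<sigma> (inv (Y t) (b \<theta> t)))" for \<theta> t
  have inv_b: "inv (Y t) (b \<theta> t) = inv (Y t) (km t \<theta> (\<gamma> t) 0) - inv (Y t) (kp t \<theta> (\<gamma> t) 0)" if "t \<in> {0..\<sigma>}" for \<theta> t
    unfolding b_eq by (rule linear_diff[OF inv_lin]) (use that \<sigma>_sub in blast)
  have int_b: "(\<lambda>t. inv (Y t) (b \<theta> t)) integrable_on {0..\<sigma>}" for \<theta>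
    using integrable_diff[OF int_m int_p, of \<theta> \<theta>] by (rule integrable_eq) (simp add: inv_b)
  have wedge_bl: "bounded_linear (\<lambda>w. wedge (F (\<gamma> \<sigma>)) (Y \<sigma> w))" by (rule wedge_bounded_linear[OF Y_lin[OF \<sigma>T]])
  have M_mm: "wedge (F (\<gamma> \<sigma>)) (mm \<theta> - mp \<theta>) = wedge (F (\<gamma> \<sigma>)) (Y \<sigma> (integral {0..\<sigma>} (\<lambda>t. inv (Y t) (b \<theta> t))))" for \<theta>
  proof -
    have "mm \<theta> - mp \<theta> = Y \<sigma> (integral {0..\<sigma>} (\<lambda>t. inv (Y t) (km t \<theta> (\<gamma> t) 0) - inv (Y t) (kp t \<theta> (\<gamma> t) 0)))"
      by (simp add: mm_def mp_def integral_diff[OF int_m int_p] linear_diff[OF Y_lin[OF \<sigma>T]])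
    also have "\<dots> = Y \<sigma> (integral {0..\<sigma>} (\<lambda>t. inv (Y t) (b \<theta> t)))"
      using inv_b by (metis (no_types, lifting) integral_cong)
    finally show ?thesis by simp
  qed
  have M_eq: "Melnikov F D \<sigma>bar Gm Gp \<theta> x\<^sub>\<sigma> = wedge (F (\<gamma> \<sigma>)) (mm \<theta> - mp \<theta>)" for \<theta>
  proof -
    have 1: "flow_deriv F D t (x\<^sub>\<sigma>, 0) = Y t" if "t \<in> {0..\<sigma>}" for t
      using Y_flow[of t] that \<sigma>_sub by (simp add: \<gamma>0)
    have 2: "orbit0 F D t x\<^sub>\<sigma> = \<gamma> t" if "t \<in> {0..\<sigma>}" for t
      using flow[of t] that \<sigma>_sub by (simp add: orbit0_def)
    have "integral {0..\<sigma>} (\<lambda>t. inv (flow_deriv F D t (x\<^sub>\<sigma>, 0)) (pert_bracket Gm Gp \<theta> t (orbit0 F D t x\<^sub>\<sigma>)))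
        = integral {0..\<sigma>} (\<lambda>t. inv (Y t) (b \<theta> t))"
      by (rule integral_cong) (simp add: 1 2 pert_bracket_def b_def add.commute)
    then show ?thesis
      using 1[of \<sigma>] 2[of \<sigma>] \<sigma>0 by (simp add: Melnikov_def x_sigma(2) M_mm)
  qed
  have M_int: "Melnikov F D \<sigma>bar Gm Gp \<theta> x\<^sub>\<sigma> = integral {0..\<sigma>} (\<psi> \<theta>)" for \<theta>
    unfolding M_eq M_mm using integral_linear[OF int_b[of \<theta>] wedge_bl] by (simp add: o_def \<psi>_def[abs_def])
  define b' where "b' \<theta> t = frechet_derivative (\<lambda>(t, z). Gm t z) (at (\<theta> + t, \<gamma> t)) (1, 0)
      + reflect (frechet_derivative (\<lambda>(t, z). Gp t z) (at (\<theta> - t, reflect (\<gamma> t))) (1, 0))" for \<theta> t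
  define \<psi>' where "\<psi>' \<theta> t = wedge (F (\<gamma> \<sigma>)) (Y \<sigma> (inv (Y t) (b' \<theta> t)))" for \<theta> t
  have \<psi>_der: "((\<lambda>\<theta>. \<psi> \<theta> t) has_vector_derivative \<psi>' \<theta> t) (at \<theta>)" if t: "t \<in> {0..\<sigma>}" for \<theta> t
  proof -
    have tT: "t \<in> {0..T}" using t \<sigma>_sub by blast
    have 1: "((\<lambda>\<theta>. Gm (\<theta> + t) (\<gamma> t)) has_vector_derivative frechet_derivative (\<lambda>(t, z). Gm t z) (at (\<theta> + t, \<gamma> t)) (1, 0)) (at \<theta>)"
    proof -
      have "((\<lambda>\<theta>. \<theta> + t) has_vector_derivative 1) (at \<theta>)" by (auto intro!: derivative_eq_intros)
      from vector_diff_chain_at[OF this smooth_has_time_derivative[OF G_smooth(2) \<gamma>D[OF tT]]]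
      show ?thesis by (simp add: o_def)
    qed
    have 2: "((\<lambda>\<theta>. Gp (\<theta> - t) (reflect (\<gamma> t))) has_vector_derivative frechet_derivative (\<lambda>(t, z). Gp t z) (at (\<theta> - t, reflect (\<gamma> t))) (1, 0)) (at \<theta>)"
    proof -
      have "((\<lambda>\<theta>. \<theta> - t) has_vector_derivative 1) (at \<theta>)" by (auto intro!: derivative_eq_intros)
      from vector_diff_chain_at[OF this smooth_has_time_derivative[OF G_smooth(1) DR[OF \<gamma>D[OF tT]]]]
      show ?thesis by (simp add: o_def)
    qed
    have bl: "bounded_linear reflect" using reflect_linear by (simp add: linear_conv_bounded_linear)
    have bl2: "bounded_linear (\<lambda>w. wedge (F (\<gamma> \<sigma>)) (Y \<sigma> (inv (Y t) w)))"
      using inv_lin[OF tT] by (intro bounded_linear_compose[OF wedge_bl]) (simp add: linear_conv_bounded_linear)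
    have "((\<lambda>\<theta>. b \<theta> t) has_vector_derivative b' \<theta> t) (at \<theta>)"
      unfolding b_def b'_def by (intro has_vector_derivative_add 1 bounded_linear.has_vector_derivative[OF bl 2])
    from bounded_linear.has_vector_derivative[OF bl2 this] show ?thesis by (simp add: \<psi>_def \<psi>'_def)
  qed
  have \<psi>_int: "\<psi> \<theta> integrable_on {0..\<sigma>}" for \<theta>
    using integrable_linear[OF int_b[of \<theta>] wedge_bl] by (simp add: o_def \<psi>_def[abs_def])
  have \<psi>'_cont: "continuous_on (UNIV \<times> {0..\<sigma>}) (\<lambda>(\<theta>, t). \<psi>' \<theta> t)"
  proof -
    define \<alpha> where "\<alpha> c t = wedge (F (\<gamma> \<sigma>)) (Y \<sigma> (inv (Y t) c))" for c t
    have "continuous_on {0..T} (\<alpha> c)" for c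
      unfolding \<alpha>_def by (rule bounded_linear.continuous_on[OF wedge_bl]) (intro Y_cont continuous_intros)
    then have \<alpha>_cont: "continuous_on (UNIV \<times> {0..\<sigma>}) (\<lambda>p :: real \<times> real. \<alpha> c (snd p))" for c
      by (rule continuous_on_compose2) (use \<sigma>_sub in \<open>auto intro!: continuous_intros\<close>)
    have dG: "continuous_on (UNIV \<times> D) (\<lambda>p. frechet_derivative (\<lambda>(t, z). Gm t z) (at p) (1, 0))"
      "continuous_on (UNIV \<times> D) (\<lambda>p. frechet_derivative (\<lambda>(t, z). Gp t z) (at p) (1, 0))"
    proof -
      have "Ck_on 1 (\<lambda>(t, z). Gm t z) (UNIV \<times> D)" "Ck_on 1 (\<lambda>(t, z). Gp t z) (UNIV \<times> D)"
        using G_smooth by (simp_all add: smooth_on_def del: Ck_on.simps)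
      then have "\<forall>v. Ck_on 0 (\<lambda>x. frechet_derivative (\<lambda>(t, z). Gm t z) (at x) v) (UNIV \<times> D)"
        "\<forall>v. Ck_on 0 (\<lambda>x. frechet_derivative (\<lambda>(t, z). Gp t z) (at x) v) (UNIV \<times> D)"
        unfolding One_nat_def Ck_on.simps(2) by blast+
      then show "continuous_on (UNIV \<times> D) (\<lambda>p. frechet_derivative (\<lambda>(t, z). Gm t z) (at p) (1, 0))"
        "continuous_on (UNIV \<times> D) (\<lambda>p. frechet_derivative (\<lambda>(t, z). Gp t z) (at p) (1, 0))"
        unfolding Ck_on.simps(1) by blast+
    qed
    have \<gamma>2: "continuous_on (UNIV \<times> {0..\<sigma>}) (\<lambda>p :: real \<times> real. \<gamma> (snd p))"
      by (rule continuous_on_compose2[OF \<gamma>_cont]) (use \<sigma>_sub in \<open>auto intro!: continuous_intros\<close>)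
    have m: "continuous_on (UNIV \<times> {0..\<sigma>}) (\<lambda>p. frechet_derivative (\<lambda>(t, z). Gm t z) (at (fst p + snd p, \<gamma> (snd p))) (1, 0))"
      by (rule continuous_on_compose2[OF dG(1)], intro continuous_intros \<gamma>2)
        (rule image_subsetI, use \<gamma>D \<sigma>_sub in \<open>simp add: mem_Times_iff subset_iff\<close>)
    have R\<gamma>2: "continuous_on (UNIV \<times> {0..\<sigma>}) (\<lambda>p :: real \<times> real. reflect (\<gamma> (snd p)))"
      by (rule continuous_on_compose2[OF reflect_cont[of UNIV] \<gamma>2]) simp
    have p: "continuous_on (UNIV \<times> {0..\<sigma>}) (\<lambda>p. frechet_derivative (\<lambda>(t, z). Gp t z) (at (fst p - snd p, reflect (\<gamma> (snd p)))) (1, 0))"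
      by (rule continuous_on_compose2[OF dG(2)], intro continuous_intros R\<gamma>2)
        (rule image_subsetI, use \<gamma>D DR \<sigma>_sub in \<open>simp add: mem_Times_iff subset_iff\<close>)
    have b'_cont: "continuous_on (UNIV \<times> {0..\<sigma>}) (\<lambda>p. b' (fst p) (snd p))"
      unfolding b'_def by (intro continuous_intros m continuous_on_compose2[OF reflect_cont[of UNIV] p]) auto
    \<comment> \<open>Continuity of \<open>inv (Y t)\<close> is known along curves in
      \<open>t\<close>, whereas \<open>b'\<close> depends on \<theta> as well; by linearity it is
      enough to know it on the two basis vectors.\<close>
    have expand: "\<psi>' \<theta> t = fst (b' \<theta> t) * \<alpha> (1, 0) t + snd (b' \<theta> t) * \<alpha> (0, 1) t" if "t \<in> {0..\<sigma>}" for \<theta> t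
    proof -
      have tT: "t \<in> {0..T}" using that \<sigma>_sub by blast
      have "b' \<theta> t = fst (b' \<theta> t) *\<^sub>R (1, 0) + snd (b' \<theta> t) *\<^sub>R (0, 1)" by (simp add: prod_eq_iff)
      then have "\<psi>' \<theta> t = wedge (F (\<gamma> \<sigma>)) (Y \<sigma> (inv (Y t) (fst (b' \<theta> t) *\<^sub>R (1, 0) + snd (b' \<theta> t) *\<^sub>R (0, 1))))"
        unfolding \<psi>'_def by (rule arg_cong)
      then show ?thesis
        by (simp only: \<alpha>_def linear_add[OF inv_lin[OF tT]] linear_scale[OF inv_lin[OF tT]]
            linear_add[OF Y_lin[OF \<sigma>T]] linear_scale[OF Y_lin[OF \<sigma>T]] wedge_linear)
    qed
    have "continuous_on (UNIV \<times> {0..\<sigma>}) (\<lambda>p. fst (b' (fst p) (snd p)) * \<alpha> (1, 0) (snd p) + snd (b' (fst p) (snd p)) * \<alpha> (0, 1) (snd p))"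
      by (intro continuous_intros b'_cont \<alpha>_cont)
    then show ?thesis
      by (rule continuous_on_eq) (simp add: case_prod_unfold mem_Times_iff expand)
  qed
  define M where "M \<theta> = Melnikov F D \<sigma>bar Gm Gp \<theta> x\<^sub>\<sigma>" for \<theta>
  have M': "deriv M \<theta>s \<noteq> 0" using M_deriv by (simp add: M_def[abs_def])
  obtain d0 where d0: "0 < d0" and M_diff: "\<And>\<theta> \<theta>'. \<bar>\<theta> - \<theta>s\<bar> \<le> d0 \<Longrightarrow> \<bar>\<theta>' - \<theta>s\<bar> \<le> d0 \<Longrightarrow>
    \<bar>M \<theta> - M \<theta>' - deriv M \<theta>s * (\<theta> - \<theta>')\<bar> \<le> \<bar>deriv M \<theta>s\<bar> / 12 * \<bar>\<theta> - \<theta>'\<bar>"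
    by (rule integral_strictly_differentiable[OF \<psi>_der \<psi>_int \<psi>'_cont _ M']) (auto simp: M_def M_int)
  have \<epsilon>_in: "\<epsilon> \<in> {-\<epsilon>\<^sub>0<..<\<epsilon>\<^sub>0}" if "\<epsilon> \<in> {0..e0}" for \<epsilon> using that e0 by auto
  have F_cont: "continuous_on D F" using Ck_on_continuous[OF F] .
  have upper_cont: "continuous_on D (upper_field F)"
    unfolding upper_field_def
    by (intro continuous_intros continuous_on_compose2[OF reflect_cont[of UNIV]] continuous_on_compose2[OF F_cont reflect_cont]) (use DR in auto)
  interpret B: bifurcation F A \<gamma> T \<rho> L km kp \<theta>s e0 \<sigma> "Y \<sigma>" mm mp \<Lambda> "deriv M \<theta>s" d0 D
    "pert_field F Gm Hm" "pert_field (upper_field F) Gp Hp"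
  proof (intro bifurcation.intro melnikov.intro melnikov_axioms.intro bifurcation_axioms.intro)
    show "wedge (F (\<gamma> \<sigma>)) (mm \<theta>s - mp \<theta>s) = 0" using M_zero by (simp add: M_eq)
    show "\<bar>wedge (F (\<gamma> \<sigma>)) (mm \<theta> - mp \<theta>) - wedge (F (\<gamma> \<sigma>)) (mm \<theta>' - mp \<theta>') - deriv M \<theta>s * (\<theta> - \<theta>')\<bar> \<le> \<bar>deriv M \<theta>s\<bar> / 12 * \<bar>\<theta> - \<theta>'\<bar>"
      if "\<bar>\<theta> - \<theta>s\<bar> \<le> d0" "\<bar>\<theta>' - \<theta>s\<bar> \<le> d0" for \<theta> \<theta>'
      using M_diff[OF that] by (simp only: M_def M_eq)
    fix z :: plane and \<epsilon> t \<theta> :: real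
    show "pert_field F Gm Hm \<epsilon> (\<theta> + t) z = F z + \<epsilon> *\<^sub>R km t \<theta> z \<epsilon>"
      by (simp add: pert_field_def km_def scaleR_add_right power2_eq_square)
    show "pert_field (upper_field F) Gp Hp \<epsilon> (\<theta> - t) (reflect z) = - reflect (F z + \<epsilon> *\<^sub>R kp t \<theta> z \<epsilon>)"
      by (simp add: pert_field_def kp_def upper_field_reflect linear_add[OF reflect_linear] linear_scale[OF reflect_linear]
          linear_diff[OF reflect_linear] linear_neg[OF reflect_linear] scaleR_add_right scaleR_diff_right power2_eq_square)
    assume \<epsilon>: "\<epsilon> \<in> {0..e0}"
    show "continuous_on (UNIV \<times> D) (\<lambda>(t, z). pert_field F Gm Hm \<epsilon> t z)"
      by (rule pert_field_cont[OF F_cont G_smooth(2) H_smooth(2) \<epsilon>_in[OF \<epsilon>]])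
    show "continuous_on (UNIV \<times> D) (\<lambda>(t, z). pert_field (upper_field F) Gp Hp \<epsilon> t z)"
      by (rule pert_field_cont[OF upper_cont G_smooth(1) H_smooth(1) \<epsilon>_in[OF \<epsilon>]])
    assume z: "z \<in> D"
    show "pert_field F Gm Hm \<epsilon> (t + 2 * \<sigma>) z = pert_field F Gm Hm \<epsilon> t z"
      "pert_field (upper_field F) Gp Hp \<epsilon> (t + 2 * \<sigma>) z = pert_field (upper_field F) Gp Hp \<epsilon> t z"
      using G_periodic[OF z, of t] H_periodic[OF z \<epsilon>_in[OF \<epsilon>], of t] by (simp_all add: pert_field_def)
  qed (use pm pp \<sigma>0 T Y_lin[OF \<sigma>T] vm vp \<Lambda> mm_lip mp_lip Y_snd q M' d0 D(1) DR FT.tube \<gamma>0 signs \<gamma>_neg in \<open>simp_all del: mem_cball\<close>)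
  obtain C \<epsilon>1 where "0 < \<epsilon>1" "\<epsilon>1 \<le> e0" and sol: "\<And>\<epsilon>. 0 < \<epsilon> \<and> \<epsilon> < \<epsilon>1 \<Longrightarrow>
     \<exists>w. isolated_crossing_periodic \<sigma> D (pert_field (upper_field F) Gp Hp \<epsilon>) (pert_field F Gm Hm \<epsilon>) w \<and>
       dist (w 0) (\<theta>s, \<gamma> 0) \<le> C * \<epsilon>"
    using B.isolated_orbits_exist by blast
  with e0 show ?thesis unfolding \<gamma>0 by (intro exI[of _ C] exI[of _ \<epsilon>1]) auto
qed

end
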